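(* Let $(R,\mathfrak{m})$ be a Noetherian local ring of dimension $d$ and of prime characteristic $p>0$, and let $t\le d$ be a positive integer such that $H^j_{\mathfrak{m}}(R)/0^F_{H^j_{\mathfrak{m}}(R)}$ has finite length for all $j<t$. Then there exists a positive integer $C$ such that for every filter regular sequence $x_1,\ldots,x_t$ of $R$ we have $\mathrm{Fte}((x_1,\ldots,x_t))\le C$.
   Context: For an ideal $I$ of $R$ and $e\ge 0$, $I^{[p^e]}=(x^{p^e}\mid x\in I)$. The Frobenius closure of $I$ is $I^F=\{x\in R\mid x^{p^e}\in I^{[p^e]}\text{ for some }e\ge 0\}$. The Frobenius test exponent of $I$ is $\mathrm{Fte}(I)=\min\{e\ge 0\mid (I^F)^{[p^e]}=I^{[p^e]}\}$ (this minimum exists by Noetherianity). The Frobenius endomorphism $x\mapsto x^p$ of $R$ induces a natural Frobenius action $F$ on each local cohomology module $H^j_{\mathfrak{m}}(R)$ (e.g. via the Čech complex), and $0^F_{H^j_{\mathfrak{m}}(R)}=\{z\in H^j_{\mathfrak{m}}(R)\mid F^e(z)=0\text{ for some }e\ge0\}$. A sequence $x_1,\ldots,x_t$ of elements of $R$ is a filter regular sequence if $(x_1,\ldots,x_t)\subseteq\mathfrak{m}$ and, for each $i=1,\ldots,t$, $x_i\notin\mathfrak{p}$ for all $\mathfrak{p}\in\operatorname{Ass}_R(R/(x_1,\ldots,x_{i-1}))\setminus\{\mathfrak{m}\}$. *)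

theory Defs
  imports "HOL-Computational_Algebra.Primes"
begin

definition is_ideal :: "'a::comm_ring_1 set \<Rightarrow> bool" where
  "is_ideal I \<longleftrightarrow> 0 \<in> I \<and> (\<forall>x\<in>I. \<forall>y\<in>I. x + y \<in> I) \<and> (\<forall>r. \<forall>x\<in>I. r * x \<in> I)"

definition gen_ideal :: "'a::comm_ring_1 set \<Rightarrow> 'a set" where
  "gen_ideal S = \<Inter>{I. is_ideal I \<and> S \<subseteq> I}"

definition noetherian_cring :: "'a::comm_ring_1 itself \<Rightarrow> bool" where
  "noetherian_cring _ \<longleftrightarrow>
     (\<forall>I::'a set. is_ideal I \<longrightarrow> (\<exists>S. finite S \<and> I = gen_ideal S))"

definition prime_ideal :: "'a::comm_ring_1 set \<Rightarrow> bool" where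
  "prime_ideal P \<longleftrightarrow> is_ideal P \<and> P \<noteq> UNIV \<and> (\<forall>x y. x * y \<in> P \<longrightarrow> x \<in> P \<or> y \<in> P)"

definition maximal_ideal :: "'a::comm_ring_1 set \<Rightarrow> bool" where
  "maximal_ideal M \<longleftrightarrow> is_ideal M \<and> M \<noteq> UNIV \<and>
     (\<forall>J. is_ideal J \<longrightarrow> M \<subseteq> J \<longrightarrow> J = M \<or> J = UNIV)"

definition local_ring_max :: "'a::comm_ring_1 set \<Rightarrow> bool" where
  "local_ring_max m \<longleftrightarrow> maximal_ideal m \<and> (\<forall>M. maximal_ideal M \<longrightarrow> M = m)"

definition prime_chain :: "nat \<Rightarrow> (nat \<Rightarrow> 'a::comm_ring_1 set) \<Rightarrow> bool" where
  "prime_chain n P \<longleftrightarrow> (\<forall>i\<le>n. prime_ideal (P i)) \<and> (\<forall>i<n. P i \<subset> P (Suc i))"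

definition krull_dim :: "'a::comm_ring_1 itself \<Rightarrow> nat \<Rightarrow> bool" where
  "krull_dim _ d \<longleftrightarrow> (\<exists>P::nat \<Rightarrow> 'a set. prime_chain d P) \<and>
     (\<forall>n (P::nat \<Rightarrow> 'a set). prime_chain n P \<longrightarrow> n \<le> d)"

definition frob_power :: "nat \<Rightarrow> nat \<Rightarrow> 'a::comm_ring_1 set \<Rightarrow> 'a set" where
  "frob_power p e I = gen_ideal ((\<lambda>x. x ^ (p ^ e)) ` I)"

definition frob_closure :: "nat \<Rightarrow> 'a::comm_ring_1 set \<Rightarrow> 'a set" where
  "frob_closure p I = {x. \<exists>e. x ^ (p ^ e) \<in> frob_power p e I}"

definition fte :: "nat \<Rightarrow> 'a::comm_ring_1 set \<Rightarrow> nat" where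
  "fte p I = (LEAST e. frob_power p e (frob_closure p I) = frob_power p e I)"

text \<open>Ass_R(R/J): prime ideals of the form ann_R(y + J).\<close>
definition assoc_primes :: "'a::comm_ring_1 set \<Rightarrow> 'a set set" where
  "assoc_primes J = {P. prime_ideal P \<and> (\<exists>y. P = {r. r * y \<in> J})}"

definition filter_regular :: "'a::comm_ring_1 set \<Rightarrow> nat \<Rightarrow> (nat \<Rightarrow> 'a) \<Rightarrow> bool" where
  "filter_regular m t x \<longleftrightarrow> gen_ideal (x ` {..<t}) \<subseteq> m \<and>
     (\<forall>i<t. \<forall>P \<in> assoc_primes (gen_ideal (x ` {..<i})) - {m}. x i \<notin> P)"

section \<open>Local cohomology via the Cech complex on generators gs of m\<close>

text \<open>A cochain of degree k is represented by numerators N S (for S a k-subset of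
  {..<length gs}) with a common exponent e; the component at S is N S / a_S^e in the
  localization R_{a_S}, where a_S is the product of the generators indexed by S.\<close>

type_synonym 'a cochain = "(nat set \<Rightarrow> 'a) \<times> nat"

definition cprod :: "'a::comm_ring_1 list \<Rightarrow> nat set \<Rightarrow> 'a" where
  "cprod gs S = (\<Prod>i\<in>S. gs ! i)"

definition csubs :: "'a list \<Rightarrow> nat \<Rightarrow> nat set set" where
  "csubs gs k = {S. S \<subseteq> {..<length gs} \<and> card S = k}"

text \<open>Equality of degree-k cochains (componentwise equality in the localizations).\<close>
definition ceq :: "'a::comm_ring_1 list \<Rightarrow> nat \<Rightarrow> 'a cochain \<Rightarrow> 'a cochain \<Rightarrow> bool" where
  "ceq gs k z z' \<longleftrightarrow> (\<forall>S\<in>csubs gs k. \<exists>M.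
      cprod gs S ^ M * (fst z S * cprod gs S ^ snd z' - fst z' S * cprod gs S ^ snd z) = 0)"

definition czero :: "'a::comm_ring_1 cochain" where
  "czero = (\<lambda>S. 0, 0)"

definition cadd :: "'a::comm_ring_1 list \<Rightarrow> 'a cochain \<Rightarrow> 'a cochain \<Rightarrow> 'a cochain" where
  "cadd gs z z' = (\<lambda>S. fst z S * cprod gs S ^ snd z' + fst z' S * cprod gs S ^ snd z, snd z + snd z')"

definition csmul :: "'a::comm_ring_1 \<Rightarrow> 'a cochain \<Rightarrow> 'a cochain" where
  "csmul r z = (\<lambda>S. r * fst z S, snd z)"

text \<open>Cech differential: (d c)_T = sum over j in T of (-1)^(position of j in T) times
  the image of c_{T - j} in R_{a_T}.\<close>
definition cdiff :: "'a::comm_ring_1 list \<Rightarrow> 'a cochain \<Rightarrow> 'a cochain" where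
  "cdiff gs z = (\<lambda>T. \<Sum>j\<in>T. (-1) ^ card {i\<in>T. i < j} * fst z (T - {j}) * (gs ! j) ^ snd z, snd z)"

definition cocycle :: "'a::comm_ring_1 list \<Rightarrow> nat \<Rightarrow> 'a cochain \<Rightarrow> bool" where
  "cocycle gs k z \<longleftrightarrow> ceq gs (Suc k) (cdiff gs z) czero"

definition coboundary :: "'a::comm_ring_1 list \<Rightarrow> nat \<Rightarrow> 'a cochain \<Rightarrow> bool" where
  "coboundary gs k z \<longleftrightarrow> ceq gs k z czero \<or> (0 < k \<and> (\<exists>w. ceq gs k z (cdiff gs w)))"

definition ccohom_eq :: "'a::comm_ring_1 list \<Rightarrow> nat \<Rightarrow> 'a cochain \<Rightarrow> 'a cochain \<Rightarrow> bool" where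
  "ccohom_eq gs k z z' \<longleftrightarrow> coboundary gs k (cadd gs z (csmul (-1) z'))"

definition cfrob :: "nat \<Rightarrow> nat \<Rightarrow> 'a::comm_ring_1 cochain \<Rightarrow> 'a cochain" where
  "cfrob p e z = (\<lambda>S. fst z S ^ (p ^ e), p ^ e * snd z)"

definition frob_nil :: "'a::comm_ring_1 list \<Rightarrow> nat \<Rightarrow> nat \<Rightarrow> 'a cochain \<Rightarrow> bool" where
  "frob_nil gs p k z \<longleftrightarrow> cocycle gs k z \<and> (\<exists>e. coboundary gs k (cfrob p e z))"

text \<open>Submodules of H^k / 0^F correspond to saturated sets of cocycles containing 0^F
  and closed under the module operations.\<close>
definition quot_submod :: "'a::comm_ring_1 list \<Rightarrow> nat \<Rightarrow> nat \<Rightarrow> 'a cochain set \<Rightarrow> bool" where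
  "quot_submod gs p k U \<longleftrightarrow> U \<subseteq> {z. cocycle gs k z} \<and> {z. frob_nil gs p k z} \<subseteq> U \<and>
     (\<forall>z\<in>U. \<forall>z'\<in>U. cadd gs z z' \<in> U) \<and> (\<forall>r. \<forall>z\<in>U. csmul r z \<in> U) \<and>
     (\<forall>z\<in>U. \<forall>z'. cocycle gs k z' \<and> ccohom_eq gs k z z' \<longrightarrow> z' \<in> U)"

definition cech_frob_quot_finite_length :: "'a::comm_ring_1 list \<Rightarrow> nat \<Rightarrow> nat \<Rightarrow> bool" where
  "cech_frob_quot_finite_length gs p k \<longleftrightarrow> (\<exists>L. \<forall>n (U::nat \<Rightarrow> 'a cochain set).
      (\<forall>i\<le>n. quot_submod gs p k (U i)) \<and> (\<forall>i<n. U i \<subset> U (Suc i)) \<longrightarrow> n \<le> L)"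

text \<open>A (chosen) finite list of generators of m; local cohomology is independent of the choice.\<close>
definition max_gens :: "'a::comm_ring_1 set \<Rightarrow> 'a list" where
  "max_gens m = (SOME gs. gen_ideal (set gs) = m)"

definition lc_frob_quot_finite_length :: "nat \<Rightarrow> 'a::comm_ring_1 set \<Rightarrow> nat \<Rightarrow> bool" where
  "lc_frob_quot_finite_length p m j \<longleftrightarrow> cech_frob_quot_finite_length (max_gens m) p j"

end

theory Submission
  imports Defs "HOL-Library.Function_Algebras" "HOL.Modules"
begin

text \<open>
  Represent \<open>H\<^sup>j\<^sub>m(R/I)\<close> as a direct limit of Koszul cohomology modules; it is Artinian, and every element \<open>u\<close>
  that is regular modulo \<open>I\<close> up to \<open>m\<close>-torsion gives a Frobenius-compatible connecting homomorphism from
  \<open>H\<^sup>j\<^sub>m(R/(I,u))\<close> to \<open>H\<^sup>j\<^sup>+\<^sup>1\<^sub>m(R/I)\<close>. By the Hartshorne--Speiser--Lyubeznik theorem, proved over the completion and descended to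
  \<open>R\<close>, the nilpotent part of each \<open>H\<^sup>j\<^sub>m(R)\<close> is killed by one power of Frobenius. The finite length hypothesis says
  that a power of \<open>m\<close> makes \<open>H\<^sup>j\<^sub>m(R)\<close> nilpotent for \<open>j < t\<close>; induction on \<open>l\<close> transfers this to
  \<open>H\<^sup>j\<^sub>m(R/(x\<^sub>1,\<dots>,x\<^sub>l))\<close> for \<open>l + j < t\<close>, with a power \<open>m\<^sup>N\<close> independent of the sequence. Once the sequence lies in
  \<open>m\<^sup>N\<close>, which holds after raising it to the power \<open>p\<^sup>N\<close>, the nilpotency exponents are bounded by a second induction
  along the connecting homomorphisms, down to \<open>H\<^sup>0\<^sub>m(R/(x\<^sub>1,\<dots>,x\<^sub>t))\<close>. To place the Frobenius closure in
  \<open>H\<^sup>0\<^sub>m\<close>, extend the sequence to a filter regular sequence of length \<open>d\<close>, modulo which everything is \<open>m\<close>-torsion,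
  and descend from length \<open>d\<close> to \<open>t\<close> by replacing the last element by its powers and applying Krull's
  intersection theorem.
\<close>

section \<open>Ideals\<close>

text \<open>Frobenius maps R/(x) to R modulo the p-th powers of x, not to itself. The local
  cohomology of R/(x) therefore carries no Frobenius action, and a nilpotency bound is directly
  available only for R itself; it has to be carried to R/(x) along connecting homomorphisms. For the
  same reason the inductions quantify over all sequences at once: a step replaces x by powers of x,
  and a constant is useful only if it serves those as well.

  The nilpotency bound needs a complete ring because its core, the double annihilator theorem for
  essential extensions of the residue field, passes from the pieces killed by powers of m to the
  whole module by Chevalley's theorem.

  No quotient modules are formed. A module is a pair of submodules B and Z standing for Z/B, and a
  homomorphism is a linear relation on representatives. An epimorphism can then be used through its
  converse, which is how the kernel of an element on local cohomology is recognised as a quotient of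
  a module of lower degree.\<close>

lemma ideal_0: "is_ideal I \<Longrightarrow> 0 \<in> I" by (simp add: is_ideal_def)
lemma ideal_add: "is_ideal I \<Longrightarrow> x \<in> I \<Longrightarrow> y \<in> I \<Longrightarrow> x + y \<in> I" by (simp add: is_ideal_def)
lemma ideal_mult: "is_ideal I \<Longrightarrow> x \<in> I \<Longrightarrow> r * x \<in> I" by (simp add: is_ideal_def)
lemma ideal_mult2: "is_ideal I \<Longrightarrow> x \<in> I \<Longrightarrow> x * r \<in> I" by (metis ideal_mult mult.commute)
lemma ideal_neg: "is_ideal I \<Longrightarrow> x \<in> I \<Longrightarrow> - x \<in> I" using ideal_mult[of I x "-1"] by simp
lemma ideal_diff: "is_ideal I \<Longrightarrow> x \<in> I \<Longrightarrow> y \<in> I \<Longrightarrow> x - y \<in> I"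
  using ideal_add[of I x "- y"] ideal_neg by auto
lemma ideal_sum: "is_ideal I \<Longrightarrow> (\<And>i. i \<in> A \<Longrightarrow> f i \<in> I) \<Longrightarrow> sum f A \<in> I"
  by (induction A rule: infinite_finite_induct) (auto simp: ideal_0 ideal_add)
lemma ideal_add_iff: "is_ideal I \<Longrightarrow> y \<in> I \<Longrightarrow> x + y \<in> I \<longleftrightarrow> x \<in> I"
  using ideal_add[of I x y] ideal_diff[of I "x + y" y] by auto
lemma ideal_diff_iff: "is_ideal I \<Longrightarrow> x - y \<in> I \<Longrightarrow> x \<in> I \<longleftrightarrow> y \<in> I"
  using ideal_add[of I "x - y" y] ideal_diff[of I x "x - y"] by auto
lemma ideal_pow: "is_ideal I \<Longrightarrow> x \<in> I \<Longrightarrow> 0 < n \<Longrightarrow> x ^ n \<in> I"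
  by (cases n) (auto simp: ideal_mult2)
lemma ideal_one: "is_ideal I \<Longrightarrow> 1 \<in> I \<Longrightarrow> I = UNIV"
  using ideal_mult[of I 1] by auto

lemma is_idealI: "0 \<in> I \<Longrightarrow> (\<And>x y. x \<in> I \<Longrightarrow> y \<in> I \<Longrightarrow> x + y \<in> I) \<Longrightarrow> (\<And>r x. x \<in> I \<Longrightarrow> r * x \<in> I) \<Longrightarrow> is_ideal I"
  by (simp add: is_ideal_def)

lemma is_ideal_UNIV: "is_ideal UNIV" by (simp add: is_ideal_def)
lemma is_ideal_zero: "is_ideal {0}" by (simp add: is_ideal_def)
lemma is_ideal_Inter: "(\<And>I. I \<in> A \<Longrightarrow> is_ideal I) \<Longrightarrow> is_ideal (\<Inter>A)" by (simp add: is_ideal_def)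

lemma is_ideal_gen: "is_ideal (gen_ideal S)"
  unfolding gen_ideal_def by (rule is_ideal_Inter) auto
lemma gen_sup: "S \<subseteq> gen_ideal S" unfolding gen_ideal_def by auto
lemma gen_in: "x \<in> S \<Longrightarrow> x \<in> gen_ideal S" using gen_sup by auto
lemma gen_least: "is_ideal I \<Longrightarrow> S \<subseteq> I \<Longrightarrow> gen_ideal S \<subseteq> I" unfolding gen_ideal_def by auto
lemma gen_mono: "S \<subseteq> T \<Longrightarrow> gen_ideal S \<subseteq> gen_ideal T"
  by (meson gen_least gen_sup is_ideal_gen subset_trans)
lemma gen_empty: "gen_ideal {} = {0}"
  using gen_least[OF is_ideal_zero, of "{}"] ideal_0[OF is_ideal_gen] by auto

definition iadd :: "'a::comm_ring_1 set \<Rightarrow> 'a \<Rightarrow> 'a set" where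
  "iadd I u = {y. \<exists>r. y - r * u \<in> I}"

lemma iaddI: "y - r * u \<in> I \<Longrightarrow> y \<in> iadd I u" by (auto simp: iadd_def)
lemma iaddE: assumes "y \<in> iadd I u" obtains r i where "y = i + r * u" "i \<in> I"
proof -
  from assms obtain r where "y - r * u \<in> I" by (auto simp: iadd_def)
  then show thesis using that[of "y - r * u" r] by simp
qed

lemma is_ideal_iadd: assumes "is_ideal I" shows "is_ideal (iadd I u)"
proof (rule is_idealI)
  show "0 \<in> iadd I u" by (rule iaddI[of _ 0]) (simp add: assms ideal_0)
next
  fix x y assume "x \<in> iadd I u" "y \<in> iadd I u"
  then obtain r s where "x - r * u \<in> I" "y - s * u \<in> I" by (auto simp: iadd_def)
  then show "x + y \<in> iadd I u" using ideal_add[OF assms, of "x - r * u" "y - s * u"]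
    by (intro iaddI[of _ "r + s"]) (simp add: algebra_simps)
next
  fix c x assume "x \<in> iadd I u"
  then obtain r where "x - r * u \<in> I" by (auto simp: iadd_def)
  then show "c * x \<in> iadd I u" using ideal_mult[OF assms, of "x - r * u" c]
    by (intro iaddI[of _ "c * r"]) (simp add: algebra_simps)
qed

lemma iadd_sup: "I \<subseteq> iadd I u" by (auto intro: iaddI[of _ 0])
lemma iadd_self: "is_ideal I \<Longrightarrow> u \<in> iadd I u" by (rule iaddI[of _ 1]) (simp add: ideal_0)
lemma iadd_mult: "is_ideal I \<Longrightarrow> r * u \<in> iadd I u" by (rule iaddI[of _ r]) (simp add: ideal_0)
lemma iadd_least: "is_ideal J \<Longrightarrow> I \<subseteq> J \<Longrightarrow> u \<in> J \<Longrightarrow> iadd I u \<subseteq> J"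
  by (auto elim!: iaddE intro: ideal_add ideal_mult)
lemma iadd_commute: "iadd (iadd I u) v = iadd (iadd I v) u"
proof -
  have "(y \<in> iadd (iadd I u) v) = (y \<in> iadd (iadd I v) u)" for y
    unfolding iadd_def by (simp add: diff_diff_eq) (metis add.commute)
  then show ?thesis by blast
qed

lemma gen_insert: "gen_ideal (insert u S) = iadd (gen_ideal S) u"
proof
  show "gen_ideal (insert u S) \<subseteq> iadd (gen_ideal S) u"
    using gen_sup[of S] iadd_sup[of "gen_ideal S" u]
    by (intro gen_least is_ideal_iadd is_ideal_gen) (auto simp: iadd_self is_ideal_gen)
  show "iadd (gen_ideal S) u \<subseteq> gen_ideal (insert u S)"
    by (intro iadd_least is_ideal_gen gen_mono) (auto intro: gen_in)
qed

definition idl :: "(nat \<Rightarrow> 'a::comm_ring_1) \<Rightarrow> nat \<Rightarrow> 'a set" where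
  "idl x l = gen_ideal (x ` {..<l})"

lemma is_ideal_idl: "is_ideal (idl x l)" by (simp add: idl_def is_ideal_gen)
lemma idl_0: "idl x 0 = {0}" by (simp add: idl_def gen_empty)
lemma idl_Suc: "idl x (Suc l) = iadd (idl x l) (x l)"
  by (simp add: idl_def lessThan_Suc gen_insert)
lemma idl_in: "i < l \<Longrightarrow> x i \<in> idl x l" unfolding idl_def by (rule gen_in) auto
lemma idl_mono: "k \<le> l \<Longrightarrow> idl x k \<subseteq> idl x l" unfolding idl_def by (intro gen_mono image_mono) auto
lemma idl_cong: "(\<And>i. i < l \<Longrightarrow> x i = y i) \<Longrightarrow> idl x l = idl y l"
  unfolding idl_def by (metis image_cong lessThan_iff)

lemma gen_sum_coeff:
  assumes "finite S" "y \<in> gen_ideal S"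
  shows "\<exists>c. y = (\<Sum>s\<in>S. c s * s)"
  using assms
proof (induction S arbitrary: y)
  case empty then show ?case by (simp add: gen_empty)
next
  case (insert u S)
  then obtain r i where y: "y = i + r * u" "i \<in> gen_ideal S" by (auto simp: gen_insert elim: iaddE)
  with insert obtain c where c: "i = (\<Sum>s\<in>S. c s * s)" by blast
  have "(\<Sum>s\<in>S. (c(u := r)) s * s) = (\<Sum>s\<in>S. c s * s)" by (rule sum.cong) (use insert in auto)
  then have "y = (\<Sum>s\<in>insert u S. (c(u := r)) s * s)" using insert y c by (simp add: add.commute)
  then show ?case by blast
qed

definition colon :: "'a::comm_ring_1 set \<Rightarrow> 'a \<Rightarrow> 'a set" where
  "colon I u = {r. r * u \<in> I}"

lemma is_ideal_colon: "is_ideal I \<Longrightarrow> is_ideal (colon I u)"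
  unfolding colon_def by (rule is_idealI) (auto simp: distrib_right ideal_0 ideal_add mult.assoc ideal_mult)
lemma colon_sup: "is_ideal I \<Longrightarrow> I \<subseteq> colon I u" by (auto simp: colon_def ideal_mult2)

subsection \<open>Powers of an ideal and saturation\<close>

primrec idpow :: "'a::comm_ring_1 set \<Rightarrow> nat \<Rightarrow> 'a set" where
  "idpow m 0 = UNIV"
| "idpow m (Suc n) = gen_ideal {a * b | a b. a \<in> m \<and> b \<in> idpow m n}"

lemma is_ideal_idpow: "is_ideal (idpow m n)" by (cases n) (auto simp: is_ideal_UNIV is_ideal_gen)
lemma idpow_mult1: "a \<in> m \<Longrightarrow> b \<in> idpow m n \<Longrightarrow> a * b \<in> idpow m (Suc n)" by (auto intro: gen_in)
lemma idpow_Suc_least: "is_ideal J \<Longrightarrow> (\<And>a b. a \<in> m \<Longrightarrow> b \<in> idpow m n \<Longrightarrow> a * b \<in> J) \<Longrightarrow> idpow m (Suc n) \<subseteq> J"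
  by (simp, rule gen_least) auto
lemma idpow_Suc_sub: "idpow m (Suc n) \<subseteq> idpow m n"
  by (rule idpow_Suc_least) (auto simp: is_ideal_idpow ideal_mult)
lemma idpow_anti: "i \<le> j \<Longrightarrow> idpow m j \<subseteq> idpow m i"
  by (rule lift_Suc_antimono_le[of "idpow m"]) (use idpow_Suc_sub in auto)
lemma idpow_1: assumes m: "is_ideal m" shows "idpow m (Suc 0) = m"
proof
  show "idpow m (Suc 0) \<subseteq> m" by (rule idpow_Suc_least) (auto simp: m ideal_mult2)
  show "m \<subseteq> idpow m (Suc 0)" using idpow_mult1[of _ m 1 0] by (auto simp del: idpow.simps(2))
qed
lemma idpow_pow: "a \<in> m \<Longrightarrow> a ^ n \<in> idpow m n"
  by (induction n) (auto simp del: idpow.simps(2) simp: idpow_mult1)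

lemma idpow_mult: "a \<in> idpow m i \<Longrightarrow> b \<in> idpow m j \<Longrightarrow> a * b \<in> idpow m (i + j)"
proof (induction i arbitrary: a)
  case 0 then show ?case by (simp add: is_ideal_idpow ideal_mult)
next
  case (Suc i)
  have "is_ideal (colon (idpow m (Suc i + j)) b)" by (simp add: is_ideal_colon is_ideal_idpow del: idpow.simps)
  moreover have "c * d \<in> colon (idpow m (Suc i + j)) b" if "c \<in> m" "d \<in> idpow m i" for c d
    using idpow_mult1[OF that(1) Suc.IH[OF that(2) Suc.prems(2)]] by (simp add: colon_def mult.assoc del: idpow.simps)
  ultimately have "idpow m (Suc i) \<subseteq> colon (idpow m (Suc i + j)) b" by (rule idpow_Suc_least)
  then show ?case using Suc.prems by (auto simp: colon_def simp del: idpow.simps)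
qed

text \<open>The power with exponent i + j is generated by products, so a containment can be tested
  on them. Later this composes two annihilation statements, one for each factor.\<close>

lemma idpow_add_least:
  assumes "is_ideal J" "\<And>a b. a \<in> idpow m i \<Longrightarrow> b \<in> idpow m j \<Longrightarrow> a * b \<in> J"
  shows "idpow m (i + j) \<subseteq> J"
  using assms
proof (induction i arbitrary: J)
  case 0 then show ?case using "0"(2)[of 1] by auto
next
  case (Suc i)
  show ?case unfolding add_Suc
  proof (rule idpow_Suc_least[OF Suc.prems(1)])
    fix a b assume a: "a \<in> m" and b: "b \<in> idpow m (i + j)"
    have "idpow m (i + j) \<subseteq> colon J a"
    proof (rule Suc.IH)
      show "is_ideal (colon J a)" by (simp add: is_ideal_colon Suc.prems)
      fix c d assume "c \<in> idpow m i" "d \<in> idpow m j"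
      then have "(a * c) * d \<in> J" using Suc.prems(2) idpow_mult1[OF a] by blast
      then show "c * d \<in> colon J a" by (simp add: colon_def algebra_simps)
    qed
    then show "a * b \<in> J" using b by (auto simp: colon_def mult.commute)
  qed
qed

lemma power_in_ideal_mono: "is_ideal J \<Longrightarrow> idpow m i \<subseteq> J \<Longrightarrow> i \<le> j \<Longrightarrow> idpow m j \<subseteq> J"
  using idpow_anti by blast

text \<open>\<open>T N\<close> is spanned by the products \<open>a * u ^ j\<close> with a in the
  i-th power of A and i + j = N, and it contains the N-th power of \<open>iadd A u\<close>. For N =
  n + k either i is at least n or j is at least k, so each product lies in J.\<close>

lemma idpow_iadd:
  assumes "is_ideal A" "is_ideal J" "idpow A n \<subseteq> J" "u ^ k \<in> J"
  shows "idpow (iadd A u) (n + k) \<subseteq> J"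
proof -
  define T where "T N = gen_ideal {a * u ^ j | a i j. a \<in> idpow A i \<and> i + j = N}" for N
  have 1: "idpow (iadd A u) N \<subseteq> T N" for N
  proof (induction N)
    case 0 have "1 * u ^ 0 \<in> T 0" unfolding T_def by (rule gen_in) (auto intro!: exI[of _ 1])
    then have "T 0 = UNIV" using ideal_one[of "T 0"] by (simp add: T_def is_ideal_gen)
    then show ?case by simp
  next
    case (Suc N)
    show ?case
    proof (rule idpow_Suc_least)
      show I: "is_ideal (T (Suc N))" by (simp add: T_def is_ideal_gen)
      fix a b assume a: "a \<in> iadd A u" and b: "b \<in> idpow (iadd A u) N"
      have "T N \<subseteq> colon (T (Suc N)) a"
        unfolding T_def[of N]
      proof (rule gen_least[OF is_ideal_colon[OF I]], rule subsetI)
        fix z assume "z \<in> {a * u ^ j |a i j. a \<in> idpow A i \<and> i + j = N}"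
        then obtain c i j where c: "c \<in> idpow A i" and N: "i + j = N" and z: "z = c * u ^ j" by blast
        obtain r b where ab: "a = b + r * u" "b \<in> A" using a by (rule iaddE)
        have "(b * c) * u ^ j \<in> T (Suc N)" unfolding T_def using idpow_mult1[OF ab(2) c] N
          by (intro gen_in) (metis (mono_tags, lifting) add_Suc mem_Collect_eq)
        moreover have "c * u ^ (Suc j) \<in> T (Suc N)" unfolding T_def using c N
          by (intro gen_in) (metis (mono_tags, lifting) add_Suc_right mem_Collect_eq)
        then have "r * (c * u ^ Suc j) \<in> T (Suc N)" by (rule ideal_mult[OF I])
        ultimately have "(b * c) * u ^ j + r * (c * u ^ Suc j) \<in> T (Suc N)" by (rule ideal_add[OF I])
        then show "z \<in> colon (T (Suc N)) a" by (simp add: colon_def ab z algebra_simps)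
      qed
      then show "a * b \<in> T (Suc N)" using b Suc by (auto simp: colon_def mult.commute)
    qed
  qed
  have "T (n + k) \<subseteq> J" unfolding T_def
  proof (rule gen_least[OF assms(2)], clarsimp)
    fix a i j assume a: "a \<in> idpow A i" "i + j = n + k"
    show "a * u ^ j \<in> J"
    proof (cases "n \<le> i")
      case True then show ?thesis using a assms(2,3) power_in_ideal_mono[OF assms(2,3)] ideal_mult2 by blast
    next
      case False then have "j = k + (j - k)" using a(2) by simp
      then have "u ^ j = u ^ k * u ^ (j - k)" by (metis power_add)
      then show ?thesis using assms(2,4) by (simp add: ideal_mult ideal_mult2)
    qed
  qed
  then show ?thesis using 1 by blast
qed

text \<open>Torsion is established one generator at a time; this turns the finitely many exponents
  into a single power of the ideal.\<close>

lemma idpow_gen_sub: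
  assumes "finite G" "is_ideal J" "\<And>g. g \<in> G \<Longrightarrow> \<exists>e. g ^ e \<in> J"
  shows "\<exists>N. idpow (gen_ideal G) N \<subseteq> J"
  using assms(1,3)
proof (induction G)
  case empty
  have "idpow {0} (Suc 0) \<subseteq> J" by (rule idpow_Suc_least) (auto simp: assms(2) ideal_0)
  then show ?case by (auto simp del: idpow.simps simp: gen_empty)
next
  case (insert u G)
  then obtain n where "idpow (gen_ideal G) n \<subseteq> J" by blast
  moreover obtain k where "u ^ k \<in> J" using insert.prems by blast
  ultimately show ?case using idpow_iadd[OF is_ideal_gen assms(2)] unfolding gen_insert by blast
qed

text \<open>The saturation of I with respect to m: modulo I it is the zeroth local cohomology of
  R/I.\<close>

definition sat :: "'a::comm_ring_1 set \<Rightarrow> 'a set \<Rightarrow> 'a set" where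
  "sat m I = {r. \<exists>N. \<forall>a\<in>idpow m N. a * r \<in> I}"

lemma satI: "(\<And>a. a \<in> idpow m N \<Longrightarrow> a * r \<in> I) \<Longrightarrow> r \<in> sat m I" by (auto simp: sat_def)
lemma sat_sup: "is_ideal I \<Longrightarrow> I \<subseteq> sat m I" by (auto intro!: satI[of m 0] ideal_mult)
lemma is_ideal_sat: assumes "is_ideal I" shows "is_ideal (sat m I)"
proof (rule is_idealI)
  show "0 \<in> sat m I" using sat_sup[OF assms] ideal_0[OF assms] by blast
next
  fix x y assume "x \<in> sat m I" "y \<in> sat m I"
  then obtain M N where "\<forall>a\<in>idpow m M. a * x \<in> I" "\<forall>a\<in>idpow m N. a * y \<in> I" by (auto simp: sat_def)
  then show "x + y \<in> sat m I"
    using idpow_anti[of M "max M N" m] idpow_anti[of N "max M N" m]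
    by (intro satI[of m "max M N"]) (auto simp: distrib_left intro!: ideal_add[OF assms])
next
  fix r x assume "x \<in> sat m I"
  then obtain M where "\<forall>a\<in>idpow m M. a * x \<in> I" by (auto simp: sat_def)
  then show "r * x \<in> sat m I" using ideal_mult[OF assms]
    by (intro satI[of m M]) (simp add: mult.left_commute[of _ r])
qed
lemma sat_mono: "I \<subseteq> J \<Longrightarrow> sat m I \<subseteq> sat m J" by (auto simp: sat_def)

text \<open>The exponent witnessing \<open>a * r\<close> in \<open>sat m I\<close> depends on a.
  Using only \<open>a = g ^ N\<close> for the finitely many generators g makes it uniform.\<close>

lemma sat_by: assumes "is_ideal I" "\<And>a. a \<in> idpow m N \<Longrightarrow> a * r \<in> sat m I" "finite G" "m = gen_ideal G"
  shows "r \<in> sat m I"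
proof -
  have "\<exists>e. g ^ e \<in> colon I r" if "g \<in> G" for g
  proof -
    have "g \<in> m" using that assms(4) gen_in by auto
    then have "g ^ N * r \<in> sat m I" using assms(2) idpow_pow by blast
    then obtain M where "\<forall>a\<in>idpow m M. a * (g ^ N * r) \<in> I" by (auto simp: sat_def)
    then have "g ^ M * (g ^ N * r) \<in> I" using \<open>g \<in> m\<close> idpow_pow by blast
    then show ?thesis by (auto simp: colon_def mult.assoc power_add intro!: exI[of _ "M + N"])
  qed
  then obtain K where "idpow m K \<subseteq> colon I r"
    using idpow_gen_sub[OF assms(3) is_ideal_colon[OF assms(1), of r]] assms(4) by blast
  then show ?thesis by (auto simp: colon_def sat_def)
qed

section \<open>Noetherian local rings\<close>

lemma noeth_acc:
  fixes X :: "nat \<Rightarrow> 'a::comm_ring_1 set"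
  assumes n: "noetherian_cring TYPE('a)" and i: "\<And>i. is_ideal (X i)" and s: "\<And>i. X i \<subseteq> X (Suc i)"
  shows "\<exists>n. \<forall>i\<ge>n. X i = X n"
proof -
  have mono: "i \<le> j \<Longrightarrow> X i \<subseteq> X j" for i j using s by (rule lift_Suc_mono_le)
  have "is_ideal (\<Union>i. X i)"
  proof (rule is_idealI)
    show "0 \<in> (\<Union>i. X i)" using ideal_0[OF i] by blast
    fix x y assume "x \<in> (\<Union>i. X i)" "y \<in> (\<Union>i. X i)"
    then obtain a b where "x \<in> X a" "y \<in> X b" by blast
    then have "x \<in> X (max a b)" "y \<in> X (max a b)"
      using mono[OF max.cobounded1[of a b]] mono[OF max.cobounded2[of b a]] by blast+
    then show "x + y \<in> (\<Union>i. X i)" using ideal_add[OF i] by blast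
  next
    fix r x assume "x \<in> (\<Union>i. X i)"
    then show "r * x \<in> (\<Union>i. X i)" using ideal_mult[OF i] by blast
  qed
  then obtain S where S: "finite S" "(\<Union>i. X i) = gen_ideal S"
    using n[unfolded noetherian_cring_def, rule_format] by metis
  have "\<forall>s\<in>S. \<exists>i. s \<in> X i" using S(2) gen_sup[of S] by auto
  then obtain f where f: "\<forall>s\<in>S. s \<in> X (f s)" by metis
  define n where "n = Max (f ` S)"
  have "S \<subseteq> X n"
  proof
    fix s assume "s \<in> S"
    then have "f s \<le> n" using S by (simp add: n_def)
    then show "s \<in> X n" using f mono \<open>s \<in> S\<close> by blast
  qed
  then have U: "(\<Union>i. X i) \<subseteq> X n" using S gen_least[OF i] by metis
  have "X k = X n" if "n \<le> k" for k using mono[OF that] U by auto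
  then show ?thesis by auto
qed

lemma noeth_max:
  fixes P :: "'a::comm_ring_1 set \<Rightarrow> bool"
  assumes n: "noetherian_cring TYPE('a)" and i: "\<And>I. P I \<Longrightarrow> is_ideal I" and ne: "P I0"
  shows "\<exists>I. P I \<and> (\<forall>J. P J \<longrightarrow> I \<subseteq> J \<longrightarrow> J = I)"
proof (rule ccontr)
  assume "\<not> ?thesis"
  then have "\<forall>I. \<exists>J. P I \<longrightarrow> P J \<and> I \<subset> J" by blast
  then obtain f where f: "\<And>I. P I \<Longrightarrow> P (f I) \<and> I \<subset> f I" by metis
  define X where "X n = (f ^^ n) I0" for n
  have XA: "P (X n)" for n by (induction n) (auto simp: X_def ne f)
  have "\<exists>n. \<forall>i\<ge>n. X i = X n"
  proof (rule noeth_acc[OF n])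
    show "is_ideal (X k)" for k using i XA by blast
    show "X k \<subseteq> X (Suc k)" for k using f[OF XA[of k]] by (auto simp: X_def)
  qed
  then obtain n where "X (Suc n) = X n" by (meson le_Suc_eq le_refl)
  then show False using f XA[of n] by (auto simp: X_def)
qed

locale nloc =
  fixes m :: "'a::comm_ring_1 set"
  assumes noeth: "noetherian_cring TYPE('a)" and loc: "local_ring_max m"
begin

lemma is_ideal_m: "is_ideal m" and one_nm: "1 \<notin> m"
  using loc unfolding local_ring_max_def maximal_ideal_def by (auto dest: ideal_one)

lemma m_max: "is_ideal J \<Longrightarrow> m \<subseteq> J \<Longrightarrow> J \<noteq> UNIV \<Longrightarrow> J = m"
  using loc unfolding local_ring_max_def maximal_ideal_def by blast

lemma proper_sub: assumes "is_ideal I" "I \<noteq> UNIV" shows "I \<subseteq> m"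
proof -
  obtain M where M: "is_ideal M \<and> I \<subseteq> M \<and> M \<noteq> UNIV"
    and mx: "\<forall>J. is_ideal J \<and> I \<subseteq> J \<and> J \<noteq> UNIV \<longrightarrow> M \<subseteq> J \<longrightarrow> J = M"
    using noeth_max[OF noeth, of "\<lambda>J. is_ideal J \<and> I \<subseteq> J \<and> J \<noteq> UNIV" I] assms by auto
  have "maximal_ideal M" unfolding maximal_ideal_def using M mx by (metis subset_trans)
  then show ?thesis using M loc unfolding local_ring_max_def by metis
qed

lemma unit: assumes "a \<notin> m" obtains b where "b * a = 1"
proof -
  have "iadd {0} a = UNIV" using proper_sub[OF is_ideal_iadd[OF is_ideal_zero]] iadd_self[OF is_ideal_zero] assms by blast
  then obtain b where "1 - b * a \<in> {0}" unfolding iadd_def by blast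
  then show thesis using that[of b] by simp
qed

lemma unit1: assumes "a \<in> m" obtains b where "b * (1 - a) = 1"
  using unit[of "1 - a"] assms ideal_add[OF is_ideal_m, of "1 - a" a] one_nm by force

lemma fin_gen: fixes I :: "'a set" assumes "is_ideal I" obtains S where "finite S" "I = gen_ideal S"
  using noeth[unfolded noetherian_cring_def, rule_format, OF assms] by metis

lemma prime_m: "prime_ideal m"
  unfolding prime_ideal_def
proof (intro conjI allI impI)
  show "is_ideal m" "m \<noteq> UNIV" using is_ideal_m one_nm by auto
  fix x y assume xy: "x * y \<in> m"
  show "x \<in> m \<or> y \<in> m"
  proof (rule ccontr)
    assume n: "\<not> (x \<in> m \<or> y \<in> m)"
    then obtain b where "b * x = 1" using unit by blast
    then have "b * (x * y) = y" by (simp add: mult.assoc[symmetric])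
    then show False using ideal_mult[OF is_ideal_m xy, of b] n by simp
  qed
qed

lemma prime_idpow: assumes "prime_ideal P" "P \<noteq> m" obtains a where "a \<in> idpow m N" "a \<notin> P"
proof -
  have P: "is_ideal P" "P \<noteq> UNIV" using assms by (auto simp: prime_ideal_def)
  have "\<not> m \<subseteq> P" using m_max P assms by blast
  then obtain g where g: "g \<in> m" "g \<notin> P" by blast
  have "g ^ N \<notin> P" by (induction N) (use P assms g ideal_one in \<open>auto simp: prime_ideal_def\<close>)
  then show thesis using that idpow_pow[OF g(1)] by blast
qed

lemma prime_sat: "prime_ideal P \<Longrightarrow> P \<noteq> m \<Longrightarrow> r \<in> sat m I \<Longrightarrow> I \<subseteq> P \<Longrightarrow> r \<in> P"
proof -
  assume P: "prime_ideal P" "P \<noteq> m" and r: "r \<in> sat m I" and s: "I \<subseteq> P"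
  obtain N where N: "\<forall>a\<in>idpow m N. a * r \<in> I" using r by (auto simp: sat_def)
  obtain a where "a \<in> idpow m N" "a \<notin> P" using prime_idpow[OF P] by blast
  then show "r \<in> P" using N s P(1) unfolding prime_ideal_def by blast
qed

text \<open>The ideals of elements carried into I by the N-th power of m increase with N, hence
  stabilise.\<close>

lemma sat_uniform: assumes I: "is_ideal I"
  obtains N where "\<And>a r. a \<in> idpow m N \<Longrightarrow> r \<in> sat m I \<Longrightarrow> a * r \<in> I"
proof -
  define X where "X N = {r. \<forall>a\<in>idpow m N. a * r \<in> I}" for N
  have "is_ideal (X N)" for N unfolding X_def
    by (rule is_idealI) (auto simp: ideal_0[OF I] distrib_left mult.left_commute intro: ideal_add[OF I] ideal_mult[OF I])
  moreover have "X N \<subseteq> X (Suc N)" for N unfolding X_def using idpow_Suc_sub by blast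
  ultimately obtain N where N: "\<forall>i\<ge>N. X i = X N" using noeth_acc[OF noeth, of X] by blast
  have "sat m I \<subseteq> X N"
  proof
    fix r assume "r \<in> sat m I"
    then obtain M where "r \<in> X M" by (auto simp: sat_def X_def)
    then have "r \<in> X (max M N)" using idpow_anti[of M "max M N" m] by (auto simp: X_def)
    then show "r \<in> X N" using N max.cobounded2[of N M] by metis
  qed
  then show thesis using that[of N] unfolding X_def by blast
qed

lemma sat_by': assumes "is_ideal I" "\<And>a. a \<in> idpow m N \<Longrightarrow> a * r \<in> sat m I" shows "r \<in> sat m I"
proof -
  obtain G where G: "finite G" "m = gen_ideal G" using fin_gen[OF is_ideal_m] by blast
  show ?thesis by (rule sat_by[OF assms(1) _ G]) (rule assms(2))
qed

text \<open>Existence of an associated prime: take a maximal ideal among the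
  \<open>colon J (r * z)\<close> with \<open>r * z\<close> outside J. If \<open>x * y\<close> lies
  in it and y does not, passing from r to \<open>y * r\<close> cannot enlarge it, so it contains
  x.\<close>

lemma colon_prime: fixes J :: "'a set" assumes J: "is_ideal J" and z: "z \<notin> J"
  obtains r where "r * z \<notin> J" "prime_ideal (colon J (r * z))" "colon J z \<subseteq> colon J (r * z)"
proof -
  define A where "A I \<longleftrightarrow> (\<exists>r. I = colon J (r * z) \<and> r * z \<notin> J)" for I
  have "1 * z \<notin> J" using z by simp
  then have "A (colon J (1 * z))" unfolding A_def by blast
  moreover have "is_ideal I" if "A I" for I using that is_ideal_colon[OF J] by (auto simp: A_def)
  ultimately obtain I where "A I" and mx: "\<forall>K. A K \<longrightarrow> I \<subseteq> K \<longrightarrow> K = I"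
    using noeth_max[OF noeth, of A "colon J (1 * z)"] by auto
  then obtain r where r: "I = colon J (r * z)" "r * z \<notin> J" unfolding A_def by blast
  have "prime_ideal I" unfolding prime_ideal_def
  proof (intro conjI allI impI)
    show "is_ideal I" using r is_ideal_colon[OF J] by simp
    have "1 \<notin> I" using r by (simp add: colon_def)
    then show "I \<noteq> UNIV" by blast
    fix x y assume xy: "x * y \<in> I"
    show "x \<in> I \<or> y \<in> I"
    proof (rule ccontr)
      assume n: "\<not> (x \<in> I \<or> y \<in> I)"
      then have "(y * r) * z \<notin> J" by (auto simp: r colon_def mult.assoc)
      moreover have "I \<subseteq> colon J ((y * r) * z)" using ideal_mult[OF J, of _ y]
        by (auto simp: r colon_def mult.left_commute[of _ y] mult.assoc)
      ultimately have "colon J ((y * r) * z) = I" using mx[rule_format, of "colon J ((y * r) * z)"] unfolding A_def by blast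
      moreover have "x \<in> colon J ((y * r) * z)" using xy by (auto simp: r colon_def algebra_simps)
      ultimately show False using n by blast
    qed
  qed
  moreover have "colon J z \<subseteq> I" using ideal_mult[OF J, of _ r] by (auto simp: r colon_def mult.left_commute[of _ r])
  ultimately show thesis using that r by blast
qed

text \<open>Filter regularity without primes: multiplication by \<open>x i\<close> on the quotient
  by the earlier elements has m-torsion kernel. After \<open>filter_regular_FR\<close> the proof
  works with this form.\<close>

definition FR :: "(nat \<Rightarrow> 'a) \<Rightarrow> nat \<Rightarrow> bool" where
  "FR x t \<longleftrightarrow> (\<forall>i<t. x i \<in> m \<and> colon (idl x i) (x i) \<subseteq> sat m (idl x i))"

text \<open>Suppose that \<open>x i\<close> kills y and y is not m-torsion. A prime P that
  annihilates a multiple of y modulo the saturation then contains \<open>x i\<close>. It differs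
  from m because R modulo the saturation has no m-torsion, and it is associated to I itself, which
  contradicts the hypothesis.\<close>

lemma filter_regular_FR: assumes "filter_regular m t x" shows "FR x t"
  unfolding FR_def
proof (intro allI impI conjI subsetI)
  fix i assume i: "i < t"
  show "x i \<in> m" using assms i gen_sup[of "x ` {..<t}"] unfolding filter_regular_def by auto
  define I where "I = idl x i"
  have I: "is_ideal I" by (simp add: I_def is_ideal_idl)
  fix y assume y: "y \<in> colon (idl x i) (x i)"
  show "y \<in> sat m (idl x i)"
  proof (rule ccontr)
    assume "y \<notin> sat m (idl x i)"
    then have "y \<notin> sat m I" by (simp add: I_def)
    then obtain r where r: "r * y \<notin> sat m I" "prime_ideal (colon (sat m I) (r * y))"
        "colon (sat m I) y \<subseteq> colon (sat m I) (r * y)"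
      using colon_prime[OF is_ideal_sat[OF I]] by blast
    define P where "P = colon (sat m I) (r * y)"
    have "x i \<in> colon (sat m I) y" using y sat_sup[OF I] by (auto simp: colon_def I_def mult.commute)
    then have xP: "x i \<in> P" using r by (auto simp: P_def)
    have PM: "P \<noteq> m"
    proof
      assume P: "P = m"
      have "r * y \<in> sat m I"
      proof (rule sat_by'[OF I, of 1])
        fix a assume "a \<in> idpow m 1"
        then have "a \<in> P" using P idpow_1[OF is_ideal_m] by (simp del: idpow.simps)
        then show "a * (r * y) \<in> sat m I" by (simp add: P_def colon_def)
      qed
      then show False using r by blast
    qed
    have Pp: "prime_ideal P" using r by (simp add: P_def)
    obtain N where N: "\<And>a r. a \<in> idpow m N \<Longrightarrow> r \<in> sat m I \<Longrightarrow> a * r \<in> I" using sat_uniform[OF I] by blast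
    \<comment> \<open>Multiplying by an element of the N-th power of m outside P turns an
      annihilator modulo the saturation into the same annihilator modulo I.\<close>
    obtain a where a: "a \<in> idpow m N" "a \<notin> P" using prime_idpow[OF Pp PM] by blast
    have "P = {b. b * (a * (r * y)) \<in> I}"
    proof
      show "P \<subseteq> {b. b * (a * (r * y)) \<in> I}"
      proof clarify
        fix b assume "b \<in> P"
        then have "b * (r * y) \<in> sat m I" by (simp add: P_def colon_def)
        then have "a * (b * (r * y)) \<in> I" using N a by blast
        then show "b * (a * (r * y)) \<in> I" by (simp add: algebra_simps)
      qed
      show "{b. b * (a * (r * y)) \<in> I} \<subseteq> P"
      proof clarify
        fix b assume "b * (a * (r * y)) \<in> I"
        then have "(b * a) * (r * y) \<in> sat m I" using sat_sup[OF I] by (auto simp: mult.assoc)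
        then have "b * a \<in> P" by (simp add: P_def colon_def)
        then show "b \<in> P" using a Pp unfolding prime_ideal_def by blast
      qed
    qed
    then have "P \<in> assoc_primes I" using Pp unfolding assoc_primes_def by blast
    then show False using assms i xP PM unfolding filter_regular_def I_def idl_def by blast
  qed
qed

text \<open>Noetherian induction on I. Let P be the annihilator of s modulo I and K = I + (s), and
  let Q be another associated prime, the annihilator of y. If a multiple of y lies in K but not in
  I, then Q = P; otherwise y has the same annihilator modulo K, so Q is associated to K.\<close>

lemma finite_assoc: fixes J :: "'a set" assumes "is_ideal J" shows "finite (assoc_primes J)"
proof (rule ccontr)
  assume n: "infinite (assoc_primes J)"
  obtain I :: "'a set" where I: "is_ideal I" "infinite (assoc_primes I)"
    and mx: "\<forall>K. is_ideal K \<and> infinite (assoc_primes K) \<longrightarrow> I \<subseteq> K \<longrightarrow> K = I"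
    using noeth_max[OF noeth, of "\<lambda>I. is_ideal I \<and> infinite (assoc_primes I)" J] n assms by auto
  have "assoc_primes I \<noteq> {}" using I(2) by auto
  then obtain P where "P \<in> assoc_primes I" by blast
  then obtain s where P: "prime_ideal P" "P = {r. r * s \<in> I}" unfolding assoc_primes_def by blast
  have "s \<notin> I" using P by (auto simp: prime_ideal_def ideal_mult[OF I(1)])
  define K where "K = iadd I s"
  have "finite (assoc_primes K)" using mx[rule_format, of K] is_ideal_iadd[OF I(1)] iadd_sup[of I s] iadd_self[OF I(1)] \<open>s \<notin> I\<close>
    by (auto simp: K_def)
  moreover have "assoc_primes I \<subseteq> insert P (assoc_primes K)"
  proof
    fix Q assume "Q \<in> assoc_primes I"
    then obtain y where Q: "prime_ideal Q" "Q = {r. r * y \<in> I}" by (auto simp: assoc_primes_def)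
    show "Q \<in> insert P (assoc_primes K)"
    proof (cases "\<exists>r. r * y \<in> K \<and> r * y \<notin> I")
      case True
      then obtain r where r: "r * y \<in> K" "r * y \<notin> I" by blast
      then obtain i a where ia: "r * y = i + a * s" "i \<in> I" by (auto simp: K_def elim: iaddE)
      have "a \<notin> P" using ia r P ideal_add[OF I(1)] by auto
      have "b \<in> Q \<longleftrightarrow> b \<in> P" for b
      proof -
        have "r \<notin> Q" "is_ideal Q" using Q r by (auto simp: prime_ideal_def)
        then have "b \<in> Q \<longleftrightarrow> b * r \<in> Q" using Q(1) ideal_mult2[of Q b r] unfolding prime_ideal_def by blast
        also have "\<dots> \<longleftrightarrow> b * (i + a * s) \<in> I" using Q by (simp add: ia(1)[symmetric] mult.assoc)
        also have "\<dots> \<longleftrightarrow> b * a \<in> P" using ideal_add_iff[OF I(1) ideal_mult[OF I(1) ia(2), of b], of "b * a * s"] P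
          by (simp add: algebra_simps)
        also have "\<dots> \<longleftrightarrow> b \<in> P" using \<open>a \<notin> P\<close> P(1) ideal_mult2[of P b a] unfolding prime_ideal_def by blast
        finally show ?thesis .
      qed
      then show ?thesis by blast
    next
      case False
      then have "Q = {r. r * y \<in> K}" using Q iadd_sup[of I s] by (auto simp: K_def)
      then show ?thesis using Q by (auto simp: assoc_primes_def)
    qed
  qed
  ultimately show False using I(2) finite_subset by blast
qed

text \<open>Induction on the number of primes. When none contains another, an element u that avoids
  all primes but P and happens to lie in P is corrected by adding v, which lies in all the others
  but not in P.\<close>

lemma prime_avoid:
  assumes "finite A" "\<And>P. P \<in> A \<Longrightarrow> prime_ideal P" "\<And>P. P \<in> A \<Longrightarrow> \<not> m \<subseteq> P"
  shows "\<exists>u\<in>m. \<forall>P\<in>A. u \<notin> P"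
  using assms
proof (induction "card A" arbitrary: A rule: less_induct)
  case less
  show ?case
  proof (cases "A = {}")
    case True then show ?thesis using ideal_0[OF is_ideal_m] by auto
  next
    case False
    have IH: "\<exists>u\<in>m. \<forall>P\<in>A - {Q}. u \<notin> P" if "Q \<in> A" for Q
    proof (rule less.hyps)
      show "card (A - {Q}) < card A" using less.prems(1) that by (rule card_Diff1_less)
    qed (use less.prems in auto)
    show ?thesis
    proof (cases "\<exists>P\<in>A. \<exists>Q\<in>A. Q \<noteq> P \<and> Q \<subseteq> P")
      case True
      then obtain P Q where PQ: "P \<in> A" "Q \<in> A" "Q \<noteq> P" "Q \<subseteq> P" by blast
      obtain u where "u \<in> m" "\<forall>P\<in>A - {Q}. u \<notin> P" using IH[OF PQ(2)] by blast
      then show ?thesis using PQ by blast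
    next
      case anti: False
      obtain P where P: "P \<in> A" using False by blast
      obtain u where u: "u \<in> m" "\<forall>Q\<in>A - {P}. u \<notin> Q" using IH[OF P] by blast
      show ?thesis
      proof (cases "u \<in> P")
        case True
        have Pp: "prime_ideal P" using P less.prems by blast
        have "\<forall>Q\<in>A - {P}. \<exists>w. w \<in> Q \<and> w \<notin> P" using anti P by blast
        then obtain w where w: "\<And>Q. Q \<in> A - {P} \<Longrightarrow> w Q \<in> Q \<and> w Q \<notin> P" by metis
        obtain a where a: "a \<in> m" "a \<notin> P" using less.prems P by blast
        define v where "v = a * prod w (A - {P})"
        have "prod w B \<notin> P" if "finite B" "B \<subseteq> A - {P}" for B
          using that
        proof (induction B)
          case empty then show ?case using Pp ideal_one by (auto simp: prime_ideal_def)
        next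
          case (insert x F) then show ?case using w[of x] Pp unfolding prime_ideal_def by auto
        qed
        then have vP: "v \<notin> P" using a Pp less.prems(1) unfolding v_def prime_ideal_def by (metis finite_Diff order_refl)
        have vQ: "v \<in> Q" if "Q \<in> A - {P}" for Q
        proof -
          have "prod w (A - {P}) = w Q * prod w (A - {P} - {Q})" using that less.prems(1) by (simp add: prod.remove)
          then have "v = (a * prod w (A - {P} - {Q})) * w Q" by (simp add: v_def algebra_simps)
          moreover have "is_ideal Q" using less.prems(2)[of Q] that by (simp add: prime_ideal_def)
          ultimately show ?thesis using w[OF that] ideal_mult by auto
        qed
        have "u + v \<notin> P" using True vP Pp ideal_add_iff[of P u v] by (auto simp: prime_ideal_def add.commute)
        moreover have "u + v \<notin> Q" if "Q \<in> A - {P}" for Q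
          using ideal_add_iff[of Q v u] vQ[OF that] u that less.prems(2)[of Q] by (auto simp: prime_ideal_def)
        moreover have "u + v \<in> m" using u a by (auto simp: v_def intro!: ideal_add[OF is_ideal_m] ideal_mult2[OF is_ideal_m])
        ultimately show ?thesis by blast
      qed (use u in blast)
    qed
  qed
qed

text \<open>R modulo the saturation has no m-torsion, so none of its associated primes contains m,
  and prime avoidance finds u in m outside all of them.\<close>

lemma FR_elem_ex: assumes I: "is_ideal I"
  obtains u where "u \<in> m" "colon I u \<subseteq> sat m I"
proof -
  define J where "J = sat m I"
  have J: "is_ideal J" using I by (simp add: J_def is_ideal_sat)
  have "\<exists>u\<in>m. \<forall>P\<in>assoc_primes J. u \<notin> P"
  proof (rule prime_avoid[OF finite_assoc[OF J]])
    fix P assume "P \<in> assoc_primes J"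
    then obtain y where P: "prime_ideal P" "P = {r. r * y \<in> J}" by (auto simp: assoc_primes_def)
    show "prime_ideal P" by fact
    show "\<not> m \<subseteq> P"
    proof
      assume s: "m \<subseteq> P"
      have "y \<in> J" unfolding J_def
      proof (rule sat_by'[OF I, of 1])
        fix a assume "a \<in> idpow m 1"
        then have "a \<in> P" using s idpow_1[OF is_ideal_m] by (auto simp del: idpow.simps)
        then show "a * y \<in> sat m I" by (simp add: P(2) J_def)
      qed
      then have "1 \<in> P" by (simp add: P(2))
      then show False using P(1) ideal_one unfolding prime_ideal_def by blast
    qed
  qed
  then obtain u where u: "u \<in> m" "\<forall>P\<in>assoc_primes J. u \<notin> P" by blast
  have "colon I u \<subseteq> J"
  proof (rule ccontr)
    assume "\<not> colon I u \<subseteq> J"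
    then obtain z where z: "z * u \<in> I" "z \<notin> J" by (auto simp: colon_def)
    obtain r where r: "r * z \<notin> J" "prime_ideal (colon J (r * z))" "colon J z \<subseteq> colon J (r * z)"
      using colon_prime[OF J z(2)] by blast
    have "u \<in> colon J z" using z sat_sup[OF I] by (auto simp: colon_def J_def mult.commute)
    then show False using r u unfolding assoc_primes_def colon_def by blast
  qed
  then show thesis using that u by (simp add: J_def)
qed

section \<open>Filter regular sequences and Krull dimension\<close>

lemma prime_disjoint:
  fixes I :: "'a set"
  assumes I: "is_ideal I" and S: "1 \<in> S" "\<And>x y. x \<in> S \<Longrightarrow> y \<in> S \<Longrightarrow> x * y \<in> S" and d: "I \<inter> S = {}"
  obtains Q where "prime_ideal Q" "I \<subseteq> Q" "Q \<inter> S = {}"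
proof -
  obtain Q where Q: "is_ideal Q" "I \<subseteq> Q" "Q \<inter> S = {}"
    and mx: "\<forall>K. is_ideal K \<and> I \<subseteq> K \<and> K \<inter> S = {} \<longrightarrow> Q \<subseteq> K \<longrightarrow> K = Q"
    using noeth_max[OF noeth, of "\<lambda>Q. is_ideal Q \<and> I \<subseteq> Q \<and> Q \<inter> S = {}" I] I d by auto
  have "prime_ideal Q" unfolding prime_ideal_def
  proof (intro conjI allI impI Q)
    show "Q \<noteq> UNIV" using Q S by blast
    fix x y assume xy: "x * y \<in> Q"
    show "x \<in> Q \<or> y \<in> Q"
    proof (rule ccontr)
      assume n: "\<not> (x \<in> Q \<or> y \<in> Q)"
      have "iadd Q z \<inter> S \<noteq> {}" if "z \<notin> Q" for z
        using mx[rule_format, of "iadd Q z"] is_ideal_iadd[OF Q(1), of z] iadd_sup[of Q z] iadd_self[OF Q(1), of z] that Q(2) by blast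
      then obtain s t where st: "s \<in> iadd Q x" "s \<in> S" "t \<in> iadd Q y" "t \<in> S" using n by blast
      then obtain i r j q where e: "s = i + r * x" "i \<in> Q" "t = j + q * y" "j \<in> Q" by (metis iaddE)
      have "s * t = i * t + (r * x) * j + (r * q) * (x * y)" by (simp add: e algebra_simps)
      then have "s * t \<in> Q" using e xy by (auto intro!: ideal_add[OF Q(1)] intro: ideal_mult[OF Q(1)] ideal_mult2[OF Q(1)])
      then show False using S(2) st Q(3) by blast
    qed
  qed
  then show thesis using that Q by blast
qed

text \<open>Each filter regular element accounts for one step in a chain of primes. If
  \<open>s * x l ^ k\<close> is in I, then s is m-torsion modulo I, hence in P, because P differs
  from m. So the products with s outside P miss I, and a prime over I that misses them lies below P
  and omits \<open>x l\<close>.\<close>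

lemma FR_chain:
  assumes "FR x l" "prime_ideal P" "P \<noteq> m" "idl x l \<subseteq> P"
  shows "\<exists>Q. prime_chain l Q \<and> Q l = P"
  using assms
proof (induction l arbitrary: P)
  case 0 then show ?case by (intro exI[of _ "\<lambda>_. P"]) (simp add: prime_chain_def)
next
  case (Suc l)
  define I where "I = idl x l"
  have I: "is_ideal I" by (simp add: I_def is_ideal_idl)
  have fr: "colon I (x l) \<subseteq> sat m I" using Suc.prems(1) by (auto simp: FR_def I_def)
  have IP: "I \<subseteq> P" "x l \<in> P" using Suc.prems(4) idl_mono[of l "Suc l" x] idl_in[of l "Suc l" x] by (auto simp: I_def)
  define S where "S = {s * x l ^ k | s k. s \<notin> P}"
  have xk: "r * x l ^ k \<in> I \<Longrightarrow> r \<in> sat m I" for r k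
  proof (induction k arbitrary: r)
    case 0 then show ?case using sat_sup[OF I] by auto
  next
    case (Suc k)
    then have "r * x l ^ k \<in> sat m I" using fr by (auto simp: colon_def algebra_simps)
    then obtain N where N: "\<forall>a\<in>idpow m N. (a * r) * x l ^ k \<in> I" by (auto simp: sat_def mult.assoc)
    show ?case by (rule sat_by'[OF I, of N]) (use N Suc.IH in blast)
  qed
  have "I \<inter> S = {}"
  proof (rule ccontr)
    assume "I \<inter> S \<noteq> {}"
    then obtain s k where s: "s \<notin> P" "s * x l ^ k \<in> I" by (auto simp: S_def)
    then show False using prime_sat[OF Suc.prems(2,3) xk[OF s(2)] IP(1)] by blast
  qed
  moreover have P1: "1 \<notin> P" using Suc.prems(2) ideal_one by (auto simp: prime_ideal_def)
  then have "1 * x l ^ 0 \<in> S" unfolding S_def by blast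
  then have "1 \<in> S" by simp
  moreover have "a * b \<in> S" if ab: "a \<in> S" "b \<in> S" for a b
  proof -
    obtain s k t j where e: "a = s * x l ^ k" "s \<notin> P" "b = t * x l ^ j" "t \<notin> P" using ab unfolding S_def by blast
    then have "a * b = (s * t) * x l ^ (k + j)" "s * t \<notin> P"
      using Suc.prems(2) by (auto simp: power_add algebra_simps prime_ideal_def)
    then show ?thesis unfolding S_def by blast
  qed
  ultimately obtain Q where Q: "prime_ideal Q" "I \<subseteq> Q" "Q \<inter> S = {}" using prime_disjoint[OF I, of S] \<open>1 \<in> S\<close> by blast
  have "s \<in> P" if "s \<in> Q" for s
  proof (rule ccontr)
    assume "s \<notin> P"
    then have "s * x l ^ 0 \<in> S" unfolding S_def by blast
    then show False using that Q by auto
  qed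
  moreover have "x l \<notin> Q"
  proof -
    have "1 * x l ^ 1 \<in> S" unfolding S_def using P1 by blast
    then show ?thesis using Q by auto
  qed
  ultimately have sub: "Q \<subset> P" using IP by blast
  have "Q \<noteq> m" using sub Suc.prems m_max[of P] by (auto simp: prime_ideal_def)
  then obtain R where R: "prime_chain l R" "R l = Q" using Suc.IH[of Q] Suc.prems(1) Q by (auto simp: FR_def I_def)
  show ?case
    by (rule exI[of _ "\<lambda>i. if i \<le> l then R i else P"])
      (use R sub Suc.prems in \<open>auto simp: prime_chain_def less_Suc_eq le_Suc_eq\<close>)
qed

text \<open>If no power of m were contained in \<open>idl x d\<close>, some prime other than m would
  contain this ideal. The chain of length d ending at that prime, followed by m, would exceed the
  dimension.\<close>

lemma FR_dim:
  assumes "\<And>n (P::nat \<Rightarrow> 'a set). prime_chain n P \<Longrightarrow> n \<le> d" "FR x d"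
  shows "sat m (idl x d) = UNIV"
proof (rule ccontr)
  assume n: "sat m (idl x d) \<noteq> UNIV"
  define I where "I = idl x d"
  have I: "is_ideal I" by (simp add: I_def is_ideal_idl)
  obtain G where G: "finite G" "m = gen_ideal G" using fin_gen[OF is_ideal_m] by blast
  have "\<exists>g\<in>G. \<forall>k. g ^ k \<notin> I"
  proof (rule ccontr)
    assume "\<not> (\<exists>g\<in>G. \<forall>k. g ^ k \<notin> I)"
    then obtain N where "idpow m N \<subseteq> I" using idpow_gen_sub[OF G(1) I] G by auto
    then have "1 \<in> sat m I" by (intro satI[of m N]) auto
    then show False using ideal_one[OF is_ideal_sat[OF I]] n by (auto simp: I_def)
  qed
  then obtain g where g: "g \<in> G" "\<And>k. g ^ k \<notin> I" by blast
  obtain P where P: "prime_ideal P" "I \<subseteq> P" "P \<inter> range ((^) g) = {}"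
  proof (rule prime_disjoint[OF I, of "range ((^) g)"])
    show "1 \<in> range ((^) g)" using rangeI[of "(^) g" 0] by simp
    show "x * y \<in> range ((^) g)" if "x \<in> range ((^) g)" "y \<in> range ((^) g)" for x y
      using that by (auto simp: power_add[symmetric])
    show "I \<inter> range ((^) g) = {}" using g(2) by auto
  qed
  have "g \<in> m" using g G gen_in by auto
  moreover have "g \<notin> P" using P(3) rangeI[of "(^) g" 1] by (auto simp del: rangeI)
  ultimately have Pm: "P \<noteq> m" by blast
  obtain Q where Q: "prime_chain d Q" "Q d = P" using FR_chain[OF assms(2) P(1) Pm] P by (auto simp: I_def)
  have Pm: "P \<subset> m" using Pm proper_sub P by (auto simp: prime_ideal_def)
  have "prime_chain (Suc d) (\<lambda>i. if i \<le> d then Q i else m)"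
    using Q Pm prime_m by (auto simp: prime_chain_def less_Suc_eq le_Suc_eq)
  then show False using assms(1) by fastforce
qed

subsection \<open>Krull's intersection theorem\<close>

text \<open>A weak form of the Artin--Rees lemma: a maximal ideal \<open>B\<close> with \<open>B \<inter> L = Q\<close> contains a power of \<open>m\<close>.\<close>
lemma weak_AR:
  assumes Q: "is_ideal Q" and L: "is_ideal L" and QL: "Q \<subseteq> L" and k: "\<And>a b. a \<in> idpow m k \<Longrightarrow> b \<in> L \<Longrightarrow> a * b \<in> Q"
  obtains B n where "is_ideal B" "B \<inter> L = Q" "idpow m n \<subseteq> B"
proof -
  obtain B where B: "is_ideal B" "B \<inter> L = Q"
    and mx: "\<forall>K. is_ideal K \<and> K \<inter> L = Q \<longrightarrow> B \<subseteq> K \<longrightarrow> K = B"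
    using noeth_max[OF noeth, of "\<lambda>B. is_ideal B \<and> B \<inter> L = Q" Q] Q QL by (auto simp: Int_absorb2)
  obtain G where G: "finite G" "m = gen_ideal G" using fin_gen[OF is_ideal_m] by blast
  have "\<exists>e. g ^ e \<in> B" if g: "g \<in> G" for g
  proof -
    have gm: "g \<in> m" using g G gen_in by auto
    have "colon B (g ^ i) \<subseteq> colon B (g ^ Suc i)" for i
      using ideal_mult[OF B(1), of _ g] by (auto simp: colon_def mult.left_commute[of _ g])
    then obtain i where i: "\<forall>j\<ge>i. colon B (g ^ j) = colon B (g ^ i)"
      using noeth_acc[OF noeth, of "\<lambda>i. colon B (g ^ i)"] is_ideal_colon[OF B(1)] by blast
    \<comment> \<open>Let \<open>l = b + r * g ^ i\<close> be in L. Multiplying by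
      \<open>g ^ k\<close> moves l into Q, so \<open>r * g ^ (i + k)\<close> is in B, and stability
      of the colon ideals puts \<open>r * g ^ i\<close> in B already. Maximality of B then gives
      \<open>g ^ i\<close> in B.\<close>
    have "iadd B (g ^ i) \<inter> L = Q"
    proof
      show "Q \<subseteq> iadd B (g ^ i) \<inter> L" using B QL iadd_sup by blast
      show "iadd B (g ^ i) \<inter> L \<subseteq> Q"
      proof
        fix l assume l: "l \<in> iadd B (g ^ i) \<inter> L"
        then obtain b r where e: "l = b + r * g ^ i" "b \<in> B" by (blast elim: iaddE)
        have "g ^ k * l \<in> B" using k[of "g ^ k" l] idpow_pow[OF gm] l B by blast
        then have "g ^ k * (r * g ^ i) \<in> B"
          using ideal_add_iff[OF B(1) ideal_mult[OF B(1) e(2), of "g ^ k"], of "g ^ k * (r * g ^ i)"]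
          by (simp add: e(1) distrib_left add.commute)
        then have "r \<in> colon B (g ^ (i + k))" by (simp add: colon_def power_add algebra_simps)
        then have "r \<in> colon B (g ^ i)" using i le_add1[of i k] by metis
        then have "r * g ^ i \<in> B" by (simp add: colon_def)
        then show "l \<in> Q" using e l B ideal_add[OF B(1)] by blast
      qed
    qed
    then have "iadd B (g ^ i) = B" using mx[rule_format, of "iadd B (g ^ i)"] is_ideal_iadd[OF B(1)] iadd_sup[of B "g ^ i"] by simp
    then show ?thesis using iadd_self[OF B(1)] by blast
  qed
  then obtain n where "idpow m n \<subseteq> B" using idpow_gen_sub[OF G(1) B(1)] G by auto
  then show thesis using that B by blast
qed

text \<open>Choose K maximal among the ideals between I and L other than L. Then L = K + (z), and
  the hypothesis puts z in K + mz, so a unit multiple of z lies in K.\<close>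

lemma nakayama:
  assumes I: "is_ideal I" and L: "is_ideal L" and IL: "I \<subseteq> L"
    and s: "L \<subseteq> gen_ideal (I \<union> {a * b | a b. a \<in> m \<and> b \<in> L})"
  shows "L = I"
proof (rule ccontr)
  assume n: "L \<noteq> I"
  obtain K where K: "is_ideal K" "I \<subseteq> K" "K \<subseteq> L" "K \<noteq> L"
    and mx: "\<forall>J. is_ideal J \<and> I \<subseteq> J \<and> J \<subseteq> L \<and> J \<noteq> L \<longrightarrow> K \<subseteq> J \<longrightarrow> J = K"
    using noeth_max[OF noeth, of "\<lambda>J. is_ideal J \<and> I \<subseteq> J \<and> J \<subseteq> L \<and> J \<noteq> L" I] I IL n by auto
  then obtain z where z: "z \<in> L" "z \<notin> K" by blast
  have Lz: "L = iadd K z"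
    using mx[rule_format, of "iadd K z"] is_ideal_iadd[OF K(1), of z] iadd_sup[of K z] iadd_self[OF K(1), of z] iadd_least[OF L K(3) z(1)] K(2) z by blast
  define T where "T = {y. \<exists>r\<in>m. y - r * z \<in> K}"
  have T: "is_ideal T"
  proof (rule is_idealI)
    show "0 \<in> T" using ideal_0[OF is_ideal_m] ideal_0[OF K(1)] by (auto simp: T_def intro!: bexI[of _ 0])
    fix x y assume "x \<in> T" "y \<in> T"
    then obtain r s where "r \<in> m" "s \<in> m" "x - r * z \<in> K" "y - s * z \<in> K" by (auto simp: T_def)
    then show "x + y \<in> T" using ideal_add[OF K(1), of "x - r * z" "y - s * z"]
      by (auto simp: T_def algebra_simps intro!: bexI[of _ "r + s"] ideal_add[OF is_ideal_m])
  next
    fix c x assume "x \<in> T"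
    then obtain r where "r \<in> m" "x - r * z \<in> K" by (auto simp: T_def)
    then show "c * x \<in> T" using ideal_mult[OF K(1), of "x - r * z" c]
      by (auto simp: T_def algebra_simps intro!: bexI[of _ "c * r"] ideal_mult[OF is_ideal_m])
  qed
  have "I \<subseteq> T" using K(2) ideal_0[OF is_ideal_m] by (auto simp: T_def intro!: bexI[of _ 0])
  moreover have "a * b \<in> T" if ab: "a \<in> m" "b \<in> L" for a b
  proof -
    obtain i r where e: "b = i + r * z" "i \<in> K" using ab Lz by (auto elim: iaddE)
    have "a * b - (a * r) * z = a * i" by (simp add: e algebra_simps)
    then show ?thesis unfolding T_def using ideal_mult[OF K(1) e(2), of a] ideal_mult2[OF is_ideal_m ab(1), of r] by (metis (mono_tags, lifting) mem_Collect_eq)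
  qed
  ultimately have "L \<subseteq> T" using gen_least[OF T, of "I \<union> {a * b | a b. a \<in> m \<and> b \<in> L}"] s by blast
  then obtain r where r: "r \<in> m" "z - r * z \<in> K" using z by (auto simp: T_def)
  obtain b where b: "b * (1 - r) = 1" using unit1[OF r(1)] by blast
  have "b * (z - r * z) = (b * (1 - r)) * z" by (simp add: algebra_simps)
  then show False using ideal_mult[OF K(1) r(2), of b] z b by simp
qed

text \<open>Let L be the m-adic closure of I and Q = I + mL. \<open>weak_AR\<close> gives an ideal B
  containing a power of m that meets L in Q. Elements of L lie in I plus that power, hence in B, so
  L = Q and Nakayama's lemma applies.\<close>

lemma krull:
  assumes I: "is_ideal I" and z: "\<And>N. \<exists>i\<in>I. z - i \<in> idpow m N"
  shows "z \<in> I"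
proof -
  define L where "L = {z. \<forall>N. \<exists>i\<in>I. z - i \<in> idpow m N}"
  have L: "is_ideal L"
  proof (rule is_idealI)
    show "0 \<in> L" using ideal_0[OF I] ideal_0[OF is_ideal_idpow] by (auto simp: L_def intro!: bexI[of _ 0])
    fix x y assume "x \<in> L" "y \<in> L"
    show "x + y \<in> L" unfolding L_def
    proof (clarify)
      fix N
      obtain i j where "i \<in> I" "j \<in> I" "x - i \<in> idpow m N" "y - j \<in> idpow m N" using \<open>x \<in> L\<close> \<open>y \<in> L\<close> unfolding L_def by blast
      then show "\<exists>i\<in>I. x + y - i \<in> idpow m N" using ideal_add[OF is_ideal_idpow, of "x - i" m N "y - j"]
        by (intro bexI[of _ "i + j"]) (auto simp: algebra_simps intro: ideal_add[OF I])
    qed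
  next
    fix c x assume "x \<in> L"
    show "c * x \<in> L" unfolding L_def
    proof (clarify)
      fix N
      obtain i where "i \<in> I" "x - i \<in> idpow m N" using \<open>x \<in> L\<close> unfolding L_def by blast
      then show "\<exists>i\<in>I. c * x - i \<in> idpow m N" using ideal_mult[OF is_ideal_idpow, of "x - i" m N c]
        by (intro bexI[of _ "c * i"]) (auto simp: right_diff_distrib intro: ideal_mult[OF I])
    qed
  qed
  have IL: "I \<subseteq> L" using ideal_0[OF is_ideal_idpow] by (auto simp: L_def intro!: bexI)
  define Q where "Q = gen_ideal (I \<union> {a * b | a b. a \<in> m \<and> b \<in> L})"
  have Q: "is_ideal Q" by (simp add: Q_def is_ideal_gen)
  have QL: "Q \<subseteq> L" unfolding Q_def using IL ideal_mult[OF L] by (intro gen_least[OF L]) auto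
  have IQ: "I \<subseteq> Q" unfolding Q_def using gen_sup by blast
  have "a * b \<in> Q" if "a \<in> idpow m 1" "b \<in> L" for a b
    unfolding Q_def using that idpow_1[OF is_ideal_m] by (intro gen_in) (auto simp del: idpow.simps)
  then obtain B n where B: "is_ideal B" "B \<inter> L = Q" "idpow m n \<subseteq> B" using weak_AR[OF Q L QL] by blast
  have "L \<subseteq> Q"
  proof
    fix z assume zL: "z \<in> L"
    then obtain i where "i \<in> I" "z - i \<in> idpow m n" by (auto simp: L_def)
    then have "z \<in> B" using B IQ ideal_diff_iff[OF B(1), of z i] by blast
    then show "z \<in> Q" using zL B by blast
  qed
  then have "L = I" using nakayama[OF I L IL] by (simp add: Q_def)
  then show ?thesis using z by (auto simp: L_def)
qed

lemma krull_0: "(\<And>N. z \<in> idpow m N) \<Longrightarrow> z = 0"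
  using krull[OF is_ideal_zero, of z] by simp

text \<open>Submodules of finite free modules are closed in the m-adic topology; this later brings
  coboundaries back from the completion. Krull's theorem matches the coordinate \<open>i0\<close>
  exactly by some \<open>w0\<close>, and the difficulty is to approximate the rest by elements of W
  that vanish at \<open>i0\<close>.\<close>

lemma closed_submodule:
  fixes W :: "('i \<Rightarrow> 'a) set"
  assumes "finite A"
    and "(\<lambda>_. 0) \<in> W" "\<And>f g. f \<in> W \<Longrightarrow> g \<in> W \<Longrightarrow> (\<lambda>i. f i + g i) \<in> W" "\<And>r f. f \<in> W \<Longrightarrow> (\<lambda>i. r * f i) \<in> W"
    and "\<And>N. \<exists>w\<in>W. \<forall>i\<in>A. v i - w i \<in> idpow m N"
  shows "\<exists>w\<in>W. \<forall>i\<in>A. v i = w i"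
  using assms
proof (induction A arbitrary: v W)
  case empty then show ?case by auto
next
  case (insert i0 A)
  note W = insert.prems(1,2,3) and cl = insert.prems(4)
  have Wd: "(\<lambda>i. f i - g i) \<in> W" if "f \<in> W" "g \<in> W" for f g
    using W(2)[OF that(1) W(3)[OF that(2), of "-1"]] by simp
  define I where "I = (\<lambda>w. w i0) ` W"
  have Ii: "w i0 \<in> I" if "w \<in> W" for w using that unfolding I_def by blast
  have Ie: "\<exists>w\<in>W. w i0 = x" if "x \<in> I" for x using that unfolding I_def by blast
  have I: "is_ideal I"
  proof (rule is_idealI)
    show "0 \<in> I" using Ii[OF W(1)] by simp
    show "x + y \<in> I" if xy: "x \<in> I" "y \<in> I" for x y using Ie[OF xy(1)] Ie[OF xy(2)] Ii[OF W(2)] by blast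
    show "r * x \<in> I" if x: "x \<in> I" for x r using Ie[OF x] Ii[OF W(3)] by blast
  qed
  have "v i0 \<in> I"
  proof (rule krull[OF I])
    fix N show "\<exists>i\<in>I. v i0 - i \<in> idpow m N" using cl[of N] Ii by blast
  qed
  then obtain w0 where w0: "w0 \<in> W" "w0 i0 = v i0" using Ie by blast
  define W' where "W' = {w \<in> W. w i0 = 0}"
  have "\<exists>w\<in>W'. \<forall>i\<in>A. (\<lambda>i. v i - w0 i) i = w i"
  proof (rule insert.IH)
    show "(\<lambda>_. 0) \<in> W'" using W(1) by (simp add: W'_def)
    show "(\<lambda>i. f i + g i) \<in> W'" if "f \<in> W'" "g \<in> W'" for f g using that W(2) by (simp add: W'_def)
    show "(\<lambda>i. r * f i) \<in> W'" if "f \<in> W'" for r f using that W(3) by (simp add: W'_def)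
    fix N
    \<comment> \<open>The N-th power of m times I. An element of I in the n-th power of m lies in Q,
      hence is the coordinate \<open>i0\<close> of an element of W all of whose coordinates are in
      the N-th power. Such an element repairs the coordinate \<open>i0\<close> of an approximation
      without spoiling the others.\<close>
    define Q where "Q = gen_ideal {a * b | a b. a \<in> idpow m N \<and> b \<in> I}"
    have Q: "is_ideal Q" by (simp add: Q_def is_ideal_gen)
    have "Q \<subseteq> I" unfolding Q_def using ideal_mult[OF I] by (intro gen_least[OF I]) auto
    moreover have "a * b \<in> Q" if "a \<in> idpow m N" "b \<in> I" for a b unfolding Q_def using that by (intro gen_in) auto
    ultimately obtain B n where B: "is_ideal B" "B \<inter> I = Q" "idpow m n \<subseteq> B" using weak_AR[OF Q I] by blast
    define J where "J = {b. \<exists>w\<in>W. w i0 = b \<and> (\<forall>i. w i \<in> idpow m N)}"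
    have Ji: "w i0 \<in> J" if "w \<in> W" "\<forall>i. w i \<in> idpow m N" for w using that unfolding J_def by blast
    have Je: "\<exists>w\<in>W. w i0 = b \<and> (\<forall>i. w i \<in> idpow m N)" if "b \<in> J" for b using that unfolding J_def by blast
    have J: "is_ideal J"
    proof (rule is_idealI)
      show "0 \<in> J" using Ji[OF W(1)] by (simp add: ideal_0 is_ideal_idpow)
      show "x + y \<in> J" if xy: "x \<in> J" "y \<in> J" for x y
      proof -
        obtain f g where "f \<in> W" "g \<in> W" "f i0 = x" "g i0 = y" "\<forall>i. f i \<in> idpow m N" "\<forall>i. g i \<in> idpow m N"
          using Je[OF xy(1)] Je[OF xy(2)] by blast
        then show ?thesis using Ji[OF W(2)[of f g]] by (auto simp: ideal_add is_ideal_idpow)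
      qed
      show "r * x \<in> J" if x: "x \<in> J" for x r
      proof -
        obtain f where "f \<in> W" "f i0 = x" "\<forall>i. f i \<in> idpow m N" using Je[OF x] by blast
        then show ?thesis using Ji[OF W(3)[of f r]] by (auto simp: ideal_mult is_ideal_idpow)
      qed
    qed
    have "Q \<subseteq> J" unfolding Q_def
    proof (rule gen_least[OF J], clarify)
      fix a b assume a: "a \<in> idpow m N" and "b \<in> I"
      then obtain w where "w \<in> W" "w i0 = b" using Ie by blast
      then show "a * b \<in> J" using Ji[OF W(3)[of w a]] ideal_mult2[OF is_ideal_idpow a] by auto
    qed
    obtain w where w: "w \<in> W" "\<forall>i\<in>insert i0 A. v i - w i \<in> idpow m (max N n)" using cl by blast
    have d: "(\<lambda>i. w0 i - w i) \<in> W" by (rule Wd[OF w0(1) w(1)])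
    have "w0 i0 - w i0 \<in> I" using Ii[OF d] by simp
    moreover have "w0 i0 - w i0 \<in> B" using w w0 B idpow_anti[of n "max N n" m] by auto
    ultimately have "w0 i0 - w i0 \<in> J" using B \<open>Q \<subseteq> J\<close> by blast
    then obtain w1 where w1: "w1 \<in> W" "w1 i0 = w0 i0 - w i0" "\<forall>i. w1 i \<in> idpow m N" using Je by blast
    define w2 where "w2 = (\<lambda>i. w i - w0 i + w1 i)"
    have "w2 \<in> W'" using w1 W(2)[OF Wd[OF w(1) w0(1)] w1(1)] by (simp add: W'_def w2_def)
    moreover have "v i - w0 i - w2 i \<in> idpow m N" if "i \<in> A" for i
    proof -
      have "v i - w i \<in> idpow m N" using w that idpow_anti[of N "max N n" m] by auto
      then show ?thesis using ideal_diff[OF is_ideal_idpow, of "v i - w i" m N "w1 i"] w1(3) by (simp add: w2_def diff_diff_eq)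
    qed
    ultimately show "\<exists>w\<in>W'. \<forall>i\<in>A. v i - w0 i - w i \<in> idpow m N" by blast
  qed
  then obtain w where w: "w \<in> W" "w i0 = 0" "\<forall>i\<in>A. v i - w0 i = w i" unfolding W'_def by auto
  have "\<forall>i\<in>insert i0 A. v i = w0 i + w i" using w0 w by (auto simp: algebra_simps)
  then show ?case using W(2)[OF w0(1) w(1)] by (intro bexI[of _ "\<lambda>i. w0 i + w i"])
qed

subsection \<open>Powers of filter regular sequences\<close>

lemma colon_pow_sat: assumes I: "is_ideal I" and c: "colon I b \<subseteq> sat m I" shows "r * b ^ k \<in> I \<Longrightarrow> r \<in> sat m I"
proof (induction k arbitrary: r)
  case 0 then show ?case using sat_sup[OF I] by auto
next
  case (Suc k)
  then have "r * b ^ k \<in> sat m I" using c by (auto simp: colon_def algebra_simps)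
  then obtain N where N: "\<forall>a\<in>idpow m N. (a * r) * b ^ k \<in> I" by (auto simp: sat_def mult.assoc)
  show ?case by (rule sat_by'[OF I, of N]) (use N Suc.IH in blast)
qed

text \<open>The sequence c is added to an arbitrary base ideal, so that the base can change from J +
  (b) to J plus a power of b while the later elements stay fixed.\<close>

primrec bidl :: "'a set \<Rightarrow> (nat \<Rightarrow> 'a) \<Rightarrow> nat \<Rightarrow> 'a set" where
  "bidl J c 0 = J"
| "bidl J c (Suc r) = iadd (bidl J c r) (c r)"

lemma is_ideal_bidl: "is_ideal J \<Longrightarrow> is_ideal (bidl J c r)" by (induction r) (auto simp: is_ideal_iadd)
lemma bidl_iadd: "bidl (iadd J b) c r = iadd (bidl J c r) b"
  by (induction r) (simp_all add: iadd_commute[of _ b])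
lemma idl_bidl: "idl x (i + k) = bidl (idl x i) (\<lambda>j. x (i + j)) k"
  by (induction k) (auto simp: idl_Suc)

definition FRb :: "'a set \<Rightarrow> (nat \<Rightarrow> 'a) \<Rightarrow> nat \<Rightarrow> bool" where
  "FRb J c r \<longleftrightarrow> (\<forall>k<r. colon (bidl J c k) (c k) \<subseteq> sat m (bidl J c k))"

lemma sat_ex: "r \<in> sat m I \<Longrightarrow> \<exists>N. \<forall>a\<in>idpow m N. a * r \<in> I" by (simp add: sat_def)

text \<open>The element b can be moved past the elements of c. From
  \<open>z * b = i + y * c r\<close>, the element y is torsion modulo J, b and the earlier c, say
  \<open>a * y = j + v * b\<close>; substituting, \<open>(a * z - v * c r) * b\<close> involves one
  element of c fewer.\<close>

lemma FRb_colon_base: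
  assumes J: "is_ideal J" and b: "colon J b \<subseteq> sat m J"
  shows "FRb (iadd J b) c r \<Longrightarrow> z * b \<in> bidl J c r \<Longrightarrow> z \<in> sat m (bidl (iadd J (b ^ k)) c r)"
proof (induction r arbitrary: z)
  case 0 then show ?case using b sat_mono[OF iadd_sup[of J "b ^ k"], of m] by (auto simp: colon_def)
next
  case (Suc r)
  define T where "T = bidl (iadd J (b ^ k)) c (Suc r)"
  have T: "is_ideal T" unfolding T_def by (intro is_ideal_bidl is_ideal_iadd J)
  have BJ: "is_ideal (bidl J c r)" by (rule is_ideal_bidl[OF J])
  obtain y i where e: "z * b = i + y * c r" "i \<in> bidl J c r" using Suc.prems(2) by (auto elim: iaddE)
  have "y * c r = - i + z * b" by (simp add: e)
  then have "y * c r \<in> bidl (iadd J b) c r"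
    unfolding bidl_iadd using ideal_neg[OF BJ e(2)] by (intro iaddI[of _ z]) simp
  then have "y \<in> sat m (bidl (iadd J b) c r)" using Suc.prems(1) by (auto simp: FRb_def colon_def)
  then obtain N where N: "\<forall>a\<in>idpow m N. a * y \<in> bidl (iadd J b) c r" using sat_ex by blast
  show ?case unfolding T_def[symmetric]
  proof (rule sat_by'[OF T])
    fix a assume "a \<in> idpow m N"
    then obtain v j where v: "a * y = j + v * b" "j \<in> bidl J c r" using N unfolding bidl_iadd by (meson iaddE)
    have "(a * z - v * c r) * b = a * (z * b) - v * b * c r" by (simp add: algebra_simps)
    also have "\<dots> = a * (i + y * c r) - (a * y - j) * c r" unfolding e(1) v(1) by simp
    also have "\<dots> = a * i + j * c r" by (simp add: algebra_simps)
    finally have "(a * z - v * c r) * b \<in> bidl J c r"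
      using ideal_add[OF BJ ideal_mult[OF BJ e(2)] ideal_mult2[OF BJ v(2)]] by simp
    then have "a * z - v * c r \<in> sat m (bidl (iadd J (b ^ k)) c r)"
      using Suc.IH Suc.prems(1) by (simp add: FRb_def)
    then have 1: "a * z - v * c r \<in> sat m T" using sat_mono[OF iadd_sup, of m] by (auto simp: T_def)
    have "v * c r \<in> T" unfolding T_def bidl.simps by (rule iadd_mult[OF is_ideal_bidl[OF is_ideal_iadd[OF J]]])
    then have "v * c r \<in> sat m T" using sat_sup[OF T] by blast
    then show "a * z \<in> sat m T" using 1 ideal_diff_iff[OF is_ideal_sat[OF T], of "a * z" "v * c r"] by blast
  qed
qed

text \<open>Induction on the exponent with \<open>b' = b ^ Suc n\<close>. If \<open>w * c k\<close>
  lies in A + (b'b), then up to torsion w = zb modulo A. The exchange lemma makes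
  \<open>c k * z\<close> torsion modulo A + (b'), the induction hypothesis makes z torsion there,
  and multiplying by b returns w to A + (b'b) up to torsion.\<close>

lemma FRb_pow:
  assumes J: "is_ideal J" and b: "colon J b \<subseteq> sat m J" and fr: "FRb (iadd J b) c r"
  shows "FRb (iadd J (b ^ Suc n)) c r"
proof (induction n)
  case 0 then show ?case using fr by simp
next
  case (Suc n)
  define b' where "b' = b ^ Suc n"
  have b'b: "b ^ Suc (Suc n) = b' * b" by (simp add: b'_def algebra_simps)
  show ?case unfolding FRb_def b'b
  proof (intro allI impI subsetI)
    fix k w assume k: "k < r" and w0: "w \<in> colon (bidl (iadd J (b' * b)) c k) (c k)"
    define A where "A = bidl J c k"
    have A: "is_ideal A" by (simp add: A_def is_ideal_bidl[OF J])
    define T where "T = iadd A (b' * b)"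
    have T: "is_ideal T" by (simp add: T_def is_ideal_iadd A)
    define T1 where "T1 = iadd A b'"
    have T1: "is_ideal T1" by (simp add: T1_def is_ideal_iadd A)
    have w: "w * c k \<in> T" using w0 by (simp add: colon_def bidl_iadd T_def A_def)
    have frk: "FRb (iadd J b) c k" using fr k by (simp add: FRb_def)
    have IHk: "colon T1 (c k) \<subseteq> sat m T1" using Suc k by (simp add: FRb_def bidl_iadd b'_def A_def T1_def del: power_Suc)
    have frk': "colon (iadd A b) (c k) \<subseteq> sat m (iadd A b)" using fr k by (simp add: FRb_def bidl_iadd A_def)
    have "T \<subseteq> iadd A b" unfolding T_def by (rule iadd_least[OF is_ideal_iadd[OF A] iadd_sup iadd_mult[OF A]])
    then have "w \<in> sat m (iadd A b)" using frk' w by (auto simp: colon_def)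
    then obtain N where N: "\<forall>a\<in>idpow m N. a * w \<in> iadd A b" using sat_ex by blast
    have "w \<in> sat m T"
    proof (rule sat_by'[OF T])
      fix a assume a: "a \<in> idpow m N"
      then obtain z j where e: "a * w = j + z * b" "j \<in> A" using N by (meson iaddE)
      have "a * (w * c k) \<in> T" by (rule ideal_mult[OF T w])
      then have "a * (w * c k) - j * c k \<in> T" using ideal_mult2[OF A e(2)] iadd_sup[of A "b' * b"] ideal_diff[OF T] unfolding T_def by blast
      moreover have "a * (w * c k) - j * c k = (a * w - j) * c k" by (simp add: algebra_simps)
      then have "a * (w * c k) - j * c k = (c k * z) * b" unfolding e(1) by (simp add: algebra_simps)
      ultimately obtain s where "(c k * z) * b - s * (b' * b) \<in> A" unfolding T_def iadd_def by auto
      moreover have "(c k * z) * b - s * (b' * b) = (c k * z - s * b') * b" by (simp add: algebra_simps)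
      ultimately have "(c k * z - s * b') * b \<in> A" by simp
      then have "c k * z - s * b' \<in> sat m (bidl (iadd J (b ^ Suc n)) c k)" unfolding A_def by (rule FRb_colon_base[OF J b frk])
      then have "c k * z - s * b' \<in> sat m T1" by (simp add: bidl_iadd A_def T1_def b'_def)
      moreover have "s * b' \<in> sat m T1" using sat_sup[OF T1] iadd_mult[OF A] by (auto simp: T1_def)
      ultimately have "c k * z \<in> sat m T1" using ideal_diff_iff[OF is_ideal_sat[OF T1]] by blast
      then obtain N' where N': "\<forall>a\<in>idpow m N'. a * (c k * z) \<in> T1" using sat_ex by blast
      have "z \<in> sat m T1"
      proof (rule sat_by'[OF T1, of N'])
        fix d assume "d \<in> idpow m N'"
        then have "d * (c k * z) \<in> T1" using N' by blast
        moreover have "d * (c k * z) = (d * z) * c k" by (simp add: mult.assoc mult.commute)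
        ultimately have "(d * z) * c k \<in> T1" by simp
        then show "d * z \<in> sat m T1" using IHk by (auto simp: colon_def)
      qed
      then obtain M where M: "\<forall>a\<in>idpow m M. a * z \<in> T1" using sat_ex by blast
      show "a * w \<in> sat m T"
      proof (rule sat_by'[OF T, of M])
        fix d assume "d \<in> idpow m M"
        then obtain j' s' where e': "d * z = j' + s' * b'" "j' \<in> A" using M unfolding T1_def by (meson iaddE)
        have "d * (a * w) = d * j + (d * z) * b" unfolding e(1) by (simp add: algebra_simps)
        also have "\<dots> = (d * j + j' * b) + s' * (b' * b)" unfolding e'(1) by (simp add: algebra_simps)
        finally have "d * (a * w) \<in> T" unfolding T_def
          using ideal_add[OF A ideal_mult[OF A e(2), of d] ideal_mult2[OF A e'(2), of b]] by (intro iaddI[of _ s']) simp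
        then show "d * (a * w) \<in> sat m T" using sat_sup[OF T] by blast
      qed
    qed
    then show "w \<in> sat m (bidl (iadd J (b' * b)) c k)" by (simp add: T_def A_def bidl_iadd)
  qed
qed

lemma FR_pow: assumes fr: "FR x t" and n: "0 < n" shows "FR (\<lambda>i. x i ^ n) t"
proof -
  \<comment> \<open>The powers are taken one element at a time: in \<open>X i\<close> the first i
    elements have been raised.\<close>
  define X where "X i j = (if j < i then x j ^ n else x j)" for i j
  have "FR (X i) t" if "i \<le> t" for i
    using that
  proof (induction i)
    case 0 then show ?case using fr by (simp add: X_def)
  next
    case (Suc i)
    then have IH: "FR (X i) t" and i: "i < t" by auto
    define J where "J = idl (X i) i"
    have J: "is_ideal J" by (simp add: J_def is_ideal_idl)
    have J': "idl (X (Suc i)) k = idl (X i) k" if "k \<le> i" for k using that by (intro idl_cong) (auto simp: X_def)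
    define c where "c j = x (Suc i + j)" for j
    have c: "c = (\<lambda>j. X i (Suc i + j))" "c = (\<lambda>j. X (Suc i) (Suc i + j))" by (auto simp: X_def c_def fun_eq_iff)
    have xi: "X i i = x i" "X (Suc i) i = x i ^ n" by (auto simp: X_def)
    have b: "colon J (x i) \<subseteq> sat m J" using IH i xi(1) unfolding FR_def J_def by metis
    have 1: "idl (X i) (Suc i + k) = bidl (iadd J (x i)) c k" for k
      unfolding idl_bidl c(1) by (simp add: idl_Suc J_def xi)
    have 2: "idl (X (Suc i)) (Suc i + k) = bidl (iadd J (x i ^ n)) c k" for k
      unfolding idl_bidl c(2) by (simp add: idl_Suc J_def xi J')
    have "FRb (iadd J (x i)) c (t - Suc i)" unfolding FRb_def
    proof (intro allI impI)
      fix k assume "k < t - Suc i"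
      then have "Suc i + k < t" by simp
      then have "colon (idl (X i) (Suc i + k)) (X i (Suc i + k)) \<subseteq> sat m (idl (X i) (Suc i + k))"
        using IH unfolding FR_def by blast
      then show "colon (bidl (iadd J (x i)) c k) (c k) \<subseteq> sat m (bidl (iadd J (x i)) c k)" unfolding 1 by (simp add: c(1))
    qed
    then have 3: "FRb (iadd J (x i ^ n)) c (t - Suc i)" using FRb_pow[OF J b, of c _ "n - 1"] n by simp
    show ?case unfolding FR_def
    proof (intro allI impI conjI)
      fix k assume k: "k < t"
      have xm: "x k \<in> m" using fr k by (simp add: FR_def)
      then show "X (Suc i) k \<in> m" using ideal_pow[OF is_ideal_m xm n] by (auto simp: X_def)
      consider "k < i" | "k = i" | "i < k" by linarith
      then show "colon (idl (X (Suc i)) k) (X (Suc i) k) \<subseteq> sat m (idl (X (Suc i)) k)"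
      proof cases
        case 1
        then have "X (Suc i) k = X i k" by (simp add: X_def)
        then show ?thesis using IH k J'[of k] 1 unfolding FR_def by (metis less_imp_le_nat)
      next
        case 2
        then show ?thesis using J'[of i] colon_pow_sat[OF J b] by (simp add: colon_def xi J_def subset_iff)
      next
        case 3
        then obtain k' where k': "k = Suc i + k'" using less_iff_Suc_add by auto
        have "colon (bidl (iadd J (x i ^ n)) c k') (c k') \<subseteq> sat m (bidl (iadd J (x i ^ n)) c k')"
          using \<open>FRb (iadd J (x i ^ n)) c (t - Suc i)\<close> k k' unfolding FRb_def by auto
        then show ?thesis unfolding k' 2 by (simp add: c(2))
      qed
    qed
  qed
  from this[of t] have "FR (X t) t" by simp
  moreover have "idl (X t) k = idl (\<lambda>i. x i ^ n) k" if "k \<le> t" for k using that by (intro idl_cong) (auto simp: X_def)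
  ultimately show ?thesis by (auto simp: FR_def X_def)
qed

lemma FR_mono: "FR x t \<Longrightarrow> l \<le> t \<Longrightarrow> FR x l" by (auto simp: FR_def)

end

section \<open>Artinian subquotients of modules\<close>

text \<open>Homomorphisms of subquotients are encoded as submodules of the product, because
  connecting homomorphisms are not functions of representatives.\<close>

definition linrel :: "('a \<Rightarrow> 'b \<Rightarrow> 'b) \<Rightarrow> ('a \<Rightarrow> 'c \<Rightarrow> 'c) \<Rightarrow> ('b::ab_group_add \<Rightarrow> 'c::ab_group_add \<Rightarrow> bool) \<Rightarrow> bool" where
  "linrel s1 s2 D \<longleftrightarrow> D 0 0 \<and> (\<forall>y z y' z'. D y z \<longrightarrow> D y' z' \<longrightarrow> D (y + y') (z + z')) \<and> (\<forall>a y z. D y z \<longrightarrow> D (s1 a y) (s2 a z))"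

lemma linrelI: "D 0 0 \<Longrightarrow> (\<And>y z y' z'. D y z \<Longrightarrow> D y' z' \<Longrightarrow> D (y + y') (z + z')) \<Longrightarrow> (\<And>a y z. D y z \<Longrightarrow> D (s1 a y) (s2 a z)) \<Longrightarrow> linrel s1 s2 D"
  by (simp add: linrel_def)
lemma linrel_0: "linrel s1 s2 D \<Longrightarrow> D 0 0" by (simp add: linrel_def)
lemma linrel_add: "linrel s1 s2 D \<Longrightarrow> D y z \<Longrightarrow> D y' z' \<Longrightarrow> D (y + y') (z + z')" by (simp add: linrel_def)
lemma linrel_scale: "linrel s1 s2 D \<Longrightarrow> D y z \<Longrightarrow> D (s1 a y) (s2 a z)" by (simp add: linrel_def)

context module
begin

definition artin :: "'b set \<Rightarrow> 'b set \<Rightarrow> bool" where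
  "artin B Z \<longleftrightarrow> subspace B \<and> subspace Z \<and> B \<subseteq> Z \<and>
     (\<forall>X. (\<forall>i. subspace (X i) \<and> B \<subseteq> X i \<and> X i \<subseteq> Z \<and> X (Suc i) \<subseteq> X i) \<longrightarrow> (\<exists>n::nat. \<forall>i\<ge>n. X i = X n))"

lemma artinI: "subspace B \<Longrightarrow> subspace Z \<Longrightarrow> B \<subseteq> Z \<Longrightarrow>
  (\<And>X. (\<And>i. subspace (X i)) \<Longrightarrow> (\<And>i. B \<subseteq> X i) \<Longrightarrow> (\<And>i. X i \<subseteq> Z) \<Longrightarrow> (\<And>i. X (Suc i) \<subseteq> X i) \<Longrightarrow> \<exists>n::nat. \<forall>i\<ge>n. X i = X n)
  \<Longrightarrow> artin B Z"
  unfolding artin_def by metis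

lemma artinD: "artin B Z \<Longrightarrow> (\<And>i. subspace (X i)) \<Longrightarrow> (\<And>i. B \<subseteq> X i) \<Longrightarrow> (\<And>i. X i \<subseteq> Z) \<Longrightarrow> (\<And>i. X (Suc i) \<subseteq> X i) \<Longrightarrow> \<exists>n::nat. \<forall>i\<ge>n. X i = X n"
  unfolding artin_def by metis

lemma artin_subspace: "artin B Z \<Longrightarrow> subspace B" "artin B Z \<Longrightarrow> subspace Z" "artin B Z \<Longrightarrow> B \<subseteq> Z"
  unfolding artin_def by auto

definition ssum :: "'b set \<Rightarrow> 'b set \<Rightarrow> 'b set" where "ssum X Y = {x + y | x y. x \<in> X \<and> y \<in> Y}"

lemma ssumI: "x \<in> X \<Longrightarrow> y \<in> Y \<Longrightarrow> x + y \<in> ssum X Y" by (auto simp: ssum_def)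
lemma ssumE: assumes "z \<in> ssum X Y" obtains x y where "z = x + y" "x \<in> X" "y \<in> Y" using assms by (auto simp: ssum_def)

lemma subspace_ssum: assumes X: "subspace X" and Y: "subspace Y" shows "subspace (ssum X Y)"
proof (rule subspaceI)
  show "0 \<in> ssum X Y" using ssumI[OF subspace_0[OF X] subspace_0[OF Y]] by simp
next
  fix u v assume "u \<in> ssum X Y" "v \<in> ssum X Y"
  then obtain x y x' y' where "u = x + y" "x \<in> X" "y \<in> Y" "v = x' + y'" "x' \<in> X" "y' \<in> Y" by (auto simp: ssum_def)
  then show "u + v \<in> ssum X Y" using ssumI[OF subspace_add[OF X, of x x'] subspace_add[OF Y, of y y']] by (simp add: algebra_simps)
next
  fix c u assume "u \<in> ssum X Y"
  then obtain x y where "u = x + y" "x \<in> X" "y \<in> Y" by (auto simp: ssum_def)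
  then show "scale c u \<in> ssum X Y" using ssumI[OF subspace_scale[OF X, of x c] subspace_scale[OF Y, of y c]] by (simp add: scale_right_distrib)
qed

lemma ssum_l: assumes "subspace Y" shows "X \<subseteq> ssum X Y"
proof fix x assume "x \<in> X" then show "x \<in> ssum X Y" using ssumI[OF _ subspace_0[OF assms], of x X] by simp qed
lemma ssum_r: assumes "subspace X" shows "Y \<subseteq> ssum X Y"
proof fix x assume "x \<in> Y" then show "x \<in> ssum X Y" using ssumI[OF subspace_0[OF assms], of x Y] by simp qed
lemma ssum_mono: "X \<subseteq> X' \<Longrightarrow> Y \<subseteq> Y' \<Longrightarrow> ssum X Y \<subseteq> ssum X' Y'" by (auto simp: ssum_def)
lemma ssum_least: "subspace Z \<Longrightarrow> X \<subseteq> Z \<Longrightarrow> Y \<subseteq> Z \<Longrightarrow> ssum X Y \<subseteq> Z" by (auto simp: ssum_def intro: subspace_add)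

lemma subspace_pre: assumes "subspace Z" "subspace B" shows "subspace {z \<in> Z. scale x z \<in> B}"
proof (rule subspaceI)
  show "0 \<in> {z \<in> Z. scale x z \<in> B}" by (simp add: subspace_0 assms)
  show "u + v \<in> {z \<in> Z. scale x z \<in> B}" if "u \<in> {z \<in> Z. scale x z \<in> B}" "v \<in> {z \<in> Z. scale x z \<in> B}" for u v
    using that by (simp add: subspace_add scale_right_distrib assms)
  show "scale c u \<in> {z \<in> Z. scale x z \<in> B}" if "u \<in> {z \<in> Z. scale x z \<in> B}" for c u
    using that subspace_scale[OF assms(2), of "scale x u" c] subspace_scale[OF assms(1), of u c] by (simp add: mult.commute)
qed

lemma subspace_scaleimg: assumes "subspace Z" shows "subspace (scale x ` Z)"
proof (rule subspaceI)
  show "0 \<in> scale x ` Z" using imageI[OF subspace_0[OF assms], of "scale x"] by simp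
  show "u + v \<in> scale x ` Z" if uv: "u \<in> scale x ` Z" "v \<in> scale x ` Z" for u v
  proof -
    obtain a b where "u = scale x a" "a \<in> Z" "v = scale x b" "b \<in> Z" using uv by blast
    then show ?thesis using imageI[OF subspace_add[OF assms, of a b], of "scale x"] by (simp add: scale_right_distrib)
  qed
  show "scale c u \<in> scale x ` Z" if u: "u \<in> scale x ` Z" for c u
  proof -
    obtain a where "u = scale x a" "a \<in> Z" using u by blast
    then show ?thesis using imageI[OF subspace_scale[OF assms, of a c], of "scale x"] by (simp add: mult.commute)
  qed
qed

lemma artin_min:
  assumes a: "artin B Z" and P: "P X0" and i: "\<And>X. P X \<Longrightarrow> subspace X \<and> B \<subseteq> X \<and> X \<subseteq> Z"
  shows "\<exists>X. P X \<and> (\<forall>Y. P Y \<longrightarrow> Y \<subseteq> X \<longrightarrow> Y = X)"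
proof (rule ccontr)
  assume "\<not> ?thesis"
  then have "\<forall>X. \<exists>Y. P X \<longrightarrow> P Y \<and> Y \<subset> X" by blast
  then obtain f where f: "\<And>X. P X \<Longrightarrow> P (f X) \<and> f X \<subset> X" by metis
  define X where "X n = (f ^^ n) X0" for n
  have XP: "P (X n)" for n by (induction n) (auto simp: X_def P f)
  have XS: "X (Suc n) \<subset> X n" for n using f[OF XP[of n]] by (simp add: X_def)
  have "\<exists>n. \<forall>i\<ge>n. X i = X n"
  proof (rule artinD[OF a])
    show "subspace (X i)" "B \<subseteq> X i" "X i \<subseteq> Z" for i using i[OF XP[of i]] by auto
    show "X (Suc i) \<subseteq> X i" for i using XS[of i] by auto
  qed
  then obtain n where "X (Suc n) = X n" by (meson le_Suc_eq le_refl)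
  then show False using XS[of n] by simp
qed

lemma artin_sub: assumes a: "artin B Z" and s: "subspace Z'" "B \<subseteq> Z'" "Z' \<subseteq> Z" shows "artin B Z'"
proof (rule artinI[OF artin_subspace(1)[OF a] s(1,2)])
  fix X assume X: "\<And>i. subspace (X i)" "\<And>i. B \<subseteq> X i" "\<And>i. X i \<subseteq> Z'" "\<And>i. X (Suc i) \<subseteq> X i"
  show "\<exists>n. \<forall>i\<ge>n. X i = X n" by (rule artinD[of B Z X]) (fact a X(1) X(2) subset_trans[OF X(3) s(3)] X(4))+
qed
lemma artin_quot: assumes a: "artin B Z" and s: "subspace B'" "B \<subseteq> B'" "B' \<subseteq> Z" shows "artin B' Z"
proof (rule artinI[OF s(1) artin_subspace(2)[OF a] s(3)])
  fix X assume X: "\<And>i. subspace (X i)" "\<And>i. B' \<subseteq> X i" "\<And>i. X i \<subseteq> Z" "\<And>i. X (Suc i) \<subseteq> X i"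
  show "\<exists>n. \<forall>i\<ge>n. X i = X n" by (rule artinD[of B Z X]) (fact a X(1) subset_trans[OF s(2) X(2)] X(3) X(4))+
qed

lemma artin_refl: "subspace B \<Longrightarrow> artin B B"
  by (rule artinI) (metis subset_antisym order_refl)+

lemma artin_ext:
  assumes 1: "artin B Y" and 2: "artin Y Z"
  shows "artin B Z"
proof (rule artinI)
  note Y = artin_subspace(1)[OF 2]
  show "subspace B" "subspace Z" "B \<subseteq> Z" using artin_subspace[OF 1] artin_subspace[OF 2] by auto
  fix X assume X: "\<And>i. subspace (X i)" "\<And>i. B \<subseteq> X i" "\<And>i. X i \<subseteq> Z" "\<And>i. X (Suc i) \<subseteq> X i"
  have anti: "i \<le> j \<Longrightarrow> X j \<subseteq> X i" for i j using X(4) by (rule lift_Suc_antimono_le)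
  have "\<exists>n. \<forall>i\<ge>n. X i \<inter> Y = X n \<inter> Y"
  proof (rule artinD[OF 1])
    show "subspace (X i \<inter> Y)" for i by (rule subspace_inter[OF X(1) Y])
    show "B \<subseteq> X i \<inter> Y" "X i \<inter> Y \<subseteq> Y" for i using X(2)[of i] artin_subspace(3)[OF 1] by auto
    show "X (Suc i) \<inter> Y \<subseteq> X i \<inter> Y" for i using X(4)[of i] by auto
  qed
  then obtain n1 where "\<forall>i\<ge>n1. X i \<inter> Y = X n1 \<inter> Y" by (elim exE)
  note n1 = this[rule_format]
  have "\<exists>n. \<forall>i\<ge>n. ssum (X i) Y = ssum (X n) Y"
  proof (rule artinD[OF 2])
    show "subspace (ssum (X i) Y)" for i by (rule subspace_ssum[OF X(1) Y])
    show "Y \<subseteq> ssum (X i) Y" for i by (rule ssum_r[OF X(1)])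
    show "ssum (X i) Y \<subseteq> Z" for i by (rule ssum_least[OF artin_subspace(2)[OF 2] X(3) artin_subspace(3)[OF 2]])
    show "ssum (X (Suc i)) Y \<subseteq> ssum (X i) Y" for i by (rule ssum_mono[OF X(4) order_refl])
  qed
  then obtain n2 where "\<forall>i\<ge>n2. ssum (X i) Y = ssum (X n2) Y" by (elim exE)
  note n2 = this[rule_format]
  define n where "n = max n1 n2"
  have "X i = X n" if i: "n \<le> i" for i
  proof
    show "X i \<subseteq> X n" using anti i by blast
    show "X n \<subseteq> X i"
    proof
      fix x assume x: "x \<in> X n"
      then have "x \<in> ssum (X n) Y" using ssum_l[OF Y] by blast
      then have "x \<in> ssum (X i) Y" using n2[of n] n2[of i] i by (simp add: n_def)
      then obtain x' y where e: "x = x' + y" "x' \<in> X i" "y \<in> Y" by (rule ssumE)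
      then have "y \<in> X n" using subspace_diff[OF X(1) x, of x'] anti[OF i] by auto
      then have "y \<in> X i" using n1[of n] n1[of i] i e by (auto simp: n_def)
      then show "x \<in> X i" using e subspace_add[OF X(1)] by auto
    qed
  qed
  then show "\<exists>n. \<forall>i\<ge>n. X i = X n" by (intro exI allI impI)
qed

text \<open>Melkersson's criterion.\<close>
lemma artin_torsion:
  assumes 1: "artin B {z \<in> Z. scale x z \<in> B}" and Z: "subspace Z" and t: "\<And>z. z \<in> Z \<Longrightarrow> \<exists>i. scale (x ^ i) z \<in> B"
  shows "artin B Z"
proof (rule artinI)
  note B = artin_subspace(1)[OF 1]
  show "subspace B" "subspace Z" "B \<subseteq> Z" using artin_subspace[OF 1] Z by auto
  fix X assume X: "\<And>i. subspace (X i)" "\<And>i. B \<subseteq> X i" "\<And>i. X i \<subseteq> Z" "\<And>i. X (Suc i) \<subseteq> X i"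
  have anti: "i \<le> j \<Longrightarrow> X j \<subseteq> X i" for i j using X(4) by (rule lift_Suc_antimono_le)
  \<comment> \<open>Modulo B, this is x^i times the elements of \<open>X n\<close> killed by
    x^(i+1). It lies in the kernel of x, which is Artinian, and decreases in n and in i. Once it is
    independent of n for all i, the chain X itself is constant.\<close>
  define Y where "Y n i = ssum (scale (x ^ i) ` {z \<in> X n. scale (x ^ Suc i) z \<in> B}) B" for n i
  have sY: "subspace (Y n i)" for n i unfolding Y_def by (intro subspace_ssum subspace_scaleimg subspace_pre X B)
  have BY: "B \<subseteq> Y n i" for n i unfolding Y_def by (intro ssum_r subspace_scaleimg subspace_pre X B)
  have YZ: "Y n i \<subseteq> {z \<in> Z. scale x z \<in> B}" for n i unfolding Y_def
  proof (rule ssum_least)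
    show "subspace {z \<in> Z. scale x z \<in> B}" by (intro subspace_pre Z B)
    show "B \<subseteq> {z \<in> Z. scale x z \<in> B}" using artin_subspace[OF 1] by blast
    show "scale (x ^ i) ` {z \<in> X n. scale (x ^ Suc i) z \<in> B} \<subseteq> {z \<in> Z. scale x z \<in> B}"
      using X(3)[of n] subspace_scale[OF Z] by auto
  qed
  have Yn: "Y n i \<subseteq> Y n' i" if "n' \<le> n" for n n' i unfolding Y_def using anti[OF that] by (intro ssum_mono) auto
  have Yi: "Y n (Suc i) \<subseteq> Y n i" for n i unfolding Y_def
  proof (rule ssum_mono)
    show "scale (x ^ Suc i) ` {z \<in> X n. scale (x ^ Suc (Suc i)) z \<in> B} \<subseteq> scale (x ^ i) ` {z \<in> X n. scale (x ^ Suc i) z \<in> B}"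
    proof clarify
      fix z assume z: "z \<in> X n" "scale (x ^ Suc (Suc i)) z \<in> B"
      then have "scale x z \<in> {z \<in> X n. scale (x ^ Suc i) z \<in> B}" using subspace_scale[OF X(1)] by (simp add: algebra_simps)
      then have "scale (x ^ i) (scale x z) \<in> scale (x ^ i) ` {z \<in> X n. scale (x ^ Suc i) z \<in> B}" by (rule imageI)
      moreover have "scale (x ^ i) (scale x z) = scale (x ^ Suc i) z" by (simp add: mult.commute)
      ultimately show "scale (x ^ Suc i) z \<in> scale (x ^ i) ` {z \<in> X n. scale (x ^ Suc i) z \<in> B}" by (simp only:)
    qed
  qed simp
  have Yi': "Y n i \<subseteq> Y n i'" if "i' \<le> i" for n i i' by (rule lift_Suc_antimono_le[of "\<lambda>i. Y n i", OF Yi that])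
  have "\<exists>N. \<forall>i\<ge>N. Y i i = Y N N"
  proof (rule artinD[OF 1])
    show "subspace (Y i i)" "B \<subseteq> Y i i" "Y i i \<subseteq> {z \<in> Z. scale x z \<in> B}" for i by (rule sY, rule BY, rule YZ)
    show "Y (Suc i) (Suc i) \<subseteq> Y i i" for i by (rule order_trans[OF Yi Yn]) simp
  qed
  then obtain N0 where "\<forall>i\<ge>N0. Y i i = Y N0 N0" by (elim exE)
  note N0 = this[rule_format]
  have big: "Y n i = Y N0 N0" if "N0 \<le> n" "N0 \<le> i" for n i
  proof
    show "Y n i \<subseteq> Y N0 N0" using Yn[OF that(1), of i] Yi'[OF that(2), of N0] by blast
    show "Y N0 N0 \<subseteq> Y n i" using N0[of "max n i"] Yn[of n "max n i" "max n i"] Yi'[of i "max n i" n] that by auto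
  qed
  have "\<exists>N. \<forall>n\<ge>N. Y n i = Y N i" for i
  proof (rule artinD[OF 1])
    show "subspace (Y n i)" "B \<subseteq> Y n i" "Y n i \<subseteq> {z \<in> Z. scale x z \<in> B}" for n by (rule sY, rule BY, rule YZ)
    show "Y (Suc n) i \<subseteq> Y n i" for n by (rule Yn) simp
  qed
  then have "\<forall>i. \<exists>N. \<forall>n\<ge>N. Y n i = Y N i" by (intro allI)
  from choice[OF this] obtain M where "\<forall>i. \<forall>n\<ge>M i. Y n i = Y (M i) i" by (elim exE)
  note M = this[rule_format]
  \<comment> \<open>From N0 on the diagonal chain settles all i at once; each of the finitely many
    smaller i contributes its own bound.\<close>
  define N where "N = N0 + (\<Sum>i<N0. M i)"
  have stab: "Y n i = Y N i" if "N \<le> n" for n i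
  proof (cases "N0 \<le> i")
    case True then show ?thesis using big[of n i] big[of N i] that by (simp add: N_def)
  next
    case False
    then have "M i \<le> (\<Sum>i<N0. M i)" by (intro member_le_sum) auto
    then have "M i \<le> N" by (simp add: N_def)
    then show ?thesis using M[of i n] M[of i N] that by (metis order_trans)
  qed
  \<comment> \<open>Induction on the power of x that carries z into B: equality of the
    \<open>Y\<close> terms supplies z' in \<open>X n\<close> such that a smaller power suffices for
    z - z'.\<close>
  have "z \<in> X n" if "N \<le> n" "z \<in> X N" "scale (x ^ i) z \<in> B" for n z i
    using that(2,3)
  proof (induction i arbitrary: z)
    case 0 then show ?case using X(2)[of n] by auto
  next
    case (Suc i)
    have "scale (x ^ i) z \<in> scale (x ^ i) ` {z \<in> X N. scale (x ^ Suc i) z \<in> B}" using Suc.prems by blast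
    then have "scale (x ^ i) z \<in> Y N i" unfolding Y_def by (rule subsetD[OF ssum_l[OF B]])
    then have "scale (x ^ i) z \<in> Y n i" using stab[OF that(1)] by simp
    then obtain z' b where z': "scale (x ^ i) z = scale (x ^ i) z' + b" "z' \<in> X n" "b \<in> B" unfolding Y_def by (auto elim!: ssumE)
    have "scale (x ^ i) (z - z') = b" using z'(1) by (simp add: scale_right_diff_distrib)
    moreover have "z - z' \<in> X N" using subspace_diff[OF X(1) Suc.prems(1)] z' anti[OF that(1)] by blast
    ultimately have "z - z' \<in> X n" using Suc.IH z' by simp
    then show ?case using subspace_add[OF X(1) _ z'(2), of "z - z'"] by simp
  qed
  note XN = this
  have "X n = X N" if n: "N \<le> n" for n
  proof
    show "X n \<subseteq> X N" by (rule anti[OF n])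
    show "X N \<subseteq> X n"
    proof
      fix z assume z: "z \<in> X N"
      then obtain i where "scale (x ^ i) z \<in> B" using t X(3) by blast
      then show "z \<in> X n" by (rule XN[OF n z])
    qed
  qed
  then show "\<exists>n. \<forall>i\<ge>n. X i = X n" by (intro exI allI impI)
qed

end

text \<open>D is total on Z1, and only elements of B1 are related to B2, but one y may be related to
  many z. So D embeds Z1/B1 in a quotient of Z2/B2, and submodules and quotients are covered
  together: a monomorphism serves as it is, an epimorphism through its converse.\<close>

lemma artin_subq:
  assumes m1: "module s1" and m2: "module s2" and D: "linrel s1 s2 D"
    and a: "module.artin s2 B2 Z2" and B1: "module.subspace s1 B1" and Z1: "module.subspace s1 Z1" and BZ: "B1 \<subseteq> Z1"
    and tot: "\<And>y. y \<in> Z1 \<Longrightarrow> \<exists>z\<in>Z2. D y z" and inj: "\<And>y z. y \<in> Z1 \<Longrightarrow> z \<in> B2 \<Longrightarrow> D y z \<Longrightarrow> y \<in> B1"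
  shows "module.artin s1 B1 Z1"
proof -
  interpret M1: module s1 by fact
  interpret M2: module s2 by fact
  show ?thesis
  proof (rule M1.artinI[OF B1 Z1 BZ])
    fix X assume X: "\<And>i. M1.subspace (X i)" "\<And>i. B1 \<subseteq> X i" "\<And>i. X i \<subseteq> Z1" "\<And>i. X (Suc i) \<subseteq> X i"
    note B2 = M2.artin_subspace(1)[OF a] and Z2 = M2.artin_subspace(2)[OF a]
    define Y where "Y i = M2.ssum {z \<in> Z2. \<exists>y\<in>X i. D y z} B2" for i
    have s: "M2.subspace {z \<in> Z2. \<exists>y\<in>X i. D y z}" for i
    proof (rule M2.subspaceI)
      show "0 \<in> {z \<in> Z2. \<exists>y\<in>X i. D y z}" using linrel_0[OF D] M1.subspace_0[OF X(1)] M2.subspace_0[OF Z2] by blast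
      fix u v assume "u \<in> {z \<in> Z2. \<exists>y\<in>X i. D y z}" "v \<in> {z \<in> Z2. \<exists>y\<in>X i. D y z}"
      then obtain y y' where "u \<in> Z2" "v \<in> Z2" "y \<in> X i" "y' \<in> X i" "D y u" "D y' v" by blast
      then show "u + v \<in> {z \<in> Z2. \<exists>y\<in>X i. D y z}"
        using linrel_add[OF D, of y u y' v] M1.subspace_add[OF X(1), of y i y'] M2.subspace_add[OF Z2, of u v] by blast
    next
      fix c u assume "u \<in> {z \<in> Z2. \<exists>y\<in>X i. D y z}"
      then obtain y where "u \<in> Z2" "y \<in> X i" "D y u" by blast
      then show "s2 c u \<in> {z \<in> Z2. \<exists>y\<in>X i. D y z}"
        using linrel_scale[OF D, of y u c] M1.subspace_scale[OF X(1), of y i c] M2.subspace_scale[OF Z2, of u c] by blast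
    qed
    have "\<exists>n. \<forall>i\<ge>n. Y i = Y n"
    proof (rule M2.artinD[OF a])
      show "M2.subspace (Y i)" for i unfolding Y_def by (rule M2.subspace_ssum[OF s B2])
      show "B2 \<subseteq> Y i" for i unfolding Y_def by (rule M2.ssum_r[OF s])
      show "Y i \<subseteq> Z2" for i unfolding Y_def by (rule M2.ssum_least[OF Z2]) (use M2.artin_subspace(3)[OF a] in auto)
      show "Y (Suc i) \<subseteq> Y i" for i unfolding Y_def using X(4)[of i] by (intro M2.ssum_mono) auto
    qed
    then obtain n where "\<forall>i\<ge>n. Y i = Y n" by (elim exE)
    note n = this[rule_format]
    have "X i = X n" if i: "n \<le> i" for i
    proof
      show "X i \<subseteq> X n" using X(4) i by (rule lift_Suc_antimono_le)
      show "X n \<subseteq> X i"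
      proof
        fix y assume y: "y \<in> X n"
        then obtain z where z: "z \<in> Z2" "D y z" using tot X(3) by blast
        then have "z \<in> {z \<in> Z2. \<exists>y\<in>X n. D y z}" using y by blast
        then have "z \<in> Y n" unfolding Y_def by (rule subsetD[OF M2.ssum_l[OF B2]])
        then have "z \<in> Y i" using n[OF i] by simp
        then obtain z' b y' where e: "z = z' + b" "y' \<in> X i" "D y' z'" "b \<in> B2" unfolding Y_def by (auto elim!: M2.ssumE)
        have "D (y + s1 (-1) y') (z + s2 (-1) z')" by (rule linrel_add[OF D z(2) linrel_scale[OF D e(3)]])
        then have "D (y - y') b" using e by simp
        moreover have "y - y' \<in> Z1" using M1.subspace_diff[OF Z1] y e X(3) by blast
        ultimately have "y - y' \<in> X i" using inj e X(2) by blast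
        then show "y \<in> X i" using M1.subspace_add[OF X(1) _ e(2), of "y - y'"] by simp
      qed
    qed
    then show "\<exists>n. \<forall>i\<ge>n. X i = X n" by (intro exI allI impI)
  qed
qed

subsection \<open>A Serre class attached to a sequence of ring elements\<close>

locale nmod = nloc m + module scale for m :: "'a::comm_ring_1 set" and scale :: "'a \<Rightarrow> 'b::ab_group_add \<Rightarrow> 'b"
begin

definition mkill :: "'b set \<Rightarrow> 'b set \<Rightarrow> bool" where
  "mkill B Z \<longleftrightarrow> (\<exists>c. \<forall>a\<in>idpow m c. \<forall>z\<in>Z. scale a z \<in> B)"

lemma mkillE: assumes "mkill B Z" obtains c where "\<forall>a\<in>idpow m c. \<forall>z\<in>Z. scale a z \<in> B"
  using assms unfolding mkill_def by (elim exE)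

text \<open>A form of cofiniteness: Z/B is Artinian, and the part of it killed by all members of xs
  is killed by a power of m. The recursion over xs lets the closure properties be proved one element
  at a time.\<close>

primrec ser :: "'a list \<Rightarrow> 'b set \<Rightarrow> 'b set \<Rightarrow> bool" where
  "ser [] B Z \<longleftrightarrow> artin B Z \<and> mkill B Z"
| "ser (x # xs) B Z \<longleftrightarrow> artin B Z \<and> ser xs B {z \<in> Z. scale x z \<in> B}"

lemma ser_artin: "ser xs B Z \<Longrightarrow> artin B Z" by (cases xs) auto

lemma is_ideal_ann: "subspace B \<Longrightarrow> is_ideal {a. scale a z \<in> B}"
  by (rule is_idealI) (auto simp: subspace_0 subspace_add scale_left_distrib subspace_scale simp flip: scale_scale)

text \<open>With relations as in \<open>artin_subq\<close> this is closure under subquotients. It is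
  proved together with closure under extensions, since each step from xs to x # xs uses both
  properties for xs.\<close>

definition ser_sub :: "'a list \<Rightarrow> bool" where
  "ser_sub xs \<longleftrightarrow> (\<forall>D B1 Z1 B2 Z2. linrel scale scale D \<longrightarrow> ser xs B2 Z2 \<longrightarrow> subspace B1 \<longrightarrow> subspace Z1 \<longrightarrow> B1 \<subseteq> Z1 \<longrightarrow>
     (\<forall>y\<in>Z1. \<exists>z\<in>Z2. D y z) \<longrightarrow> (\<forall>y\<in>Z1. \<forall>z\<in>B2. D y z \<longrightarrow> y \<in> B1) \<longrightarrow> ser xs B1 Z1)"

definition ser_ext :: "'a list \<Rightarrow> bool" where
  "ser_ext xs \<longleftrightarrow> (\<forall>B Y Z. ser xs B Y \<longrightarrow> ser xs Y Z \<longrightarrow> ser xs B Z)"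

lemma ser_subD:
  assumes "ser_sub xs" "linrel scale scale D" "ser xs B2 Z2" "subspace B1" "subspace Z1" "B1 \<subseteq> Z1"
    and tot: "\<And>y. y \<in> Z1 \<Longrightarrow> \<exists>z\<in>Z2. D y z" and inj: "\<And>y z. y \<in> Z1 \<Longrightarrow> z \<in> B2 \<Longrightarrow> D y z \<Longrightarrow> y \<in> B1"
  shows "ser xs B1 Z1"
proof -
  have 1: "\<forall>y\<in>Z1. \<exists>z\<in>Z2. D y z" and 2: "\<forall>y\<in>Z1. \<forall>z\<in>B2. D y z \<longrightarrow> y \<in> B1" using tot inj by auto
  show ?thesis
    using assms(1)[unfolded ser_sub_def, THEN spec[where x=D], THEN spec[where x=B1], THEN spec[where x=Z1],
      THEN spec[where x=B2], THEN spec[where x=Z2]] assms(2-6) 1 2 by simp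
qed

lemma ser_extD: "ser_ext xs \<Longrightarrow> ser xs B Y \<Longrightarrow> ser xs Y Z \<Longrightarrow> ser xs B Z"
  unfolding ser_ext_def by blast

lemma ser_Nil: "ser_sub []" "ser_ext []"
proof -
  show "ser_sub []" unfolding ser_sub_def
  proof (intro allI impI)
    fix D B1 Z1 B2 Z2
    assume D: "linrel scale scale D" and a: "ser [] B2 Z2" and B1: "subspace B1" "subspace Z1" "B1 \<subseteq> Z1"
      and tot: "\<forall>y\<in>Z1. \<exists>z\<in>Z2. D y z" and inj: "\<forall>y\<in>Z1. \<forall>z\<in>B2. D y z \<longrightarrow> y \<in> B1"
    have "mkill B2 Z2" using a by simp
    then obtain c where c: "\<forall>a\<in>idpow m c. \<forall>z\<in>Z2. scale a z \<in> B2" by (rule mkillE)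
    have "scale a y \<in> B1" if h: "a \<in> idpow m c" "y \<in> Z1" for a y
    proof -
      obtain z where z: "z \<in> Z2" "D y z" using tot h(2) by blast
      then have "scale a z \<in> B2" using c h(1) by blast
      then show ?thesis using linrel_scale[OF D z(2), of a] inj subspace_scale[OF B1(2) h(2), of a] by blast
    qed
    then have "mkill B1 Z1" unfolding mkill_def by blast
    moreover have "artin B1 Z1"
    proof (rule artin_subq[OF module_axioms module_axioms D _ B1])
      show "artin B2 Z2" using a by simp
    qed (use tot inj in blast)+
    ultimately show "ser [] B1 Z1" by simp
  qed
  show "ser_ext []" unfolding ser_ext_def
  proof (intro allI impI)
    fix B Y Z assume 1: "ser [] B Y" and 2: "ser [] Y Z"
    note B = artin_subspace(1)[OF ser_artin[OF 1]]
    have "mkill B Y" "mkill Y Z" using 1 2 by auto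
    then obtain c d where c: "\<forall>a\<in>idpow m c. \<forall>z\<in>Y. scale a z \<in> B" and d: "\<forall>a\<in>idpow m d. \<forall>z\<in>Z. scale a z \<in> Y"
      by (meson mkillE)
    have "idpow m (c + d) \<subseteq> {a. scale a z \<in> B}" if "z \<in> Z" for z
      by (rule idpow_add_least[OF is_ideal_ann[OF B]]) (use c d that in \<open>auto simp flip: scale_scale\<close>)
    then have "mkill B Z" unfolding mkill_def by blast
    then show "ser [] B Z" using artin_ext[of B Y Z] 1 2 by simp
  qed
qed

text \<open>The kernel A of x on Z/B is an extension: its part inside Y is the kernel of x on Y/B,
  and A modulo that part embeds in the kernel of x on Z/Y.\<close>

lemma ser_ext_step: assumes s: "ser_sub xs" and e: "ser_ext xs" shows "ser_ext (x # xs)"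
  unfolding ser_ext_def
proof (intro allI impI)
  fix B Y Z assume 1: "ser (x # xs) B Y" and 2: "ser (x # xs) Y Z"
  have B: "subspace B" and Y: "subspace Y" "B \<subseteq> Y" and Z: "subspace Z" "Y \<subseteq> Z"
    using artin_subspace[OF ser_artin[OF 1]] artin_subspace[OF ser_artin[OF 2]] by auto
  define A where "A = {z \<in> Z. scale x z \<in> B}"
  have A: "subspace A" by (simp add: A_def subspace_pre Z B)
  have AY: "{z \<in> Y. scale x z \<in> B} = A \<inter> Y" using Z by (auto simp: A_def)
  have "ser xs (A \<inter> Y) A"
  proof (rule ser_subD[OF s, of "(=)"])
    show "linrel scale scale (=)" by (rule linrelI) auto
    show "ser xs Y {z \<in> Z. scale x z \<in> Y}" using 2 by simp
    show "subspace (A \<inter> Y)" by (rule subspace_inter[OF A Y(1)])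
    show "subspace A" by (rule A)
  qed (use Y in \<open>auto simp: A_def\<close>)
  then have "ser xs B A" using ser_extD[OF e] 1 AY by auto
  then show "ser (x # xs) B Z" using artin_ext[of B Y Z] 1 2 by (auto simp: A_def)
qed

text \<open>Kernels of x do not pass to quotients. With K the submodule of Z2 related to B1, Z1/B1
  embeds in Z2/K. By the snake lemma, the kernel of x on Z2/K is built from the kernel of x on Z2/B2
  and a submodule of K/xK, so the class must be shown to contain K/xK.\<close>

lemma ser_sub_step: assumes s: "ser_sub xs" and e: "ser_ext xs" shows "ser_sub (x # xs)"
  unfolding ser_sub_def
proof (intro allI impI)
  fix D B1 Z1 B2 Z2
  assume D: "linrel scale scale D" and ser2: "ser (x # xs) B2 Z2" and B1: "subspace B1" and Z1: "subspace Z1" and BZ1: "B1 \<subseteq> Z1"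
    and tot: "\<forall>y\<in>Z1. \<exists>z\<in>Z2. D y z" and inj: "\<forall>y\<in>Z1. \<forall>z\<in>B2. D y z \<longrightarrow> y \<in> B1"
  have art1: "artin B1 Z1"
    by (rule artin_subq[OF module_axioms module_axioms D ser_artin[OF ser2] B1 Z1 BZ1]) (use tot inj in blast)+
  have art2: "artin B2 Z2" by (rule ser_artin[OF ser2])
  have B2: "subspace B2" and Z2: "subspace Z2" and BZ2: "B2 \<subseteq> Z2" using artin_subspace[OF art2] by auto
  define A1 where "A1 = {y \<in> Z1. scale x y \<in> B1}"
  define A2 where "A2 = {z \<in> Z2. scale x z \<in> B2}"
  have A1: "subspace A1" by (simp add: A1_def subspace_pre Z1 B1)
  have A2: "subspace A2" by (simp add: A2_def subspace_pre Z2 B2)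
  have serA2: "ser xs B2 A2" using ser2 by (simp add: A2_def)
  define K0 where "K0 = {z \<in> Z2. \<exists>y\<in>B1. D y z}"
  have K0: "subspace K0"
  proof (rule subspaceI)
    show "0 \<in> K0" using linrel_0[OF D] subspace_0[OF B1] subspace_0[OF Z2] by (auto simp: K0_def)
    fix u v assume "u \<in> K0" "v \<in> K0"
    then obtain y y' where "u \<in> Z2" "v \<in> Z2" "y \<in> B1" "y' \<in> B1" "D y u" "D y' v" by (auto simp: K0_def)
    then show "u + v \<in> K0" unfolding K0_def using linrel_add[OF D, of y u y' v] subspace_add[OF B1, of y y'] subspace_add[OF Z2, of u v] by blast
  next
    fix c u assume "u \<in> K0"
    then obtain y where "u \<in> Z2" "y \<in> B1" "D y u" by (auto simp: K0_def)
    then show "scale c u \<in> K0" unfolding K0_def using linrel_scale[OF D, of y u c] subspace_scale[OF B1, of y c] subspace_scale[OF Z2, of u c] by blast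
  qed
  define K where "K = ssum K0 B2"
  have K: "subspace K" by (simp add: K_def subspace_ssum K0 B2)
  have KZ: "K \<subseteq> Z2" unfolding K_def by (rule ssum_least[OF Z2 _ BZ2]) (auto simp: K0_def)
  have BK: "B2 \<subseteq> K" unfolding K_def by (rule ssum_r[OF K0])
  \<comment> \<open>The kernel of x^i on K/B2, an iterated extension of subquotients of the kernel
    of x. As K/B2 is Artinian, the images of x^i on it stabilise, which gives K = xK +
    \<open>N i\<close> for some i; so K/xK is a quotient of \<open>N i\<close>.\<close>
  define N where "N i = {z \<in> K. scale (x ^ i) z \<in> B2}" for i
  have N: "subspace (N i)" for i by (simp add: N_def subspace_pre K B2)
  have BN: "B2 \<subseteq> N i" for i unfolding N_def using BK subspace_scale[OF B2] by auto
  have serN: "ser xs B2 (N i)" for i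
  proof (induction i)
    case 0
    show ?case
      by (rule ser_subD[OF s, of "(=)", OF _ serA2 B2 N BN])
        (use BZ2 subspace_scale[OF B2] in \<open>auto simp: N_def A2_def intro!: linrelI\<close>)
  next
    case (Suc i)
    have "ser xs (N i) (N (Suc i))"
    proof (rule ser_subD[OF s, of "\<lambda>z w. w = scale (x ^ i) z", OF _ serA2 N N])
      show "linrel scale scale (\<lambda>z w. w = scale (x ^ i) z)" by (rule linrelI) (auto simp: scale_right_distrib algebra_simps)
      show "N i \<subseteq> N (Suc i)" unfolding N_def using subspace_scale[OF B2, of _ x] by (auto simp flip: scale_scale)
      show "\<exists>w\<in>A2. w = scale (x ^ i) y" if "y \<in> N (Suc i)" for y
        using that KZ subspace_scale[OF Z2, of y "x ^ i"] by (auto simp: N_def A2_def)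
      show "y \<in> N i" if "y \<in> N (Suc i)" "z \<in> B2" "z = scale (x ^ i) y" for y z using that by (auto simp: N_def)
    qed
    then show ?case using ser_extD[OF e Suc] by blast
  qed
  define Y where "Y i = ssum (scale (x ^ i) ` K) B2" for i
  have "\<exists>n. \<forall>i\<ge>n. Y i = Y n"
  proof (rule artinD[OF art2])
    show "subspace (Y i)" for i unfolding Y_def by (intro subspace_ssum subspace_scaleimg K B2)
    show "B2 \<subseteq> Y i" for i unfolding Y_def by (intro ssum_r subspace_scaleimg K)
    show "Y i \<subseteq> Z2" for i unfolding Y_def using KZ subspace_scale[OF Z2] by (intro ssum_least[OF Z2 _ BZ2]) auto
    show "Y (Suc i) \<subseteq> Y i" for i unfolding Y_def
    proof (rule ssum_mono)
      show "scale (x ^ Suc i) ` K \<subseteq> scale (x ^ i) ` K"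
      proof clarify
        fix k assume "k \<in> K"
        then have "scale (x ^ i) (scale x k) \<in> scale (x ^ i) ` K" using subspace_scale[OF K] by blast
        then show "scale (x ^ Suc i) k \<in> scale (x ^ i) ` K" by (simp add: mult.commute)
      qed
    qed simp
  qed
  then obtain i where i: "Y (Suc i) = Y i" by (meson le_Suc_eq le_refl)
  have KxN: "\<exists>k'\<in>K. \<exists>n\<in>N i. k = scale x k' + n" if k: "k \<in> K" for k
  proof -
    have "scale (x ^ i) k \<in> Y i" unfolding Y_def using k ssum_l[OF B2] by blast
    then obtain k' b where e: "scale (x ^ i) k = scale (x ^ Suc i) k' + b" "k' \<in> K" "b \<in> B2"
      unfolding i(1)[symmetric] by (subst (asm) Y_def) (elim ssumE, blast)
    have "scale (x ^ i) (k - scale x k') = b" using e(1) by (simp add: scale_right_diff_distrib mult.commute)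
    then have "k - scale x k' \<in> N i" unfolding N_def using subspace_diff[OF K k subspace_scale[OF K e(2), of x]] e(3) by auto
    then show ?thesis using e(2) by (metis add.commute diff_add_cancel)
  qed
  \<comment> \<open>The elements of A1 that come from the kernel of x on Z2/B2; A1 modulo A' embeds
    in K/xK.\<close>
  define A' where "A' = ssum {y \<in> A1. \<exists>z\<in>A2. D y z} B1"
  have sA0: "subspace {y \<in> A1. \<exists>z\<in>A2. D y z}"
  proof (rule subspaceI)
    show "0 \<in> {y \<in> A1. \<exists>z\<in>A2. D y z}" using linrel_0[OF D] subspace_0[OF A1] subspace_0[OF A2] by blast
    fix u v assume "u \<in> {y \<in> A1. \<exists>z\<in>A2. D y z}" "v \<in> {y \<in> A1. \<exists>z\<in>A2. D y z}"
    then obtain z z' where "u \<in> A1" "v \<in> A1" "z \<in> A2" "z' \<in> A2" "D u z" "D v z'" by blast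
    then show "u + v \<in> {y \<in> A1. \<exists>z\<in>A2. D y z}" using linrel_add[OF D, of u z v z'] subspace_add[OF A1, of u v] subspace_add[OF A2, of z z'] by blast
  next
    fix c u assume "u \<in> {y \<in> A1. \<exists>z\<in>A2. D y z}"
    then obtain z where "u \<in> A1" "z \<in> A2" "D u z" by blast
    then show "scale c u \<in> {y \<in> A1. \<exists>z\<in>A2. D y z}" using linrel_scale[OF D, of u z c] subspace_scale[OF A1, of u c] subspace_scale[OF A2, of z c] by blast
  qed
  have BA1: "B1 \<subseteq> A1" unfolding A1_def using BZ1 subspace_scale[OF B1] by auto
  have A': "subspace A'" unfolding A'_def by (rule subspace_ssum[OF sA0 B1])
  have BA': "B1 \<subseteq> A'" unfolding A'_def by (rule ssum_r[OF sA0])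
  have A'A1: "A' \<subseteq> A1" unfolding A'_def by (rule ssum_least[OF A1 _ BA1]) auto
  have "ser xs B1 A'"
  proof (rule ser_subD[OF s, of "\<lambda>y z. \<exists>b\<in>B1. D (y - b) z", OF _ serA2 B1 A' BA'])
    show "linrel scale scale (\<lambda>y z. \<exists>b\<in>B1. D (y - b) z)"
    proof (rule linrelI)
      show "\<exists>b\<in>B1. D (0 - b) 0" using linrel_0[OF D] subspace_0[OF B1] by (auto intro!: bexI[of _ "0::'b"])
      fix y z y' z' assume "\<exists>b\<in>B1. D (y - b) z" "\<exists>b\<in>B1. D (y' - b) z'"
      then obtain b b' where "b \<in> B1" "b' \<in> B1" "D (y - b) z" "D (y' - b') z'" by blast
      then show "\<exists>b\<in>B1. D (y + y' - b) (z + z')" using linrel_add[OF D, of "y - b" z "y' - b'" z'] subspace_add[OF B1, of b b']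
        by (intro bexI[of _ "b + b'"]) (simp_all add: algebra_simps)
    next
      fix a y z assume "\<exists>b\<in>B1. D (y - b) z"
      then obtain b where "b \<in> B1" "D (y - b) z" by blast
      then show "\<exists>b\<in>B1. D (scale a y - b) (scale a z)" using linrel_scale[OF D, of "y - b" z a] subspace_scale[OF B1, of b a]
        by (intro bexI[of _ "scale a b"]) (simp_all add: scale_right_diff_distrib)
    qed
    show "\<exists>z\<in>A2. \<exists>b\<in>B1. D (y - b) z" if y: "y \<in> A'" for y
    proof -
      obtain y0 b z where "y = y0 + b" "b \<in> B1" "z \<in> A2" "D y0 z" using y unfolding A'_def by (auto elim!: ssumE)
      then show ?thesis by (intro bexI[of _ z] bexI[of _ b]) auto
    qed
    show "y \<in> B1" if h: "y \<in> A'" "z \<in> B2" "\<exists>b\<in>B1. D (y - b) z" for y z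
    proof -
      obtain b where b: "b \<in> B1" "D (y - b) z" using h(3) by blast
      have "y - b \<in> Z1" using h(1) A'A1 subspace_diff[OF Z1] b(1) BZ1 by (auto simp: A1_def)
      then have "y - b \<in> B1" using inj b(2) h(2) by blast
      then show ?thesis using subspace_add[OF B1 _ b(1), of "y - b"] by simp
    qed
  qed
  moreover have "ser xs A' A1"
  proof (rule ser_subD[OF s, of "\<lambda>y n. \<exists>z\<in>Z2. \<exists>k\<in>K. D y z \<and> scale x z = scale x k + n", OF _ serN A' A1 A'A1])
    show "linrel scale scale (\<lambda>y n. \<exists>z\<in>Z2. \<exists>k\<in>K. D y z \<and> scale x z = scale x k + n)"
    proof (rule linrelI)
      show "\<exists>z\<in>Z2. \<exists>k\<in>K. D 0 z \<and> scale x z = scale x k + 0" using linrel_0[OF D] subspace_0[OF Z2] subspace_0[OF K]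
        by (intro bexI[of _ 0]) auto
      fix y n y' n' assume "\<exists>z\<in>Z2. \<exists>k\<in>K. D y z \<and> scale x z = scale x k + n" "\<exists>z\<in>Z2. \<exists>k\<in>K. D y' z \<and> scale x z = scale x k + n'"
      then obtain z k z' k' where *: "z \<in> Z2" "k \<in> K" "D y z" "scale x z = scale x k + n" "z' \<in> Z2" "k' \<in> K" "D y' z'" "scale x z' = scale x k' + n'" by blast
      show "\<exists>z\<in>Z2. \<exists>k\<in>K. D (y + y') z \<and> scale x z = scale x k + (n + n')"
        using * linrel_add[OF D *(3,7)] subspace_add[OF Z2 *(1,5)] subspace_add[OF K *(2,6)]
        by (intro bexI[of _ "z + z'"] bexI[of _ "k + k'"]) (simp_all add: scale_right_distrib algebra_simps)
    next
      fix a y n assume "\<exists>z\<in>Z2. \<exists>k\<in>K. D y z \<and> scale x z = scale x k + n"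
      then obtain z k where *: "z \<in> Z2" "k \<in> K" "D y z" "scale x z = scale x k + n" by blast
      have "scale x (scale a z) = scale x (scale a k) + scale a n" using arg_cong[OF *(4), of "scale a"] by (simp add: scale_right_distrib mult.commute)
      then show "\<exists>z\<in>Z2. \<exists>k\<in>K. D (scale a y) z \<and> scale x z = scale x k + scale a n"
        using linrel_scale[OF D *(3), of a] subspace_scale[OF Z2 *(1), of a] subspace_scale[OF K *(2), of a] by blast
    qed
    show "\<exists>n\<in>N i. \<exists>z\<in>Z2. \<exists>k\<in>K. D y z \<and> scale x z = scale x k + n" if y: "y \<in> A1" for y
    proof -
      obtain z where z: "z \<in> Z2" "D y z" using tot y by (auto simp: A1_def)
      have "scale x z \<in> K0" unfolding K0_def using y linrel_scale[OF D z(2), of x] subspace_scale[OF Z2 z(1), of x] by (auto simp: A1_def)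
      then have "scale x z \<in> K" unfolding K_def using ssum_l[OF B2] by blast
      then show ?thesis using KxN z by blast
    qed
    show "y \<in> A'" if y: "y \<in> A1" and n: "n \<in> B2" and ex: "\<exists>z\<in>Z2. \<exists>k\<in>K. D y z \<and> scale x z = scale x k + n" for y n
    proof -
      obtain z k where *: "z \<in> Z2" "k \<in> K" "D y z" "scale x z = scale x k + n" using ex by blast
      obtain k0 c where k0: "k = k0 + c" "k0 \<in> K0" "c \<in> B2" using *(2) unfolding K_def by (rule ssumE)
      obtain b where b: "b \<in> B1" "D b k0" "k0 \<in> Z2" using k0(2) by (auto simp: K0_def)
      have "D (y + scale (-1) b) (z + scale (-1) k0)" by (rule linrel_add[OF D *(3) linrel_scale[OF D b(2)]])
      then have "D (y - b) (z - k0)" by simp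
      moreover have "scale x (z - k0) = scale x c + n" by (simp add: scale_right_diff_distrib *(4) k0(1) scale_right_distrib)
      then have "z - k0 \<in> A2" unfolding A2_def using subspace_diff[OF Z2 *(1) b(3)] subspace_add[OF B2 subspace_scale[OF B2 k0(3)] n] by simp
      moreover have "y - b \<in> A1" using subspace_diff[OF A1 y] b(1) BA1 by blast
      ultimately have "y - b + b \<in> A'" unfolding A'_def using b(1) by (intro ssumI) auto
      then show ?thesis by simp
    qed
  qed
  ultimately have "ser xs B1 A1" by (rule ser_extD[OF e])
  then show "ser (x # xs) B1 Z1" using art1 by (simp add: A1_def)
qed

lemma ser_closure: "ser_sub xs \<and> ser_ext xs"
  by (induction xs) (simp_all add: ser_Nil ser_ext_step ser_sub_step)

lemmas ser_subq = ser_subD[OF conjunct1[OF ser_closure]]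

text \<open>W lies in each of the successive kernels, hence in the last one, which a power of m
  carries into B.\<close>

lemma ser_kill:
  assumes "ser xs B Z" "W \<subseteq> Z" "\<And>x w. x \<in> set xs \<Longrightarrow> w \<in> W \<Longrightarrow> scale x w \<in> B"
  obtains c where "\<And>a w. a \<in> idpow m c \<Longrightarrow> w \<in> W \<Longrightarrow> scale a w \<in> B"
proof -
  have "mkill B W" using assms
  proof (induction xs arbitrary: Z)
    case Nil
    then obtain c where "\<forall>a\<in>idpow m c. \<forall>z\<in>Z. scale a z \<in> B" by (auto elim: mkillE)
    then show ?case using Nil(2) unfolding mkill_def by blast
  next
    case (Cons x xs)
    then have "W \<subseteq> {z \<in> Z. scale x z \<in> B}" by auto
    then show ?case using Cons.IH[of "{z \<in> Z. scale x z \<in> B}"] Cons.prems by auto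
  qed
  then obtain c where "\<forall>a\<in>idpow m c. \<forall>z\<in>W. scale a z \<in> B" by (rule mkillE)
  then show thesis using that[of c] by simp
qed

end

section \<open>The Hartshorne--Speiser--Lyubeznik theorem over a complete local ring\<close>

interpretation rm: module "(*) :: 'a::comm_ring_1 \<Rightarrow> 'a \<Rightarrow> 'a"
  by standard (auto simp: algebra_simps)

declare rm.scale_scale [simp del]

lemma rm_subspace: "rm.subspace I \<longleftrightarrow> is_ideal I"
  unfolding rm.subspace_def is_ideal_def by blast

context nloc
begin

text \<open>Take b in the last power of m that does not kill z modulo I; then \<open>b * z\<close>
  is a nonzero socle element of R/I.\<close>

lemma least_power:
  assumes "\<And>a. a \<in> idpow m n \<Longrightarrow> a * z \<in> I" "z \<notin> I"
  obtains b where "b * z \<notin> I" "\<And>a. a \<in> m \<Longrightarrow> a * (b * z) \<in> I"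
proof -
  define k where "k = (LEAST k. \<forall>a\<in>idpow m k. a * z \<in> I)"
  have k: "\<forall>a\<in>idpow m k. a * z \<in> I" unfolding k_def by (rule LeastI[of _ n]) (use assms(1) in blast)
  have "k \<noteq> 0" using k assms(2) by (metis UNIV_I idpow.simps(1) mult_1)
  then obtain j where j: "k = Suc j" by (cases k) auto
  have "\<not> (\<forall>a\<in>idpow m j. a * z \<in> I)" using not_less_Least[of j "\<lambda>k. \<forall>a\<in>idpow m k. a * z \<in> I"] j by (simp add: k_def)
  then obtain b where b: "b \<in> idpow m j" "b * z \<notin> I" by blast
  show thesis
  proof (rule that[OF b(2)])
    fix a assume "a \<in> m"
    then have "a * b \<in> idpow m k" unfolding j using idpow_mult1 b(1) by blast
    then show "a * (b * z) \<in> I" using k by (metis mult.assoc)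
  qed
qed

text \<open>A maximal K with K/I Artinian is all of L. Otherwise \<open>least_power\<close> gives v
  in L outside K with mv inside K; no ideal lies strictly between K and K + (v), so K + (v) would be
  a larger choice.\<close>

lemma artin_ideal:
  assumes I: "is_ideal I" and L: "is_ideal L" and IL: "I \<subseteq> L" and c: "\<And>a b. a \<in> idpow m c \<Longrightarrow> b \<in> L \<Longrightarrow> a * b \<in> I"
  shows "rm.artin I L"
proof -
  define Q where "Q K \<longleftrightarrow> is_ideal K \<and> I \<subseteq> K \<and> K \<subseteq> L \<and> rm.artin I K" for K
  have "Q I" unfolding Q_def using I IL rm.artin_refl[of I] rm_subspace by blast
  moreover have "is_ideal K" if "Q K" for K using that by (simp add: Q_def)
  ultimately obtain K where K: "Q K" and mx: "\<forall>J. Q J \<longrightarrow> K \<subseteq> J \<longrightarrow> J = K" using noeth_max[OF noeth, of Q I] by auto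
  have Ki: "is_ideal K" "I \<subseteq> K" "K \<subseteq> L" "rm.artin I K" using K by (auto simp: Q_def)
  have "L \<subseteq> K"
  proof (rule ccontr)
    assume "\<not> L \<subseteq> K"
    then obtain z where z: "z \<in> L" "z \<notin> K" by blast
    have "a * z \<in> K" if "a \<in> idpow m c" for a using c[OF that z(1)] Ki(2) by blast
    then obtain b where b: "b * z \<notin> K" "\<And>a. a \<in> m \<Longrightarrow> a * (b * z) \<in> K" using least_power[OF _ z(2), of c] by blast
    define v where "v = b * z"
    have vL: "v \<in> L" using ideal_mult[OF L z(1)] by (simp add: v_def)
    define K' where "K' = iadd K v"
    have K': "is_ideal K'" "K \<subseteq> K'" "K' \<subseteq> L" "v \<in> K'"
      unfolding K'_def using is_ideal_iadd[OF Ki(1)] iadd_sup[of K v] iadd_least[OF L Ki(3) vL] iadd_self[OF Ki(1)] by auto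
    have two: "X = K \<or> X = K'" if X: "is_ideal X" "K \<subseteq> X" "X \<subseteq> K'" for X
    proof (rule ccontr)
      assume n: "\<not> (X = K \<or> X = K')"
      then obtain w where w: "w \<in> X" "w \<notin> K" using X by blast
      then obtain r i where e: "w = i + r * v" "i \<in> K" using X(3) unfolding K'_def by (blast elim: iaddE)
      have "r \<notin> m" using w(2) e b(2)[of r] ideal_add[OF Ki(1), of i "r * v"] by (auto simp: v_def)
      then obtain q where q: "q * r = 1" using unit by blast
      have "r * v \<in> X" using ideal_diff[OF X(1) w(1), of i] e X(2) by auto
      then have "q * (r * v) \<in> X" by (rule ideal_mult[OF X(1)])
      then have "v \<in> X" using q by (simp flip: mult.assoc)
      then have "K' \<subseteq> X" unfolding K'_def by (rule iadd_least[OF X(1,2)])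
      then show False using n X by blast
    qed
    have "rm.artin K K'"
    proof (rule rm.artinI)
      show "rm.subspace K" "rm.subspace K'" "K \<subseteq> K'" using K' Ki by (simp_all add: rm_subspace)
      fix X assume X: "\<And>i. rm.subspace (X i)" "\<And>i. K \<subseteq> X i" "\<And>i. X i \<subseteq> K'" "\<And>i. X (Suc i) \<subseteq> X i"
      have anti: "i \<le> j \<Longrightarrow> X j \<subseteq> X i" for i j using X(4) by (rule lift_Suc_antimono_le)
      have two': "X i = K \<or> X i = K'" for i using two[of "X i"] X rm_subspace by blast
      show "\<exists>n. \<forall>i\<ge>n. X i = X n"
      proof (cases "\<exists>n. X n = K")
        case True
        then obtain n where "X n = K" by blast
        then have "X i = X n" if "n \<le> i" for i using anti[OF that] X(2)[of i] by blast
        then show ?thesis by (intro exI allI impI)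
      next
        case False
        then show ?thesis using two' by (metis order_refl)
      qed
    qed
    then have "Q K'" unfolding Q_def using K' Ki rm.artin_ext by blast
    then have "K' = K" using mx K'(2) by blast
    then show False using K'(4) b(1) by (simp add: v_def)
  qed
  then show ?thesis using Ki by (metis subset_antisym)
qed

section \<open>Completeness and Chevalley's theorem\<close>

definition complete :: bool where
  "complete \<longleftrightarrow> (\<forall>f. (\<forall>n. f (Suc n) - f n \<in> idpow m n) \<longrightarrow> (\<exists>l. \<forall>n. l - f n \<in> idpow m n))"

lemma diff_tele: assumes "\<And>k. f (Suc k) - f k \<in> idpow m (n + k)" shows "f k - f 0 \<in> idpow m n"
proof (induction k)
  case 0 then show ?case by (simp add: ideal_0 is_ideal_idpow)
next
  case (Suc k)
  have "f (Suc k) - f k \<in> idpow m n" using assms[of k] idpow_anti[of n "n + k" m] by auto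
  then show ?case using ideal_add[OF is_ideal_idpow Suc, of "f (Suc k) - f k"] by simp
qed

text \<open>R modulo a power of m is Artinian, so the images of the \<open>b i\<close> in it
  stabilise. An element of a late ideal can therefore be moved into later and later ones by smaller
  and smaller corrections. These converge by completeness, and the limit lies in every
  \<open>b i\<close> because ideals are closed by Krull's theorem.\<close>

lemma chevalley:
  assumes cp: complete and b: "\<And>i. is_ideal (b i)" and dec: "\<And>i. b (Suc i) \<subseteq> b i"
  shows "\<exists>i. \<forall>u\<in>b i. \<exists>x\<in>(\<Inter>i. b i). u - x \<in> idpow m n"
proof -
  have anti: "i \<le> j \<Longrightarrow> b j \<subseteq> b i" for i j using dec by (rule lift_Suc_antimono_le)
  define s where "s n i = {z. \<exists>x\<in>b i. z - x \<in> idpow m n}" for n i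
  have s: "is_ideal (s n i)" for n i
  proof (rule is_idealI)
    show "0 \<in> s n i" unfolding s_def using ideal_0[OF b] by (auto intro!: bexI[of _ 0] simp: ideal_0 is_ideal_idpow)
    fix x y assume "x \<in> s n i" "y \<in> s n i"
    then obtain x' y' where h: "x' \<in> b i" "x - x' \<in> idpow m n" "y' \<in> b i" "y - y' \<in> idpow m n" by (auto simp: s_def)
    have "(x + y) - (x' + y') = (x - x') + (y - y')" by (simp add: algebra_simps)
    then have "(x + y) - (x' + y') \<in> idpow m n" by (simp only: ideal_add[OF is_ideal_idpow h(2,4)])
    then show "x + y \<in> s n i" unfolding s_def using ideal_add[OF b h(1,3)] by blast
  next
    fix r x assume "x \<in> s n i"
    then obtain x' where h: "x' \<in> b i" "x - x' \<in> idpow m n" by (auto simp: s_def)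
    have "r * x - r * x' \<in> idpow m n" using ideal_mult[OF is_ideal_idpow h(2), of r] by (simp add: right_diff_distrib)
    then show "r * x \<in> s n i" unfolding s_def using ideal_mult[OF b h(1)] by blast
  qed
  have "\<exists>j. \<forall>i\<ge>j. s n i = s n j" for n
  proof (rule rm.artinD)
    show "rm.artin (idpow m n) UNIV"
      by (rule artin_ideal[of _ _ n]) (auto simp: is_ideal_idpow is_ideal_UNIV ideal_mult2)
    show "rm.subspace (s n i)" for i using s rm_subspace by blast
    show "idpow m n \<subseteq> s n i" for i unfolding s_def using ideal_0[OF b] by (auto intro!: bexI[of _ 0])
    show "s n i \<subseteq> UNIV" for i by simp
    show "s n (Suc i) \<subseteq> s n i" for i unfolding s_def using dec[of i] by blast
  qed
  then have "\<forall>n. \<exists>j. \<forall>i\<ge>j. s n i = s n j" by (intro allI)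
  from choice[OF this] obtain j where "\<forall>n. \<forall>i\<ge>j n. s n i = s n (j n)" by (elim exE)
  note j = this[rule_format]
  \<comment> \<open>A nondecreasing index that dominates \<open>j n\<close>, so that the images
    modulo the n-th power are stable from there on, and also n, so that every \<open>b i\<close> is
    reached.\<close>
  define jj where "jj n = n + (\<Sum>k\<le>n. j k)" for n
  have jj1: "j n \<le> jj n" for n unfolding jj_def using member_le_sum[of n "{..n}" j] by simp
  have jj2: "jj n \<le> jj (Suc n)" for n by (simp add: jj_def)
  have jj3: "n \<le> jj n" for n by (simp add: jj_def)
  have step: "\<exists>v\<in>b i. u - v \<in> idpow m k" if h: "u \<in> b (jj k)" "jj k \<le> i" for u i k
  proof -
    have "u \<in> s k (jj k)" unfolding s_def using h(1) by (auto intro!: bexI[of _ u] simp: ideal_0 is_ideal_idpow)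
    moreover have "s k (jj k) = s k (j k)" by (rule j[OF jj1])
    moreover have "s k i = s k (j k)" by (rule j) (use jj1[of k] h(2) in simp)
    ultimately show ?thesis by (auto simp: s_def)
  qed
  show ?thesis
  proof (intro exI[of _ "jj n"] ballI)
    fix u assume u: "u \<in> b (jj n)"
    have "\<exists>f. \<forall>k. (f k \<in> b (jj (n + k)) \<and> (k = 0 \<longrightarrow> f k = u)) \<and> f (Suc k) - f k \<in> idpow m (n + k)"
    proof (rule dependent_nat_choice)
      show "\<exists>x. x \<in> b (jj (n + 0)) \<and> (0 = (0::nat) \<longrightarrow> x = u)" using u by simp
      fix x k assume x: "x \<in> b (jj (n + k)) \<and> (k = 0 \<longrightarrow> x = u)"
      obtain v where v: "v \<in> b (jj (n + Suc k))" "x - v \<in> idpow m (n + k)"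
        using step[of x "n + k" "jj (n + Suc k)"] x jj2[of "n + k"] by auto
      then show "\<exists>y. (y \<in> b (jj (n + Suc k)) \<and> (Suc k = 0 \<longrightarrow> y = u)) \<and> y - x \<in> idpow m (n + k)"
        using ideal_neg[OF is_ideal_idpow v(2)] by auto
    qed
    then obtain f where f: "\<And>k. f k \<in> b (jj (n + k))" "f 0 = u" "\<And>k. f (Suc k) - f k \<in> idpow m (n + k)" by blast
    have "\<forall>k. f (Suc k) - f k \<in> idpow m k" using f(3) idpow_anti[of _ "n + _" m] by (meson le_add2 subsetD)
    then obtain l where l: "\<And>k. l - f k \<in> idpow m k" using cp unfolding complete_def by blast
    have "l \<in> b i" for i
    proof (rule krull[OF b])
      fix N
      define k where "k = max N i"
      have "l - f k \<in> idpow m N" using l[of k] idpow_anti[of N k m] by (auto simp: k_def)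
      moreover have "i \<le> jj (n + k)" using jj3[of "n + k"] by (simp add: k_def)
      then have "f k \<in> b i" using f(1)[of k] anti by blast
      ultimately show "\<exists>x\<in>b i. l - x \<in> idpow m N" by blast
    qed
    moreover have "u - l = - ((l - f n) + (f n - f 0))" by (simp add: f(2))
    then have "u - l \<in> idpow m n"
      using ideal_neg[OF is_ideal_idpow ideal_add[OF is_ideal_idpow l[of n] diff_tele[of f n n, OF f(3)]]] by simp
    ultimately show "\<exists>x\<in>\<Inter>i. b i. u - x \<in> idpow m n" by blast
  qed
qed

end

context nmod
begin

section \<open>Annihilators and essential extensions of the residue field\<close>

definition ann :: "'b set \<Rightarrow> 'b set \<Rightarrow> 'a set" where "ann K Y = {a. \<forall>k\<in>K. scale a k \<in> Y}"

lemma is_ideal_ann2: assumes "subspace Y" shows "is_ideal (ann K Y)"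
proof (rule is_idealI)
  show "0 \<in> ann K Y" using subspace_0[OF assms] by (simp add: ann_def)
  show "a + b \<in> ann K Y" if "a \<in> ann K Y" "b \<in> ann K Y" for a b
    using that subspace_add[OF assms] by (simp add: ann_def scale_left_distrib)
  show "r * a \<in> ann K Y" if "a \<in> ann K Y" for r a
    using that subspace_scale[OF assms, of _ r] by (simp add: ann_def flip: scale_scale)
qed

lemma least_power_mod:
  assumes Y: "subspace Y" and t: "\<And>a. a \<in> idpow m n \<Longrightarrow> scale a z \<in> Y" and z: "z \<notin> Y"
  obtains b where "scale b z \<notin> Y" "\<And>a. a \<in> m \<Longrightarrow> scale a (scale b z) \<in> Y"
proof -
  define I where "I = {a. scale a z \<in> Y}"
  have "1 \<notin> I" using z by (simp add: I_def)
  moreover have "a * 1 \<in> I" if "a \<in> idpow m n" for a using t[OF that] by (simp add: I_def)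
  ultimately obtain b where "b * 1 \<notin> I" "\<And>a. a \<in> m \<Longrightarrow> a * (b * 1) \<in> I" using least_power[of n 1 I] by blast
  then show thesis using that[of b] by (simp add: I_def)
qed

text \<open>The double annihilator theorem for a submodule \<open>K\<close> of an essential extension \<open>X/Y\<close> of the residue field;
  first for \<open>K/Y\<close> killed by a power of \<open>m\<close>.\<close>
lemma double_ann_fin:
  assumes Y: "subspace Y" and X: "subspace X" and YX: "Y \<subseteq> X" and v: "v \<in> X" "v \<notin> Y"
    and co: "\<And>w. w \<in> X \<Longrightarrow> w \<notin> Y \<Longrightarrow> \<exists>r. v - scale r w \<in> Y"
    and K: "subspace K" "Y \<subseteq> K" "K \<subseteq> X" and n: "\<And>a k. a \<in> idpow m n \<Longrightarrow> k \<in> K \<Longrightarrow> scale a k \<in> Y"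
    and c: "c \<in> X" "\<And>a. a \<in> ann K Y \<Longrightarrow> scale a c \<in> Y"
  shows "c \<in> K"
proof -
  \<comment> \<open>The socle of X/Y is one-dimensional, spanned by v: if m kills w modulo Y and v =
    rw modulo Y, then r cannot lie in m, so it is a unit.\<close>
  have soc_v: "\<exists>r. w - scale r v \<in> Y" if w: "w \<in> X" "\<And>a. a \<in> m \<Longrightarrow> scale a w \<in> Y" for w
  proof (cases "w \<in> Y")
    case True then show ?thesis by (intro exI[of _ 0]) simp
  next
    case False
    then obtain r where r: "v - scale r w \<in> Y" using co w(1) by blast
    have "r \<notin> m"
    proof
      assume "r \<in> m"
      then have "v - scale r w + scale r w \<in> Y" using subspace_add[OF Y r w(2)] by blast
      then show False using v by simp
    qed
    then obtain q where q: "q * r = 1" using unit by blast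
    have "scale q (v - scale r w) \<in> Y" by (rule subspace_scale[OF Y r])
    then have "scale q v - w \<in> Y" using q by (simp add: scale_right_diff_distrib)
    then have "- (scale q v - w) \<in> Y" by (rule subspace_neg[OF Y])
    then show ?thesis by (intro exI[of _ q]) simp
  qed
  have soc: "\<exists>r. w - scale r s \<in> Y" if w: "w \<in> X" "\<And>a. a \<in> m \<Longrightarrow> scale a w \<in> Y" and s: "s \<in> X" "s \<notin> Y" for w s
  proof -
    obtain r where r: "w - scale r v \<in> Y" using soc_v[OF w] by blast
    obtain t where t: "v - scale t s \<in> Y" using co[OF s] by blast
    have "w - scale r v + scale r (v - scale t s) \<in> Y" using subspace_add[OF Y r subspace_scale[OF Y t]] by blast
    then show ?thesis by (intro exI[of _ "r * t"]) (simp add: scale_right_diff_distrib)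
  qed
  \<comment> \<open>The submodules for which the double annihilator theorem holds. Their
    annihilators contain the n-th power of m, so one with minimal annihilator exists. If it is not
    K, adding some k with mk inside W gives a good W' with the same annihilator, which forces k into
    W.\<close>
  define good where "good W \<longleftrightarrow> subspace W \<and> Y \<subseteq> W \<and> W \<subseteq> K \<and> (\<forall>c\<in>X. (\<forall>a\<in>ann W Y. scale a c \<in> Y) \<longrightarrow> c \<in> W)" for W
  have goodY: "good Y"
  proof -
    have "c \<in> Y" if h: "\<forall>a\<in>ann Y Y. scale a c \<in> Y" for c
    proof -
      have "1 \<in> ann Y Y" by (simp add: ann_def)
      then have "scale 1 c \<in> Y" using h by blast
      then show ?thesis by simp
    qed
    then show ?thesis unfolding good_def using Y K by blast
  qed
  define P where "P I \<longleftrightarrow> (\<exists>W. good W \<and> I = ann W Y)" for I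
  have "\<exists>I. P I \<and> (\<forall>J. P J \<longrightarrow> J \<subseteq> I \<longrightarrow> J = I)"
  proof (rule rm.artin_min)
    show "rm.artin (idpow m n) UNIV"
      by (rule artin_ideal[of _ _ n]) (auto simp: is_ideal_idpow is_ideal_UNIV ideal_mult2)
    show "P (ann Y Y)" unfolding P_def using goodY by blast
    fix I assume "P I"
    then obtain W where W: "good W" "I = ann W Y" by (auto simp: P_def)
    have "idpow m n \<subseteq> I" unfolding W(2) ann_def using W(1) n by (auto simp: good_def)
    then show "rm.subspace I \<and> idpow m n \<subseteq> I \<and> I \<subseteq> UNIV" using is_ideal_ann2[OF Y] W(2) by (simp add: rm_subspace)
  qed
  then obtain I where I: "P I" "\<forall>J. P J \<longrightarrow> J \<subseteq> I \<longrightarrow> J = I" by (elim exE conjE)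
  obtain W where W: "good W" "I = ann W Y" using I(1) unfolding P_def by (elim exE conjE)
  have mn: "ann W' Y = ann W Y" if h: "good W'" "ann W' Y \<subseteq> ann W Y" for W'
  proof -
    have "P (ann W' Y)" unfolding P_def using h(1) by auto
    then show ?thesis using I(2) h(2) W(2) by simp
  qed
  have Ws: "subspace W" "Y \<subseteq> W" "W \<subseteq> K" using W by (auto simp: good_def)
  have Wd: "c \<in> W" if "c \<in> X" "\<And>a. a \<in> ann W Y \<Longrightarrow> scale a c \<in> Y" for c using W that by (auto simp: good_def)
  have "K \<subseteq> W"
  proof (rule ccontr)
    assume "\<not> K \<subseteq> W"
    then obtain k0 where k0: "k0 \<in> K" "k0 \<notin> W" by blast
    have "scale a k0 \<in> W" if "a \<in> idpow m n" for a using n[OF that k0(1)] Ws(2) by blast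
    then obtain b where b: "scale b k0 \<notin> W" "\<And>a. a \<in> m \<Longrightarrow> scale a (scale b k0) \<in> W" using least_power_mod[OF Ws(1) _ k0(2), of n] by blast
    define k where "k = scale b k0"
    have k: "k \<in> K" "k \<notin> W" "\<And>a. a \<in> m \<Longrightarrow> scale a k \<in> W" using b subspace_scale[OF K(1) k0(1)] by (auto simp: k_def)
    have kX: "k \<in> X" using k K by blast
    define W' where "W' = {z. \<exists>r. z - scale r k \<in> W}"
    have W'i: "z \<in> W'" if "z - scale r k \<in> W" for z r using that by (auto simp: W'_def)
    have annW': "u \<in> ann W' Y" if u: "u \<in> ann W Y" "scale u k \<in> Y" for u
      unfolding ann_def
    proof (intro CollectI ballI)
      fix z assume "z \<in> W'"
      then obtain r where "z - scale r k \<in> W" by (auto simp: W'_def)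
      then have "scale u (z - scale r k) \<in> Y" using u by (auto simp: ann_def)
      then have "scale u (z - scale r k) + scale r (scale u k) \<in> Y" using subspace_add[OF Y _ subspace_scale[OF Y u(2)]] by blast
      then show "scale u z \<in> Y" by (simp add: scale_right_diff_distrib mult.commute)
    qed
    have "good W'" unfolding good_def
    proof (intro conjI ballI impI)
      show "subspace W'"
      proof (rule subspaceI)
        show "0 \<in> W'" by (rule W'i[of _ 0]) (simp add: subspace_0 Ws)
        fix x y assume "x \<in> W'" "y \<in> W'"
        then obtain r s where "x - scale r k \<in> W" "y - scale s k \<in> W" by (auto simp: W'_def)
        then have "(x - scale r k) + (y - scale s k) \<in> W" by (rule subspace_add[OF Ws(1)])
        then show "x + y \<in> W'" by (intro W'i[of _ "r + s"]) (simp add: scale_left_distrib algebra_simps)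
      next
        fix a x assume "x \<in> W'"
        then obtain r where "x - scale r k \<in> W" by (auto simp: W'_def)
        then have "scale a (x - scale r k) \<in> W" by (rule subspace_scale[OF Ws(1)])
        then show "scale a x \<in> W'" by (intro W'i[of _ "a * r"]) (simp add: scale_right_diff_distrib)
      qed
      show "Y \<subseteq> W'" using Ws(2) by (auto intro!: W'i[of _ 0])
      show "W' \<subseteq> K"
      proof
        fix z assume "z \<in> W'"
        then obtain r where "z - scale r k \<in> W" by (auto simp: W'_def)
        then have "(z - scale r k) + scale r k \<in> K" using subspace_add[OF K(1) _ subspace_scale[OF K(1) k(1)]] Ws(3) by blast
        then show "z \<in> K" by simp
      qed
      fix c assume c: "c \<in> X" "\<forall>a\<in>ann W' Y. scale a c \<in> Y"
      \<comment> \<open>Both \<open>scale u0 k\<close> and \<open>scale u0 c\<close> are socle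
        elements of X/Y and the first is nonzero, so the second is a multiple of it with some factor
        r0. Then c - r0 k is killed by the whole annihilator of W, hence lies in W.\<close>
      obtain u0 where u0: "u0 \<in> ann W Y" "scale u0 k \<notin> Y" using Wd[OF kX] k(2) by blast
      have au: "scale a (scale u k) \<in> Y" if h: "a \<in> m" "u \<in> ann W Y" for a u
      proof -
        have "scale u (scale a k) \<in> Y" using k(3)[OF h(1)] h(2) by (auto simp: ann_def)
        then show ?thesis by (simp add: mult.commute)
      qed
      have "\<exists>r. scale u0 c - scale r (scale u0 k) \<in> Y"
      proof (rule soc)
        show "scale u0 c \<in> X" "scale u0 k \<in> X" "scale u0 k \<notin> Y" using subspace_scale[OF X] c kX u0 by auto
        fix a assume a: "a \<in> m"
        have "a * u0 \<in> ann W' Y" by (rule annW') (use ideal_mult[OF is_ideal_ann2[OF Y] u0(1)] au[OF a u0(1)] in auto)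
        then have "scale (a * u0) c \<in> Y" using c(2) by blast
        then show "scale a (scale u0 c) \<in> Y" by simp
      qed
      then obtain r0 where r0: "scale u0 c - scale r0 (scale u0 k) \<in> Y" by blast
      have "c - scale r0 k \<in> W"
      proof (rule Wd)
        show "c - scale r0 k \<in> X" using subspace_diff[OF X c(1) subspace_scale[OF X kX]] .
        fix u assume u: "u \<in> ann W Y"
        obtain s where s: "scale u k - scale s (scale u0 k) \<in> Y"
          using soc[of "scale u k" "scale u0 k"] au[OF _ u] subspace_scale[OF X kX] u0(2) by blast
        have "u - s * u0 \<in> ann W' Y"
          by (rule annW') (use ideal_diff[OF is_ideal_ann2[OF Y] u ideal_mult[OF is_ideal_ann2[OF Y] u0(1)]] s in \<open>auto simp: scale_left_diff_distrib\<close>)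
        then have 1: "scale (u - s * u0) c \<in> Y" using c(2) by blast
        have e1: "scale u (c - scale r0 k) = scale u c - scale r0 (scale u k)"
          unfolding scale_right_diff_distrib scale_left_commute[of u r0 k] ..
        have e2: "scale (u - s * u0) c = scale u c - scale s (scale u0 c)" by (simp add: scale_left_diff_distrib)
        have e3: "scale r0 (scale s (scale u0 k)) = scale s (scale r0 (scale u0 k))" by (rule scale_left_commute)
        have "scale u (c - scale r0 k) = scale (u - s * u0) c + scale s (scale u0 c - scale r0 (scale u0 k)) - scale r0 (scale u k - scale s (scale u0 k))"
          unfolding e1 e2 scale_right_diff_distrib[of s] scale_right_diff_distrib[of r0] e3 by (simp del: scale_scale)
        then show "scale u (c - scale r0 k) \<in> Y"
          using subspace_diff[OF Y subspace_add[OF Y 1 subspace_scale[OF Y r0]] subspace_scale[OF Y s]] by simp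
      qed
      then show "c \<in> W'" by (rule W'i)
    qed
    have kW': "k \<in> W'" by (rule W'i[of _ 1]) (simp add: subspace_0 Ws)
    have "W \<subseteq> W'" by (auto intro!: W'i[of _ 0])
    then have "ann W' Y \<subseteq> ann W Y" by (auto simp: ann_def)
    then have "ann W' Y = ann W Y" by (rule mn[OF \<open>good W'\<close>])
    then have "k \<in> W" using Wd[OF kX] kW' by (auto simp: ann_def)
    then show False using k by blast
  qed
  then have "K = W" using Ws by blast
  then show ?thesis using Wd c by blast
qed

text \<open>K is the union of its parts \<open>L n\<close> killed by powers of m, so its annihilator
  is the intersection of theirs. By Chevalley's theorem the annihilator of some \<open>L i\<close>
  lies in that of K plus a power of m killing c. It therefore kills c, and the finite case puts c in
  \<open>L i\<close>.\<close>

lemma double_ann: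
  assumes cp: complete and Y: "subspace Y" and X: "subspace X" and YX: "Y \<subseteq> X" and v: "v \<in> X" "v \<notin> Y"
    and co: "\<And>w. w \<in> X \<Longrightarrow> w \<notin> Y \<Longrightarrow> \<exists>r. v - scale r w \<in> Y"
    and tor: "\<And>z. z \<in> X \<Longrightarrow> \<exists>n. \<forall>a\<in>idpow m n. scale a z \<in> Y"
    and K: "subspace K" "Y \<subseteq> K" "K \<subseteq> X"
    and c: "c \<in> X" "\<And>a. a \<in> ann K Y \<Longrightarrow> scale a c \<in> Y"
  shows "c \<in> K"
proof -
  define L where "L n = {k \<in> K. \<forall>a\<in>idpow m n. scale a k \<in> Y}" for n
  have L: "subspace (L n)" for n
  proof (rule subspaceI)
    show "0 \<in> L n" by (simp add: L_def subspace_0 K Y)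
    show "x + y \<in> L n" if "x \<in> L n" "y \<in> L n" for x y using that by (simp add: L_def subspace_add K Y scale_right_distrib)
    show "scale r x \<in> L n" if h: "x \<in> L n" for r x
    proof -
      have "scale a (scale r x) \<in> Y" if "a \<in> idpow m n" for a
        using h that subspace_scale[OF Y, of "scale a x" r] by (simp add: L_def mult.commute)
      then show ?thesis using h by (simp add: L_def subspace_scale K)
    qed
  qed
  have YL: "Y \<subseteq> L n" for n unfolding L_def using K subspace_scale[OF Y] by auto
  obtain n where n: "\<forall>a\<in>idpow m n. scale a c \<in> Y" using tor[OF c(1)] by blast
  have "\<exists>i. \<forall>u\<in>ann (L i) Y. \<exists>x\<in>(\<Inter>i. ann (L i) Y). u - x \<in> idpow m n"
  proof (rule chevalley[OF cp])
    show "is_ideal (ann (L i) Y)" for i by (rule is_ideal_ann2[OF Y])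
    show "ann (L (Suc i)) Y \<subseteq> ann (L i) Y" for i
      unfolding ann_def L_def using idpow_Suc_sub[of m i] by blast
  qed
  then obtain i where i: "\<forall>u\<in>ann (L i) Y. \<exists>x\<in>(\<Inter>i. ann (L i) Y). u - x \<in> idpow m n" by blast
  have "c \<in> L i"
  proof (rule double_ann_fin[OF Y X YX v co L YL, of i i])
    show "L i \<subseteq> X" using K by (auto simp: L_def)
    show "scale a k \<in> Y" if "a \<in> idpow m i" "k \<in> L i" for a k using that by (simp add: L_def)
    show "c \<in> X" by (rule c)
    fix u assume "u \<in> ann (L i) Y"
    then obtain x where x: "x \<in> (\<Inter>i. ann (L i) Y)" "u - x \<in> idpow m n" using i by blast
    have "x \<in> ann K Y" unfolding ann_def
    proof (intro CollectI ballI)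
      fix k assume k: "k \<in> K"
      then obtain j where "\<forall>a\<in>idpow m j. scale a k \<in> Y" using tor K by blast
      then have "k \<in> L j" using k by (simp add: L_def)
      then show "scale x k \<in> Y" using x(1) by (auto simp: ann_def)
    qed
    then have "scale x c + scale (u - x) c \<in> Y" using subspace_add[OF Y c(2)] n x(2) by blast
    then show "scale u c \<in> Y" by (simp add: scale_left_diff_distrib)
  qed
  then show ?thesis by (simp add: L_def)
qed

text \<open>This replaces Matlis duality: dually, a finitely generated module over R/P has finite
  rank, and every step with annihilator inside P uses up rank. The proof reduces to an essential
  extension X/Y of the residue field, where a submodule with annihilator inside P is already
  everything.\<close>

lemma no_chain:
  assumes cp: complete and art: "artin B Z" and tor: "\<And>z. z \<in> Z \<Longrightarrow> \<exists>n. \<forall>a\<in>idpow m n. scale a z \<in> B"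
    and P: "prime_ideal P" and PZ: "\<And>a z. a \<in> P \<Longrightarrow> z \<in> Z \<Longrightarrow> scale a z \<in> B"
    and L: "\<And>i. subspace (L i)" "\<And>i. B \<subseteq> L i" "\<And>i. L i \<subseteq> Z" "\<And>i. L i \<subseteq> L (Suc i)"
    and LP: "\<And>i a. a \<in> ann (L (Suc i)) (L i) \<Longrightarrow> a \<in> P"
  shows False
proof -
  have B: "subspace B" and Z: "subspace Z" and BZ: "B \<subseteq> Z" using artin_subspace[OF art] by auto
  have mono: "i \<le> j \<Longrightarrow> L i \<subseteq> L j" for i j using L(4) by (rule lift_Suc_mono_le)
  have P1: "1 \<notin> P" using P ideal_one by (auto simp: prime_ideal_def)
  \<comment> \<open>Step i counts for X if the annihilator of the step cut down to X is still inside
    P. A minimal X with infinitely many counting steps is chosen, so that every proper submodule of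
    X containing B has only finitely many.\<close>
  define gd where "gd X i \<longleftrightarrow> ann (L (Suc i) \<inter> X) (L i) \<subseteq> P" for X i
  define Q where "Q X \<longleftrightarrow> subspace X \<and> B \<subseteq> X \<and> X \<subseteq> Z \<and> (\<forall>n. \<exists>i\<ge>n. gd X i)" for X
  have "gd Z i" for i
  proof -
    have "L (Suc i) \<inter> Z = L (Suc i)" using L(3)[of "Suc i"] by blast
    then show ?thesis using LP by (auto simp: gd_def)
  qed
  then have "Q Z" unfolding Q_def using Z BZ by blast
  then have "\<exists>X. Q X \<and> (\<forall>Y. Q Y \<longrightarrow> Y \<subseteq> X \<longrightarrow> Y = X)" by (rule artin_min[OF art]) (simp add: Q_def)
  then obtain X where X: "Q X" and mn: "\<And>Y. Q Y \<Longrightarrow> Y \<subseteq> X \<Longrightarrow> Y = X" by blast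
  have Xs: "subspace X" "B \<subseteq> X" "X \<subseteq> Z" and Xi: "\<forall>n. \<exists>i\<ge>n. gd X i" using X by (auto simp: Q_def)
  have "X \<noteq> B"
  proof
    assume e: "X = B"
    obtain i where i: "gd X i" using Xi by blast
    have "1 \<in> ann (L (Suc i) \<inter> X) (L i)" using L(2)[of i] by (auto simp: ann_def e)
    then show False using i P1 by (auto simp: gd_def)
  qed
  then obtain v where v: "v \<in> X" "v \<notin> B" using Xs by blast
  \<comment> \<open>Zorn's lemma gives a maximal Y in X without v. Every submodule of X properly
    containing Y then contains v, which is the property \<open>co\<close> required by the double
    annihilator theorem.\<close>
  define A where "A = {Y. subspace Y \<and> B \<subseteq> Y \<and> Y \<subseteq> X \<and> v \<notin> Y}"
  have "\<exists>Y\<in>A. \<forall>W\<in>A. Y \<subseteq> W \<longrightarrow> W = Y"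
  proof (rule subset_Zorn_nonempty)
    show "A \<noteq> {}" using B Xs v by (auto simp: A_def)
    fix C assume C: "C \<noteq> {}" "subset.chain A C"
    have CA: "Y \<in> A" if "Y \<in> C" for Y using C(2) that by (auto simp: subset.chain_def)
    have Cc: "Y \<subseteq> W \<or> W \<subseteq> Y" if "Y \<in> C" "W \<in> C" for Y W using C(2) that by (auto simp: subset.chain_def)
    have "subspace (\<Union>C)"
    proof (rule subspaceI)
      show "0 \<in> \<Union>C" using C(1) CA subspace_0 by (auto simp: A_def)
      fix x y assume "x \<in> \<Union>C" "y \<in> \<Union>C"
      then obtain Y W where h: "x \<in> Y" "Y \<in> C" "y \<in> W" "W \<in> C" by blast
      from Cc[OF h(2,4)] show "x + y \<in> \<Union>C"
      proof
        assume "Y \<subseteq> W"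
        then have "x + y \<in> W" using h CA[OF h(4)] subspace_add[of W x y] by (auto simp: A_def)
        then show ?thesis using h by blast
      next
        assume "W \<subseteq> Y"
        then have "x + y \<in> Y" using h CA[OF h(2)] subspace_add[of Y x y] by (auto simp: A_def)
        then show ?thesis using h by blast
      qed
    next
      fix a x assume "x \<in> \<Union>C"
      then obtain Y where h: "x \<in> Y" "Y \<in> C" by blast
      then have "scale a x \<in> Y" using CA[OF h(2)] subspace_scale[of Y x a] by (auto simp: A_def)
      then show "scale a x \<in> \<Union>C" using h by blast
    qed
    then show "\<Union>C \<in> A" using C(1) CA by (auto simp: A_def)
  qed
  then obtain Y where YA: "Y \<in> A" and Ymx: "\<And>W. W \<in> A \<Longrightarrow> Y \<subseteq> W \<Longrightarrow> W = Y" by blast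
  have Y: "subspace Y" "B \<subseteq> Y" "Y \<subseteq> X" "v \<notin> Y" using YA by (auto simp: A_def)
  have co: "\<exists>r. v - scale r w \<in> Y" if w: "w \<in> X" "w \<notin> Y" for w
  proof (rule ccontr)
    assume n: "\<not> (\<exists>r. v - scale r w \<in> Y)"
    define W where "W = {z. \<exists>r. z - scale r w \<in> Y}"
    have Wi: "z \<in> W" if "z - scale r w \<in> Y" for z r using that by (auto simp: W_def)
    have "subspace W"
    proof (rule subspaceI)
      show "0 \<in> W" by (rule Wi[of _ 0]) (simp add: subspace_0 Y)
      fix x y assume "x \<in> W" "y \<in> W"
      then obtain r s where "x - scale r w \<in> Y" "y - scale s w \<in> Y" by (auto simp: W_def)
      then have "(x - scale r w) + (y - scale s w) \<in> Y" by (rule subspace_add[OF Y(1)])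
      then show "x + y \<in> W" by (intro Wi[of _ "r + s"]) (simp add: scale_left_distrib algebra_simps)
    next
      fix a x assume "x \<in> W"
      then obtain r where "x - scale r w \<in> Y" by (auto simp: W_def)
      then have "scale a (x - scale r w) \<in> Y" by (rule subspace_scale[OF Y(1)])
      then show "scale a x \<in> W" by (intro Wi[of _ "a * r"]) (simp add: scale_right_diff_distrib)
    qed
    moreover have "Y \<subseteq> W" by (auto intro!: Wi[of _ 0])
    moreover have "W \<subseteq> X"
    proof
      fix z assume "z \<in> W"
      then obtain r where "z - scale r w \<in> Y" by (auto simp: W_def)
      then have "(z - scale r w) + scale r w \<in> X" using subspace_add[OF Xs(1) _ subspace_scale[OF Xs(1) w(1)]] Y(3) by blast
      then show "z \<in> X" by simp
    qed
    moreover have "v \<notin> W" using n by (auto simp: W_def)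
    ultimately have "W = Y" using Ymx Y(2) by (auto simp: A_def)
    moreover have "w \<in> W" by (rule Wi[of _ 1]) (simp add: subspace_0 Y)
    ultimately show False using w by blast
  qed
  have "\<not> Q Y" using mn[of Y] Y v by blast
  then obtain n0 where n0: "\<And>i. n0 \<le> i \<Longrightarrow> \<not> gd Y i" using Y Xs by (auto simp: Q_def)
  define K where "K i = ssum (L i \<inter> X) Y" for i
  have K: "subspace (K i)" "Y \<subseteq> K i" "K i \<subseteq> X" for i
    unfolding K_def using subspace_ssum[OF subspace_inter[OF L(1) Xs(1)] Y(1)] ssum_r[OF subspace_inter[OF L(1) Xs(1)]]
      ssum_least[OF Xs(1), of "L i \<inter> X" Y] Y(3) by auto
  \<comment> \<open>At a late step that counts for X but not for Y, some a' outside P pushes the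
    part inside Y down one step. If a annihilates the step in X/Y, then a'a annihilates it in X, so
    a'a and hence a lies in P.\<close>
  have annK: "a \<in> P" if i: "n0 \<le> i" "gd X i" and a: "a \<in> ann (K (Suc i)) (K i)" for a i
  proof -
    obtain a' where a': "a' \<in> ann (L (Suc i) \<inter> Y) (L i)" "a' \<notin> P" using n0[OF i(1)] by (auto simp: gd_def)
    have "a' * a \<in> ann (L (Suc i) \<inter> X) (L i)" unfolding ann_def
    proof (intro CollectI ballI)
      fix z assume z: "z \<in> L (Suc i) \<inter> X"
      then have "z \<in> K (Suc i)" unfolding K_def by (rule subsetD[OF ssum_l[OF Y(1)]])
      then have "scale a z \<in> K i" using a by (auto simp: ann_def)
      then obtain k y where e: "scale a z = k + y" "k \<in> L i \<inter> X" "y \<in> Y" unfolding K_def by (rule ssumE)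
      have "scale a z - k \<in> L (Suc i)" using subspace_diff[OF L(1) subspace_scale[OF L(1)], of z "Suc i" k a] z e(2) L(4)[of i] by blast
      then have "y \<in> L (Suc i) \<inter> Y" using e by simp
      then have "scale a' y \<in> L i" using a'(1) by (auto simp: ann_def)
      then have "scale a' k + scale a' y \<in> L i" using subspace_add[OF L(1) subspace_scale[OF L(1)]] e(2) by blast
      then show "scale (a' * a) z \<in> L i" using e(1) by (simp add: scale_right_distrib flip: scale_scale)
    qed
    then have "a' * a \<in> P" using i(2) by (auto simp: gd_def)
    then show ?thesis using P a'(2) by (auto simp: prime_ideal_def)
  qed
  obtain i where i: "n0 \<le> i" "gd X i" using Xi by blast
  have "X \<subseteq> K (Suc i)"
  proof
    fix c assume c: "c \<in> X"
    show "c \<in> K (Suc i)"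
    proof (rule double_ann[OF cp Y(1) Xs(1) Y(3) v(1) Y(4) co _ K(1) K(2) K(3) c])
      show "\<exists>n. \<forall>a\<in>idpow m n. scale a z \<in> Y" if "z \<in> X" for z using tor[of z] that Xs(3) Y(2) by blast
      fix a assume "a \<in> ann (K (Suc i)) Y"
      then have "a \<in> ann (K (Suc i)) (K i)" using K(2)[of i] by (auto simp: ann_def)
      then have "a \<in> P" by (rule annK[OF i])
      then show "scale a c \<in> Y" using PZ c Xs(3) Y(2) by blast
    qed
  qed
  \<comment> \<open>The chain in X/Y has already reached X, so it is constant from here on; one more
    counting step puts 1 in P.\<close>
  obtain j where j: "Suc (max n0 i) \<le> j" "gd X j" using Xi by blast
  have "Suc i \<le> j" using j(1) by simp
  then have "K (Suc i) \<subseteq> K j" unfolding K_def using mono[of "Suc i" j] by (intro ssum_mono) auto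
  then have "K j = X" using \<open>X \<subseteq> K (Suc i)\<close> K(3)[of j] by blast
  then have "1 \<in> ann (K (Suc j)) (K j)" using K(3)[of "Suc j"] by (auto simp: ann_def)
  then have "1 \<in> P" by (rule annK[rotated 2]) (use j in auto)
  then show False using P1 by blast
qed

text \<open>Let \<open>K e\<close> be the kernel of F^e on Z/B and \<open>J e\<close> the
  annihilator of K(e+1)/K(e). Frobenius makes the \<open>J e\<close> increase, so they are constant
  from some E on. If \<open>J E\<close> is the unit ideal, the kernels are constant from E on.
  Otherwise let \<open>P = colon (J E) f\<close> be prime: the submodules f K(E+1+i), taken modulo
  K(E+1), are killed by P while every step has annihilator inside P, contrary to
  \<open>no_chain\<close>.\<close>

theorem HSL:
  assumes cp: complete and art: "artin B Z" and tor: "\<And>z. z \<in> Z \<Longrightarrow> \<exists>n. \<forall>a\<in>idpow m n. scale a z \<in> B"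
    and Fa: "\<And>x y. F (x + y) = F x + F y" and Fs: "\<And>a x. F (scale a x) = scale (a ^ p) (F x)"
    and FB: "\<And>x. x \<in> B \<Longrightarrow> F x \<in> B" and FZ: "\<And>x. x \<in> Z \<Longrightarrow> F x \<in> Z" and p: "2 \<le> p"
  shows "\<exists>e. \<forall>z\<in>Z. (\<exists>n. (F ^^ n) z \<in> B) \<longrightarrow> (F ^^ e) z \<in> B"
proof -
  have B: "subspace B" and Z: "subspace Z" and BZ: "B \<subseteq> Z" using artin_subspace[OF art] by auto
  define K where "K e = {z \<in> Z. (F ^^ e) z \<in> B}" for e
  have Fna: "(F ^^ e) (x + y) = (F ^^ e) x + (F ^^ e) y" for e x y by (induction e) (auto simp: Fa)
  have Fn0: "(F ^^ e) 0 = 0" for e using Fna[of e 0 0] by simp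
  have Fns: "\<exists>b. (F ^^ e) (scale a x) = scale b ((F ^^ e) x)" for e a x
  proof (induction e)
    case 0 show ?case by (intro exI[of _ a]) simp
  next
    case (Suc e)
    then obtain b where "(F ^^ e) (scale a x) = scale b ((F ^^ e) x)" by (elim exE)
    then show ?case by (intro exI[of _ "b ^ p"]) (simp add: Fs)
  qed
  have K: "subspace (K e)" for e
  proof (rule subspaceI)
    show "0 \<in> K e" by (simp add: K_def Fn0 subspace_0 B Z)
    show "x + y \<in> K e" if "x \<in> K e" "y \<in> K e" for x y using that by (simp add: K_def Fna subspace_add B Z)
    show "scale a x \<in> K e" if x: "x \<in> K e" for a x
    proof -
      obtain b where "(F ^^ e) (scale a x) = scale b ((F ^^ e) x)" using Fns by blast
      then show ?thesis using x by (simp add: K_def subspace_scale B Z)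
    qed
  qed
  have KS: "z \<in> K (Suc e) \<longleftrightarrow> z \<in> Z \<and> F z \<in> K e" for z e using FZ by (auto simp: K_def funpow_swap1)
  have Kmono1: "K e \<subseteq> K (Suc e)" for e unfolding K_def using FB by auto
  have Kmono: "i \<le> j \<Longrightarrow> K i \<subseteq> K j" for i j using Kmono1 by (rule lift_Suc_mono_le)
  have BK: "B \<subseteq> K e" for e using Kmono[of 0 e] BZ by (auto simp: K_def)
  define J where "J e = ann (K (Suc e)) (K e)" for e
  have Ji: "is_ideal (J e)" for e unfolding J_def by (rule is_ideal_ann2[OF K])
  have J1: "J e \<subseteq> J (Suc e)" for e
  proof
    fix a assume a: "a \<in> J e"
    show "a \<in> J (Suc e)" unfolding J_def ann_def
    proof (intro CollectI ballI)
      fix z assume z: "z \<in> K (Suc (Suc e))"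
      then have zz: "z \<in> Z" "F z \<in> K (Suc e)" using KS by auto
      then have "scale a (F z) \<in> K e" using a by (auto simp: J_def ann_def)
      then have "scale (a ^ (p - 1)) (scale a (F z)) \<in> K e" by (rule subspace_scale[OF K])
      moreover have "a ^ (p - 1) * a = a ^ p" using p by (cases p) (auto simp: mult.commute)
      ultimately have "F (scale a z) \<in> K e" by (simp add: Fs)
      then show "scale a z \<in> K (Suc e)" using KS subspace_scale[OF Z zz(1)] by blast
    qed
  qed
  obtain E where "\<forall>i\<ge>E. J i = J E" using noeth_acc[OF noeth, of J, OF Ji J1] by (elim exE)
  note E = this[rule_format]
  have "1 \<in> J E"
  proof (rule ccontr)
    assume n1: "1 \<notin> J E"
    \<comment> \<open>F(az) = a^p F(z) is a multiple of a^2 F(z), as p is at least 2. By induction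
      one factor a moves F(z) into K(E+1) and the other one into K(E).\<close>
    have JK: "\<forall>z\<in>K (E + i). \<forall>a\<in>J E. scale a z \<in> K (Suc E) \<and> (\<forall>b\<in>J E. scale b (scale a z) \<in> K E)" for i
    proof (induction i)
      case 0
      then show ?case using subspace_scale[OF K] Kmono1[of E] by auto
    next
      case (Suc i)
      show ?case
      proof (intro ballI conjI)
        fix z a assume z: "z \<in> K (E + Suc i)" and a: "a \<in> J E"
        have zz: "z \<in> Z" "F z \<in> K (E + i)" using z KS[of z "E + i"] by auto
        have "scale a (scale a (F z)) \<in> K E" using Suc zz(2) a by blast
        then have "scale (a ^ (p - 2)) (scale a (scale a (F z))) \<in> K E" by (rule subspace_scale[OF K])
        then have "scale (a ^ (p - 2) * (a * a)) (F z) \<in> K E" by (simp only: scale_scale mult.assoc)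
        moreover have "a ^ (p - 2) * (a * a) = a ^ p"
          using p by (metis le_add_diff_inverse2 power2_eq_square power_add)
        ultimately have "F (scale a z) \<in> K E" by (simp only: Fs)
        then show 1: "scale a z \<in> K (Suc E)" using KS subspace_scale[OF Z zz(1)] by blast
        fix b assume "b \<in> J E"
        then show "scale b (scale a z) \<in> K E" using 1 by (auto simp: J_def ann_def)
      qed
    qed
    define B' where "B' = K (Suc E)"
    have B': "subspace B'" "B \<subseteq> B'" "B' \<subseteq> Z" unfolding B'_def by (rule K, rule BK) (simp add: K_def)
    obtain f where f: "f * 1 \<notin> J E" "prime_ideal (colon (J E) (f * 1))" using colon_prime[OF Ji n1] by blast
    define P where "P = colon (J E) f"
    have Pp: "prime_ideal P" using f by (simp add: P_def)
    define Z' where "Z' = {z \<in> Z. \<forall>a\<in>P. scale a z \<in> B'}"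
    have Z': "subspace Z'"
    proof (rule subspaceI)
      show "0 \<in> Z'" by (simp add: Z'_def subspace_0 B' Z)
      show "x + y \<in> Z'" if "x \<in> Z'" "y \<in> Z'" for x y using that by (simp add: Z'_def subspace_add B' Z scale_right_distrib)
      show "scale r x \<in> Z'" if h: "x \<in> Z'" for r x
      proof -
        have "scale a (scale r x) \<in> B'" if "a \<in> P" for a
          using h that subspace_scale[OF B'(1), of "scale a x" r] by (simp add: Z'_def mult.commute)
        then show ?thesis using h by (simp add: Z'_def subspace_scale Z)
      qed
    qed
    have BZ': "B' \<subseteq> Z'" unfolding Z'_def using B' subspace_scale[OF B'(1)] by auto
    define L where "L i = ssum (scale f ` K (Suc E + i)) B'" for i
    have LK: "L i \<subseteq> K (Suc E + i)" for i unfolding L_def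
      using subspace_scale[OF K] Kmono[of "Suc E" "Suc E + i"] by (intro ssum_least[OF K]) (auto simp: B'_def)
    show False
    proof (rule no_chain[OF cp _ _ Pp, of B' Z' L])
      show "artin B' Z'" by (rule artin_sub[OF artin_quot[OF art B'] Z' BZ']) (auto simp: Z'_def)
      show "\<exists>n. \<forall>a\<in>idpow m n. scale a z \<in> B'" if "z \<in> Z'" for z using tor[of z] that B'(2) by (auto simp: Z'_def)
      show "scale a z \<in> B'" if "a \<in> P" "z \<in> Z'" for a z using that by (simp add: Z'_def)
      show "subspace (L i)" for i unfolding L_def by (rule subspace_ssum[OF subspace_scaleimg[OF K] B'(1)])
      show "B' \<subseteq> L i" for i unfolding L_def by (rule ssum_r[OF subspace_scaleimg[OF K]])
      show "L i \<subseteq> Z'" for i unfolding L_def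
      proof (rule ssum_least[OF Z' _ BZ'], clarify)
        fix z assume z: "z \<in> K (Suc E + i)"
        have "scale a (scale f z) \<in> B'" if "a \<in> P" for a
        proof -
          have "a * f \<in> J E" using that by (simp add: P_def colon_def)
          then have "scale (a * f) z \<in> K (Suc E)" using JK[of "Suc i"] z by simp
          then show ?thesis by (simp add: B'_def)
        qed
        then show "scale f z \<in> Z'" using z subspace_scale[OF Z] by (auto simp: Z'_def K_def)
      qed
      show "L i \<subseteq> L (Suc i)" for i unfolding L_def using Kmono1 by (intro ssum_mono) auto
      show "a \<in> P" if a: "a \<in> ann (L (Suc i)) (L i)" for i a
      proof -
        have "a * f \<in> J (Suc E + i)" unfolding J_def ann_def
        proof (intro CollectI ballI)
          fix z assume "z \<in> K (Suc (Suc E + i))"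
          then have "scale f z \<in> scale f ` K (Suc E + Suc i)" by simp
          then have "scale f z \<in> L (Suc i)" unfolding L_def by (rule subsetD[OF ssum_l[OF B'(1)]])
          then have "scale a (scale f z) \<in> L i" using a by (auto simp: ann_def)
          then show "scale (a * f) z \<in> K (Suc E + i)" using LK by auto
        qed
        then have "a * f \<in> J E" using E[of "Suc E + i"] by simp
        then show ?thesis by (simp add: P_def colon_def)
      qed
    qed
  qed
  then have eq: "K (Suc (E + i)) \<subseteq> K (E + i)" for i
  proof -
    have "1 \<in> J (E + i)" using E[of "E + i"] \<open>1 \<in> J E\<close> by simp
    then show ?thesis by (auto simp: J_def ann_def)
  qed
  have "K (E + i) \<subseteq> K E" for i by (induction i) (use eq in auto)
  then have "K n \<subseteq> K E" for n using Kmono[of n "E + n"] by force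
  then show ?thesis by (intro exI[of _ E]) (auto simp: K_def)
qed

end

section \<open>Local cohomology as a direct limit of Koszul cohomology\<close>

text \<open>An element of \<open>H\<^sup>j\<^sub>m(R/I)\<close> is represented by a sequence \<open>s\<close>: for large \<open>e\<close> the cochain \<open>s e\<close> is a cocycle modulo \<open>I\<close>
  of the Koszul complex on the \<open>e\<close>-th powers of the generators \<open>gs\<close>, and \<open>s (Suc e)\<close> is its image under
  the transition map, which multiplies the component at \<open>S\<close> by the product of the generators indexed by \<open>S\<close>.
  The fraction with numerators \<open>N\<close> and exponent \<open>e\<close> of the Cech complex corresponds to \<open>lift e N\<close>.\<close>

definition vs :: "'a::comm_ring_1 \<Rightarrow> (nat \<Rightarrow> nat set \<Rightarrow> 'a) \<Rightarrow> nat \<Rightarrow> nat set \<Rightarrow> 'a" where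
  "vs a s = (\<lambda>e S. a * s e S)"

definition ksg :: "nat set \<Rightarrow> nat \<Rightarrow> 'a::comm_ring_1" where
  "ksg T j = (-1) ^ card {i\<in>T. i < j}"

definition koszul :: "'a::comm_ring_1 list \<Rightarrow> nat \<Rightarrow> (nat set \<Rightarrow> 'a) \<Rightarrow> nat set \<Rightarrow> 'a" where
  "koszul gs e c T = (\<Sum>j\<in>T. ksg T j * c (T - {j}) * (gs ! j) ^ e)"

definition shift :: "'a::comm_ring_1 list \<Rightarrow> nat \<Rightarrow> (nat set \<Rightarrow> 'a) \<Rightarrow> nat set \<Rightarrow> 'a" where
  "shift gs k c = (\<lambda>S. cprod gs S ^ k * c S)"

definition lift :: "'a::comm_ring_1 list \<Rightarrow> nat \<Rightarrow> (nat set \<Rightarrow> 'a) \<Rightarrow> nat \<Rightarrow> nat set \<Rightarrow> 'a" where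
  "lift gs e c = (\<lambda>e'. shift gs (e' - e) c)"

lemma module_vs: "module (vs :: 'a::comm_ring_1 \<Rightarrow> _)"
  by standard (auto simp: vs_def fun_eq_iff algebra_simps)

lemma csubs_fin: "S \<in> csubs gs k \<Longrightarrow> finite S" unfolding csubs_def by (auto dest: finite_subset)
lemma csubs_del: "T \<in> csubs gs (Suc k) \<Longrightarrow> j \<in> T \<Longrightarrow> T - {j} \<in> csubs gs k"
  unfolding csubs_def using finite_subset[of T "{..<length gs}"] by auto
lemma csubs_0: "csubs gs 0 = {{}}"
proof -
  have "S = {}" if "S \<in> csubs gs 0" for S using that csubs_fin[OF that] by (simp add: csubs_def)
  then show ?thesis by (auto simp: csubs_def)
qed

lemma koszul_cong: "(\<And>S. S \<in> csubs gs k \<Longrightarrow> c S = c' S) \<Longrightarrow> T \<in> csubs gs (Suc k) \<Longrightarrow> koszul gs e c T = koszul gs e c' T"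
  unfolding koszul_def by (rule sum.cong) (auto simp: csubs_del)
lemma koszul_add: "koszul gs e (\<lambda>S. c S + c' S) T = koszul gs e c T + koszul gs e c' T"
  unfolding koszul_def by (simp only: distrib_left distrib_right sum.distrib)
lemma koszul_diff: "koszul gs e (\<lambda>S. c S - c' S) T = koszul gs e c T - koszul gs e c' T"
  unfolding koszul_def by (simp only: left_diff_distrib right_diff_distrib sum_subtractf)
lemma koszul_mult: "koszul gs e (\<lambda>S. a * c S) T = a * koszul gs e c T"
  unfolding koszul_def by (simp add: sum_distrib_left mult.left_commute mult.assoc)
lemma koszul_zero: "koszul gs e (\<lambda>S. 0) T = 0" unfolding koszul_def by simp
lemma koszul_empty: "koszul gs e c {} = 0" unfolding koszul_def by simp
lemma koszul_ideal: "is_ideal I \<Longrightarrow> (\<And>S. S \<in> csubs gs k \<Longrightarrow> c S \<in> I) \<Longrightarrow> T \<in> csubs gs (Suc k) \<Longrightarrow> koszul gs e c T \<in> I"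
  unfolding koszul_def by (intro ideal_sum ideal_mult2 ideal_mult) (auto simp: csubs_del)

lemma cprod_remove: "finite T \<Longrightarrow> j \<in> T \<Longrightarrow> cprod gs T = gs ! j * cprod gs (T - {j})"
  unfolding cprod_def by (simp add: prod.remove)

text \<open>The transition maps commute with the differentials, because \<open>cprod gs T\<close> is
  \<open>gs ! j\<close> times the product over the remaining indices.\<close>

lemma koszul_shift: assumes "finite T" shows "koszul gs (e + k) (shift gs k c) T = cprod gs T ^ k * koszul gs e c T"
  unfolding koszul_def sum_distrib_left
proof (rule sum.cong[OF refl])
  fix j assume "j \<in> T"
  then have "cprod gs T ^ k = (gs ! j) ^ k * cprod gs (T - {j}) ^ k" using cprod_remove[OF assms] by (metis power_mult_distrib)
  then show "ksg T j * shift gs k c (T - {j}) * gs ! j ^ (e + k) = cprod gs T ^ k * (ksg T j * c (T - {j}) * gs ! j ^ e)"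
    by (simp add: shift_def power_add mult_ac)
qed

text \<open>Removing i and then j, or j and then i, leads to the same component with opposite
  signs.\<close>

lemma koszul_koszul: assumes T: "finite T" shows "koszul gs e (koszul gs e c) T = 0"
proof -
  define sg :: "nat set \<Rightarrow> nat \<Rightarrow> 'a" where sgk: "sg = ksg"
  have sg_def: "sg U j = (-1) ^ card {i\<in>U. i < j}" for U j by (simp add: sgk ksg_def)
  define f where "f i j = sg T i * sg (T - {i}) j * c (T - {i} - {j}) * (gs ! i) ^ e * (gs ! j) ^ e" for i j
  have sgl: "sg (T - {i}) j = sg T j" if "j < i" for i j
  proof -
    have "{k \<in> T - {i}. k < j} = {k \<in> T. k < j}" using that by auto
    then show ?thesis by (simp add: sg_def)
  qed
  have sgr: "sg (T - {i}) j = - sg T j" if "i < j" "i \<in> T" for i j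
  proof -
    have "{k \<in> T. k < j} = insert i {k \<in> T - {i}. k < j}" using that by auto
    then have "card {k \<in> T. k < j} = Suc (card {k \<in> T - {i}. k < j})" using T by simp
    then show ?thesis by (simp add: sg_def)
  qed
  have anti: "f j i = - f i j" if "i \<in> T" "j \<in> T" "i < j" for i j
  proof -
    have "T - {i} - {j} = T - {j} - {i}" by auto
    then show ?thesis unfolding f_def sgr[OF that(3,1)] sgl[OF that(3)] by (simp add: mult_ac)
  qed
  have "koszul gs e (koszul gs e c) T = (\<Sum>i\<in>T. \<Sum>j\<in>T - {i}. f i j)"
    unfolding koszul_def f_def sgk sum_distrib_left sum_distrib_right
    by (intro sum.cong refl) (simp add: mult_ac)
  also have "\<dots> = (\<Sum>(i,j)\<in>Sigma T (\<lambda>i. T - {i}). f i j)" using T by (intro sum.Sigma) auto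
  also have "Sigma T (\<lambda>i. T - {i}) = {(i,j) \<in> T \<times> T. i < j} \<union> {(i,j) \<in> T \<times> T. j < i}" by auto
  also have "(\<Sum>(i,j)\<in>\<dots>. f i j) = (\<Sum>(i,j)\<in>{(i,j) \<in> T \<times> T. i < j}. f i j) + (\<Sum>(i,j)\<in>{(i,j) \<in> T \<times> T. j < i}. f i j)"
    using T by (intro sum.union_disjoint) (auto intro: finite_subset[of _ "T \<times> T"])
  also have "(\<Sum>(i,j)\<in>{(i,j) \<in> T \<times> T. j < i}. f i j) = (\<Sum>(i,j)\<in>{(i,j) \<in> T \<times> T. i < j}. f j i)"
    by (rule sum.reindex_bij_witness[of _ "\<lambda>(i,j). (j,i)" "\<lambda>(i,j). (j,i)"]) auto
  also have "(\<Sum>(i,j)\<in>{(i,j) \<in> T \<times> T. i < j}. f j i) = - (\<Sum>(i,j)\<in>{(i,j) \<in> T \<times> T. i < j}. f i j)"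
    unfolding sum_negf[symmetric] by (rule sum.cong) (auto simp: anti)
  finally show ?thesis by simp
qed

definition koszul_htpy :: "nat \<Rightarrow> (nat set \<Rightarrow> 'a::comm_ring_1) \<Rightarrow> nat set \<Rightarrow> 'a" where
  "koszul_htpy i c S = (if i \<in> S then 0 else ksg S i * c (insert i S))"

text \<open>Contraction with the index i is a null homotopy of multiplication by
  \<open>(gs ! i) ^ e\<close>; this is what makes every class of local cohomology m-torsion. If i is
  not in S, only the term of \<open>insert i S\<close> that removes i again survives the
  signs.\<close>

lemma koszul_homotopy:
  assumes S: "finite S"
  shows "koszul gs e (koszul_htpy i c) S + koszul_htpy i (koszul gs e c) S = (gs ! i) ^ e * c S"
proof (cases "i \<in> S")
  case True
  have "koszul gs e (koszul_htpy i c) S = (\<Sum>j\<in>{i}. ksg S j * koszul_htpy i c (S - {j}) * (gs ! j) ^ e)"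
    unfolding koszul_def using True S by (intro sum.mono_neutral_right) (auto simp: koszul_htpy_def)
  also have "\<dots> = (ksg S i * ksg (S - {i}) i) * c (insert i (S - {i})) * (gs ! i) ^ e"
    by (simp add: koszul_htpy_def mult.assoc)
  also have "ksg (S - {i}) i = (ksg S i :: 'a)"
  proof -
    have "{k\<in>S - {i}. k < i} = {k\<in>S. k < i}" by auto
    then show ?thesis by (simp add: ksg_def)
  qed
  also have "ksg S i * ksg S i = (1::'a)" by (simp add: ksg_def flip: power_add)
  also have "insert i (S - {i}) = S" using True by auto
  finally have "koszul gs e (koszul_htpy i c) S = (gs ! i) ^ e * c S" by (simp add: mult.commute)
  moreover have "koszul_htpy i (koszul gs e c) S = 0" using True by (simp add: koszul_htpy_def)
  ultimately show ?thesis by simp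
next
  case False
  define sg :: "nat set \<Rightarrow> nat \<Rightarrow> 'a" where sgk: "sg = ksg"
  have sg_def: "sg U j = (-1) ^ card {i\<in>U. i < j}" for U j by (simp add: sgk ksg_def)
  have sq: "sg U j * sg U j = 1" for U j by (simp add: sg_def flip: power_add)
  have i1: "sg (insert i S) i = sg S i"
  proof -
    have "{k \<in> insert i S. k < i} = {k \<in> S. k < i}" by auto
    then show ?thesis by (simp add: sg_def)
  qed
  have k1: "sg S k * sg (S - {k}) i + sg S i * sg (insert i S) k = 0" if k: "k \<in> S" for k
  proof (cases "k < i")
    case True
    have "{j \<in> S. j < i} = insert k {j \<in> S - {k}. j < i}" using True k by auto
    then have "card {j \<in> S. j < i} = Suc (card {j \<in> S - {k}. j < i})" using S by simp
    moreover have "{j \<in> insert i S. j < k} = {j \<in> S. j < k}" using True by auto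
    ultimately show ?thesis by (simp add: sg_def)
  next
    case F: False
    then have "i < k" using k False by (metis linorder_neqE_nat)
    then have "{j \<in> insert i S. j < k} = insert i {j \<in> S. j < k}" by auto
    then have "card {j \<in> insert i S. j < k} = Suc (card {j \<in> S. j < k})" using S False by simp
    moreover have "{j \<in> S - {k}. j < i} = {j \<in> S. j < i}" using F by auto
    ultimately show ?thesis by (simp add: sg_def)
  qed
  have "koszul_htpy i (koszul gs e c) S = sg S i * (\<Sum>j\<in>insert i S. sg (insert i S) j * c (insert i S - {j}) * (gs ! j) ^ e)"
    using False by (simp add: koszul_htpy_def koszul_def sgk)
  also have "\<dots> = sg S i * (sg S i * c S * (gs ! i) ^ e) + (\<Sum>j\<in>S. sg S i * (sg (insert i S) j * c (insert i S - {j}) * (gs ! j) ^ e))"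
    using S False by (simp add: distrib_left sum_distrib_left i1 insert_Diff_if)
  also have "sg S i * (sg S i * c S * (gs ! i) ^ e) = (gs ! i) ^ e * c S" 
  proof -
    have "sg S i * (sg S i * c S * (gs ! i) ^ e) = (sg S i * sg S i) * ((gs ! i) ^ e * c S)" by (simp add: mult_ac)
    then show ?thesis by (simp only: sq mult_1)
  qed
  finally have 1: "koszul_htpy i (koszul gs e c) S = (gs ! i) ^ e * c S + (\<Sum>j\<in>S. sg S i * (sg (insert i S) j * c (insert i S - {j}) * (gs ! j) ^ e))" .
  have "koszul gs e (koszul_htpy i c) S = (\<Sum>j\<in>S. sg S j * (sg (S - {j}) i * c (insert i (S - {j}))) * (gs ! j) ^ e)"
    unfolding koszul_def using False by (intro sum.cong) (auto simp: koszul_htpy_def sgk)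
  then have "koszul gs e (koszul_htpy i c) S + (\<Sum>j\<in>S. sg S i * (sg (insert i S) j * c (insert i S - {j}) * (gs ! j) ^ e))
     = (\<Sum>j\<in>S. sg S j * (sg (S - {j}) i * c (insert i (S - {j}))) * (gs ! j) ^ e + sg S i * (sg (insert i S) j * c (insert i S - {j}) * (gs ! j) ^ e))"
    by (simp add: sum.distrib)
  also have "\<dots> = 0"
  proof (rule sum.neutral, rule ballI)
    fix j assume j: "j \<in> S"
    have "insert i S - {j} = insert i (S - {j})" using False j by auto
    then have "sg S j * (sg (S - {j}) i * c (insert i (S - {j}))) * (gs ! j) ^ e + sg S i * (sg (insert i S) j * c (insert i S - {j}) * (gs ! j) ^ e)
       = (sg S j * sg (S - {j}) i + sg S i * sg (insert i S) j) * (c (insert i (S - {j})) * (gs ! j) ^ e)"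
      by (simp add: distrib_left distrib_right mult_ac)
    then show "sg S j * (sg (S - {j}) i * c (insert i (S - {j}))) * (gs ! j) ^ e + sg S i * (sg (insert i S) j * c (insert i S - {j}) * (gs ! j) ^ e) = 0"
      by (simp add: k1[OF j])
  qed
  finally show ?thesis using 1 by (simp add: algebra_simps)
qed

locale kos = nloc m for m :: "'a::comm_ring_1 set" + fixes gs :: "'a list"
  assumes gs: "gen_ideal (set gs) = m"
begin

sublocale V: nmod m "vs :: 'a \<Rightarrow> (nat \<Rightarrow> nat set \<Rightarrow> 'a) \<Rightarrow> nat \<Rightarrow> nat set \<Rightarrow> 'a"
  by (simp add: nmod_def nloc_axioms module_vs)

lemma g_m: "i < length gs \<Longrightarrow> gs ! i \<in> m" using gs gen_in[of "gs ! i" "set gs"] by auto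

lemma cprod_m: assumes "S \<in> csubs gs (Suc k)" shows "cprod gs S ^ n \<in> idpow m n"
proof -
  have f: "finite S" by (rule csubs_fin[OF assms])
  obtain j where j: "j \<in> S" using assms by (fastforce simp: csubs_def)
  then have "gs ! j \<in> m" using g_m assms by (auto simp: csubs_def)
  then have "cprod gs S \<in> m" unfolding cprod_remove[OF f j] by (rule ideal_mult2[OF is_ideal_m])
  then show ?thesis by (rule idpow_pow)
qed

definition ZZ :: "nat \<Rightarrow> 'a set \<Rightarrow> (nat \<Rightarrow> nat set \<Rightarrow> 'a) set" where
  "ZZ j I = {s. \<exists>e0. \<forall>e\<ge>e0. (\<forall>S\<in>csubs gs j. s (Suc e) S - cprod gs S * s e S \<in> I) \<and> (\<forall>T\<in>csubs gs (Suc j). koszul gs e (s e) T \<in> I)}"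

text \<open>The primitive w may vary with e; by \<open>BB_at\<close> one exponent suffices, since
  \<open>shift\<close> carries a primitive along. Finitely many exponents are disregarded
  throughout, because a division by u below yields a cocycle only after a delay.\<close>

definition BB :: "nat \<Rightarrow> 'a set \<Rightarrow> (nat \<Rightarrow> nat set \<Rightarrow> 'a) set" where
  "BB j I = {s \<in> ZZ j I. \<exists>e0. \<forall>e\<ge>e0. \<exists>w. \<forall>S\<in>csubs gs j. s e S - koszul gs e w S \<in> I}"

lemma ZZ_get:
  assumes I: "is_ideal I" and s: "s \<in> ZZ j I"
  obtains e0 where "e1 \<le> e0" "\<And>k S. S \<in> csubs gs j \<Longrightarrow> s (e0 + k) S - cprod gs S ^ k * s e0 S \<in> I"
    "\<And>e T. e0 \<le> e \<Longrightarrow> T \<in> csubs gs (Suc j) \<Longrightarrow> koszul gs e (s e) T \<in> I"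
proof -
  obtain e2 where e2: "\<forall>e\<ge>e2. (\<forall>S\<in>csubs gs j. s (Suc e) S - cprod gs S * s e S \<in> I) \<and> (\<forall>T\<in>csubs gs (Suc j). koszul gs e (s e) T \<in> I)"
    using s unfolding ZZ_def by blast
  define e0 where "e0 = max e1 e2"
  have "s (e0 + k) S - cprod gs S ^ k * s e0 S \<in> I" if S: "S \<in> csubs gs j" for k S
  proof (induction k)
    case 0 show ?case by (simp add: ideal_0[OF I])
  next
    case (Suc k)
    have 1: "s (Suc (e0 + k)) S - cprod gs S * s (e0 + k) S \<in> I" using e2 S by (simp add: e0_def)
    have "s (e0 + Suc k) S - cprod gs S ^ Suc k * s e0 S
      = (s (Suc (e0 + k)) S - cprod gs S * s (e0 + k) S) + cprod gs S * (s (e0 + k) S - cprod gs S ^ k * s e0 S)"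
      by (simp add: right_diff_distrib mult.assoc)
    then show ?case by (simp only: ideal_add[OF I 1 ideal_mult[OF I Suc]])
  qed
  then show thesis using that[of e0] e2 by (simp add: e0_def)
qed

lemma lift_at: "e0 \<le> e \<Longrightarrow> lift gs e0 c e = shift gs (e - e0) c" by (simp add: lift_def)
lemma lift_plus: "lift gs e0 c (e0 + k) S = cprod gs S ^ k * c S" by (simp add: lift_def shift_def)

lemma lift_ZZ:
  assumes I: "is_ideal I" and c: "\<And>T. T \<in> csubs gs (Suc j) \<Longrightarrow> koszul gs e0 c T \<in> I"
  shows "lift gs e0 c \<in> ZZ j I"
  unfolding ZZ_def
proof (intro CollectI exI[of _ e0] allI impI conjI ballI)
  fix e assume e: "e0 \<le> e"
  then obtain k where k: "e = e0 + k" using le_Suc_ex by blast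
  show "lift gs e0 c (Suc e) S - cprod gs S * lift gs e0 c e S \<in> I" for S
    using lift_plus[of e0 c "Suc k" S] lift_plus[of e0 c k S] by (simp add: k ideal_0[OF I] mult.assoc)
  show "koszul gs e (lift gs e0 c e) T \<in> I" if T: "T \<in> csubs gs (Suc j)" for T
    unfolding lift_at[OF e] using koszul_shift[OF csubs_fin[OF T], of gs e0 k c] ideal_mult[OF I c[OF T]] by (simp add: k)
qed

lemma BB_at:
  assumes I: "is_ideal I" and s: "s \<in> ZZ j I" and c: "\<And>k S. S \<in> csubs gs j \<Longrightarrow> s (e0 + k) S - cprod gs S ^ k * s e0 S \<in> I"
    and w: "\<And>S. S \<in> csubs gs j \<Longrightarrow> s e0 S - koszul gs e0 w S \<in> I"
  shows "s \<in> BB j I"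
  unfolding BB_def
proof (intro CollectI conjI s exI[of _ e0] allI impI)
  fix e assume e: "e0 \<le> e"
  then obtain k where k: "e = e0 + k" using le_Suc_ex by blast
  have "s e S - koszul gs e (shift gs k w) S \<in> I" if S: "S \<in> csubs gs j" for S
  proof -
    have "s e S - koszul gs e (shift gs k w) S = (s e S - cprod gs S ^ k * s e0 S) + cprod gs S ^ k * (s e0 S - koszul gs e0 w S)"
      unfolding k koszul_shift[OF csubs_fin[OF S]] by (simp add: right_diff_distrib)
    then show ?thesis using ideal_add[OF I c[OF S, of k] ideal_mult[OF I w[OF S], of "cprod gs S ^ k"]] unfolding k by (simp only:)
  qed
  then show "\<exists>w. \<forall>S\<in>csubs gs j. s e S - koszul gs e w S \<in> I" by blast
qed

lemma BB_get: assumes "s \<in> BB j I" obtains e0 where "\<And>e. e0 \<le> e \<Longrightarrow> \<exists>w. \<forall>S\<in>csubs gs j. s e S - koszul gs e w S \<in> I"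
  using assms unfolding BB_def by blast

lemma BB_ZZ: "BB j I \<subseteq> ZZ j I" unfolding BB_def by blast

lemma subspace_ZZ: assumes I: "is_ideal I" shows "V.subspace (ZZ j I)"
proof (rule V.subspaceI)
  show "0 \<in> ZZ j I" by (simp add: ZZ_def koszul_def ideal_0[OF I])
  fix s t assume st: "s \<in> ZZ j I" "t \<in> ZZ j I"
  obtain e1 e2 where e1: "\<forall>e\<ge>e1. (\<forall>S\<in>csubs gs j. s (Suc e) S - cprod gs S * s e S \<in> I) \<and> (\<forall>T\<in>csubs gs (Suc j). koszul gs e (s e) T \<in> I)"
    and e2: "\<forall>e\<ge>e2. (\<forall>S\<in>csubs gs j. t (Suc e) S - cprod gs S * t e S \<in> I) \<and> (\<forall>T\<in>csubs gs (Suc j). koszul gs e (t e) T \<in> I)"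
    using st unfolding ZZ_def by blast
  show "s + t \<in> ZZ j I" unfolding ZZ_def
  proof (intro CollectI exI[of _ "max e1 e2"] allI impI conjI ballI)
    fix e assume "max e1 e2 \<le> e"
    then have e: "e1 \<le> e" "e2 \<le> e" by auto
    show "(s + t) (Suc e) S - cprod gs S * (s + t) e S \<in> I" if S: "S \<in> csubs gs j" for S
    proof -
      have "(s (Suc e) S - cprod gs S * s e S) + (t (Suc e) S - cprod gs S * t e S) \<in> I" using e1 e2 e S ideal_add[OF I] by blast
      moreover have "(s + t) (Suc e) S - cprod gs S * (s + t) e S = (s (Suc e) S - cprod gs S * s e S) + (t (Suc e) S - cprod gs S * t e S)"
        by (simp add: distrib_left)
      ultimately show ?thesis by (simp only:)
    qed
    show "koszul gs e ((s + t) e) T \<in> I" if T: "T \<in> csubs gs (Suc j)" for T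
    proof -
      have "koszul gs e (s e) T + koszul gs e (t e) T \<in> I" using e1 e2 e T ideal_add[OF I] by blast
      moreover have "(s + t) e = (\<lambda>S. s e S + t e S)" by (simp add: fun_eq_iff)
      ultimately show ?thesis by (simp only: koszul_add)
    qed
  qed
next
  fix a s assume "s \<in> ZZ j I"
  then obtain e1 where e1: "\<forall>e\<ge>e1. (\<forall>S\<in>csubs gs j. s (Suc e) S - cprod gs S * s e S \<in> I) \<and> (\<forall>T\<in>csubs gs (Suc j). koszul gs e (s e) T \<in> I)"
    unfolding ZZ_def by blast
  show "vs a s \<in> ZZ j I" unfolding ZZ_def
  proof (intro CollectI exI[of _ e1] allI impI conjI ballI)
    fix e assume e: "e1 \<le> e"
    show "vs a s (Suc e) S - cprod gs S * vs a s e S \<in> I" if S: "S \<in> csubs gs j" for S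
    proof -
      have "a * (s (Suc e) S - cprod gs S * s e S) \<in> I" using e1 e S ideal_mult[OF I] by blast
      then show ?thesis by (simp add: vs_def right_diff_distrib mult.left_commute[of _ a])
    qed
    show "koszul gs e (vs a s e) T \<in> I" if T: "T \<in> csubs gs (Suc j)" for T
      using e1 e T ideal_mult[OF I] by (simp add: vs_def koszul_mult)
  qed
qed

lemma subspace_BB: assumes I: "is_ideal I" shows "V.subspace (BB j I)"
proof (rule V.subspaceI)
  show "0 \<in> BB j I" unfolding BB_def using V.subspace_0[OF subspace_ZZ[OF I]]
    by (auto intro!: exI[of _ 0] exI[of _ "\<lambda>S. 0"] simp: koszul_zero ideal_0[OF I])
  fix s t assume st: "s \<in> BB j I" "t \<in> BB j I"
  obtain e1 where e1: "\<And>e. e1 \<le> e \<Longrightarrow> \<exists>w. \<forall>S\<in>csubs gs j. s e S - koszul gs e w S \<in> I" using BB_get[OF st(1)] by blast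
  obtain e2 where e2: "\<And>e. e2 \<le> e \<Longrightarrow> \<exists>w. \<forall>S\<in>csubs gs j. t e S - koszul gs e w S \<in> I" using BB_get[OF st(2)] by blast
  have "\<exists>w. \<forall>S\<in>csubs gs j. (s + t) e S - koszul gs e w S \<in> I" if e: "max e1 e2 \<le> e" for e
  proof -
    obtain w w' where w: "\<forall>S\<in>csubs gs j. s e S - koszul gs e w S \<in> I" "\<forall>S\<in>csubs gs j. t e S - koszul gs e w' S \<in> I"
      using e1[of e] e2[of e] e by auto
    have "(s + t) e S - koszul gs e (\<lambda>S. w S + w' S) S \<in> I" if S: "S \<in> csubs gs j" for S
    proof -
      have "(s e S - koszul gs e w S) + (t e S - koszul gs e w' S) \<in> I" using w S ideal_add[OF I] by blast
      moreover have "(s + t) e S - (koszul gs e w S + koszul gs e w' S) = (s e S - koszul gs e w S) + (t e S - koszul gs e w' S)" by simp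
      ultimately show ?thesis by (simp only: koszul_add)
    qed
    then show ?thesis by blast
  qed
  moreover have "s + t \<in> ZZ j I" using st BB_ZZ V.subspace_add[OF subspace_ZZ[OF I]] by blast
  ultimately show "s + t \<in> BB j I" unfolding BB_def by blast
next
  fix a s assume s: "s \<in> BB j I"
  obtain e1 where e1: "\<And>e. e1 \<le> e \<Longrightarrow> \<exists>w. \<forall>S\<in>csubs gs j. s e S - koszul gs e w S \<in> I" using BB_get[OF s] by blast
  have "\<exists>w. \<forall>S\<in>csubs gs j. vs a s e S - koszul gs e w S \<in> I" if e: "e1 \<le> e" for e
  proof -
    obtain w where w: "\<forall>S\<in>csubs gs j. s e S - koszul gs e w S \<in> I" using e1[OF e] by blast
    have "vs a s e S - koszul gs e (\<lambda>S. a * w S) S \<in> I" if S: "S \<in> csubs gs j" for S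
    proof -
      have "a * (s e S - koszul gs e w S) \<in> I" using w S ideal_mult[OF I] by blast
      then show ?thesis by (simp add: koszul_mult vs_def right_diff_distrib)
    qed
    then show ?thesis by blast
  qed
  moreover have "vs a s \<in> ZZ j I" using s BB_ZZ V.subspace_scale[OF subspace_ZZ[OF I]] by blast
  ultimately show "vs a s \<in> BB j I" unfolding BB_def by blast
qed

lemma ZZ_mono: "I \<subseteq> J \<Longrightarrow> ZZ j I \<subseteq> ZZ j J" unfolding ZZ_def by blast
lemma BB_mono: assumes "I \<subseteq> J" shows "BB j I \<subseteq> BB j J"
proof
  fix s assume s: "s \<in> BB j I"
  obtain e0 where e0: "\<And>e. e0 \<le> e \<Longrightarrow> \<exists>w. \<forall>S\<in>csubs gs j. s e S - koszul gs e w S \<in> I" using BB_get[OF s] by metis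
  have "\<exists>w. \<forall>S\<in>csubs gs j. s e S - koszul gs e w S \<in> J" if "e0 \<le> e" for e using e0[OF that] assms by blast
  moreover have "s \<in> ZZ j J" using s BB_ZZ ZZ_mono[OF assms] by blast
  ultimately show "s \<in> BB j J" unfolding BB_def by blast
qed

lemma BB_ideal:
  assumes s: "s \<in> ZZ j I" and h: "\<And>e S. e0 \<le> e \<Longrightarrow> S \<in> csubs gs j \<Longrightarrow> s e S \<in> I"
  shows "s \<in> BB j I"
proof -
  have "\<exists>w. \<forall>S\<in>csubs gs j. s e S - koszul gs e w S \<in> I" if "e0 \<le> e" for e
    using h[OF that] by (intro exI[where x = "\<lambda>S. 0"]) (simp add: koszul_zero)
  then show ?thesis using s unfolding BB_def by blast
qed

lemma ideal_mult_BB: assumes I: "is_ideal I" and s: "s \<in> ZZ j I" and a: "a \<in> I" shows "vs a s \<in> BB j I"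
  by (rule BB_ideal[OF V.subspace_scale[OF subspace_ZZ[OF I] s]]) (simp add: vs_def ideal_mult2[OF I a])

text \<open>If s is a cocycle from e0 on, the Koszul homotopy makes \<open>g ^ e0\<close> times s a
  coboundary, for each generator g.\<close>

lemma torsion: assumes I: "is_ideal I" and s: "s \<in> ZZ j I" shows "\<exists>N. \<forall>a\<in>idpow m N. vs a s \<in> BB j I"
proof -
  obtain e0 where e0: "\<And>k S. S \<in> csubs gs j \<Longrightarrow> s (e0 + k) S - cprod gs S ^ k * s e0 S \<in> I"
    "\<And>e T. e0 \<le> e \<Longrightarrow> T \<in> csubs gs (Suc j) \<Longrightarrow> koszul gs e (s e) T \<in> I" using ZZ_get[OF I s, of 0] by metis
  have "\<exists>e. g ^ e \<in> {a. vs a s \<in> BB j I}" if "g \<in> set gs" for g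
  proof -
    obtain i where i: "i < length gs" "g = gs ! i" using \<open>g \<in> set gs\<close> by (metis in_set_conv_nth)
    have "vs (g ^ e0) s \<in> BB j I"
    proof (rule BB_at[OF I V.subspace_scale[OF subspace_ZZ[OF I] s], where ?e0.0 = e0 and w = "koszul_htpy i (s e0)"])
      fix k S assume S: "S \<in> csubs gs j"
      have "g ^ e0 * (s (e0 + k) S - cprod gs S ^ k * s e0 S) \<in> I" by (rule ideal_mult[OF I e0(1)[OF S]])
      then show "vs (g ^ e0) s (e0 + k) S - cprod gs S ^ k * vs (g ^ e0) s e0 S \<in> I" by (simp add: vs_def right_diff_distrib mult.left_commute[of _ "g ^ e0"])
    next
      fix S assume S: "S \<in> csubs gs j"
      have "koszul_htpy i (koszul gs e0 (s e0)) S \<in> I"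
      proof (cases "i \<in> S")
        case True then show ?thesis by (simp add: koszul_htpy_def ideal_0[OF I])
      next
        case False
        then have "insert i S \<in> csubs gs (Suc j)" using S i finite_subset[of S "{..<length gs}"] by (auto simp: csubs_def)
        then show ?thesis using False e0(2)[of e0] by (simp add: koszul_htpy_def ideal_mult[OF I])
      qed
      moreover have "vs (g ^ e0) s e0 S - koszul gs e0 (koszul_htpy i (s e0)) S = koszul_htpy i (koszul gs e0 (s e0)) S"
        using koszul_homotopy[OF csubs_fin[OF S], of gs e0 i "s e0"] by (simp add: vs_def i(2) algebra_simps)
      ultimately show "vs (g ^ e0) s e0 S - koszul gs e0 (koszul_htpy i (s e0)) S \<in> I" by simp
    qed
    then show ?thesis by blast
  qed
  then obtain N where "idpow (gen_ideal (set gs)) N \<subseteq> {a. vs a s \<in> BB j I}"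
    using idpow_gen_sub[OF _ V.is_ideal_ann[OF subspace_BB[OF I]], of "set gs" s j] by blast
  then show ?thesis unfolding gs by blast
qed

end

subsection \<open>The long exact sequence of an element\<close>

context kos
begin

text \<open>The connecting homomorphism of \<open>0 \<rightarrow> R/(I:u) \<rightarrow> R/I \<rightarrow> R/(I,u) \<rightarrow> 0\<close>, as a relation.\<close>
definition conn :: "nat \<Rightarrow> 'a set \<Rightarrow> 'a \<Rightarrow> (nat \<Rightarrow> nat set \<Rightarrow> 'a) \<Rightarrow> (nat \<Rightarrow> nat set \<Rightarrow> 'a) \<Rightarrow> bool" where
  "conn j I u y z \<longleftrightarrow> (\<exists>e0. \<forall>e\<ge>e0. \<exists>c. \<forall>T\<in>csubs gs (Suc j). koszul gs e (y e) T - u * z e T - u * koszul gs e c T \<in> I)"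

lemma conn_get: assumes "conn j I u y z"
  obtains e0 where "\<And>e. e0 \<le> e \<Longrightarrow> \<exists>c. \<forall>T\<in>csubs gs (Suc j). koszul gs e (y e) T - u * z e T - u * koszul gs e c T \<in> I"
  using assms unfolding conn_def by blast

lemma linrel_conn: assumes I: "is_ideal I" shows "linrel vs vs (conn j I u)"
proof (rule linrelI)
  show "conn j I u 0 0" unfolding conn_def
    by (intro exI[where x = 0] allI impI exI[where x = "\<lambda>S. 0"] ballI) (simp add: koszul_def ideal_0[OF I])
  fix y z y' z' assume "conn j I u y z" "conn j I u y' z'"
  obtain e1 where e1: "\<And>e. e1 \<le> e \<Longrightarrow> \<exists>c. \<forall>T\<in>csubs gs (Suc j). koszul gs e (y e) T - u * z e T - u * koszul gs e c T \<in> I"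
    using conn_get[OF \<open>conn j I u y z\<close>] by metis
  obtain e2 where e2: "\<And>e. e2 \<le> e \<Longrightarrow> \<exists>c. \<forall>T\<in>csubs gs (Suc j). koszul gs e (y' e) T - u * z' e T - u * koszul gs e c T \<in> I"
    using conn_get[OF \<open>conn j I u y' z'\<close>] by metis
  have "\<exists>c. \<forall>T\<in>csubs gs (Suc j). koszul gs e ((y + y') e) T - u * (z + z') e T - u * koszul gs e c T \<in> I" if e: "max e1 e2 \<le> e" for e
  proof -
    obtain c c' where c: "\<forall>T\<in>csubs gs (Suc j). koszul gs e (y e) T - u * z e T - u * koszul gs e c T \<in> I"
      "\<forall>T\<in>csubs gs (Suc j). koszul gs e (y' e) T - u * z' e T - u * koszul gs e c' T \<in> I" using e1[of e] e2[of e] e by auto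
    have "koszul gs e ((y + y') e) T - u * (z + z') e T - u * koszul gs e (\<lambda>S. c S + c' S) T \<in> I" if T: "T \<in> csubs gs (Suc j)" for T
    proof -
      have "(y + y') e = (\<lambda>S. y e S + y' e S)" by (simp add: fun_eq_iff)
      then have "koszul gs e ((y + y') e) T - u * (z + z') e T - u * koszul gs e (\<lambda>S. c S + c' S) T
        = (koszul gs e (y e) T - u * z e T - u * koszul gs e c T) + (koszul gs e (y' e) T - u * z' e T - u * koszul gs e c' T)"
        by (simp add: koszul_add distrib_left)
      then show ?thesis using ideal_add[OF I] c T by (simp only:)
    qed
    then show ?thesis by blast
  qed
  then show "conn j I u (y + y') (z + z')" unfolding conn_def by blast
next
  fix a y z assume "conn j I u y z"
  obtain e1 where e1: "\<And>e. e1 \<le> e \<Longrightarrow> \<exists>c. \<forall>T\<in>csubs gs (Suc j). koszul gs e (y e) T - u * z e T - u * koszul gs e c T \<in> I"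
    using conn_get[OF \<open>conn j I u y z\<close>] by metis
  have "\<exists>c. \<forall>T\<in>csubs gs (Suc j). koszul gs e (vs a y e) T - u * vs a z e T - u * koszul gs e c T \<in> I" if e: "e1 \<le> e" for e
  proof -
    obtain c where c: "\<forall>T\<in>csubs gs (Suc j). koszul gs e (y e) T - u * z e T - u * koszul gs e c T \<in> I" using e1[OF e] by blast
    have "koszul gs e (vs a y e) T - u * vs a z e T - u * koszul gs e (\<lambda>S. a * c S) T \<in> I" if T: "T \<in> csubs gs (Suc j)" for T
    proof -
      have "a * (koszul gs e (y e) T - u * z e T - u * koszul gs e c T) \<in> I" using c T ideal_mult[OF I] by blast
      then show ?thesis by (simp add: vs_def koszul_mult right_diff_distrib mult.left_commute[of _ a])
    qed
    then show ?thesis by blast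
  qed
  then show "conn j I u (vs a y) (vs a z)" unfolding conn_def by blast
qed

text \<open>A component at a nonempty S may be multiplied by powers of \<open>cprod gs S\<close>,
  which lies in m. This allows cancelling u modulo I although its kernel is only m-torsion; N is the
  delay that results.\<close>

lemma colon_uniform: assumes I: "is_ideal I" and u: "colon I u \<subseteq> sat m I"
  obtains N where "\<And>S r. S \<in> csubs gs (Suc k) \<Longrightarrow> u * r \<in> I \<Longrightarrow> cprod gs S ^ N * r \<in> I"
proof -
  obtain N where N: "\<And>a r. a \<in> idpow m N \<Longrightarrow> r \<in> sat m I \<Longrightarrow> a * r \<in> I" using sat_uniform[OF I] by blast
  have "cprod gs S ^ N * r \<in> I" if "S \<in> csubs gs (Suc k)" "u * r \<in> I" for S r
  proof -
    have "r \<in> colon I u" using that(2) by (simp add: colon_def mult.commute)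
    then show ?thesis using N[OF cprod_m[OF that(1)]] u by blast
  qed
  then show thesis using that by blast
qed

text \<open>Write dy = uw modulo I. Then u dw lies in I, so dw is m-torsion modulo I, and a shift by
  N turns w into a cocycle.\<close>

lemma conn_total:
  assumes I: "is_ideal I" and u: "colon I u \<subseteq> sat m I" and y: "y \<in> ZZ j (iadd I u)"
  shows "\<exists>z\<in>ZZ (Suc j) I. conn j I u y z"
proof -
  have Iu: "is_ideal (iadd I u)" by (rule is_ideal_iadd[OF I])
  obtain e0 where e0: "\<And>k S. S \<in> csubs gs j \<Longrightarrow> y (e0 + k) S - cprod gs S ^ k * y e0 S \<in> iadd I u"
    "\<And>e T. e0 \<le> e \<Longrightarrow> T \<in> csubs gs (Suc j) \<Longrightarrow> koszul gs e (y e) T \<in> iadd I u" using ZZ_get[OF Iu y, of 0] by metis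
  have "\<forall>T. \<exists>r. T \<in> csubs gs (Suc j) \<longrightarrow> koszul gs e0 (y e0) T - r * u \<in> I" using e0(2)[of e0] by (auto simp: iadd_def)
  from choice[OF this] obtain w where w: "\<And>T. T \<in> csubs gs (Suc j) \<Longrightarrow> koszul gs e0 (y e0) T - w T * u \<in> I" by blast
  obtain N where N: "\<And>S r. S \<in> csubs gs (Suc (Suc j)) \<Longrightarrow> u * r \<in> I \<Longrightarrow> cprod gs S ^ N * r \<in> I"
    using colon_uniform[OF I u, of "Suc j"] by blast
  define z where "z = lift gs (e0 + N) (shift gs N w)"
  have zZ: "z \<in> ZZ (Suc j) I" unfolding z_def
  proof (rule lift_ZZ[OF I])
    fix T assume T: "T \<in> csubs gs (Suc (Suc j))"
    have "koszul gs e0 (\<lambda>S. koszul gs e0 (y e0) S - u * w S) T \<in> I"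
      by (rule koszul_ideal[OF I _ T]) (use w in \<open>simp add: mult.commute\<close>)
    then have "- (u * koszul gs e0 w T) \<in> I"
      by (simp add: koszul_diff koszul_mult koszul_koszul[OF csubs_fin[OF T]])
    then have "u * koszul gs e0 w T \<in> I" using ideal_neg[OF I] by fastforce
    from N[OF T this] show "koszul gs (e0 + N) (shift gs N w) T \<in> I" by (simp add: koszul_shift[OF csubs_fin[OF T]])
  qed
  have "\<exists>c. \<forall>T\<in>csubs gs (Suc j). koszul gs e (y e) T - u * z e T - u * koszul gs e c T \<in> I" if e: "e0 + N \<le> e" for e
  proof -
    obtain k where k: "e = e0 + N + k" using le_Suc_ex[OF e] by blast
    \<comment> \<open>The cochain y follows the transition maps only modulo I and u. The multiples
      of u that occur form c, and the term \<open>u * koszul gs e c T\<close> in \<open>conn\<close>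
      absorbs them.\<close>
    have "\<forall>S. \<exists>r. S \<in> csubs gs j \<longrightarrow> (y e S - cprod gs S ^ (N + k) * y e0 S) - r * u \<in> I"
      using e0(1)[of _ "N + k"] by (auto simp: iadd_def k add.assoc)
    from choice[OF this] obtain c where c: "\<And>S. S \<in> csubs gs j \<Longrightarrow> (y e S - cprod gs S ^ (N + k) * y e0 S) - c S * u \<in> I" by blast
    have "koszul gs e (y e) T - u * z e T - u * koszul gs e c T \<in> I" if T: "T \<in> csubs gs (Suc j)" for T
    proof -
      have zT: "z e T = cprod gs T ^ (N + k) * w T" unfolding z_def k lift_plus by (simp add: shift_def power_add mult_ac)
      have "koszul gs e (\<lambda>S. (y e S - shift gs (N + k) (y e0) S) - u * c S) T \<in> I"
        by (rule koszul_ideal[OF I _ T]) (use c in \<open>simp add: mult.commute shift_def\<close>)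
      then have 1: "koszul gs e (y e) T - cprod gs T ^ (N + k) * koszul gs e0 (y e0) T - u * koszul gs e c T \<in> I"
        using koszul_shift[OF csubs_fin[OF T], of gs e0 "N + k" "y e0"] by (simp add: koszul_diff koszul_mult k add.assoc)
      have 2: "cprod gs T ^ (N + k) * (koszul gs e0 (y e0) T - w T * u) \<in> I" by (rule ideal_mult[OF I w[OF T]])
      have "koszul gs e (y e) T - u * z e T - u * koszul gs e c T =
        (koszul gs e (y e) T - cprod gs T ^ (N + k) * koszul gs e0 (y e0) T - u * koszul gs e c T)
         + cprod gs T ^ (N + k) * (koszul gs e0 (y e0) T - w T * u)"
        unfolding zT by (simp add: right_diff_distrib mult_ac)
      then show ?thesis using ideal_add[OF I 1 2] by (simp only:)
    qed
    then show ?thesis by blast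
  qed
  then have "conn j I u y z" unfolding conn_def by blast
  then show ?thesis using zZ by blast
qed

text \<open>Well-definedness: if y = dw + uc' modulo I, the relation puts u(z - d(c' - c)) in I, and
  a shift by N cancels u.\<close>

lemma conn_BB:
  assumes I: "is_ideal I" and u: "colon I u \<subseteq> sat m I" and y: "y \<in> BB j (iadd I u)" and z: "z \<in> ZZ (Suc j) I" and D: "conn j I u y z"
  shows "z \<in> BB (Suc j) I"
proof -
  obtain e1 where e1: "\<And>e. e1 \<le> e \<Longrightarrow> \<exists>w. \<forall>S\<in>csubs gs j. y e S - koszul gs e w S \<in> iadd I u" using BB_get[OF y] by metis
  obtain e2 where e2: "\<And>e. e2 \<le> e \<Longrightarrow> \<exists>c. \<forall>T\<in>csubs gs (Suc j). koszul gs e (y e) T - u * z e T - u * koszul gs e c T \<in> I" using conn_get[OF D] by metis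
  obtain e0 where e0: "max e1 e2 \<le> e0" "\<And>k S. S \<in> csubs gs (Suc j) \<Longrightarrow> z (e0 + k) S - cprod gs S ^ k * z e0 S \<in> I"
    using ZZ_get[OF I z, of "max e1 e2"] by metis
  obtain w where w: "\<forall>S\<in>csubs gs j. y e0 S - koszul gs e0 w S \<in> iadd I u" using e1[of e0] e0(1) by auto
  obtain c where c: "\<forall>T\<in>csubs gs (Suc j). koszul gs e0 (y e0) T - u * z e0 T - u * koszul gs e0 c T \<in> I" using e2[of e0] e0(1) by auto
  have "\<forall>S. \<exists>r. S \<in> csubs gs j \<longrightarrow> y e0 S - koszul gs e0 w S - r * u \<in> I" using w by (auto simp: iadd_def)
  from choice[OF this] obtain c' where c': "\<And>S. S \<in> csubs gs j \<Longrightarrow> y e0 S - koszul gs e0 w S - c' S * u \<in> I" by blast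
  obtain N where N: "\<And>S r. S \<in> csubs gs (Suc j) \<Longrightarrow> u * r \<in> I \<Longrightarrow> cprod gs S ^ N * r \<in> I" using colon_uniform[OF I u, of j] by blast
  define d where "d S = c' S - c S" for S
  show ?thesis
  proof (rule BB_at[OF I z, where ?e0.0 = "e0 + N" and w = "shift gs N d"])
    fix k S assume S: "S \<in> csubs gs (Suc j)"
    have "z (e0 + N + k) S - cprod gs S ^ k * z (e0 + N) S = (z (e0 + (N + k)) S - cprod gs S ^ (N + k) * z e0 S) - cprod gs S ^ k * (z (e0 + N) S - cprod gs S ^ N * z e0 S)"
      by (simp add: right_diff_distrib power_add add.assoc mult_ac)
    then show "z (e0 + N + k) S - cprod gs S ^ k * z (e0 + N) S \<in> I"
      using ideal_diff[OF I e0(2)[OF S, of "N + k"] ideal_mult[OF I e0(2)[OF S, of N]]] by (simp only:)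
  next
    fix S assume S: "S \<in> csubs gs (Suc j)"
    have "koszul gs e0 (\<lambda>S. y e0 S - koszul gs e0 w S - u * c' S) S \<in> I"
      by (rule koszul_ideal[OF I _ S]) (use c' in \<open>simp add: mult.commute\<close>)
    then have 1: "koszul gs e0 (y e0) S - u * koszul gs e0 c' S \<in> I" by (simp add: koszul_diff koszul_mult koszul_koszul[OF csubs_fin[OF S]])
    have "u * (z e0 S - koszul gs e0 d S) = (koszul gs e0 (y e0) S - u * koszul gs e0 c' S) - (koszul gs e0 (y e0) S - u * z e0 S - u * koszul gs e0 c S)"
      unfolding d_def koszul_diff by (simp add: right_diff_distrib)
    then have "u * (z e0 S - koszul gs e0 d S) \<in> I" using ideal_diff[OF I 1] c S by (simp only:)
    then have 2: "cprod gs S ^ N * (z e0 S - koszul gs e0 d S) \<in> I" by (rule N[OF S])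
    have "z (e0 + N) S - koszul gs (e0 + N) (shift gs N d) S = (z (e0 + N) S - cprod gs S ^ N * z e0 S) + cprod gs S ^ N * (z e0 S - koszul gs e0 d S)"
      unfolding koszul_shift[OF csubs_fin[OF S]] by (simp add: right_diff_distrib)
    then show "z (e0 + N) S - koszul gs (e0 + N) (shift gs N d) S \<in> I" using ideal_add[OF I e0(2)[OF S] 2] by (simp only:)
  qed
qed

text \<open>A primitive w of uz modulo I is a cocycle modulo I and u, and its class is the preimage
  of z: the kernel of u is the image of the connecting homomorphism.\<close>

lemma conn_surj:
  assumes I: "is_ideal I" and z: "z \<in> ZZ (Suc j) I" and uz: "vs u z \<in> BB (Suc j) I"
  shows "\<exists>y\<in>ZZ j (iadd I u). conn j I u y z"
proof -
  obtain e1 where e1: "\<And>e. e1 \<le> e \<Longrightarrow> \<exists>w. \<forall>S\<in>csubs gs (Suc j). vs u z e S - koszul gs e w S \<in> I" using BB_get[OF uz] by metis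
  obtain e0 where e0: "e1 \<le> e0" "\<And>k S. S \<in> csubs gs (Suc j) \<Longrightarrow> z (e0 + k) S - cprod gs S ^ k * z e0 S \<in> I"
    using ZZ_get[OF I z, of e1] by metis
  obtain w where w: "\<forall>S\<in>csubs gs (Suc j). u * z e0 S - koszul gs e0 w S \<in> I" using e1[OF e0(1)] by (auto simp: vs_def)
  have "lift gs e0 w \<in> ZZ j (iadd I u)"
  proof (rule lift_ZZ[OF is_ideal_iadd[OF I]])
    fix T assume T: "T \<in> csubs gs (Suc j)"
    have "- (u * z e0 T - koszul gs e0 w T) \<in> I" using ideal_neg[OF I] w T by blast
    then show "koszul gs e0 w T \<in> iadd I u" by (intro iaddI[of _ "z e0 T"]) (simp add: mult.commute)
  qed
  moreover have "conn j I u (lift gs e0 w) z" unfolding conn_def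
  proof (intro exI[where x = e0] allI impI exI[where x = "\<lambda>S. 0"] ballI)
    fix e T assume e: "e0 \<le> e" and T: "T \<in> csubs gs (Suc j)"
    obtain k where k: "e = e0 + k" using le_Suc_ex[OF e] by blast
    have "lift gs e0 w e = shift gs k w" by (simp add: lift_def k)
    then have "koszul gs e (lift gs e0 w e) T - u * z e T - u * koszul gs e (\<lambda>S. 0) T
      = - (u * (z (e0 + k) T - cprod gs T ^ k * z e0 T) + cprod gs T ^ k * (u * z e0 T - koszul gs e0 w T))"
      by (simp add: k koszul_shift[OF csubs_fin[OF T]] koszul_zero right_diff_distrib mult.left_commute)
    moreover have "u * (z (e0 + k) T - cprod gs T ^ k * z e0 T) + cprod gs T ^ k * (u * z e0 T - koszul gs e0 w T) \<in> I"
      by (rule ideal_add[OF I ideal_mult[OF I e0(2)[OF T]] ideal_mult[OF I]]) (use w T in blast)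
    ultimately show "koszul gs e (lift gs e0 w e) T - u * z e T - u * koszul gs e (\<lambda>S. 0) T \<in> I" using ideal_neg[OF I] by (simp only:)
  qed
  ultimately show ?thesis by blast
qed

text \<open>If z = dw modulo I, then y - u(c + w) is a cocycle modulo I that agrees with y modulo u:
  the kernel of the connecting homomorphism consists of reductions of classes modulo I.\<close>

lemma conn_ker:
  assumes I: "is_ideal I" and y: "y \<in> ZZ j (iadd I u)" and z: "z \<in> BB (Suc j) I" and D: "conn j I u y z"
  shows "\<exists>v\<in>ZZ j I. y - v \<in> BB j (iadd I u)"
proof -
  have Iu: "is_ideal (iadd I u)" by (rule is_ideal_iadd[OF I])
  obtain e1 where e1: "\<And>e. e1 \<le> e \<Longrightarrow> \<exists>w. \<forall>S\<in>csubs gs (Suc j). z e S - koszul gs e w S \<in> I" using BB_get[OF z] by metis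
  obtain e2 where e2: "\<And>e. e2 \<le> e \<Longrightarrow> \<exists>c. \<forall>T\<in>csubs gs (Suc j). koszul gs e (y e) T - u * z e T - u * koszul gs e c T \<in> I" using conn_get[OF D] by metis
  obtain e0 where e0: "max e1 e2 \<le> e0" "\<And>k S. S \<in> csubs gs j \<Longrightarrow> y (e0 + k) S - cprod gs S ^ k * y e0 S \<in> iadd I u"
    using ZZ_get[OF Iu y, of "max e1 e2"] by metis
  obtain w where w: "\<forall>S\<in>csubs gs (Suc j). z e0 S - koszul gs e0 w S \<in> I" using e1[of e0] e0(1) by auto
  obtain c where c: "\<forall>T\<in>csubs gs (Suc j). koszul gs e0 (y e0) T - u * z e0 T - u * koszul gs e0 c T \<in> I" using e2[of e0] e0(1) by auto
  define x where "x S = y e0 S - u * (c S + w S)" for S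
  have vZ: "lift gs e0 x \<in> ZZ j I"
  proof (rule lift_ZZ[OF I])
    fix T assume T: "T \<in> csubs gs (Suc j)"
    have "koszul gs e0 x T = (koszul gs e0 (y e0) T - u * z e0 T - u * koszul gs e0 c T) + u * (z e0 T - koszul gs e0 w T)"
      unfolding x_def koszul_diff koszul_mult koszul_add by (simp add: right_diff_distrib distrib_left)
    moreover have "(koszul gs e0 (y e0) T - u * z e0 T - u * koszul gs e0 c T) + u * (z e0 T - koszul gs e0 w T) \<in> I"
      using c w T by (intro ideal_add[OF I] ideal_mult[OF I]) auto
    ultimately show "koszul gs e0 x T \<in> I" by (simp only:)
  qed
  have dZ: "y - lift gs e0 x \<in> ZZ j (iadd I u)"
    using V.subspace_diff[OF subspace_ZZ[OF Iu] y] vZ ZZ_mono[OF iadd_sup[of I u]] by blast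
  have dk: "(y - lift gs e0 x) (e0 + k) S \<in> iadd I u" if S: "S \<in> csubs gs j" for k S
  proof -
    have "(y - lift gs e0 x) (e0 + k) S = (y (e0 + k) S - cprod gs S ^ k * y e0 S) + (cprod gs S ^ k * (c S + w S)) * u"
      by (simp add: lift_plus x_def right_diff_distrib mult_ac)
    then show ?thesis using ideal_add[OF Iu e0(2)[OF S] iadd_mult[OF I]] by (simp only:)
  qed
  have "y - lift gs e0 x \<in> BB j (iadd I u)"
  proof (rule BB_ideal[OF dZ])
    fix e S assume "e0 \<le> e" "S \<in> csubs gs j"
    then show "(y - lift gs e0 x) e S \<in> iadd I u" using dk le_Suc_ex by blast
  qed
  then show ?thesis using vZ by blast
qed

text \<open>If the cocycle v equals dw + uc modulo I, then u dc lies in I, and c becomes a cocycle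
  after a shift by N. So a class that vanishes modulo u is u times a class.\<close>

lemma reduction_ker:
  assumes I: "is_ideal I" and u: "colon I u \<subseteq> sat m I" and v: "v \<in> ZZ j I" and vB: "v \<in> BB j (iadd I u)"
  shows "\<exists>w\<in>ZZ j I. v - vs u w \<in> BB j I"
proof -
  obtain e1 where e1: "\<And>e. e1 \<le> e \<Longrightarrow> \<exists>w. \<forall>S\<in>csubs gs j. v e S - koszul gs e w S \<in> iadd I u" using BB_get[OF vB] by metis
  obtain e0 where e0: "e1 \<le> e0" "\<And>k S. S \<in> csubs gs j \<Longrightarrow> v (e0 + k) S - cprod gs S ^ k * v e0 S \<in> I"
    "\<And>e T. e0 \<le> e \<Longrightarrow> T \<in> csubs gs (Suc j) \<Longrightarrow> koszul gs e (v e) T \<in> I" using ZZ_get[OF I v, of e1] by metis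
  obtain w where w: "\<forall>S\<in>csubs gs j. v e0 S - koszul gs e0 w S \<in> iadd I u" using e1[OF e0(1)] by auto
  have "\<forall>S. \<exists>r. S \<in> csubs gs j \<longrightarrow> v e0 S - koszul gs e0 w S - r * u \<in> I" using w by (auto simp: iadd_def)
  from choice[OF this] obtain c where c: "\<And>S. S \<in> csubs gs j \<Longrightarrow> v e0 S - koszul gs e0 w S - c S * u \<in> I" by blast
  obtain N where N: "\<And>S r. S \<in> csubs gs (Suc j) \<Longrightarrow> u * r \<in> I \<Longrightarrow> cprod gs S ^ N * r \<in> I" using colon_uniform[OF I u, of j] by blast
  define x where "x = lift gs (e0 + N) (shift gs N c)"
  have xZ: "x \<in> ZZ j I" unfolding x_def
  proof (rule lift_ZZ[OF I])
    fix T assume T: "T \<in> csubs gs (Suc j)"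
    have "koszul gs e0 (\<lambda>S. v e0 S - koszul gs e0 w S - u * c S) T \<in> I"
      by (rule koszul_ideal[OF I _ T]) (use c in \<open>simp add: mult.commute\<close>)
    then have 1: "koszul gs e0 (v e0) T - u * koszul gs e0 c T \<in> I" by (simp add: koszul_diff koszul_mult koszul_koszul[OF csubs_fin[OF T]])
    have "koszul gs e0 (v e0) T - (koszul gs e0 (v e0) T - u * koszul gs e0 c T) \<in> I" by (rule ideal_diff[OF I e0(3)[OF order_refl T] 1])
    then have "u * koszul gs e0 c T \<in> I" by simp
    from N[OF T this] show "koszul gs (e0 + N) (shift gs N c) T \<in> I" by (simp add: koszul_shift[OF csubs_fin[OF T]])
  qed
  have dZ: "v - vs u x \<in> ZZ j I" by (rule V.subspace_diff[OF subspace_ZZ[OF I] v V.subspace_scale[OF subspace_ZZ[OF I] xZ]])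
  have "v - vs u x \<in> BB j I"
  proof (rule BB_at[OF I dZ, where ?e0.0 = "e0 + N" and w = "shift gs N w"])
    fix k S assume S: "S \<in> csubs gs j"
    have "(v - vs u x) (e0 + N + k) S - cprod gs S ^ k * (v - vs u x) (e0 + N) S
       = (v (e0 + (N + k)) S - cprod gs S ^ (N + k) * v e0 S) - cprod gs S ^ k * (v (e0 + N) S - cprod gs S ^ N * v e0 S)
        - u * (x (e0 + N + k) S - cprod gs S ^ k * x (e0 + N + 0) S)"
      by (simp add: vs_def right_diff_distrib power_add add.assoc mult_ac)
    also have "u * (x (e0 + N + k) S - cprod gs S ^ k * x (e0 + N + 0) S) = 0" unfolding x_def lift_plus by simp
    finally show "(v - vs u x) (e0 + N + k) S - cprod gs S ^ k * (v - vs u x) (e0 + N) S \<in> I"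
      using ideal_diff[OF I e0(2)[OF S, of "N + k"] ideal_mult[OF I e0(2)[OF S, of N]]] by simp
  next
    fix S assume S: "S \<in> csubs gs j"
    have xS: "x (e0 + N) S = cprod gs S ^ N * c S" unfolding x_def using lift_plus[of "e0 + N" "shift gs N c" 0 S] by (simp add: shift_def)
    have "(v - vs u x) (e0 + N) S - koszul gs (e0 + N) (shift gs N w) S
      = (v (e0 + N) S - cprod gs S ^ N * v e0 S) + cprod gs S ^ N * (v e0 S - koszul gs e0 w S - c S * u)"
      unfolding koszul_shift[OF csubs_fin[OF S]] by (simp add: vs_def xS right_diff_distrib mult_ac)
    then show "(v - vs u x) (e0 + N) S - koszul gs (e0 + N) (shift gs N w) S \<in> I"
      using ideal_add[OF I e0(2)[OF S] ideal_mult[OF I c[OF S]]] by (simp only:)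
  qed
  then show ?thesis using xZ by blast
qed

subsection \<open>Local cohomology modules are Artinian\<close>

text \<open>In degree 0 the only component is the empty set, where the transition map is
  multiplication by 1; so a constant sequence represents the class of an element r of the
  saturation.\<close>

definition cst :: "'a \<Rightarrow> nat \<Rightarrow> nat set \<Rightarrow> 'a" where "cst r = (\<lambda>e S. r)"

lemma cprod_empty: "cprod gs {} = 1" by (simp add: cprod_def)

lemma cst_ZZ: assumes I: "is_ideal I" and r: "r \<in> sat m I" shows "cst r \<in> ZZ 0 I"
proof -
  obtain N where N: "\<forall>a\<in>idpow m N. a * r \<in> I" using r by (auto simp: sat_def)
  have "koszul gs e (cst r e) T \<in> I" if e: "N \<le> e" and T: "T \<in> csubs gs (Suc 0)" for e T
    unfolding koszul_def
  proof (rule ideal_sum[OF I])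
    fix j assume j: "j \<in> T"
    then have "gs ! j \<in> m" using T g_m by (auto simp: csubs_def)
    then have "(gs ! j) ^ e \<in> idpow m N" using idpow_pow[of "gs ! j" m e] idpow_anti[OF e] by blast
    then have "ksg T j * ((gs ! j) ^ e * r) \<in> I" using N ideal_mult[OF I] by blast
    then show "ksg T j * cst r e (T - {j}) * gs ! j ^ e \<in> I" by (simp add: cst_def mult_ac)
  qed
  then show ?thesis unfolding ZZ_def
    by (intro CollectI exI[where x = N]) (auto simp: csubs_0 cprod_empty cst_def ideal_0[OF I])
qed

lemma ZZ_0_get: assumes I: "is_ideal I" and s: "s \<in> ZZ 0 I"
  obtains e0 where "\<And>k. s (e0 + k) {} - s e0 {} \<in> I" "s e0 {} \<in> sat m I"
proof -
  obtain e0 where e0: "\<And>k S. S \<in> csubs gs 0 \<Longrightarrow> s (e0 + k) S - cprod gs S ^ k * s e0 S \<in> I"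
    "\<And>e T. e0 \<le> e \<Longrightarrow> T \<in> csubs gs (Suc 0) \<Longrightarrow> koszul gs e (s e) T \<in> I" using ZZ_get[OF I s, of 0] by metis
  have "\<exists>e. g ^ e \<in> colon I (s e0 {})" if "g \<in> set gs" for g
  proof -
    obtain i where i: "i < length gs" "g = gs ! i" using \<open>g \<in> set gs\<close> by (metis in_set_conv_nth)
    have "{i} \<in> csubs gs (Suc 0)" using i by (simp add: csubs_def)
    then have "koszul gs e0 (s e0) {i} \<in> I" using e0(2) by blast
    moreover have "{k\<in>{i}. k < i} = {}" by auto
    then have "ksg {i} i = (1 :: 'a)" unfolding ksg_def by (simp only: card.empty power_0)
    then have "koszul gs e0 (s e0) {i} = s e0 {} * g ^ e0" by (simp add: koszul_def i(2))
    ultimately have "g ^ e0 * s e0 {} \<in> I" by (simp add: mult.commute)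
    then show ?thesis by (auto simp: colon_def)
  qed
  then obtain N where "idpow (gen_ideal (set gs)) N \<subseteq> colon I (s e0 {})"
    using idpow_gen_sub[OF _ is_ideal_colon[OF I], of "set gs" "s e0 {}"] by blast
  then have "s e0 {} \<in> sat m I" unfolding gs by (intro satI[of m N]) (auto simp: colon_def)
  then show thesis using that[of e0] e0(1) by (simp add: csubs_0 cprod_empty)
qed

lemma BB_0_get: assumes "s \<in> BB 0 I" obtains e0 where "\<And>e. e0 \<le> e \<Longrightarrow> s e {} \<in> I"
proof -
  obtain e0 where "\<And>e. e0 \<le> e \<Longrightarrow> \<exists>w. \<forall>S\<in>csubs gs 0. s e S - koszul gs e w S \<in> I" using BB_get[OF assms] by metis
  then have "\<And>e. e0 \<le> e \<Longrightarrow> s e {} \<in> I" by (simp add: csubs_0 koszul_empty)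
  then show thesis using that by blast
qed

lemma H0_kill: assumes I: "is_ideal I" shows "V.mkill (BB 0 I) (ZZ 0 I)"
proof -
  obtain N where N: "\<And>a r. a \<in> idpow m N \<Longrightarrow> r \<in> sat m I \<Longrightarrow> a * r \<in> I" using sat_uniform[OF I] by blast
  have "vs a s \<in> BB 0 I" if a: "a \<in> idpow m N" and s: "s \<in> ZZ 0 I" for a s
  proof -
    obtain e0 where e0: "\<And>k. s (e0 + k) {} - s e0 {} \<in> I" "s e0 {} \<in> sat m I" using ZZ_0_get[OF I s] by metis
    have k: "a * s (e0 + k) {} \<in> I" for k
    proof -
      have "a * s (e0 + k) {} = a * (s (e0 + k) {} - s e0 {}) + a * s e0 {}" by (simp add: right_diff_distrib)
      then show ?thesis using ideal_add[OF I ideal_mult[OF I e0(1)] N[OF a e0(2)]] by (simp only:)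
    qed
    show ?thesis
    proof (rule BB_ideal[OF V.subspace_scale[OF subspace_ZZ[OF I] s], where ?e0.0 = e0])
      fix e S assume "e0 \<le> e" "S \<in> csubs gs 0"
      then show "vs a s e S \<in> I" using k le_Suc_ex[of e0 e] by (auto simp: csubs_0 vs_def)
    qed
  qed
  then show ?thesis unfolding V.mkill_def by blast
qed

lemma H0_artin: assumes I: "is_ideal I" shows "V.artin (BB 0 I) (ZZ 0 I)"
proof (rule artin_subq[where ?s2.0 = "(*)" and ?B2.0 = I and ?Z2.0 = "sat m I" and D = "\<lambda>s r. \<exists>e0. \<forall>e\<ge>e0. s e {} - r \<in> I"])
  show "module vs" by (rule module_vs)
  show "module ((*) :: 'a \<Rightarrow> 'a \<Rightarrow> 'a)" by (rule rm.module_axioms)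
  show "linrel vs (*) (\<lambda>s r. \<exists>e0. \<forall>e\<ge>e0. s e {} - r \<in> I)"
  proof (rule linrelI)
    show "\<exists>e0. \<forall>e\<ge>e0. (0 :: nat \<Rightarrow> nat set \<Rightarrow> 'a) e {} - 0 \<in> I" by (simp add: ideal_0[OF I])
    fix s s' :: "nat \<Rightarrow> nat set \<Rightarrow> 'a" and r r' assume h: "\<exists>e0. \<forall>e\<ge>e0. s e {} - r \<in> I" "\<exists>e0. \<forall>e\<ge>e0. s' e {} - r' \<in> I"
    obtain e1 where "\<forall>e\<ge>e1. s e {} - r \<in> I" using h(1) by (elim exE)
    moreover obtain e2 where "\<forall>e\<ge>e2. s' e {} - r' \<in> I" using h(2) by (elim exE)
    ultimately have e: "\<forall>e\<ge>e1. s e {} - r \<in> I" "\<forall>e\<ge>e2. s' e {} - r' \<in> I" .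
    have "(s + s') e {} - (r + r') \<in> I" if "max e1 e2 \<le> e" for e
    proof -
      have "(s + s') e {} - (r + r') = (s e {} - r) + (s' e {} - r')" by simp
      moreover have "(s e {} - r) + (s' e {} - r') \<in> I" using e that by (intro ideal_add[OF I]) auto
      ultimately show ?thesis by (simp only:)
    qed
    then show "\<exists>e0. \<forall>e\<ge>e0. (s + s') e {} - (r + r') \<in> I" by blast
  next
    fix a r and s :: "nat \<Rightarrow> nat set \<Rightarrow> 'a" assume "\<exists>e0. \<forall>e\<ge>e0. s e {} - r \<in> I"
    then obtain e1 where e: "\<forall>e\<ge>e1. s e {} - r \<in> I" by blast
    have "vs a s e {} - a * r \<in> I" if "e1 \<le> e" for e
    proof -
      have "a * (s e {} - r) \<in> I" using e that ideal_mult[OF I] by blast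
      then show ?thesis by (simp add: vs_def right_diff_distrib)
    qed
    then show "\<exists>e0. \<forall>e\<ge>e0. vs a s e {} - a * r \<in> I" by blast
  qed
  obtain N where "\<And>a r. a \<in> idpow m N \<Longrightarrow> r \<in> sat m I \<Longrightarrow> a * r \<in> I" using sat_uniform[OF I] by blast
  then show "rm.artin I (sat m I)" by (rule artin_ideal[OF I is_ideal_sat[OF I] sat_sup[OF I]])
  show "V.subspace (BB 0 I)" "V.subspace (ZZ 0 I)" "BB 0 I \<subseteq> ZZ 0 I" by (rule subspace_BB[OF I], rule subspace_ZZ[OF I], rule BB_ZZ)
  show "\<exists>r\<in>sat m I. \<exists>e0. \<forall>e\<ge>e0. s e {} - r \<in> I" if s: "s \<in> ZZ 0 I" for s
  proof -
    obtain e0 where e0: "\<And>k. s (e0 + k) {} - s e0 {} \<in> I" "s e0 {} \<in> sat m I" using ZZ_0_get[OF I s] by metis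
    have "s e {} - s e0 {} \<in> I" if "e0 \<le> e" for e using e0(1) le_Suc_ex[OF that] by blast
    then show ?thesis using e0(2) by blast
  qed
  show "s \<in> BB 0 I" if s: "s \<in> ZZ 0 I" and r: "r \<in> I" and ex: "\<exists>e0. \<forall>e\<ge>e0. s e {} - r \<in> I" for s r
  proof -
    obtain e0 where e0: "\<forall>e\<ge>e0. s e {} - r \<in> I" using ex by blast
    show ?thesis by (rule BB_ideal[OF s, where ?e0.0 = e0]) (use e0 ideal_diff_iff[OF I, of _ r] r in \<open>auto simp: csubs_0\<close>)
  qed
qed

text \<open>By Melkersson's criterion it suffices that the kernel of some u in m is Artinian. That
  kernel is the image of the connecting homomorphism from one degree lower modulo I and u, so
  \<open>conn\<close> is used with its arguments exchanged.\<close>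

lemma H_artin: "is_ideal I \<Longrightarrow> V.artin (BB j I) (ZZ j I)"
proof (induction j arbitrary: I)
  case 0 then show ?case by (rule H0_artin)
next
  case (Suc j)
  note I = Suc.prems
  obtain u where u: "u \<in> m" "colon I u \<subseteq> sat m I" using FR_elem_ex[OF I] by blast
  show ?case
  proof (rule V.artin_torsion[of _ _ u])
    show "V.subspace (ZZ (Suc j) I)" by (rule subspace_ZZ[OF I])
    show "\<exists>i. vs (u ^ i) z \<in> BB (Suc j) I" if "z \<in> ZZ (Suc j) I" for z
      using torsion[OF I that] idpow_pow[OF u(1)] by blast
    show "V.artin (BB (Suc j) I) {z \<in> ZZ (Suc j) I. vs u z \<in> BB (Suc j) I}"
    proof (rule artin_subq[OF module_vs module_vs, where D = "\<lambda>z y. conn j I u y z" and ?B2.0 = "BB j (iadd I u)" and ?Z2.0 = "ZZ j (iadd I u)"])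
      show "linrel vs vs (\<lambda>z y. conn j I u y z)" using linrel_conn[OF I, of j u] unfolding linrel_def by blast
      show "V.artin (BB j (iadd I u)) (ZZ j (iadd I u))" by (rule Suc.IH[OF is_ideal_iadd[OF I]])
      show "V.subspace (BB (Suc j) I)" by (rule subspace_BB[OF I])
      show "V.subspace {z \<in> ZZ (Suc j) I. vs u z \<in> BB (Suc j) I}" by (rule V.subspace_pre[OF subspace_ZZ[OF I] subspace_BB[OF I]])
      show "BB (Suc j) I \<subseteq> {z \<in> ZZ (Suc j) I. vs u z \<in> BB (Suc j) I}" using BB_ZZ V.subspace_scale[OF subspace_BB[OF I]] by blast
      show "\<exists>y\<in>ZZ j (iadd I u). conn j I u y z" if "z \<in> {z \<in> ZZ (Suc j) I. vs u z \<in> BB (Suc j) I}" for z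
        using conn_surj[OF I] that by blast
      show "z \<in> BB (Suc j) I" if "z \<in> {z \<in> ZZ (Suc j) I. vs u z \<in> BB (Suc j) I}" "y \<in> BB j (iadd I u)" "conn j I u y z" for z y
        using conn_BB[OF I u(2) that(2) _ that(3)] that(1) by blast
    qed
  qed
qed

end

section \<open>Frobenius actions on local cohomology\<close>

locale frob = kos m gs for m :: "'a::comm_ring_1 set" and gs + fixes p :: nat
  assumes prime_p: "prime p" and char_p: "CHAR('a) = p"
begin

lemma p2: "2 \<le> p" using prime_p prime_ge_2_nat by blast
lemma q0: "0 < p ^ n" using p2 by simp

lemma fadd: "(x + y :: 'a) ^ (p ^ n) = x ^ (p ^ n) + y ^ (p ^ n)"
  by (rule freshmans_dream') (use prime_p char_p in auto)
lemma fneg: "(- x :: 'a) ^ (p ^ n) = - (x ^ (p ^ n))"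
proof -
  have "(x + - x) ^ (p ^ n) = x ^ (p ^ n) + (- x) ^ (p ^ n)" by (rule fadd)
  then have "x ^ (p ^ n) + (- x) ^ (p ^ n) = 0" using p2 by (simp add: power_0_left)
  then show ?thesis by (simp add: add_eq_0_iff)
qed
lemma fdiff: "(x - y :: 'a) ^ (p ^ n) = x ^ (p ^ n) - y ^ (p ^ n)"
  using fadd[of x "- y" n] fneg[of y n] by simp
lemma fsum: "(sum f A :: 'a) ^ (p ^ n) = (\<Sum>i\<in>A. f i ^ (p ^ n))"
  by (rule freshmans_dream_sum') (use prime_p char_p in auto)

lemma ksg_pow: "(ksg T j :: 'a) ^ (p ^ n) = ksg T j"
proof -
  have "(-1 :: 'a) ^ (p ^ n) = -1" using fneg[of 1 n] by simp
  then show ?thesis unfolding ksg_def by (metis power_mult mult.commute)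
qed

lemma koszul_frob: "koszul gs (p ^ n * e) (\<lambda>S. c S ^ (p ^ n)) T = (koszul gs e c T) ^ (p ^ n)"
  unfolding koszul_def fsum by (simp add: power_mult_distrib ksg_pow power_mult mult.commute[of "p ^ n" e])

text \<open>The q-th power of a cochain for exponent k is a cochain for exponent qk. At an exponent
  e in between, it is carried on from \<open>q * (e div q)\<close> by \<open>e mod q\<close>
  transition maps.\<close>

definition Fr :: "nat \<Rightarrow> (nat \<Rightarrow> nat set \<Rightarrow> 'a) \<Rightarrow> nat \<Rightarrow> nat set \<Rightarrow> 'a" where
  "Fr q s = (\<lambda>e S. cprod gs S ^ (e mod q) * s (e div q) S ^ q)"

lemma Fr_mult: "Fr (q * q') s = Fr q (Fr q' s)"
proof (intro ext)
  fix e S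
  have "e mod (q * q') = (e div q mod q') * q + e mod q" by (simp add: mod_mult2_eq mult.commute)
  then have "cprod gs S ^ (e mod (q * q')) = cprod gs S ^ (e mod q) * (cprod gs S ^ (e div q mod q')) ^ q"
    by (simp only: power_add power_mult mult.commute[of "cprod gs S ^ (e mod q)"])
  moreover have "s (e div (q * q')) S ^ (q * q') = (s (e div q div q') S ^ q') ^ q"
    by (simp add: div_mult2_eq mult.commute flip: power_mult)
  ultimately show "Fr (q * q') s e S = Fr q (Fr q' s) e S" by (simp add: Fr_def power_mult_distrib mult.assoc)
qed
lemma Fr_1: "Fr (p ^ 0) s = s" by (simp add: Fr_def)
lemma Fr_add: "Fr (p ^ n) (s + t) = Fr (p ^ n) s + Fr (p ^ n) t" by (simp add: Fr_def fun_eq_iff fadd distrib_left)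
lemma Fr_diff: "Fr (p ^ n) (s - t) = Fr (p ^ n) s - Fr (p ^ n) t" by (simp add: Fr_def fun_eq_iff fdiff right_diff_distrib)
lemma Fr_vs: "Fr q (vs a s) = vs (a ^ q) (Fr q s)" by (simp add: Fr_def vs_def fun_eq_iff power_mult_distrib mult.left_commute)
lemma Fr_plus: "Fr (p ^ (n + k)) s = Fr (p ^ n) (Fr (p ^ k) s)" by (simp add: power_add Fr_mult)
lemma Fr_funpow: "((Fr p) ^^ n) s = Fr (p ^ n) s"
proof (induction n)
  case 0 then show ?case using Fr_1 by simp
next
  case (Suc n) then show ?case by (simp add: Fr_mult)
qed

lemma Fr_shift: "Fr q s e = shift gs (e mod q) (\<lambda>S. s (e div q) S ^ q)" by (simp add: Fr_def shift_def)

lemma koszul_Fr: assumes "finite T" shows "koszul gs e (Fr (p ^ n) s e) T = cprod gs T ^ (e mod p ^ n) * (koszul gs (e div p ^ n) (s (e div p ^ n)) T) ^ (p ^ n)"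
  using koszul_shift[OF assms, of gs "p ^ n * (e div p ^ n)" "e mod p ^ n"] by (simp add: Fr_shift koszul_frob)

lemma koszul_shift_Fr: assumes "finite T"
  shows "koszul gs e (shift gs (e mod p ^ n) (\<lambda>S. w S ^ (p ^ n))) T = cprod gs T ^ (e mod p ^ n) * (koszul gs (e div p ^ n) w T) ^ (p ^ n)"
  using koszul_shift[OF assms, of gs "p ^ n * (e div p ^ n)" "e mod p ^ n"] by (simp add: koszul_frob)

lemma div_ge: "p ^ n * e0 \<le> e \<Longrightarrow> e0 \<le> e div p ^ n"
  using less_eq_div_iff_mult_less_eq[OF q0, of e0 e n] by (simp add: mult.commute)

lemma Fr_ZZ:
  assumes I': "is_ideal I'" and II: "\<And>i. i \<in> I \<Longrightarrow> i ^ (p ^ n) \<in> I'" and s: "s \<in> ZZ j I"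
  shows "Fr (p ^ n) s \<in> ZZ j I'"
proof -
  obtain e0 where e0: "\<forall>e\<ge>e0. (\<forall>S\<in>csubs gs j. s (Suc e) S - cprod gs S * s e S \<in> I) \<and> (\<forall>T\<in>csubs gs (Suc j). koszul gs e (s e) T \<in> I)"
    using s unfolding ZZ_def by blast
  show ?thesis unfolding ZZ_def
  proof (intro CollectI exI[where x = "p ^ n * e0"] allI impI conjI ballI)
    fix e assume "p ^ n * e0 \<le> e"
    then have e: "e0 \<le> e div p ^ n" by (rule div_ge)
    define q where "q = p ^ n"
    define k where "k = e div q"
    have q: "0 < q" unfolding q_def by (rule q0)
    show "Fr (p ^ n) s (Suc e) S - cprod gs S * Fr (p ^ n) s e S \<in> I'" if S: "S \<in> csubs gs j" for S
    \<comment> \<open>Only when \<open>Suc e\<close> is a multiple of q does the underlying exponent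
      advance; otherwise compatibility holds by construction.\<close>
    proof (cases "Suc (e mod q) = q")
      case True
      then have 1: "Suc e mod q = 0" "Suc e div q = Suc k" by (simp_all add: mod_Suc div_Suc k_def)
      have "cprod gs S * (cprod gs S ^ (e mod q) * s k S ^ q) = (cprod gs S * s k S) ^ q"
        by (metis True power_Suc power_mult_distrib mult.assoc)
      then have "Fr q s (Suc e) S - cprod gs S * Fr q s e S = (s (Suc k) S - cprod gs S * s k S) ^ q"
        by (simp add: Fr_def 1 k_def[symmetric] fdiff[of _ _ n, folded q_def])
      moreover have "(s (Suc k) S - cprod gs S * s k S) ^ q \<in> I'" unfolding q_def by (rule II) (use e0 e S in \<open>simp add: k_def q_def\<close>)
      ultimately show ?thesis by (simp add: q_def)
    next
      case False
      then have "Suc e mod q = Suc (e mod q)" "Suc e div q = k" by (simp_all add: mod_Suc div_Suc k_def)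
      then have "Fr q s (Suc e) S - cprod gs S * Fr q s e S = 0" by (simp add: Fr_def k_def mult.assoc)
      then show ?thesis using ideal_0[OF I'] by (simp add: q_def)
    qed
    show "koszul gs e (Fr (p ^ n) s e) T \<in> I'" if T: "T \<in> csubs gs (Suc j)" for T
      unfolding koszul_Fr[OF csubs_fin[OF T]] by (rule ideal_mult[OF I' II]) (use e0 e T in blast)
  qed
qed

lemma Fr_BB:
  assumes I': "is_ideal I'" and II: "\<And>i. i \<in> I \<Longrightarrow> i ^ (p ^ n) \<in> I'" and s: "s \<in> BB j I"
  shows "Fr (p ^ n) s \<in> BB j I'"
proof -
  obtain e0 where e0: "\<And>e. e0 \<le> e \<Longrightarrow> \<exists>w. \<forall>S\<in>csubs gs j. s e S - koszul gs e w S \<in> I" using BB_get[OF s] by metis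
  have "\<exists>w. \<forall>S\<in>csubs gs j. Fr (p ^ n) s e S - koszul gs e w S \<in> I'" if e: "p ^ n * e0 \<le> e" for e
  proof -
    obtain w where w: "\<forall>S\<in>csubs gs j. s (e div p ^ n) S - koszul gs (e div p ^ n) w S \<in> I" using e0[OF div_ge[OF e]] by blast
    have "Fr (p ^ n) s e S - koszul gs e (shift gs (e mod p ^ n) (\<lambda>S. w S ^ (p ^ n))) S \<in> I'" if S: "S \<in> csubs gs j" for S
    proof -
      have "Fr (p ^ n) s e S - koszul gs e (shift gs (e mod p ^ n) (\<lambda>S. w S ^ (p ^ n))) S
        = cprod gs S ^ (e mod p ^ n) * (s (e div p ^ n) S - koszul gs (e div p ^ n) w S) ^ (p ^ n)"
        unfolding koszul_shift_Fr[OF csubs_fin[OF S]] fdiff by (simp add: Fr_def right_diff_distrib)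
      moreover have "cprod gs S ^ (e mod p ^ n) * (s (e div p ^ n) S - koszul gs (e div p ^ n) w S) ^ (p ^ n) \<in> I'"
        by (rule ideal_mult[OF I' II]) (use w S in blast)
      ultimately show ?thesis by (simp only:)
    qed
    then show ?thesis by blast
  qed
  moreover have "Fr (p ^ n) s \<in> ZZ j I'" by (rule Fr_ZZ[OF I' II]) (use s BB_ZZ in auto)
  ultimately show ?thesis unfolding BB_def by blast
qed

lemma Fr_conn:
  assumes I': "is_ideal I'" and II: "\<And>i. i \<in> I \<Longrightarrow> i ^ (p ^ n) \<in> I'" and D: "conn j I u y z"
  shows "conn j I' (u ^ (p ^ n)) (Fr (p ^ n) y) (Fr (p ^ n) z)"
proof -
  obtain e0 where e0: "\<And>e. e0 \<le> e \<Longrightarrow> \<exists>c. \<forall>T\<in>csubs gs (Suc j). koszul gs e (y e) T - u * z e T - u * koszul gs e c T \<in> I" using conn_get[OF D] by metis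
  have "\<exists>c. \<forall>T\<in>csubs gs (Suc j). koszul gs e (Fr (p ^ n) y e) T - u ^ (p ^ n) * Fr (p ^ n) z e T - u ^ (p ^ n) * koszul gs e c T \<in> I'"
    if e: "p ^ n * e0 \<le> e" for e
  proof -
    define k where "k = e div p ^ n"
    obtain c where c: "\<forall>T\<in>csubs gs (Suc j). koszul gs k (y k) T - u * z k T - u * koszul gs k c T \<in> I"
      using e0[OF div_ge[OF e]] unfolding k_def by blast
    have "koszul gs e (Fr (p ^ n) y e) T - u ^ (p ^ n) * Fr (p ^ n) z e T - u ^ (p ^ n) * koszul gs e (shift gs (e mod p ^ n) (\<lambda>S. c S ^ (p ^ n))) T \<in> I'"
      if T: "T \<in> csubs gs (Suc j)" for T
    proof -
      have "koszul gs e (Fr (p ^ n) y e) T - u ^ (p ^ n) * Fr (p ^ n) z e T - u ^ (p ^ n) * koszul gs e (shift gs (e mod p ^ n) (\<lambda>S. c S ^ (p ^ n))) T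
        = cprod gs T ^ (e mod p ^ n) * (koszul gs k (y k) T - u * z k T - u * koszul gs k c T) ^ (p ^ n)"
        unfolding koszul_shift_Fr[OF csubs_fin[OF T]] koszul_Fr[OF csubs_fin[OF T]] fdiff
        by (simp add: Fr_def right_diff_distrib power_mult_distrib k_def mult.left_commute)
      moreover have "cprod gs T ^ (e mod p ^ n) * (koszul gs k (y k) T - u * z k T - u * koszul gs k c T) ^ (p ^ n) \<in> I'"
        by (rule ideal_mult[OF I' II]) (use c T in blast)
      ultimately show ?thesis by (simp only:)
    qed
    then show ?thesis by blast
  qed
  then show ?thesis unfolding conn_def by blast
qed

section \<open>Nilpotent classes along filter regular sequences\<close>

abbreviation pw :: "(nat \<Rightarrow> 'a) \<Rightarrow> nat \<Rightarrow> nat \<Rightarrow> 'a" where "pw x n \<equiv> (\<lambda>i. x i ^ (p ^ n))"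

lemma conn_scale: "is_ideal I \<Longrightarrow> conn j I u y z \<Longrightarrow> conn j I u (vs a y) (vs a z)"
  using linrel_conn[of I j u] unfolding linrel_def by blast

lemma pw_pw: "pw (pw x n) k = pw x (n + k)" by (simp add: fun_eq_iff power_add flip: power_mult)

lemma idl_pw: "i \<in> idl x l \<Longrightarrow> i ^ (p ^ n) \<in> idl (pw x n) l"
proof -
  have "is_ideal {i. i ^ (p ^ n) \<in> idl (pw x n) l}"
    using q0[of n] by (intro is_idealI) (auto simp: fadd power_mult_distrib power_0_left ideal_0 ideal_add ideal_mult is_ideal_idl)
  then have "idl x l \<subseteq> {i. i ^ (p ^ n) \<in> idl (pw x n) l}"
    unfolding idl_def[of x] by (rule gen_least) (auto simp: idl_in[of _ l "pw x n"])
  then show "i \<in> idl x l \<Longrightarrow> i ^ (p ^ n) \<in> idl (pw x n) l" by blast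
qed

lemma iadd_pw: fixes I I' :: "'a set" assumes I': "is_ideal I'" and II: "\<And>i. i \<in> I \<Longrightarrow> i ^ (p ^ n) \<in> I'" and y: "y \<in> iadd I u"
  shows "y ^ (p ^ n) \<in> iadd I' (u ^ (p ^ n))"
proof -
  obtain r i where e: "y = i + r * u" "i \<in> I" using y by (rule iaddE)
  show ?thesis by (rule iaddI[of _ "r ^ (p ^ n)"]) (simp add: e(1) fadd power_mult_distrib II[OF e(2)])
qed

lemma FR_pw: "FR x t \<Longrightarrow> FR (pw x n) t" by (rule FR_pow) (use q0 in auto)

lemma pow_idpow: "a \<in> idpow m k \<Longrightarrow> a ^ (p ^ n) \<in> idpow m k" by (rule ideal_pow[OF is_ideal_idpow _ q0])

text \<open>The target of the n-th Frobenius is the cohomology modulo the powers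
  \<open>pw x n\<close>, so n occurs in the ideal too; by \<open>nil_later\<close> a class that has
  vanished stays zero.\<close>

definition nil :: "(nat \<Rightarrow> 'a) \<Rightarrow> nat \<Rightarrow> nat \<Rightarrow> (nat \<Rightarrow> nat set \<Rightarrow> 'a) \<Rightarrow> bool" where
  "nil x l j z \<longleftrightarrow> (\<exists>n. Fr (p ^ n) z \<in> BB j (idl (pw x n) l))"

lemma nil_later: assumes "Fr (p ^ n) z \<in> BB j (idl (pw x n) l)" "n \<le> n'" shows "Fr (p ^ n') z \<in> BB j (idl (pw x n') l)"
proof -
  obtain k where k: "n' = n + k" using le_Suc_ex[OF assms(2)] by blast
  have "Fr (p ^ k) (Fr (p ^ n) z) \<in> BB j (idl (pw (pw x n) k) l)"
    by (rule Fr_BB[OF is_ideal_idl idl_pw assms(1)])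
  then show ?thesis unfolding pw_pw k using Fr_plus[of k n z] by (simp add: add.commute)
qed

lemma nil_ideal: "is_ideal {a. nil x l j (vs a z)}" if z: "z \<in> ZZ j (idl x l)"
proof (rule is_idealI)
  have "vs 0 z \<in> BB j (idl x l)" by (rule ideal_mult_BB[OF is_ideal_idl z ideal_0[OF is_ideal_idl]])
  then show "0 \<in> {a. nil x l j (vs a z)}" unfolding nil_def using Fr_1 by (intro CollectI exI[of _ 0]) simp
  fix a b assume "a \<in> {a. nil x l j (vs a z)}" "b \<in> {a. nil x l j (vs a z)}"
  then obtain n k where 1: "Fr (p ^ n) (vs a z) \<in> BB j (idl (pw x n) l)" "Fr (p ^ k) (vs b z) \<in> BB j (idl (pw x k) l)" by (auto simp: nil_def)
  have "vs (a + b) z = vs a z + vs b z" by (simp add: vs_def fun_eq_iff distrib_right)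
  then have "Fr (p ^ max n k) (vs (a + b) z) \<in> BB j (idl (pw x (max n k)) l)"
    using V.subspace_add[OF subspace_BB[OF is_ideal_idl] nil_later[OF 1(1)] nil_later[OF 1(2)], of "max n k"] by (simp add: Fr_add)
  then show "a + b \<in> {a. nil x l j (vs a z)}" unfolding nil_def by blast
next
  fix r a assume "a \<in> {a. nil x l j (vs a z)}"
  then obtain n where n: "Fr (p ^ n) (vs a z) \<in> BB j (idl (pw x n) l)" by (auto simp: nil_def)
  have "vs (r * a) z = vs r (vs a z)" by (simp add: vs_def mult.assoc)
  then have "Fr (p ^ n) (vs (r * a) z) \<in> BB j (idl (pw x n) l)"
    using V.subspace_scale[OF subspace_BB[OF is_ideal_idl] n, of "r ^ (p ^ n)"] by (simp add: Fr_vs power_mult_distrib)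
  then show "r * a \<in> {a. nil x l j (vs a z)}" unfolding nil_def by blast
qed

text \<open>For a in the k2-th power of m, the image of az under the connecting homomorphism is
  nilpotent, so a Frobenius image of az lifts to a class v modulo one element fewer, and b in the
  k1-th power makes v nilpotent. The exponents add. They are independent of x because the induction
  hypothesis is applied to powers of x as well.\<close>

lemma nil_killed:
  assumes hyp: "\<And>j. j < t \<Longrightarrow> \<exists>k. \<forall>a\<in>idpow m k. \<forall>z\<in>ZZ j {0}. \<exists>n. Fr (p ^ n) (vs a z) \<in> BB j {0}"
  shows "l + j < t \<Longrightarrow> \<exists>k. \<forall>x. FR x t \<longrightarrow> (\<forall>a\<in>idpow m k. \<forall>z\<in>ZZ j (idl x l). nil x l j (vs a z))"
proof (induction l arbitrary: j)
  case 0
  then show ?case using hyp[of j] by (simp add: nil_def idl_0)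
next
  case (Suc l)
  obtain k1 where k1: "\<forall>x. FR x t \<longrightarrow> (\<forall>a\<in>idpow m k1. \<forall>z\<in>ZZ j (idl x l). nil x l j (vs a z))" using Suc.IH[of j] Suc.prems by auto
  obtain k2 where k2: "\<forall>x. FR x t \<longrightarrow> (\<forall>a\<in>idpow m k2. \<forall>z\<in>ZZ (Suc j) (idl x l). nil x l (Suc j) (vs a z))" using Suc.IH[of "Suc j"] Suc.prems by auto
  show ?case
  proof (intro exI[of _ "k1 + k2"] allI impI ballI)
    fix x a z assume x: "FR x t" and a: "a \<in> idpow m (k1 + k2)" and z: "z \<in> ZZ j (idl x (Suc l))"
    have lt: "l < t" using Suc.prems by simp
    have u: "colon (idl x' l) (x' l) \<subseteq> sat m (idl x' l)" if "FR x' t" for x' using that lt by (auto simp: FR_def)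
    have "idpow m (k1 + k2) \<subseteq> {a. nil x (Suc l) j (vs a z)}"
    proof (rule idpow_add_least[OF nil_ideal[OF z]])
      fix b a assume b: "b \<in> idpow m k1" and a: "a \<in> idpow m k2"
      obtain w where w: "w \<in> ZZ (Suc j) (idl x l)" "conn j (idl x l) (x l) z w"
        using conn_total[OF is_ideal_idl u[OF x]] z unfolding idl_Suc by blast
      obtain n where n: "Fr (p ^ n) (vs a w) \<in> BB (Suc j) (idl (pw x n) l)" using k2 x a w(1) unfolding nil_def by blast
      have c: "conn j (idl (pw x n) l) (pw x n l) (Fr (p ^ n) (vs a z)) (Fr (p ^ n) (vs a w))"
        by (rule Fr_conn[OF is_ideal_idl idl_pw conn_scale[OF is_ideal_idl w(2)]])
      have "Fr (p ^ n) (vs a z) \<in> ZZ j (idl (pw x n) (Suc l))"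
        by (rule Fr_ZZ[OF is_ideal_idl idl_pw V.subspace_scale[OF subspace_ZZ[OF is_ideal_idl] z]])
      then obtain v where v: "v \<in> ZZ j (idl (pw x n) l)" "Fr (p ^ n) (vs a z) - v \<in> BB j (idl (pw x n) (Suc l))"
        using conn_ker[OF is_ideal_idl _ n c] unfolding idl_Suc by blast
      \<comment> \<open>Frobenius turns the factor b into this power, which still lies in the k1-th
        power of m.\<close>
      define b' where "b' = b ^ (p ^ n)"
      obtain n' where n': "Fr (p ^ n') (vs b' v) \<in> BB j (idl (pw (pw x n) n') l)"
        using k1 FR_pw[OF x, of n] pow_idpow[OF b, of n] v(1) unfolding nil_def b'_def by blast
      have "Fr (p ^ n') (vs b' (Fr (p ^ n) (vs a z) - v)) \<in> BB j (idl (pw (pw x n) n') (Suc l))"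
        by (rule Fr_BB[OF is_ideal_idl idl_pw V.subspace_scale[OF subspace_BB[OF is_ideal_idl] v(2)]])
      moreover have "Fr (p ^ n') (vs b' v) \<in> BB j (idl (pw (pw x n) n') (Suc l))" using n' BB_mono[OF idl_mono[of l "Suc l"]] by auto
      ultimately have "Fr (p ^ n') (vs b' (Fr (p ^ n) (vs a z) - v)) + Fr (p ^ n') (vs b' v) \<in> BB j (idl (pw (pw x n) n') (Suc l))"
        by (rule V.subspace_add[OF subspace_BB[OF is_ideal_idl]])
      moreover have "vs b' (Fr (p ^ n) (vs a z) - v) + vs b' v = Fr (p ^ n) (vs (b * a) z)"
        unfolding b'_def Fr_vs by (simp add: vs_def fun_eq_iff right_diff_distrib power_mult_distrib mult.assoc)
      then have "Fr (p ^ n') (vs b' (Fr (p ^ n) (vs a z) - v)) + Fr (p ^ n') (vs b' v) = Fr (p ^ (n' + n)) (vs (b * a) z)"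
        by (simp add: Fr_plus flip: Fr_add)
      ultimately have "Fr (p ^ (n + n')) (vs (b * a) z) \<in> BB j (idl (pw x (n + n')) (Suc l))" unfolding pw_pw by (simp add: add.commute)
      then show "b * a \<in> {a. nil x (Suc l) j (vs a z)}" unfolding nil_def by blast
    qed
    then show "nil x (Suc l) j (vs a z)" using a by blast
  qed
qed

definition HSLb :: "nat \<Rightarrow> bool" where
  "HSLb j \<longleftrightarrow> (\<exists>h. \<forall>z\<in>ZZ j {0}. (\<exists>n. Fr (p ^ n) z \<in> BB j {0}) \<longrightarrow> Fr (p ^ h) z \<in> BB j {0})"

text \<open>The image of z under the connecting homomorphism is nilpotent, so e2 kills it and a
  Frobenius image of z lifts to v modulo one element fewer. Nilpotency of z only says that some
  Frobenius image of v vanishes modulo a power of the last element, hence is that power times a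
  class. The power lies in the N-th power of m, so the product is nilpotent; thus v is nilpotent and
  e1 applies.\<close>

lemma nil_bounded:
  assumes hsl: "\<And>j. j \<le> t \<Longrightarrow> HSLb j"
    and N: "\<And>l j x a z. l + j < t \<Longrightarrow> FR x t \<Longrightarrow> a \<in> idpow m N \<Longrightarrow> z \<in> ZZ j (idl x l) \<Longrightarrow> nil x l j (vs a z)"
  shows "l + j \<le> t \<Longrightarrow> \<exists>e. \<forall>x. FR x t \<longrightarrow> (\<forall>i<t. x i \<in> idpow m N) \<longrightarrow> (\<forall>z\<in>ZZ j (idl x l). nil x l j z \<longrightarrow> Fr (p ^ e) z \<in> BB j (idl (pw x e) l))"
proof (induction l arbitrary: j)
  case 0
  then have "HSLb j" using hsl by simp
  then obtain h where "\<forall>z\<in>ZZ j {0}. (\<exists>n. Fr (p ^ n) z \<in> BB j {0}) \<longrightarrow> Fr (p ^ h) z \<in> BB j {0}" unfolding HSLb_def by blast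
  then show ?case unfolding nil_def idl_0 by blast
next
  case (Suc l)
  obtain e1 where e1: "\<forall>x. FR x t \<longrightarrow> (\<forall>i<t. x i \<in> idpow m N) \<longrightarrow> (\<forall>z\<in>ZZ j (idl x l). nil x l j z \<longrightarrow> Fr (p ^ e1) z \<in> BB j (idl (pw x e1) l))"
    using Suc.IH[of j] Suc.prems by auto
  obtain e2 where e2: "\<forall>x. FR x t \<longrightarrow> (\<forall>i<t. x i \<in> idpow m N) \<longrightarrow> (\<forall>z\<in>ZZ (Suc j) (idl x l). nil x l (Suc j) z \<longrightarrow> Fr (p ^ e2) z \<in> BB (Suc j) (idl (pw x e2) l))"
    using Suc.IH[of "Suc j"] Suc.prems by auto
  have lt: "l < t" "l + j < t" using Suc.prems by auto
  have u: "colon (idl x l) (x l) \<subseteq> sat m (idl x l)" if "FR x t" for x using that lt by (auto simp: FR_def)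
  show ?case
  proof (intro exI[of _ "e2 + e1"] allI impI ballI)
    fix x z assume x: "FR x t" and d: "\<forall>i<t. x i \<in> idpow m N" and z: "z \<in> ZZ j (idl x (Suc l))" and nz: "nil x (Suc l) j z"
    obtain n where n: "Fr (p ^ n) z \<in> BB j (idl (pw x n) (Suc l))" using nz by (auto simp: nil_def)
    obtain w where w: "w \<in> ZZ (Suc j) (idl x l)" "conn j (idl x l) (x l) z w"
      using conn_total[OF is_ideal_idl u[OF x]] z unfolding idl_Suc by blast
    have cF: "conn j (idl (pw x k) l) (pw x k l) (Fr (p ^ k) z) (Fr (p ^ k) w)" for k by (rule Fr_conn[OF is_ideal_idl idl_pw w(2)])
    have "Fr (p ^ n) w \<in> BB (Suc j) (idl (pw x n) l)"
      using conn_BB[OF is_ideal_idl u[OF FR_pw[OF x]] _ Fr_ZZ[OF is_ideal_idl idl_pw w(1)] cF] n unfolding idl_Suc by blast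
    then have "nil x l (Suc j) w" unfolding nil_def by blast
    then have we: "Fr (p ^ e2) w \<in> BB (Suc j) (idl (pw x e2) l)" using e2 x d w(1) by blast
    define x' where "x' = pw x e2"
    have x': "FR x' t" "\<forall>i<t. x' i \<in> idpow m N" unfolding x'_def using FR_pw[OF x] pow_idpow d by auto
    have "Fr (p ^ e2) z \<in> ZZ j (idl x' (Suc l))" unfolding x'_def by (rule Fr_ZZ[OF is_ideal_idl idl_pw z])
    then obtain v where v: "v \<in> ZZ j (idl x' l)" "Fr (p ^ e2) z - v \<in> BB j (idl x' (Suc l))"
      using conn_ker[OF is_ideal_idl _ we cF] unfolding idl_Suc x'_def by blast
    have vF: "Fr (p ^ k) (Fr (p ^ e2) z) - Fr (p ^ k) v \<in> BB j (idl (pw x' k) (Suc l))" for k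
      using Fr_BB[OF is_ideal_idl idl_pw v(2)] by (simp add: Fr_diff)
    have "Fr (p ^ (e2 + n)) z \<in> BB j (idl (pw x (e2 + n)) (Suc l))" by (rule nil_later[OF n]) simp
    then have "Fr (p ^ n) (Fr (p ^ e2) z) \<in> BB j (idl (pw x' n) (Suc l))" unfolding x'_def pw_pw using Fr_plus[of n e2 z] by (simp add: add.commute)
    then have "Fr (p ^ n) (Fr (p ^ e2) z) - (Fr (p ^ n) (Fr (p ^ e2) z) - Fr (p ^ n) v) \<in> BB j (idl (pw x' n) (Suc l))"
      by (rule V.subspace_diff[OF subspace_BB[OF is_ideal_idl] _ vF])
    then have "Fr (p ^ n) v \<in> BB j (iadd (idl (pw x' n) l) (pw x' n l))" by (simp add: idl_Suc)
    then obtain r where r: "r \<in> ZZ j (idl (pw x' n) l)" "Fr (p ^ n) v - vs (pw x' n l) r \<in> BB j (idl (pw x' n) l)"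
      using reduction_ker[OF is_ideal_idl u[OF FR_pw[OF x'(1)]] Fr_ZZ[OF is_ideal_idl idl_pw v(1)]] by blast
    have "nil (pw x' n) l j (vs (pw x' n l) r)" using N[OF lt(2) FR_pw[OF x'(1)] pow_idpow r(1)] x'(2) lt(1) by blast
    then obtain n' where n': "Fr (p ^ n') (vs (pw x' n l) r) \<in> BB j (idl (pw (pw x' n) n') l)" by (auto simp: nil_def)
    have "Fr (p ^ n') (Fr (p ^ n) v - vs (pw x' n l) r) \<in> BB j (idl (pw (pw x' n) n') l)" by (rule Fr_BB[OF is_ideal_idl idl_pw r(2)])
    from V.subspace_add[OF subspace_BB[OF is_ideal_idl] this n'] have "Fr (p ^ (n + n')) v \<in> BB j (idl (pw x' (n + n')) l)"
      unfolding pw_pw using Fr_plus[of n' n v] by (simp add: Fr_diff add.commute)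
    then have "nil x' l j v" unfolding nil_def by blast
    then have "Fr (p ^ e1) v \<in> BB j (idl (pw x' e1) l)" using e1 x' v(1) by blast
    then have "Fr (p ^ e1) v \<in> BB j (idl (pw x' e1) (Suc l))" using BB_mono[OF idl_mono[of l "Suc l"]] by auto
    from V.subspace_add[OF subspace_BB[OF is_ideal_idl] vF[of e1] this]
    show "Fr (p ^ (e2 + e1)) z \<in> BB j (idl (pw x (e2 + e1)) (Suc l))"
      unfolding x'_def pw_pw using Fr_plus[of e1 e2 z] by (simp add: add.commute)
  qed
qed

subsection \<open>Bounding Frobenius exponents off the closed point\<close>

text \<open>The kernel of \<open>x l\<close> is a quotient of the module of one degree lower modulo
  one more element, which belongs to the class by induction. In degree 0 the module is killed by a
  power of m.\<close>

lemma ser_H: assumes x: "FR x n" shows "l \<le> n \<Longrightarrow> V.ser (map x [l..<n]) (BB (n - l) (idl x l)) (ZZ (n - l) (idl x l))"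
proof (induction rule: inc_induct)
  case base
  then show ?case using H0_artin[OF is_ideal_idl] H0_kill[OF is_ideal_idl] by simp
next
  case (step l)
  define j where "j = n - Suc l"
  have j: "n - l = Suc j" using step.hyps by (simp add: j_def)
  have I: "is_ideal (idl x l)" by (rule is_ideal_idl)
  have u: "colon (idl x l) (x l) \<subseteq> sat m (idl x l)" using x step.hyps by (auto simp: FR_def)
  have "V.ser (map x [Suc l..<n]) (BB (Suc j) (idl x l)) {z \<in> ZZ (Suc j) (idl x l). vs (x l) z \<in> BB (Suc j) (idl x l)}"
  proof (rule V.ser_subq[where D = "\<lambda>z y. conn j (idl x l) (x l) y z" and ?B2.0 = "BB j (idl x (Suc l))" and ?Z2.0 = "ZZ j (idl x (Suc l))"])
    show "linrel vs vs (\<lambda>z y. conn j (idl x l) (x l) y z)" using linrel_conn[OF I, of j "x l"] unfolding linrel_def by blast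
    show "V.ser (map x [Suc l..<n]) (BB j (idl x (Suc l))) (ZZ j (idl x (Suc l)))" using step.IH by (simp add: j_def)
    show "V.subspace (BB (Suc j) (idl x l))" by (rule subspace_BB[OF I])
    show "V.subspace {z \<in> ZZ (Suc j) (idl x l). vs (x l) z \<in> BB (Suc j) (idl x l)}" by (rule V.subspace_pre[OF subspace_ZZ[OF I] subspace_BB[OF I]])
    show "BB (Suc j) (idl x l) \<subseteq> {z \<in> ZZ (Suc j) (idl x l). vs (x l) z \<in> BB (Suc j) (idl x l)}"
      using BB_ZZ V.subspace_scale[OF subspace_BB[OF I]] by blast
    show "\<exists>y\<in>ZZ j (idl x (Suc l)). conn j (idl x l) (x l) y z" if "z \<in> {z \<in> ZZ (Suc j) (idl x l). vs (x l) z \<in> BB (Suc j) (idl x l)}" for z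
      unfolding idl_Suc using conn_surj[OF I] that by blast
    show "z \<in> BB (Suc j) (idl x l)" if "z \<in> {z \<in> ZZ (Suc j) (idl x l). vs (x l) z \<in> BB (Suc j) (idl x l)}" "y \<in> BB j (idl x (Suc l))" "conn j (idl x l) (x l) y z" for z y
      using conn_BB[OF I u _ _ that(3)] that(1,2) unfolding idl_Suc by blast
  qed
  then show ?case using step.hyps H_artin[OF I, of "Suc j"] by (simp add: j upt_conv_Cons)
qed

text \<open>The composite of the connecting homomorphisms \<open>H\<^sup>i(R/(x\<^sub>1,\<dots>,x\<^sub>l)) \<rightarrow> H\<^sup>i\<^sup>+\<^sup>l(R)\<close>.\<close>
primrec chn :: "(nat \<Rightarrow> 'a) \<Rightarrow> nat \<Rightarrow> nat \<Rightarrow> (nat \<Rightarrow> nat set \<Rightarrow> 'a) \<Rightarrow> (nat \<Rightarrow> nat set \<Rightarrow> 'a) \<Rightarrow> bool" where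
  "chn x 0 i y w \<longleftrightarrow> w = y"
| "chn x (Suc l) i y w \<longleftrightarrow> (\<exists>y'. y' \<in> ZZ (Suc i) (idl x l) \<and> conn i (idl x l) (x l) y y' \<and> chn x l (Suc i) y' w)"

lemma chn_total: "FR x l \<Longrightarrow> y \<in> ZZ i (idl x l) \<Longrightarrow> \<exists>w\<in>ZZ (i + l) {0}. chn x l i y w"
proof (induction l arbitrary: i y)
  case 0 then show ?case by (simp add: idl_0)
next
  case (Suc l)
  have u: "colon (idl x l) (x l) \<subseteq> sat m (idl x l)" using Suc.prems(1) by (auto simp: FR_def)
  obtain y' where y': "y' \<in> ZZ (Suc i) (idl x l)" "conn i (idl x l) (x l) y y'"
    using conn_total[OF is_ideal_idl u] Suc.prems(2) unfolding idl_Suc by blast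
  obtain w where "w \<in> ZZ (Suc i + l) {0}" "chn x l (Suc i) y' w" using Suc.IH[OF FR_mono[OF Suc.prems(1)] y'(1)] by auto
  then show ?case using y' by auto
qed

lemma chn_BB: "FR x l \<Longrightarrow> y \<in> BB i (idl x l) \<Longrightarrow> chn x l i y w \<Longrightarrow> w \<in> BB (i + l) {0}"
proof (induction l arbitrary: i y)
  case 0 then show ?case by (simp add: idl_0)
next
  case (Suc l)
  have u: "colon (idl x l) (x l) \<subseteq> sat m (idl x l)" using Suc.prems(1) by (auto simp: FR_def)
  obtain y' where y': "y' \<in> ZZ (Suc i) (idl x l)" "conn i (idl x l) (x l) y y'" "chn x l (Suc i) y' w" using Suc.prems(3) by auto
  have "y' \<in> BB (Suc i) (idl x l)" using conn_BB[OF is_ideal_idl u _ y'(1,2)] Suc.prems(2) unfolding idl_Suc by blast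
  then have "w \<in> BB (Suc i + l) {0}" using Suc.IH[OF FR_mono[OF Suc.prems(1)] _ y'(3)] by auto
  then show ?case by simp
qed

lemma chn_Fr: "chn x l i y w \<Longrightarrow> chn (pw x n) l i (Fr (p ^ n) y) (Fr (p ^ n) w)"
proof (induction l arbitrary: i y)
  case 0 then show ?case by simp
next
  case (Suc l)
  then obtain y' where y': "y' \<in> ZZ (Suc i) (idl x l)" "conn i (idl x l) (x l) y y'" "chn x l (Suc i) y' w" by auto
  have "Fr (p ^ n) y' \<in> ZZ (Suc i) (idl (pw x n) l)" by (rule Fr_ZZ[OF is_ideal_idl idl_pw y'(1)])
  moreover have "conn i (idl (pw x n) l) (pw x n l) (Fr (p ^ n) y) (Fr (p ^ n) y')" by (rule Fr_conn[OF is_ideal_idl idl_pw y'(2)])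
  ultimately show ?case using Suc.IH[OF y'(3)] by auto
qed

text \<open>By induction, for b in a power of m the class by dies under the first connecting
  homomorphism and lifts to a class v modulo l elements. All of \<open>idl x n\<close> kills v up to
  classes that vanish modulo the next element, so v lies in the common kernel of a module of the
  class \<open>ser\<close>, and a further power of m kills it.\<close>

lemma chn_kill:
  assumes x: "FR x n"
  shows "l \<le> n \<Longrightarrow> \<exists>c. \<forall>y\<in>ZZ (Suc n - l) (idl x l). (\<forall>a\<in>idl x n. vs a y \<in> BB (Suc n - l) (idl x l)) \<longrightarrow>
     (\<forall>w. chn x l (Suc n - l) y w \<longrightarrow> w \<in> BB (Suc n) {0} \<longrightarrow> (\<forall>b\<in>idpow m c. vs b y \<in> BB (Suc n - l) (idl x l)))"
proof (induction l)
  case 0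
  show ?case
    by (rule exI[of _ 0]) (auto simp: idl_0 intro: V.subspace_scale[OF subspace_BB[OF is_ideal_zero]])
next
  case (Suc l)
  define i where "i = n - l"
  have i: "Suc n - l = Suc i" "Suc n - Suc l = i" using Suc.prems by (auto simp: i_def)
  define I where "I = idl x n"
  define J where "J = idl x l"
  define K where "K = idl x (Suc l)"
  have J: "is_ideal J" and K: "is_ideal K" by (simp_all add: J_def K_def is_ideal_idl)
  have KJ: "K = iadd J (x l)" by (simp add: K_def J_def idl_Suc)
  have JK: "J \<subseteq> K" by (simp add: J_def K_def idl_mono)
  have u: "colon J (x l) \<subseteq> sat m J" using x Suc.prems by (auto simp: FR_def J_def)
  obtain c where c: "\<forall>y\<in>ZZ (Suc i) J. (\<forall>a\<in>I. vs a y \<in> BB (Suc i) J) \<longrightarrow>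
     (\<forall>w. chn x l (Suc i) y w \<longrightarrow> w \<in> BB (Suc n) {0} \<longrightarrow> (\<forall>b\<in>idpow m c. vs b y \<in> BB (Suc i) J))"
    using Suc unfolding i I_def J_def by auto
  define W where "W = {v \<in> ZZ i J. \<forall>a\<in>I. vs a v \<in> BB i K}"
  \<comment> \<open>\<open>ZZ i J\<close> modulo B' is the image of the degree i cohomology of R/J
    in that of R/K. It is a quotient of a module covered by \<open>ser_H\<close>, hence still in the
    class.\<close>
  define B' where "B' = BB i K \<inter> ZZ i J"
  have B': "V.subspace B'" unfolding B'_def by (rule V.subspace_inter[OF subspace_BB[OF K] subspace_ZZ[OF J]])
  have "V.ser (map x [l..<n]) B' (ZZ i J)"
  proof (rule V.ser_subq[where D = "(=)" and ?B2.0 = "BB i J" and ?Z2.0 = "ZZ i J"])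
    show "linrel vs vs (=)" by (rule linrelI) auto
    show "V.ser (map x [l..<n]) (BB i J) (ZZ i J)" unfolding i_def J_def by (rule ser_H[OF x]) (use Suc.prems in simp)
    show "V.subspace (ZZ i J)" by (rule subspace_ZZ[OF J])
    show "B' \<subseteq> ZZ i J" by (simp add: B'_def)
    show "y \<in> B'" if "y \<in> ZZ i J" "z \<in> BB i J" "y = z" for y z using that BB_mono[OF JK] by (auto simp: B'_def)
  qed (use B' in auto)
  then obtain d where d: "\<And>a w. a \<in> idpow m d \<Longrightarrow> w \<in> W \<Longrightarrow> vs a w \<in> B'"
  proof (rule V.ser_kill[where W = W])
    show "W \<subseteq> ZZ i J" by (auto simp: W_def)
    fix a w assume a: "a \<in> set (map x [l..<n])" and w: "w \<in> W"
    have "a \<in> I" using a idl_in[of _ n x] by (auto simp: I_def)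
    then show "vs a w \<in> B'" using w V.subspace_scale[OF subspace_ZZ[OF J]] by (auto simp: W_def B'_def)
  qed blast
  show ?case unfolding i
  proof (intro exI[of _ "d + c"] ballI impI allI)
    fix y w b
    assume y: "y \<in> ZZ i (idl x (Suc l))" and ay: "\<forall>a\<in>idl x n. vs a y \<in> BB i (idl x (Suc l))"
      and ch: "chn x (Suc l) i y w" and w: "w \<in> BB (Suc n) {0}" and b: "b \<in> idpow m (d + c)"
    have yK: "y \<in> ZZ i K" and ayK: "\<And>a. a \<in> I \<Longrightarrow> vs a y \<in> BB i K" using y ay by (auto simp: K_def I_def)
    obtain y' where y': "y' \<in> ZZ (Suc i) J" "conn i J (x l) y y'" "chn x l (Suc i) y' w" using ch by (auto simp: J_def)
    have cs: "conn i J (x l) (vs a y) (vs a y')" for a by (rule conn_scale[OF J y'(2)])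
    have "vs a y' \<in> BB (Suc i) J" if "a \<in> I" for a
      using conn_BB[OF J u _ V.subspace_scale[OF subspace_ZZ[OF J] y'(1)] cs] ayK[OF that] unfolding KJ by blast
    then have by': "vs b y' \<in> BB (Suc i) J" if "b \<in> idpow m c" for b using c y'(1,3) w that by blast
    have "idpow m (d + c) \<subseteq> {b. vs b y \<in> BB i K}"
    proof (rule idpow_add_least[OF V.is_ideal_ann[OF subspace_BB[OF K]]])
      fix a b assume a: "a \<in> idpow m d" and b: "b \<in> idpow m c"
      obtain v where v: "v \<in> ZZ i J" "vs b y - v \<in> BB i K"
        using conn_ker[OF J _ by'[OF b] cs] V.subspace_scale[OF subspace_ZZ[OF K] yK] unfolding KJ by blast
      have "v \<in> W" unfolding W_def
      proof (intro CollectI conjI ballI v(1))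
        fix e assume e: "e \<in> I"
        have "vs e v = vs b (vs e y) - vs e (vs b y - v)" by (simp add: vs_def fun_eq_iff right_diff_distrib mult.left_commute)
        then show "vs e v \<in> BB i K"
          using V.subspace_diff[OF subspace_BB[OF K] V.subspace_scale[OF subspace_BB[OF K] ayK[OF e]] V.subspace_scale[OF subspace_BB[OF K] v(2)]] by simp
      qed
      then have "vs a v \<in> BB i K" using d[OF a] by (auto simp: B'_def)
      then have "vs a (vs b y - v) + vs a v \<in> BB i K" by (rule V.subspace_add[OF subspace_BB[OF K] V.subspace_scale[OF subspace_BB[OF K] v(2)]])
      moreover have "vs a (vs b y - v) + vs a v = vs (a * b) y" by (simp add: vs_def fun_eq_iff right_diff_distrib mult.assoc)
      ultimately show "a * b \<in> {b. vs b y \<in> BB i K}" by simp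
    qed
    then show "vs b y \<in> BB i (idl x (Suc l))" using b by (auto simp: K_def)
  qed
qed

text \<open>The point is that C serves all U. Since y is a class modulo I, it is killed by I
  whatever U is, and \<open>chn_kill\<close> bounds it in terms of x alone; the remaining lift to
  degree 0 modulo I is bounded by \<open>H0_kill\<close>.\<close>

lemma top_kill:
  assumes x: "FR x n"
  shows "\<exists>C. \<forall>U s y w. colon (idl x n) U \<subseteq> sat m (idl x n) \<longrightarrow> s \<in> ZZ 0 (iadd (idl x n) U) \<longrightarrow> y \<in> ZZ 1 (idl x n) \<longrightarrow>
     conn 0 (idl x n) U s y \<longrightarrow> chn x n 1 y w \<longrightarrow> w \<in> BB (Suc n) {0} \<longrightarrow> (\<forall>b\<in>idpow m C. vs b s \<in> BB 0 (iadd (idl x n) U))"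
proof -
  define I where "I = idl x n"
  have I: "is_ideal I" by (simp add: I_def is_ideal_idl)
  obtain c where c: "\<forall>y\<in>ZZ 1 I. (\<forall>a\<in>I. vs a y \<in> BB 1 I) \<longrightarrow> (\<forall>w. chn x n 1 y w \<longrightarrow> w \<in> BB (Suc n) {0} \<longrightarrow> (\<forall>b\<in>idpow m c. vs b y \<in> BB 1 I))"
    using chn_kill[OF x, of n] by (auto simp: I_def)
  obtain d where d: "\<forall>a\<in>idpow m d. \<forall>z\<in>ZZ 0 I. vs a z \<in> BB 0 I" using H0_kill[OF I] by (rule V.mkillE)
  show ?thesis unfolding I_def[symmetric]
  proof (intro exI[of _ "d + c"] allI impI ballI)
    fix U s y w b
    assume s: "s \<in> ZZ 0 (iadd I U)" and y: "y \<in> ZZ 1 I" and D: "conn 0 I U s y" and ch: "chn x n 1 y w" and w: "w \<in> BB (Suc n) {0}" and b: "b \<in> idpow m (d + c)"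
    have K: "is_ideal (iadd I U)" by (rule is_ideal_iadd[OF I])
    have "\<forall>a\<in>I. vs a y \<in> BB 1 I" using ideal_mult_BB[OF I y] by blast
    then have by': "vs b y \<in> BB 1 I" if "b \<in> idpow m c" for b using c y ch w that by blast
    have "idpow m (d + c) \<subseteq> {b. vs b s \<in> BB 0 (iadd I U)}"
    proof (rule idpow_add_least[OF V.is_ideal_ann[OF subspace_BB[OF K]]])
      fix a b assume a: "a \<in> idpow m d" and b: "b \<in> idpow m c"
      have "conn 0 I U (vs b s) (vs b y)" by (rule conn_scale[OF I D])
      then obtain v where v: "v \<in> ZZ 0 I" "vs b s - v \<in> BB 0 (iadd I U)"
        using conn_ker[OF I V.subspace_scale[OF subspace_ZZ[OF K] s]] by'[OF b] by auto
      have "vs a v \<in> BB 0 (iadd I U)" using d a v(1) BB_mono[OF iadd_sup[of I U]] by blast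
      then have "vs a (vs b s - v) + vs a v \<in> BB 0 (iadd I U)" by (rule V.subspace_add[OF subspace_BB[OF K] V.subspace_scale[OF subspace_BB[OF K] v(2)]])
      moreover have "vs a (vs b s - v) + vs a v = vs (a * b) s" by (simp add: vs_def fun_eq_iff right_diff_distrib mult.assoc)
      ultimately show "a * b \<in> {b. vs b s \<in> BB 0 (iadd I U)}" by simp
    qed
    then show "vs b s \<in> BB 0 (iadd I U)" using b by blast
  qed
qed

lemma Fr_cst: "Fr q (cst r) e {} = r ^ q" by (simp add: Fr_def cst_def cprod_empty)

text \<open>A power U of a filter regular u is appended to the sequence. The bound for the longer
  sequence puts a Frobenius power of y in the saturation, the resulting class maps to a nilpotent
  class of degree l + 1 over R, and h more Frobenius steps kill that image. By
  \<open>top_kill\<close> a power of m independent of U then moves \<open>y ^ (p ^ (e + h))\<close>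
  into I plus a power of U.\<close>

lemma frob_sat_bounded:
  assumes hsl: "\<And>j. j \<le> d \<Longrightarrow> HSLb j" and dim: "\<And>x. FR x d \<Longrightarrow> sat m (idl x d) = UNIV"
  shows "l \<le> d \<Longrightarrow> \<exists>e. \<forall>x y. FR x l \<longrightarrow> (\<exists>n. y ^ (p ^ n) \<in> idl (pw x n) l) \<longrightarrow> y ^ (p ^ e) \<in> sat m (idl (pw x e) l)"
proof (induction rule: inc_induct)
  case base
  then show ?case using dim FR_pw by (intro exI[of _ 0]) auto
next
  case (step l)
  obtain e where e: "\<And>x y. FR x (Suc l) \<Longrightarrow> (\<exists>n. y ^ (p ^ n) \<in> idl (pw x n) (Suc l)) \<Longrightarrow> y ^ (p ^ e) \<in> sat m (idl (pw x e) (Suc l))"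
    using step.IH by blast
  have "HSLb (Suc l)" using hsl step.hyps by simp
  then obtain h where h: "\<And>z. z \<in> ZZ (Suc l) {0} \<Longrightarrow> (\<exists>n. Fr (p ^ n) z \<in> BB (Suc l) {0}) \<Longrightarrow> Fr (p ^ h) z \<in> BB (Suc l) {0}"
    unfolding HSLb_def by blast
  show ?case
  proof (intro exI[of _ "e + h"] allI impI)
    fix x y assume x: "FR x l" and ex: "\<exists>n. y ^ (p ^ n) \<in> idl (pw x n) l"
    obtain n where n: "y ^ (p ^ n) \<in> idl (pw x n) l" using ex by blast
    obtain u where u: "u \<in> m" "colon (idl x l) u \<subseteq> sat m (idl x l)" using FR_elem_ex[OF is_ideal_idl] by blast
    define I where "I = idl (pw x (e + h)) l"
    have I: "is_ideal I" by (simp add: I_def is_ideal_idl)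
    \<comment> \<open>C is chosen before the exponent k of u; otherwise letting k grow would prove
      nothing.\<close>
    obtain C where C: "\<forall>U s y w. colon I U \<subseteq> sat m I \<longrightarrow> s \<in> ZZ 0 (iadd I U) \<longrightarrow> y \<in> ZZ 1 I \<longrightarrow>
     conn 0 I U s y \<longrightarrow> chn (pw x (e + h)) l 1 y w \<longrightarrow> w \<in> BB (Suc l) {0} \<longrightarrow> (\<forall>b\<in>idpow m C. vs b s \<in> BB 0 (iadd I U))"
      using top_kill[OF FR_pw[OF x, of "e + h"]] unfolding I_def by blast
    have main: "b * y ^ (p ^ (e + h)) \<in> iadd I ((u ^ Suc k) ^ (p ^ (e + h)))" if b: "b \<in> idpow m C" for b k
    proof -
      define U where "U = u ^ Suc k"
      define x' where "x' = x(l := U)"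
      have xl: "idl (pw x' k) l = idl (pw x k) l" for k by (rule idl_cong) (simp add: x'_def)
      have xS: "idl (pw x' k) (Suc l) = iadd (idl (pw x k) l) (U ^ (p ^ k))" for k unfolding idl_Suc xl by (simp add: x'_def)
      have "idl x' i = idl x i" if "i \<le> l" for i by (rule idl_cong) (use that in \<open>simp add: x'_def\<close>)
      moreover have "colon (idl x l) U \<subseteq> sat m (idl x l)" unfolding U_def colon_def using colon_pow_sat[OF is_ideal_idl u(2)] by blast
      moreover have "U \<in> m" unfolding U_def by (rule ideal_pow[OF is_ideal_m u(1)]) simp
      ultimately have x': "FR x' (Suc l)" using x unfolding FR_def by (auto simp: less_Suc_eq x'_def)
      have cU: "colon (idl (pw x k) l) (U ^ (p ^ k)) \<subseteq> sat m (idl (pw x k) l)" for k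
      proof -
        have "colon (idl (pw x' k) l) (pw x' k l) \<subseteq> sat m (idl (pw x' k) l)" using FR_pw[OF x', of k] unfolding FR_def by blast
        then show ?thesis unfolding xl by (simp add: x'_def)
      qed
      define J where "J = idl (pw x e) l"
      have J: "is_ideal J" by (simp add: J_def is_ideal_idl)
      have JI: "i ^ (p ^ h) \<in> I" if "i \<in> J" for i using idl_pw[of i "pw x e" l h] that by (simp add: J_def I_def pw_pw)
      have "y ^ (p ^ n) \<in> idl (pw x' n) (Suc l)" using n iadd_sup unfolding xS by blast
      then have "y ^ (p ^ e) \<in> sat m (iadd J (U ^ (p ^ e)))" using e[OF x'] unfolding xS J_def by blast
      then have s: "cst (y ^ (p ^ e)) \<in> ZZ 0 (iadd J (U ^ (p ^ e)))" (is "?s \<in> _") by (rule cst_ZZ[OF is_ideal_iadd[OF J]])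
      obtain y1 where y1: "y1 \<in> ZZ (Suc 0) J" "conn 0 J (U ^ (p ^ e)) ?s y1"
        using conn_total[OF J _ s] cU[of e] unfolding J_def by blast
      obtain w where w: "w \<in> ZZ (Suc 0 + l) {0}" "chn (pw x e) l (Suc 0) y1 w"
        using chn_total[OF FR_pw[OF x]] y1(1) unfolding J_def by blast
      define I2 where "I2 = idl (pw x (e + n)) l"
      have I2: "is_ideal I2" by (simp add: I2_def is_ideal_idl)
      have JI2: "i ^ (p ^ n) \<in> I2" if "i \<in> J" for i using idl_pw[of i "pw x e" l n] that by (simp add: J_def I2_def pw_pw)
      have "y ^ (p ^ (e + n)) \<in> I2" 
      proof -
        have "(y ^ (p ^ n)) ^ (p ^ e) = y ^ (p ^ (n + e))" by (simp add: power_add power_mult)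
        then show ?thesis using idl_pw[OF n, of e] unfolding I2_def pw_pw add.commute[of e n] by (simp only:)
      qed
      \<comment> \<open>After n more Frobenius steps the power of y lies in the ideal of the
        sequence without U, so the class vanishes and its images are nilpotent.\<close>
      have "Fr (p ^ n) ?s \<in> BB 0 (iadd I2 ((U ^ (p ^ e)) ^ (p ^ n)))"
      proof (rule BB_ideal[where ?e0.0 = 0])
        show "Fr (p ^ n) ?s \<in> ZZ 0 (iadd I2 ((U ^ (p ^ e)) ^ (p ^ n)))"
          by (rule Fr_ZZ[OF is_ideal_iadd[OF I2] iadd_pw[OF I2 JI2] s])
        fix e' S assume "S \<in> csubs gs 0"
        then have "Fr (p ^ n) ?s e' S = y ^ (p ^ (e + n))" by (simp add: csubs_0 Fr_cst power_add flip: power_mult)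
        then show "Fr (p ^ n) ?s e' S \<in> iadd I2 ((U ^ (p ^ e)) ^ (p ^ n))" using \<open>y ^ (p ^ (e + n)) \<in> I2\<close> iadd_sup by auto
      qed
      then have "Fr (p ^ n) y1 \<in> BB (Suc 0) I2"
      proof (rule conn_BB[OF I2, rotated])
        show "colon I2 ((U ^ (p ^ e)) ^ (p ^ n)) \<subseteq> sat m I2" using cU[of "e + n"] by (simp add: I2_def power_add flip: power_mult)
        show "Fr (p ^ n) y1 \<in> ZZ (Suc 0) I2" by (rule Fr_ZZ[OF I2 JI2 y1(1)])
        show "conn 0 I2 ((U ^ (p ^ e)) ^ (p ^ n)) (Fr (p ^ n) ?s) (Fr (p ^ n) y1)" by (rule Fr_conn[OF I2 JI2 y1(2)])
      qed
      then have "Fr (p ^ n) w \<in> BB (Suc 0 + l) {0}"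
        using chn_BB[OF FR_pw[OF x] _ chn_Fr[OF w(2), of n, unfolded pw_pw]] unfolding I2_def by blast
      then have wB: "Fr (p ^ h) w \<in> BB (Suc l) {0}" using h w(1) by auto
      define U' where "U' = (U ^ (p ^ e)) ^ (p ^ h)"
      have U': "U' = U ^ (p ^ (e + h))" by (simp add: U'_def power_add flip: power_mult)
      have "vs b (Fr (p ^ h) ?s) \<in> BB 0 (iadd I U')"
      proof (rule C[rule_format, OF _ _ _ _ _ wB b])
        show "colon I U' \<subseteq> sat m I" unfolding U' I_def by (rule cU)
        show "Fr (p ^ h) ?s \<in> ZZ 0 (iadd I U')" unfolding U'_def by (rule Fr_ZZ[OF is_ideal_iadd[OF I] iadd_pw[OF I JI] s])
        show "Fr (p ^ h) y1 \<in> ZZ 1 I" using Fr_ZZ[OF I JI y1(1)] by simp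
        show "conn 0 I U' (Fr (p ^ h) ?s) (Fr (p ^ h) y1)" unfolding U'_def by (rule Fr_conn[OF I JI y1(2)])
        show "chn (pw x (e + h)) l 1 (Fr (p ^ h) y1) (Fr (p ^ h) w)" using chn_Fr[OF w(2), of h] by (simp add: pw_pw)
      qed
      then obtain e0 where "vs b (Fr (p ^ h) ?s) e0 {} \<in> iadd I U'" by (rule BB_0_get) blast
      then show ?thesis by (simp add: vs_def Fr_cst U' U_def power_add flip: power_mult)
    qed
    show "y ^ (p ^ (e + h)) \<in> sat m (idl (pw x (e + h)) l)" unfolding I_def[symmetric]
    proof (rule satI[of m C])
      fix b assume b: "b \<in> idpow m C"
      show "b * y ^ (p ^ (e + h)) \<in> I"
      proof (rule krull[OF I])
        fix N
        obtain i r where e': "b * y ^ (p ^ (e + h)) = i + r * (u ^ Suc N) ^ (p ^ (e + h))" "i \<in> I" using main[OF b, of N] by (rule iaddE)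
        have "u ^ Suc N \<in> idpow m N" using idpow_pow[OF u(1), of "Suc N"] idpow_anti[of N "Suc N" m] by auto
        then have "r * (u ^ Suc N) ^ (p ^ (e + h)) \<in> idpow m N" using ideal_mult[OF is_ideal_idpow pow_idpow] by blast
        then show "\<exists>i\<in>I. b * y ^ (p ^ (e + h)) - i \<in> idpow m N" using e' by (intro bexI[of _ i]) auto
      qed
    qed
  qed
qed

end

section \<open>Complete local rings\<close>

text \<open>The filtration is not assumed to consist of the powers of \<open>L 1\<close>. In the
  completion its members are kernels of projections, and they are identified with the powers only in
  \<open>idpow_low\<close>, by means of \<open>L_gen\<close>.\<close>

locale cpl =
  fixes L :: "nat \<Rightarrow> 'a::comm_ring_1 set"
  assumes L_0: "L 0 = UNIV" and L_ideal: "is_ideal (L n)" and L_Suc: "L (Suc n) \<subseteq> L n"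
    and L_mult: "x \<in> L i \<Longrightarrow> y \<in> L j \<Longrightarrow> x * y \<in> L (i + j)"
    and L_sep: "(\<And>n. x \<in> L n) \<Longrightarrow> x = 0"
    and L_comp: "(\<And>n. f (Suc n) - f n \<in> L n) \<Longrightarrow> \<exists>l. \<forall>n. l - f n \<in> L n"
    and L_one: "1 \<notin> L 1" and L_res: "x \<notin> L 1 \<Longrightarrow> \<exists>b. b * x - 1 \<in> L 1"
begin

lemma L_pow: "a \<in> L 1 \<Longrightarrow> a ^ k \<in> L k"
proof (induction k)
  case 0 then show ?case by (simp add: L_0)
next
  case (Suc k) then show ?case using L_mult[of a 1 "a ^ k" k] by simp
qed

lemma L_mult_left: "x \<in> L i \<Longrightarrow> r * x \<in> L i" using L_ideal ideal_mult by blast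

text \<open>Successive approximation: a remainder in \<open>X k\<close> is reduced to one in
  \<open>X (Suc k)\<close> by a combination of G with coefficients in \<open>L k\<close>. The
  coefficients of each g form a convergent series, and separatedness shows that the limits represent
  the given element.\<close>

lemma series:
  assumes G: "finite G" and X: "\<And>k. X k \<subseteq> L k"
    and st: "\<And>k x. x \<in> X k \<Longrightarrow> \<exists>c. (\<forall>g\<in>G. c g \<in> L k) \<and> x - (\<Sum>g\<in>G. c g * g) \<in> X (Suc k)"
  shows "X 0 \<subseteq> gen_ideal G"
proof
  fix x0 assume x0: "x0 \<in> X 0"
  have "\<exists>x. \<forall>k. (x k \<in> X k \<and> (k = 0 \<longrightarrow> x k = x0)) \<and> (\<exists>c. (\<forall>g\<in>G. c g \<in> L k) \<and> x (Suc k) = x k - (\<Sum>g\<in>G. c g * g))"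
    by (rule dependent_nat_choice) (use x0 st in fastforce)+
  then obtain x where x: "\<And>k. x k \<in> X k" "x 0 = x0" and "\<And>k. \<exists>c. (\<forall>g\<in>G. c g \<in> L k) \<and> x (Suc k) = x k - (\<Sum>g\<in>G. c g * g)" by blast
  then obtain c where c: "\<And>k g. g \<in> G \<Longrightarrow> c k g \<in> L k" "\<And>k. x (Suc k) = x k - (\<Sum>g\<in>G. c k g * g)" by metis
  define s where "s g n = (\<Sum>k<n. c k g)" for g n
  have "\<exists>l. \<forall>n. l - s g n \<in> L n" if "g \<in> G" for g by (rule L_comp) (simp add: s_def c(1) that)
  then obtain l where l: "\<And>g n. g \<in> G \<Longrightarrow> l g - s g n \<in> L n" by metis
  have e: "x0 = x n + (\<Sum>g\<in>G. s g n * g)" for n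
    by (induction n) (simp_all add: x(2) s_def c(2) distrib_right sum.distrib)
  have "x0 - (\<Sum>g\<in>G. l g * g) \<in> L n" for n
  proof -
    have "x0 - (\<Sum>g\<in>G. l g * g) = x n - (\<Sum>g\<in>G. g * (l g - s g n))"
      by (subst e[of n]) (simp add: right_diff_distrib sum_subtractf mult.commute)
    moreover have "(\<Sum>g\<in>G. g * (l g - s g n)) \<in> L n" by (rule ideal_sum[OF L_ideal]) (simp add: L_mult_left l)
    ultimately show ?thesis using ideal_diff[OF L_ideal] x(1)[of n] X[of n] by auto
  qed
  then have "x0 - (\<Sum>g\<in>G. l g * g) = 0" by (rule L_sep)
  moreover have "(\<Sum>g\<in>G. l g * g) \<in> gen_ideal G" by (intro ideal_sum ideal_mult is_ideal_gen gen_in)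
  ultimately show "x0 \<in> gen_ideal G" by simp
qed

text \<open>The geometric series for the inverse of bx, phrased as \<open>series\<close> with the
  single generator bx: y and y(bx) agree up to the next term of the filtration.\<close>

lemma L_unit: assumes "x \<notin> L 1" shows "\<exists>b. b * x = 1"
proof -
  obtain b where b: "b * x - 1 \<in> L 1" using L_res[OF assms] by blast
  have "L 0 \<subseteq> gen_ideal {b * x}"
  proof (rule series)
    fix k y assume y: "y \<in> L k"
    have "y - y * (b * x) = - (y * (b * x - 1))" by (simp add: right_diff_distrib)
    moreover have "y * (b * x - 1) \<in> L (Suc k)" using L_mult[OF y b] by simp
    ultimately show "\<exists>c. (\<forall>g\<in>{b * x}. c g \<in> L k) \<and> y - (\<Sum>g\<in>{b * x}. c g * g) \<in> L (Suc k)"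
      using y ideal_neg[OF L_ideal] by (intro exI[of _ "\<lambda>_. y"]) simp
  qed auto
  then have "1 \<in> gen_ideal {b * x}" by (auto simp: L_0)
  then obtain c where "1 = c * (b * x)" using gen_insert[of "b * x" "{}"] by (auto simp: gen_empty elim: iaddE)
  then show ?thesis by (metis mult.assoc)
qed

lemma L_local: "local_ring_max (L 1)"
proof -
  have sub: "J \<subseteq> L 1" if "is_ideal J" "J \<noteq> UNIV" for J

  proof
    fix x assume x: "x \<in> J"
    show "x \<in> L 1"
    proof (rule ccontr)
      assume "x \<notin> L 1"
      then obtain b where "b * x = 1" using L_unit by blast
      then show False using ideal_mult[OF that(1) x, of b] ideal_one[OF that(1)] that(2) by simp
    qed
  qed
  have u: "L 1 \<noteq> UNIV" using L_one by auto
  have "maximal_ideal (L 1)" unfolding maximal_ideal_def using u L_ideal sub by blast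
  moreover have "M = L 1" if "maximal_ideal M" for M
    using that sub[of M] L_ideal[of 1] u unfolding maximal_ideal_def by blast
  ultimately show ?thesis unfolding local_ring_max_def by blast
qed

text \<open>Cohen's criterion: the maximal counterexample \<open>P\<close> satisfies \<open>P = (s\<^sub>1,\<dots>,s\<^sub>k) + aP\<close> for every \<open>a \<notin> P\<close>.\<close>
lemma L_noetherian: assumes G0: "finite G0" "L 1 = gen_ideal G0" shows "noetherian_cring TYPE('a)"
  unfolding noetherian_cring_def
proof (rule ccontr)
  define fg where "fg P \<longleftrightarrow> (\<exists>S. finite S \<and> P = gen_ideal S)" for P :: "'a set"
  assume "\<not> (\<forall>I::'a set. is_ideal I \<longrightarrow> (\<exists>S. finite S \<and> I = gen_ideal S))"
  then have ne: "{P. is_ideal P \<and> \<not> fg P} \<noteq> {}" unfolding fg_def by blast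
  have "\<exists>M\<in>{P. is_ideal P \<and> \<not> fg P}. \<forall>X\<in>{P. is_ideal P \<and> \<not> fg P}. M \<subseteq> X \<longrightarrow> X = M"
  proof (rule subset_Zorn_nonempty[OF ne])
    fix C assume C: "C \<noteq> {}" "subset.chain {P. is_ideal P \<and> \<not> fg P} C"
    then have Ci: "\<And>P. P \<in> C \<Longrightarrow> is_ideal P" "\<And>P. P \<in> C \<Longrightarrow> \<not> fg P" and Cc: "\<And>P Q. P \<in> C \<Longrightarrow> Q \<in> C \<Longrightarrow> P \<subseteq> Q \<or> Q \<subseteq> P"
      unfolding subset.chain_def by auto
    have U: "is_ideal (\<Union>C)"
    proof (rule is_idealI)
      show "0 \<in> \<Union>C" using C(1) Ci(1) ideal_0 by blast
      show "x + y \<in> \<Union>C" if xy: "x \<in> \<Union>C" "y \<in> \<Union>C" for x y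
      proof -
        obtain P Q where PQ: "P \<in> C" "x \<in> P" "Q \<in> C" "y \<in> Q" using xy by blast
        then obtain R where "R \<in> C" "x \<in> R" "y \<in> R" using Cc[of P Q] by blast
        then show ?thesis using ideal_add[OF Ci(1)] by blast
      qed
      show "r * x \<in> \<Union>C" if "x \<in> \<Union>C" for r x using that Ci(1) ideal_mult by blast
    qed
    moreover have "\<not> fg (\<Union>C)"
    proof
      assume "fg (\<Union>C)"
      then obtain S where S: "finite S" "\<Union>C = gen_ideal S" unfolding fg_def by blast
      then have "S \<subseteq> \<Union>C" using gen_sup by blast
      then obtain P where P: "P \<in> C" "S \<subseteq> P" using finite_subset_Union_chain[OF S(1) _ C] by blast
      then have "gen_ideal S \<subseteq> P" using gen_least Ci(1) by blast
      then have "P = gen_ideal S" using S(2) P(1) by blast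
      then show False using Ci(2)[OF P(1)] S(1) unfolding fg_def by blast
    qed
    ultimately show "\<Union>C \<in> {P. is_ideal P \<and> \<not> fg P}" by blast
  qed
  then obtain P where P: "is_ideal P" "\<not> fg P" and mx: "\<And>X. is_ideal X \<Longrightarrow> \<not> fg X \<Longrightarrow> P \<subseteq> X \<Longrightarrow> X = P" by blast
  have "\<not> G0 \<subseteq> P"
  proof
    assume "G0 \<subseteq> P"
    then have LP: "L 1 \<subseteq> P" using gen_least[OF P(1)] G0(2) by blast
    have "P \<noteq> UNIV"
    proof
      assume "P = UNIV"
      then have "P = gen_ideal {1}" using ideal_one[OF is_ideal_gen gen_in, of "{1}"] by auto
      then show False using P(2) unfolding fg_def by blast
    qed
    then have "P = L 1" using L_local P(1) LP unfolding local_ring_max_def maximal_ideal_def by blast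
    then show False using P(2) G0 unfolding fg_def by blast
  qed
  then obtain a where a: "a \<notin> P" "a \<in> L 1" using G0(2) gen_sup by blast
  have "iadd P a \<noteq> P" using a(1) iadd_self[OF P(1)] by blast
  then have "fg (iadd P a)" using mx[OF is_ideal_iadd[OF P(1)]] iadd_sup by blast
  then obtain T where T: "finite T" "iadd P a = gen_ideal T" unfolding fg_def by blast
  \<comment> \<open>The components in P of the generators of P + (a) form a finite set S with P
    inside (S) + (a). The coefficient of a in an element of P then lies in P : a.\<close>
  have "\<forall>t\<in>T. \<exists>i r. t = i + r * a \<and> i \<in> P"
  proof
    fix t assume "t \<in> T"
    then have "t \<in> iadd P a" using T(2) gen_in by blast
    then show "\<exists>i r. t = i + r * a \<and> i \<in> P" by (rule iaddE) blast
  qed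
  then obtain i r where ir: "\<And>t. t \<in> T \<Longrightarrow> t = i t + r t * a \<and> i t \<in> P" by metis
  define S where "S = i ` T"
  have S: "finite S" "S \<subseteq> P" using T(1) ir by (auto simp: S_def)
  have "t \<in> iadd (gen_ideal S) a" if "t \<in> T" for t
    by (rule iaddI[of _ "r t"]) (use ir[OF that] gen_in[of "i t" S] that in \<open>metis S_def image_eqI add_diff_cancel_right'\<close>)
  then have PS: "P \<subseteq> iadd (gen_ideal S) a" using iadd_sup[of P a] T(2) gen_least[OF is_ideal_iadd[OF is_ideal_gen]] by blast
  have dec: "\<exists>s r. q = s + r * a \<and> s \<in> gen_ideal S \<and> r \<in> colon P a" if q: "q \<in> P" for q
  proof -
    obtain r s where e: "q = s + r * a" "s \<in> gen_ideal S" using PS q by (blast elim: iaddE)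
    have "s \<in> P" using e(2) gen_least[OF P(1) S(2)] by blast
    then have "r * a \<in> P" using e(1) q ideal_diff[OF P(1) q, of s] by simp
    then show ?thesis using e by (auto simp: colon_def)
  qed
  \<comment> \<open>Otherwise P : a is larger than P, hence finitely generated, and so is P = (S) +
    a(P : a).\<close>
  have "colon P a = P"
  proof (rule ccontr)
    assume "colon P a \<noteq> P"
    then have "fg (colon P a)" using mx[OF is_ideal_colon[OF P(1)]] colon_sup[OF P(1)] by blast
    then obtain T2 where T2: "finite T2" "colon P a = gen_ideal T2" unfolding fg_def by blast
    define V where "V = S \<union> (\<lambda>t. t * a) ` T2"
    have "colon P a \<subseteq> colon (gen_ideal V) a" unfolding T2(2)
      by (rule gen_least[OF is_ideal_colon[OF is_ideal_gen]]) (auto simp: colon_def V_def intro: gen_in)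
    then have "P \<subseteq> gen_ideal V" using dec gen_mono[of S V] ideal_add[OF is_ideal_gen, of _ V] by (fastforce simp: V_def colon_def)
    moreover have "gen_ideal V \<subseteq> P"
      using gen_in[of _ T2] T2(2) S(2) by (intro gen_least[OF P(1)]) (auto simp: V_def colon_def)
    ultimately have "P = gen_ideal V" by blast
    moreover have "finite V" using S T2 by (simp add: V_def)
    ultimately show False using P(2) unfolding fg_def by blast
  qed
  note cP = this
  \<comment> \<open>Now P = (S) + aP. Iterating leaves a remainder in a^k P, which tends to zero
    because a lies in \<open>L 1\<close>.\<close>
  have "{a ^ 0 * q | q. q \<in> P} \<subseteq> gen_ideal S"
  proof (rule series[OF S(1), where X = "\<lambda>k. {a ^ k * q | q. q \<in> P}"])
    show "{a ^ k * q | q. q \<in> P} \<subseteq> L k" for k using ideal_mult2[OF L_ideal L_pow[OF a(2)]] by auto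
    fix k x assume "x \<in> {a ^ k * q | q. q \<in> P}"
    then obtain q where q: "x = a ^ k * q" "q \<in> P" by blast
    obtain s r where sr: "q = s + r * a" "s \<in> gen_ideal S" "r \<in> P" using dec[OF q(2)] cP by blast
    obtain c where c: "s = (\<Sum>g\<in>S. c g * g)" using gen_sum_coeff[OF S(1) sr(2)] by blast
    have "x - (\<Sum>g\<in>S. (a ^ k * c g) * g) = a ^ Suc k * r"
      unfolding q(1) sr(1) c by (simp add: distrib_left sum_distrib_left mult_ac)
    then show "\<exists>c. (\<forall>g\<in>S. c g \<in> L k) \<and> x - (\<Sum>g\<in>S. c g * g) \<in> {a ^ Suc k * q | q. q \<in> P}"
      using sr(3) ideal_mult2[OF L_ideal L_pow[OF a(2)]] by (intro exI[of _ "\<lambda>g. a ^ k * c g"]) auto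
  qed
  then have "P \<subseteq> gen_ideal S" by auto
  then have "P = gen_ideal S" using gen_least[OF P(1) S(2)] by blast
  then show False using P(2) S(1) unfolding fg_def by blast
qed

lemma L_gen:
  assumes "finite G" "G \<subseteq> L n"
    and "\<And>k x. x \<in> L (n + k) \<Longrightarrow> \<exists>c. (\<forall>g\<in>G. c g \<in> L k) \<and> x - (\<Sum>g\<in>G. c g * g) \<in> L (n + Suc k)"
  shows "L n = gen_ideal G"
proof
  have a: "L (k + n) \<subseteq> L k" for k n by (induction n) (use L_Suc in auto)
  have "L (n + 0) \<subseteq> gen_ideal G" by (rule series[OF assms(1) _ assms(3)]) (use a[of _ n] in \<open>auto simp: add.commute\<close>)
  then show "L n \<subseteq> gen_ideal G" by simp
qed (rule gen_least[OF L_ideal assms(2)])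

lemma idpow_L: "idpow (L 1) n \<subseteq> L n"
proof (induction n)
  case (Suc n)
  show ?case by (rule idpow_Suc_least[OF L_ideal]) (use L_mult[of _ 1 _ n] Suc in auto)
qed (simp add: L_0)

end

section \<open>Completion of a local ring\<close>

text \<open>The ideal of the completion has to be a function of the type; the case distinction keeps the powers proper for every ring.\<close>
definition mI :: "'a::comm_ring_1 set" where
  "mI = (if is_ideal {x :: 'a. \<not> x dvd 1} then {x. \<not> x dvd 1} else {0})"

lemma is_ideal_mI: "is_ideal mI" by (simp add: mI_def is_ideal_zero)
lemma one_mI: "1 \<notin> mI" by (simp add: mI_def)

lemma (in nloc) mI_eq: "mI = m"
proof -
  have "{x. \<not> x dvd 1} = m" 
  proof (intro Collect_eqI[THEN trans, OF _ Collect_mem_eq] iffI)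
    show "x \<in> m" if h: "\<not> x dvd 1" for x by (rule ccontr, erule unit) (use h dvd_triv_right in metis)
    show "\<not> x dvd 1" if h: "x \<in> m" for x using ideal_mult2[OF is_ideal_m h] one_nm by (metis dvdE)
  qed
  then show ?thesis using is_ideal_m by (simp add: mI_def)
qed

text \<open>The inverse limit of the quotients by powers of \<open>mI\<close>, as a partial
  equivalence: its domain consists of the sequences whose n-th and next terms agree modulo the n-th
  power, and the n-th terms are compared modulo that power.\<close>

definition crel :: "(nat \<Rightarrow> 'a::comm_ring_1) \<Rightarrow> (nat \<Rightarrow> 'a) \<Rightarrow> bool" where
  "crel f g \<longleftrightarrow> (\<forall>n. f (Suc n) - f n \<in> idpow mI n) \<and> (\<forall>n. g (Suc n) - g n \<in> idpow mI n) \<and> (\<forall>n. f n - g n \<in> idpow mI n)"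

lemma idpow_zero: "0 \<in> idpow M n" using is_ideal_idpow ideal_0 by blast

lemma crel_const: "crel (\<lambda>_. a) (\<lambda>_. a)" by (simp add: crel_def idpow_zero)

quotient_type (overloaded) 'a compl = "nat \<Rightarrow> 'a::comm_ring_1" / partial: crel
proof (rule part_equivpI)
  show "\<exists>f :: nat \<Rightarrow> 'a. crel f f" using crel_const by blast
  show "symp (crel :: (nat \<Rightarrow> 'a) \<Rightarrow> _)"
  proof (rule sympI)
    fix f g :: "nat \<Rightarrow> 'a" assume f: "crel f g"
    have "g n - f n \<in> idpow mI n" for n using f ideal_neg[OF is_ideal_idpow, of "f n - g n" mI n] by (simp add: crel_def)
    then show "crel g f" using f by (simp add: crel_def)
  qed
  show "transp (crel :: (nat \<Rightarrow> 'a) \<Rightarrow> _)"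
  proof (rule transpI)
    fix f g h :: "nat \<Rightarrow> 'a" assume f: "crel f g" "crel g h"
    have "f n - h n \<in> idpow mI n" for n using f ideal_add[OF is_ideal_idpow, of "f n - g n" mI n "g n - h n"] by (simp add: crel_def)
    then show "crel f h" using f by (simp add: crel_def)
  qed
qed

lemma idpow_mult_diff: "a - a' \<in> idpow M n \<Longrightarrow> b - b' \<in> idpow M n \<Longrightarrow> a * b - a' * b' \<in> idpow M n"
proof -
  assume h: "a - a' \<in> idpow M n" "b - b' \<in> idpow M n"
  have "a * b - a' * b' = (a - a') * b + a' * (b - b')" by (simp add: algebra_simps)
  then show ?thesis using ideal_add[OF is_ideal_idpow ideal_mult2[OF is_ideal_idpow h(1)] ideal_mult[OF is_ideal_idpow h(2)]] by simp
qed
lemma idpow_add_diff: "a - a' \<in> idpow M n \<Longrightarrow> b - b' \<in> idpow M n \<Longrightarrow> (a + b) - (a' + b') \<in> idpow M n"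
  using ideal_add[OF is_ideal_idpow, of "a - a'" M n "b - b'"] by (simp add: algebra_simps)
lemma idpow_neg_diff: "a - a' \<in> idpow M n \<Longrightarrow> (- a) - (- a') \<in> idpow M n"
  using ideal_neg[OF is_ideal_idpow, of "a - a'" M n] by simp

lemma crel_add: "crel f f' \<Longrightarrow> crel g g' \<Longrightarrow> crel (\<lambda>n. f n + g n) (\<lambda>n. f' n + g' n)" by (simp add: crel_def idpow_add_diff)
lemma crel_mult: "crel f f' \<Longrightarrow> crel g g' \<Longrightarrow> crel (\<lambda>n. f n * g n) (\<lambda>n. f' n * g' n)" by (simp add: crel_def idpow_mult_diff)
lemma crel_neg: "crel f f' \<Longrightarrow> crel (\<lambda>n. - f n) (\<lambda>n. - f' n)" unfolding crel_def using idpow_neg_diff by blast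

instantiation compl :: (comm_ring_1) comm_ring_1
begin
lift_definition zero_compl :: "'a compl" is "\<lambda>_. 0" by (rule crel_const)
lift_definition one_compl :: "'a compl" is "\<lambda>_. 1" by (rule crel_const)
lift_definition plus_compl :: "'a compl \<Rightarrow> 'a compl \<Rightarrow> 'a compl" is "\<lambda>f g n. f n + g n" by (rule crel_add)
lift_definition times_compl :: "'a compl \<Rightarrow> 'a compl \<Rightarrow> 'a compl" is "\<lambda>f g n. f n * g n" by (rule crel_mult)
lift_definition uminus_compl :: "'a compl \<Rightarrow> 'a compl" is "\<lambda>f n. - f n" by (rule crel_neg)
definition minus_compl :: "'a compl \<Rightarrow> 'a compl \<Rightarrow> 'a compl" where "minus_compl x y = x + - y"
instance
proof
  fix a b c :: "'a compl"
  show "a + b + c = a + (b + c)" by transfer (simp only: add.assoc, intro crel_add)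
  show "a + b = b + a" by transfer (subst add.commute, intro crel_add)
  show "0 + a = a" by transfer (simp only: add_0)
  show "- a + a = 0" by transfer (simp only: left_minus, rule crel_const)
  show "a - b = a + - b" by (rule minus_compl_def)
  show "a * b * c = a * (b * c)" by transfer (simp only: mult.assoc, intro crel_mult)
  show "a * b = b * a" by transfer (subst mult.commute, intro crel_mult)
  show "1 * a = a" by transfer (simp only: mult_1)
  show "(a + b) * c = a * c + b * c" by transfer (simp only: distrib_right, intro crel_add crel_mult)
  show "(0::'a compl) \<noteq> 1"
  proof (transfer, rule notI)
    assume "crel (\<lambda>_. 0::'a) (\<lambda>_. 1)"
    then have "(0::'a) - 1 \<in> idpow mI (Suc 0)" unfolding crel_def by blast
    then have "- 1 \<in> (mI :: 'a set)" by (simp add: idpow_1[OF is_ideal_mI] del: idpow.simps)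
    then have "- (- 1) \<in> (mI :: 'a set)" by (rule ideal_neg[OF is_ideal_mI])
    then show False using one_mI[where ?'a = 'a] by simp
  qed
qed
end

section \<open>The embedding of the ring and the filtration of the completion\<close>

lift_definition emb :: "'a::comm_ring_1 \<Rightarrow> 'a compl" is "\<lambda>a n. a" by (rule crel_const)
text \<open>The kernel of the projection of the completion onto the ring modulo the n-th power of
  \<open>mI\<close>.\<close>

lift_definition low :: "nat \<Rightarrow> 'a::comm_ring_1 compl \<Rightarrow> bool" is "\<lambda>n f. f n \<in> idpow mI n"
  unfolding crel_def by (rule ideal_diff_iff[OF is_ideal_idpow]) blast


lemma emb_add: "emb (a + b) = emb a + emb b" by transfer (rule crel_const)
lemma emb_mult: "emb (a * b) = emb a * emb b" by transfer (rule crel_const)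
lemma emb_neg: "emb (- a) = - emb a" by transfer (rule crel_const)
lemma emb_0: "emb 0 = 0" by transfer (rule crel_const)
lemma emb_1: "emb 1 = 1" by transfer (rule crel_const)
lemma emb_diff: "emb (a - b) = emb a - emb b" using emb_add[of a "- b"] by (simp add: emb_neg)
lemma emb_sum: "emb (sum f A) = (\<Sum>a\<in>A. emb (f a))" by (induction A rule: infinite_finite_induct) (simp_all add: emb_0 emb_add)
lemma emb_prod: "emb (prod f A) = (\<Prod>a\<in>A. emb (f a))" by (induction A rule: infinite_finite_induct) (simp_all add: emb_1 emb_mult)
lemma emb_power: "emb (a ^ n) = emb a ^ n" by (induction n) (simp_all add: emb_1 emb_mult)
lemma emb_of_nat: "emb (of_nat n) = of_nat n" by (induction n) (simp_all add: emb_0 emb_1 emb_add)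
lemma low_emb: "low n (emb a) \<longleftrightarrow> a \<in> idpow mI n" by transfer simp
lemma low_approx: "\<exists>a. low n (x - emb a)" 
  unfolding minus_compl_def
proof (transfer)
  fix n and f :: "nat \<Rightarrow> 'a"
  show "\<exists>a. f n + - a \<in> idpow mI n" by (rule exI[of _ "f n"]) (simp add: idpow_zero)
qed

lemma coherent_low: assumes "crel f f" "f n \<in> idpow mI n" shows "f (n + k) \<in> idpow mI n"
proof (induction k)
  case 0 then show ?case using assms by simp
next
  case (Suc k)
  have "f (Suc (n + k)) - f (n + k) \<in> idpow mI n" using assms(1) idpow_anti[of n "n + k" mI] by (auto simp: crel_def)
  then show ?case using Suc ideal_diff_iff[OF is_ideal_idpow] by auto
qed

lemma low_0: "low 0 x" by transfer simp
lemma low_zero: "low n 0" by transfer (rule idpow_zero)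
lemma low_add: "low n x \<Longrightarrow> low n y \<Longrightarrow> low n (x + y)" by transfer (rule ideal_add[OF is_ideal_idpow])
lemma low_mult_left: "low n x \<Longrightarrow> low n (r * x)" by transfer (rule ideal_mult[OF is_ideal_idpow])
lemma is_ideal_low: "is_ideal {x. low n x}" by (rule is_idealI) (auto simp: low_zero low_add low_mult_left)
lemma low_Suc: "low (Suc n) x \<Longrightarrow> low n x"
proof (transfer)
  fix n and f :: "nat \<Rightarrow> 'a" assume f: "crel f f" "f (Suc n) \<in> idpow mI (Suc n)"
  have "f (Suc n) \<in> idpow mI n" using f(2) idpow_Suc_sub by blast
  moreover have "f (Suc n) - f n \<in> idpow mI n" using f(1) by (simp add: crel_def)
  ultimately show "f n \<in> idpow mI n" using ideal_diff_iff[OF is_ideal_idpow] by blast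
qed
lemma low_mult: "low i x \<Longrightarrow> low j y \<Longrightarrow> low (i + j) (x * y)"
proof (transfer)
  fix i j and f g :: "nat \<Rightarrow> 'a" assume "crel f f" "crel g g" "f i \<in> idpow mI i" "g j \<in> idpow mI j"
  then show "f (i + j) * g (i + j) \<in> idpow mI (i + j)"
    using coherent_low[of f i j] coherent_low[of g j i] idpow_mult by (metis add.commute)
qed
lemma low_sep: assumes "\<And>n. low n x" shows "x = 0"
proof -
  have "\<forall>n. low n x \<Longrightarrow> x = 0"
  proof (transfer)
    fix f :: "nat \<Rightarrow> 'a" assume f: "crel f f" "\<forall>n. f n \<in> idpow mI n"
    then show "crel f (\<lambda>_. 0)" by (simp add: crel_def idpow_zero)
  qed
  then show ?thesis using assms by blast
qed
lemma low_diff: "low n x \<Longrightarrow> low n y \<Longrightarrow> low n (x - y)" using ideal_diff[OF is_ideal_low, of x n y] by simp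
text \<open>Each \<open>X n\<close> is approximated by a ring element \<open>a n\<close> with the
  same n-th component. The sequence a is itself coherent, and the element that it represents is the
  limit.\<close>

lemma low_comp:
  fixes X :: "nat \<Rightarrow> 'a::comm_ring_1 compl"
  assumes X: "\<And>n. low n (X (Suc n) - X n)" shows "\<exists>l. \<forall>n. low n (l - X n)"
proof -
  define a where "a n = (SOME a. low n (X n - emb a))" for n
  have a: "low n (X n - emb (a n))" for n unfolding a_def by (rule someI_ex[OF low_approx])
  have "low n (emb (a (Suc n) - a n))" for n
  proof -
    have "emb (a (Suc n) - a n) = (X n - emb (a n)) + ((X (Suc n) - X n) - (X (Suc n) - emb (a (Suc n))))" by (simp add: emb_diff)
    then show ?thesis using low_add[OF a[of n] low_diff[OF X[of n] low_Suc[OF a[of "Suc n"]]]] by simp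
  qed
  then have c: "crel a a" by (simp add: crel_def low_emb idpow_zero)
  have "\<exists>l. \<forall>n. low n (l - emb (a n))" unfolding minus_compl_def
  proof (transfer fixing: a)
    show "\<exists>l\<in>{f. crel f f}. \<forall>n. l n + - a n \<in> idpow mI n" using c by (intro bexI[of _ a]) (auto simp: idpow_zero)
  qed
  then obtain l where l: "\<And>n. low n (l - emb (a n))" by blast
  have "low n (l - X n)" for n using low_diff[OF l a, of n] by simp
  then show ?thesis by blast
qed

context nloc begin

sublocale C: cpl "\<lambda>n. {x :: 'a compl. low n x}"
proof
  show "1 \<notin> {x :: 'a compl. low 1 x}" using low_emb[of 1 "1::'a"] one_nm by (simp add: emb_1 mI_eq idpow_1[OF is_ideal_m] del: idpow.simps)
  show "\<exists>b. b * x - 1 \<in> {x :: 'a compl. low 1 x}" if x: "x \<notin> {x. low 1 x}" for x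
  proof -
    obtain a where a: "low 1 (x - emb a)" using low_approx by blast
    have "\<not> low 1 (emb a)" using x low_add[OF a, of "emb a"] by auto
    then have "a \<notin> m" by (simp add: low_emb mI_eq idpow_1[OF is_ideal_m] del: idpow.simps)
    then obtain b where b: "b * a = 1" by (rule unit)
    have "emb b * x - 1 = emb b * (x - emb a)" by (simp add: right_diff_distrib b emb_1 flip: emb_mult)
    then show ?thesis using low_mult_left[OF a] by (intro exI[of _ "emb b"]) simp
  qed
qed (auto simp: low_0 intro: is_ideal_low low_Suc low_mult low_sep low_comp)

lemma emb_eq_0: "emb (a :: 'a) = 0 \<longleftrightarrow> a = 0"
proof
  assume "emb a = 0"
  then have "a \<in> idpow m n" for n using low_zero[of n, where ?'a = 'a] low_emb[of n a] by (simp add: mI_eq)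
  then show "a = 0" by (rule krull_0)
qed (simp add: emb_0)

lemma emb_inj: "inj (emb :: 'a \<Rightarrow> _)"
  using emb_eq_0 by (intro injI) (metis emb_diff eq_iff_diff_eq_0)

text \<open>Control of the coefficients, and not only membership in the ideal of G, is what makes
  the series in \<open>compl_gen\<close> converge.\<close>

lemma idpow_coeff:
  assumes G: "finite G" "idpow m n = gen_ideal G" and x: "x \<in> idpow m (n + k)"
  shows "\<exists>c. (\<forall>g\<in>G. c g \<in> idpow m k) \<and> x = (\<Sum>g\<in>G. c g * g)"
proof -
  define J where "J = {x. \<exists>c. (\<forall>g\<in>G. c g \<in> idpow m k) \<and> x = (\<Sum>g\<in>G. c g * g)}"
  have "is_ideal J"
  proof (rule is_idealI)
    show "0 \<in> J" unfolding J_def by (intro CollectI exI[of _ "\<lambda>_. 0"]) (simp add: idpow_zero)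
    show "x + y \<in> J" if xy: "x \<in> J" "y \<in> J" for x y
    proof -
      obtain c d where "\<forall>g\<in>G. c g \<in> idpow m k" "x = (\<Sum>g\<in>G. c g * g)" "\<forall>g\<in>G. d g \<in> idpow m k" "y = (\<Sum>g\<in>G. d g * g)" using xy by (auto simp: J_def)
      then show ?thesis unfolding J_def
        by (intro CollectI exI[of _ "\<lambda>g. c g + d g"]) (simp add: ideal_add[OF is_ideal_idpow] distrib_right sum.distrib)
    qed
    show "r * x \<in> J" if x: "x \<in> J" for r x
    proof -
      obtain c where "\<forall>g\<in>G. c g \<in> idpow m k" "x = (\<Sum>g\<in>G. c g * g)" using x by (auto simp: J_def)
      then show ?thesis unfolding J_def
        by (intro CollectI exI[of _ "\<lambda>g. r * c g"]) (simp add: ideal_mult[OF is_ideal_idpow] sum_distrib_left mult.assoc)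
    qed
  qed
  moreover have "a * b \<in> J" if a: "a \<in> idpow m n" and b: "b \<in> idpow m k" for a b
  proof -
    obtain c where c: "a = (\<Sum>g\<in>G. c g * g)" using gen_sum_coeff[OF G(1)] a unfolding G(2) by blast
    have "a * b = (\<Sum>g\<in>G. (c g * b) * g)" unfolding c sum_distrib_right by (rule sum.cong) (simp_all add: mult_ac)
    then show ?thesis unfolding J_def
      by (intro CollectI exI[of _ "\<lambda>g. c g * b"] conjI ballI ideal_mult[OF is_ideal_idpow b])
  qed
  ultimately have "idpow m (n + k) \<subseteq> J" by (rule idpow_add_least)
  then show ?thesis using x by (auto simp: J_def)
qed

text \<open>Ring elements approximate those of the completion, and a ring element of the (n+k)-th
  power of m is a combination of G with coefficients in the k-th power. Successive approximation
  does the rest.\<close>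

lemma compl_gen: assumes G: "finite G" "idpow m n = gen_ideal G" shows "{x. low n x} = gen_ideal (emb ` G)"
proof (rule C.L_gen)
  show "finite (emb ` G)" using G(1) by simp
  show "emb ` G \<subseteq> {x. low n x}" using gen_in[of _ G] G(2) by (auto simp: low_emb mI_eq)
  fix k and x :: "'a compl" assume x: "x \<in> {x. low (n + k) x}"
  obtain a where a: "low (n + Suc k) (x - emb a)" using low_approx by blast
  then have "low (n + k) (x - emb a)" using low_Suc by simp
  then have "low (n + k) (emb a)" using low_diff[of "n + k" x "x - emb a"] x by simp
  then have "a \<in> idpow m (n + k)" by (simp add: low_emb mI_eq)
  from idpow_coeff[OF G this] obtain c where c: "\<forall>g\<in>G. c g \<in> idpow m k" "a = (\<Sum>g\<in>G. c g * g)" by blast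
  have "(\<Sum>g\<in>emb ` G. emb (c (inv emb g)) * g) = (\<Sum>g\<in>G. emb (c (inv emb (emb g))) * emb g)"
    by (subst sum.reindex) (use emb_inj in \<open>auto intro: inj_on_subset\<close>)
  also have "\<dots> = emb a" by (simp add: c(2) emb_sum emb_mult inv_f_f[OF emb_inj])
  finally show "\<exists>c. (\<forall>g\<in>emb ` G. c g \<in> {x. low k x}) \<and> x - (\<Sum>g\<in>emb ` G. c g * g) \<in> {x. low (n + Suc k) x}"
    using a c(1) by (intro exI[of _ "\<lambda>g. emb (c (inv emb g))"]) (auto simp: inv_f_f[OF emb_inj] low_emb mI_eq)
qed

lemma emb_idpow: "a \<in> idpow m n \<Longrightarrow> emb a \<in> idpow {x. low 1 x} n"
proof (induction n arbitrary: a)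
  case (Suc n)
  have "idpow m (Suc n) \<subseteq> {a. emb a \<in> idpow {x. low 1 x} (Suc n)}"
  proof (rule idpow_Suc_least)
    show "is_ideal {a. emb a \<in> idpow {x. low 1 x} (Suc n)}"
      by (rule is_idealI) (simp_all add: emb_0 emb_add emb_mult idpow_zero ideal_add[OF is_ideal_idpow] ideal_mult[OF is_ideal_idpow] del: idpow.simps)
    fix a b assume "a \<in> m" "b \<in> idpow m n"
    then show "a * b \<in> {a. emb a \<in> idpow {x. low 1 x} (Suc n)}"
      unfolding mem_Collect_eq emb_mult by (intro idpow_mult1 Suc.IH) (simp_all add: low_emb mI_eq idpow_1[OF is_ideal_m] del: idpow.simps)
  qed
  then show ?case using Suc.prems by blast
qed simp

lemma idpow_low: "idpow {x :: 'a compl. low 1 x} n = {x. low n x}"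
proof (rule subset_antisym[OF C.idpow_L])
  obtain G where G: "finite G" "idpow m n = gen_ideal G" using fin_gen[OF is_ideal_idpow] by metis
  show "{x :: 'a compl. low n x} \<subseteq> idpow {x. low 1 x} n" unfolding compl_gen[OF G]
    by (rule gen_least[OF is_ideal_idpow]) (use emb_idpow G(2) gen_in in blast)
qed

lemma low_nloc: "nloc {x :: 'a compl. low 1 x}"
proof
  obtain G where G: "finite G" "m = gen_ideal G" using fin_gen[OF is_ideal_m] by metis
  show "noetherian_cring TYPE('a compl)"
  proof (rule C.L_noetherian[OF _ compl_gen[OF G(1)]])
    show "finite (emb ` G)" using G(1) by simp
    show "idpow m 1 = gen_ideal G" unfolding One_nat_def idpow_1[OF is_ideal_m] by (rule G(2))
  qed
  show "local_ring_max {x :: 'a compl. low 1 x}" by (rule C.L_local)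
qed

lemma low_complete: "nloc.complete {x :: 'a compl. low 1 x}"
  unfolding nloc.complete_def[OF low_nloc] idpow_low using low_comp by auto

end

context frob begin

section \<open>The nilpotency bound, over a complete ring and by descent\<close>

lemma HSLb_complete: assumes complete shows "HSLb j"
proof -
  have z: "is_ideal {0 :: 'a}" by (rule is_ideal_zero)
  have P: "i ^ (p ^ n) \<in> {0 :: 'a}" if "i \<in> {0}" for i n using that p2 by (simp add: power_0_left)
  have "\<exists>e. \<forall>z\<in>ZZ j {0}. (\<exists>n. (Fr p ^^ n) z \<in> BB j {0}) \<longrightarrow> (Fr p ^^ e) z \<in> BB j {0}"
  proof (rule V.HSL[OF assms H_artin[OF z] _ _ _ _ _ p2])
    show "\<exists>n. \<forall>a\<in>idpow m n. vs a s \<in> BB j {0}" if "s \<in> ZZ j {0}" for s by (rule torsion[OF z that])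
    show "Fr p (x + y) = Fr p x + Fr p y" for x y using Fr_add[of 1] by simp
    show "Fr p (vs a x) = vs (a ^ p) (Fr p x)" for a x by (rule Fr_vs)
    show "Fr p x \<in> BB j {0}" if "x \<in> BB j {0}" for x using Fr_BB[OF z P that, of 1] by simp
    show "Fr p x \<in> ZZ j {0}" if "x \<in> ZZ j {0}" for x using Fr_ZZ[OF z P that, of 1] by simp
  qed
  then show ?thesis unfolding HSLb_def Fr_funpow .
qed

lemma low_frob: "frob {x :: 'a compl. low 1 x} (map emb gs) p"
proof -
  interpret R: nloc "{x :: 'a compl. low 1 x}" by (rule low_nloc)
  have "{x. low 1 x} = gen_ideal (emb ` set gs)" by (rule compl_gen) (use gs idpow_1[OF is_ideal_m] in auto)
  moreover have "CHAR('a compl) = p"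
  proof (rule CHAR_eqI)
    show "of_nat p = (0 :: 'a compl)" using emb_of_nat[of p, where ?'a = 'a] char_p by (metis emb_0 of_nat_CHAR)
    fix n assume "of_nat n = (0 :: 'a compl)"
    then have "emb (of_nat n :: 'a) = 0" by (simp add: emb_of_nat)
    then show "p dvd n" using char_p by (simp add: emb_eq_0 of_nat_eq_0_iff_char_dvd)
  qed
  ultimately show ?thesis by unfold_locales (use prime_p in auto)
qed

lemma emb_cprod: "S \<subseteq> {..<length gs} \<Longrightarrow> cprod (map emb gs) S = emb (cprod gs S)"
  unfolding cprod_def emb_prod by (rule prod.cong) auto
lemma emb_koszul: "T \<subseteq> {..<length gs} \<Longrightarrow> koszul (map emb gs) e (\<lambda>S. emb (c S)) T = emb (koszul gs e c T)"
  unfolding koszul_def emb_sum by (rule sum.cong) (auto simp: emb_mult emb_power ksg_def emb_neg emb_1)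
lemma csubs_map: "csubs (map f xs) k = csubs xs k" by (simp add: csubs_def)

text \<open>The exponent h found over the completion serves R as well. A cochain over R that is a
  coboundary over the completion has a primitive there; approximating this primitive by ring
  elements places the cochain in the m-adic closure of the coboundaries over R, and these are closed
  by \<open>closed_submodule\<close>.\<close>

theorem HSLb_all: "HSLb j"
proof -
  interpret R: frob "{x :: 'a compl. low 1 x}" "map emb gs" p by (rule low_frob)
  obtain h where h: "\<forall>z\<in>R.ZZ j {0}. (\<exists>n. R.Fr (p ^ n) z \<in> R.BB j {0}) \<longrightarrow> R.Fr (p ^ h) z \<in> R.BB j {0}"
    using R.HSLb_complete[OF low_complete] unfolding R.HSLb_def by blast
  have sub: "S \<subseteq> {..<length gs}" if "S \<in> csubs gs k" for S k using that by (simp add: csubs_def)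
  have P: "i ^ (p ^ n) \<in> {0 :: 'b::comm_ring_1}" if "i \<in> {0}" for i n using that p2 by (simp add: power_0_left)
  show ?thesis unfolding HSLb_def
  proof (intro exI[of _ h] ballI impI)
    fix z assume z: "z \<in> ZZ j {0}" and "\<exists>n. Fr (p ^ n) z \<in> BB j {0}"
    then obtain n where n: "Fr (p ^ n) z \<in> BB j {0}" by blast
    define E where "E = (\<lambda>e S. emb (z e S))"
    have EF: "R.Fr q E e S = emb (Fr q z e S)" if "S \<in> csubs gs k" for q e S k
      by (simp add: R.Fr_def Fr_def E_def emb_cprod[OF sub[OF that]] emb_mult emb_power)
    obtain e0 where e0: "\<forall>e\<ge>e0. (\<forall>S\<in>csubs gs j. z (Suc e) S - cprod gs S * z e S \<in> {0}) \<and> (\<forall>T\<in>csubs gs (Suc j). koszul gs e (z e) T \<in> {0})"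
      using z unfolding ZZ_def by blast
    have E: "E \<in> R.ZZ j {0}" unfolding R.ZZ_def csubs_map
    proof (intro CollectI exI[of _ e0] allI impI conjI ballI)
      fix e assume e: "e0 \<le> e"
      show "E (Suc e) S - cprod (map emb gs) S * E e S \<in> {0}" if S: "S \<in> csubs gs j" for S
        using e0 e S by (simp add: E_def emb_cprod[OF sub[OF S]] flip: emb_mult)
      show "koszul (map emb gs) e (E e) T \<in> {0}" if T: "T \<in> csubs gs (Suc j)" for T
        using e0 e T by (simp add: E_def emb_koszul[OF sub[OF T]] emb_0)
    qed
    have RF: "R.Fr (p ^ n) E \<in> R.ZZ j {0}" for n by (rule R.Fr_ZZ[OF is_ideal_zero P E])
    obtain e1 where e1: "\<And>e. e1 \<le> e \<Longrightarrow> \<exists>w. \<forall>S\<in>csubs gs j. Fr (p ^ n) z e S - koszul gs e w S \<in> {0}" using BB_get[OF n] by metis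
    have "\<exists>w. \<forall>S\<in>csubs gs j. R.Fr (p ^ n) E e S - koszul (map emb gs) e w S \<in> {0}" if e: "e1 \<le> e" for e
    proof -
      obtain w where w: "\<forall>S\<in>csubs gs j. Fr (p ^ n) z e S - koszul gs e w S \<in> {0}" using e1[OF e] by blast
      show ?thesis by (intro exI[of _ "\<lambda>S. emb (w S)"] ballI) (use w in \<open>simp add: EF emb_koszul sub\<close>)
    qed
    then have "R.Fr (p ^ n) E \<in> R.BB j {0}" unfolding R.BB_def csubs_map using RF by blast
    then have "R.Fr (p ^ h) E \<in> R.BB j {0}" using h E by blast
    then obtain e2 where e2: "\<And>e. e2 \<le> e \<Longrightarrow> \<exists>w. \<forall>S\<in>csubs gs j. R.Fr (p ^ h) E e S - koszul (map emb gs) e w S \<in> {0}"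
      unfolding R.BB_def csubs_map by blast
    have "\<exists>w. \<forall>S\<in>csubs gs j. Fr (p ^ h) z e S - koszul gs e w S \<in> {0}" if e: "e2 \<le> e" for e
    proof -
      obtain w where w: "\<And>S. S \<in> csubs gs j \<Longrightarrow> emb (Fr (p ^ h) z e S) = koszul (map emb gs) e w S" using e2[OF e] by (auto simp: EF)
      have "\<exists>f\<in>{f. \<exists>w. f = koszul gs e w}. \<forall>S\<in>csubs gs j. Fr (p ^ h) z e S = f S"
      proof (rule closed_submodule)
        show "finite (csubs gs j)" unfolding csubs_def by (rule finite_subset[of _ "Pow {..<length gs}"]) auto
        show "(\<lambda>_. 0) \<in> {f. \<exists>w. f = koszul gs e w}" by (intro CollectI exI[of _ "\<lambda>_. 0"]) (simp add: koszul_def fun_eq_iff)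
        show "(\<lambda>i. f i + g i) \<in> {f. \<exists>w. f = koszul gs e w}" if fg: "f \<in> {f. \<exists>w. f = koszul gs e w}" "g \<in> {f. \<exists>w. f = koszul gs e w}" for f g
        proof -
          obtain v w where "f = koszul gs e v" "g = koszul gs e w" using fg by blast
          then show ?thesis
            by (intro CollectI exI[of _ "\<lambda>S. v S + w S"]) (simp add: koszul_def fun_eq_iff distrib_left distrib_right sum.distrib)
        qed
        show "(\<lambda>i. r * f i) \<in> {f. \<exists>w. f = koszul gs e w}" if f: "f \<in> {f. \<exists>w. f = koszul gs e w}" for f r
        proof -
          obtain v where "f = koszul gs e v" using f by blast
          then show ?thesis
            by (intro CollectI exI[of _ "\<lambda>S. r * v S"]) (simp add: koszul_def fun_eq_iff sum_distrib_left mult_ac)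
        qed
        fix N
        define w' where "w' S = (SOME a. low N (w S - emb a))" for S
        have w': "low N (w S - emb (w' S))" for S unfolding w'_def by (rule someI_ex[OF low_approx])
        have "Fr (p ^ h) z e S - koszul gs e w' S \<in> idpow m N" if S: "S \<in> csubs gs j" for S
        proof -
          have "emb (Fr (p ^ h) z e S - koszul gs e w' S) = koszul (map emb gs) e (\<lambda>S. w S - emb (w' S)) S"
            by (simp add: emb_diff w[OF S] emb_koszul[OF sub[OF S], symmetric]) (simp add: koszul_def right_diff_distrib left_diff_distrib sum_subtractf)
          also have "\<dots> \<in> {x. low N x}" unfolding koszul_def
            by (intro ideal_sum[OF is_ideal_low] ideal_mult2[OF is_ideal_low] ideal_mult[OF is_ideal_low]) (simp add: w')
          finally show ?thesis by (simp add: low_emb mI_eq)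
        qed
        then show "\<exists>f\<in>{f. \<exists>w. f = koszul gs e w}. \<forall>S\<in>csubs gs j. Fr (p ^ h) z e S - f S \<in> idpow m N" by blast
      qed
      then show ?thesis by auto
    qed
    moreover have "Fr (p ^ h) z \<in> ZZ j {0}" by (rule Fr_ZZ[OF is_ideal_zero P z])
    ultimately show "Fr (p ^ h) z \<in> BB j {0}" unfolding BB_def by blast
  qed
qed

end

section \<open>Cech cochains\<close>

context frob begin

text \<open>The subtraction in \<open>lift\<close> truncates, so it matches the operations on Cech
  cochains only at large exponents. By \<open>eveq_BB\<close> cocycles that agree eventually differ
  by a coboundary.\<close>

definition eveq :: "nat \<Rightarrow> (nat \<Rightarrow> nat set \<Rightarrow> 'a) \<Rightarrow> (nat \<Rightarrow> nat set \<Rightarrow> 'a) \<Rightarrow> bool" where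
  "eveq j s t \<longleftrightarrow> (\<exists>e0. \<forall>e\<ge>e0. \<forall>S\<in>csubs gs j. s e S = t e S)"

lemma eveq_sym: "eveq j s t \<Longrightarrow> eveq j t s" unfolding eveq_def by metis

lemma eveq_ZZ: assumes "eveq j s t" "s \<in> ZZ j I" shows "t \<in> ZZ j I"
proof -
  obtain e0 where e0: "\<forall>e\<ge>e0. \<forall>S\<in>csubs gs j. s e S = t e S" using assms(1) unfolding eveq_def by blast
  obtain e1 where e1: "\<forall>e\<ge>e1. (\<forall>S\<in>csubs gs j. s (Suc e) S - cprod gs S * s e S \<in> I) \<and> (\<forall>T\<in>csubs gs (Suc j). koszul gs e (s e) T \<in> I)"
    using assms(2) unfolding ZZ_def by blast
  show ?thesis unfolding ZZ_def
  proof (intro CollectI exI[of _ "max e0 e1"] allI impI conjI ballI)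
    fix e assume e: "max e0 e1 \<le> e"
    show "t (Suc e) S - cprod gs S * t e S \<in> I" if "S \<in> csubs gs j" for S using e0 e1 e that by (metis le_SucI max.bounded_iff)
    show "koszul gs e (t e) T \<in> I" if T: "T \<in> csubs gs (Suc j)" for T
      using e1 e T koszul_cong[OF _ T, of "s e" "t e" e] e0 by (metis max.bounded_iff)
  qed
qed

lemma eveq_BB: assumes "eveq j s t" "s \<in> ZZ j {0}" shows "s - t \<in> BB j {0}"
proof -
  obtain e0 where e0: "\<forall>e\<ge>e0. \<forall>S\<in>csubs gs j. s e S = t e S" using assms(1) unfolding eveq_def by blast
  show ?thesis
  proof (rule BB_ideal[where ?e0.0 = e0])
    show "s - t \<in> ZZ j {0}" by (rule V.subspace_diff[OF subspace_ZZ[OF is_ideal_zero] assms(2) eveq_ZZ[OF assms]])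
    show "(s - t) e S \<in> {0}" if "e0 \<le> e" "S \<in> csubs gs j" for e S using e0 that by simp
  qed
qed

lemma eveq_mem:
  assumes X: "V.subspace X" "BB j {0} \<subseteq> X" and s: "eveq j s t" "s \<in> ZZ j {0}" "s \<in> X" shows "t \<in> X"
proof -
  have "s - (s - t) \<in> X" using V.subspace_diff[OF X(1) s(3)] eveq_BB[OF s(1,2)] X(2) by blast
  then show ?thesis by simp
qed

abbreviation lc :: "'a cochain \<Rightarrow> nat \<Rightarrow> nat set \<Rightarrow> 'a" where "lc c \<equiv> lift gs (snd c) (fst c)"

lemma lc_at: "snd c \<le> e \<Longrightarrow> lc c e S = cprod gs S ^ (e - snd c) * fst c S" by (simp add: lift_at shift_def)

lemma fst_cdiff: "fst (cdiff gs c) = koszul gs (snd c) (fst c)" and snd_cdiff: "snd (cdiff gs c) = snd c"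
  by (simp_all add: cdiff_def koszul_def ksg_def fun_eq_iff)

lemma koszul_lc: assumes "snd c \<le> e" "finite T" shows "koszul gs e (lc c e) T = cprod gs T ^ (e - snd c) * koszul gs (snd c) (fst c) T"
  using koszul_shift[OF assms(2), of gs "snd c" "e - snd c" "fst c"] assms(1) by (simp add: lift_at)

lemma csubs_finite: "finite (csubs gs j)"
  unfolding csubs_def by (rule finite_subset[of _ "Pow {..<length gs}"]) auto

lemma fin_bound: "finite A \<Longrightarrow> (\<And>x. x \<in> A \<Longrightarrow> \<exists>n::nat. Q x n) \<Longrightarrow> (\<And>x n n'. Q x n \<Longrightarrow> n \<le> n' \<Longrightarrow> Q x n') \<Longrightarrow> \<exists>n. \<forall>x\<in>A. Q x n"
proof (induction A rule: finite_induct)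
  case (insert a A)
  obtain n where "\<forall>x\<in>A. Q x n" using insert.IH insert.prems by (metis insertI2)
  moreover obtain k where "Q a k" using insert.prems(1)[of a] by blast
  ultimately have "\<forall>x\<in>insert a A. Q x (max n k)" using insert.prems(2) by (metis insert_iff max.cobounded1 max.cobounded2)
  then show ?case by blast
qed simp

lemma power_zero_later: "a ^ n * b = 0 \<Longrightarrow> n \<le> n' \<Longrightarrow> a ^ n' * b = (0 :: 'a)"
  by (metis le_add_diff_inverse2 mult.assoc mult_zero_right power_add)

text \<open>Vanishing in a localization means being killed by a power of \<open>cprod gs T\<close>.
  There are finitely many T, so one power M serves them all, and the Koszul representative is a
  cocycle from exponent \<open>snd c + M\<close> on.\<close>

lemma cocycle_iff: "cocycle gs j c \<longleftrightarrow> lc c \<in> ZZ j {0}"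
proof
  assume c: "cocycle gs j c"
  have "\<exists>M. \<forall>T\<in>csubs gs (Suc j). cprod gs T ^ M * koszul gs (snd c) (fst c) T = 0"
    by (rule fin_bound[OF csubs_finite]) (use c power_zero_later in \<open>auto simp: cocycle_def ceq_def czero_def fst_cdiff\<close>)
  then obtain M where M: "\<forall>T\<in>csubs gs (Suc j). cprod gs T ^ M * koszul gs (snd c) (fst c) T = 0" by blast
  show "lc c \<in> ZZ j {0}" unfolding ZZ_def
  proof (intro CollectI exI[of _ "snd c + M"] allI impI conjI ballI)
    fix e assume e: "snd c + M \<le> e"
    show "lc c (Suc e) S - cprod gs S * lc c e S \<in> {0}" for S using e by (simp add: lc_at Suc_diff_le)
    show "koszul gs e (lc c e) T \<in> {0}" if T: "T \<in> csubs gs (Suc j)" for T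
      using koszul_lc[OF _ csubs_fin[OF T], of c e] power_zero_later[OF M[rule_format, OF T], of "e - snd c"] e by simp
  qed
next
  assume "lc c \<in> ZZ j {0}"
  then obtain e0 where e0: "\<forall>e\<ge>e0. \<forall>T\<in>csubs gs (Suc j). koszul gs e (lc c e) T \<in> {0}" unfolding ZZ_def by blast
  have "cprod gs T ^ e0 * koszul gs (snd c) (fst c) T = 0" if T: "T \<in> csubs gs (Suc j)" for T
    using e0[rule_format, of "snd c + e0", OF _ T] koszul_lc[OF _ csubs_fin[OF T], of c "snd c + e0"] by simp
  then show "cocycle gs j c" unfolding cocycle_def ceq_def czero_def fst_cdiff snd_cdiff by auto
qed

lemma coboundary_iff: assumes c: "lc c \<in> ZZ j {0}" shows "coboundary gs j c \<longleftrightarrow> lc c \<in> BB j {0}"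
proof
  assume "coboundary gs j c"
  then show "lc c \<in> BB j {0}" unfolding coboundary_def
  proof (elim disjE conjE exE)
    assume "ceq gs j c czero"
    then have "\<exists>M. \<forall>S\<in>csubs gs j. cprod gs S ^ M * fst c S = 0"
      by (intro fin_bound[OF csubs_finite]) (use power_zero_later in \<open>auto simp: ceq_def czero_def\<close>)
    then obtain M where M: "\<forall>S\<in>csubs gs j. cprod gs S ^ M * fst c S = 0" by blast
    show ?thesis
    proof (rule BB_ideal[OF c, where ?e0.0 = "snd c + M"])
      show "lc c e S \<in> {0}" if "snd c + M \<le> e" "S \<in> csubs gs j" for e S
        using power_zero_later[OF M[rule_format, OF that(2)], of "e - snd c"] that(1) by (simp add: lc_at)
    qed
  next
    fix w assume w: "ceq gs j c (cdiff gs w)"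
    let ?f = "\<lambda>S. fst c S * cprod gs S ^ snd w - koszul gs (snd w) (fst w) S * cprod gs S ^ snd c"
    have "\<exists>M. \<forall>S\<in>csubs gs j. cprod gs S ^ M * ?f S = 0"
      by (rule fin_bound[OF csubs_finite]) (use w power_zero_later in \<open>auto simp: ceq_def fst_cdiff snd_cdiff\<close>)
    then obtain M where M: "\<forall>S\<in>csubs gs j. cprod gs S ^ M * ?f S = 0" by blast
    have "lc c e S - koszul gs e (lc w e) S = 0" if e: "snd c + snd w + M \<le> e" and S: "S \<in> csubs gs j" for e S
    proof -
      \<comment> \<open>What remains of e after both denominators have been cleared.\<close>
      define n where "n = e - snd c - snd w"
      have n: "e - snd c = n + snd w" "e - snd w = n + snd c" "M \<le> n" using e by (auto simp: n_def)
      have "lc c e S - koszul gs e (lc w e) S = cprod gs S ^ n * ?f S"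
        using e by (simp add: koszul_lc[OF _ csubs_fin[OF S]] lc_at n power_add right_diff_distrib mult_ac)
      then show ?thesis using power_zero_later[OF M[rule_format, OF S] n(3)] by simp
    qed
    then have "\<forall>e\<ge>snd c + snd w + M. \<exists>w. \<forall>S\<in>csubs gs j. lc c e S - koszul gs e w S \<in> {0}" by blast
    then show ?thesis unfolding BB_def using c by blast
  qed
next
  assume "lc c \<in> BB j {0}"
  then obtain e0 where e0: "\<And>e. e0 \<le> e \<Longrightarrow> \<exists>w. \<forall>S\<in>csubs gs j. lc c e S - koszul gs e w S \<in> {0}" by (rule BB_get) blast
  define e where "e = snd c + e0"
  obtain w where w: "\<And>S. S \<in> csubs gs j \<Longrightarrow> cprod gs S ^ e0 * fst c S = koszul gs e w S" using e0[of e] by (auto simp: e_def lc_at)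
  show "coboundary gs j c"
  proof (cases j)
    \<comment> \<open>The Koszul differential has no term at the empty set, so in degree 0 a
      coboundary is eventually zero; this is the first alternative in
      \<open>coboundary\<close>.\<close>
    case 0
    have "ceq gs j c czero" unfolding ceq_def czero_def
      by (intro ballI exI[of _ e0]) (use w in \<open>simp add: 0 csubs_0 koszul_empty\<close>)
    then show ?thesis by (simp add: coboundary_def)
  next
    case (Suc k)
    have "fst c S * cprod gs S ^ e = koszul gs e w S * cprod gs S ^ snd c" if "S \<in> csubs gs j" for S
      unfolding w[OF that, symmetric] by (simp add: e_def power_add mult_ac)
    then have "ceq gs j c (cdiff gs (w, e))" unfolding ceq_def fst_cdiff snd_cdiff by (intro ballI exI[of _ 0]) simp
    then show ?thesis using Suc unfolding coboundary_def by blast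
  qed
qed

lemma lc_cadd: "eveq j (lc c + lc c') (lc (cadd gs c c'))" unfolding eveq_def
proof (intro exI[of _ "snd c + snd c'"] allI impI ballI)
  fix e S assume e: "snd c + snd c' \<le> e"
  define n where "n = e - snd c - snd c'"
  have n: "e - snd c = n + snd c'" "e - snd c' = n + snd c" "e - (snd c + snd c') = n" using e by (auto simp: n_def)
  show "(lc c + lc c') e S = lc (cadd gs c c') e S"
    using e by (simp add: lc_at n) (simp add: cadd_def n power_add distrib_left mult_ac lift_at shift_def)
qed

lemma lc_csmul: "lc (csmul r c) = vs r (lc c)" by (simp add: csmul_def lift_def shift_def vs_def fun_eq_iff mult.left_commute)

lemma lc_cfrob: "eveq j (Fr (p ^ n) (lc c)) (lc (cfrob p n c))" unfolding eveq_def
proof (intro exI[of _ "p ^ n * snd c"] allI impI ballI)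
  fix e S assume e: "p ^ n * snd c \<le> e"
  have d: "snd c \<le> e div p ^ n" by (rule div_ge[OF e])
  have "e mod p ^ n + (e div p ^ n - snd c) * p ^ n = e - p ^ n * snd c"
    using d by (simp add: diff_mult_distrib) (metis add.commute diff_add_assoc div_mult_mod_eq mult.commute mult_le_mono1)
  then have "cprod gs S ^ (e - p ^ n * snd c) = cprod gs S ^ (e mod p ^ n) * (cprod gs S ^ (e div p ^ n - snd c)) ^ (p ^ n)"
    by (metis power_add power_mult)
  then show "Fr (p ^ n) (lc c) e S = lc (cfrob p n c) e S"
    using e d by (simp add: Fr_def lc_at cfrob_def lift_at shift_def power_mult_distrib mult.assoc)
qed

lemma ZZ_lc: assumes z: "z \<in> ZZ j {0}" obtains c where "eveq j z (lc c)"
proof -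
  obtain e0 where e0: "\<And>k S. S \<in> csubs gs j \<Longrightarrow> z (e0 + k) S - cprod gs S ^ k * z e0 S \<in> {0}" using ZZ_get[OF is_ideal_zero z, of 0] by metis
  have "z e S = lc (z e0, e0) e S" if "e0 \<le> e" "S \<in> csubs gs j" for e S
    using e0[OF that(2), of "e - e0"] that(1) by (simp add: lift_at shift_def)
  then show ?thesis using that[of "(z e0, e0)"] unfolding eveq_def by blast
qed

lemma Fr_ZZ0: "z \<in> ZZ j {0} \<Longrightarrow> Fr (p ^ n) z \<in> ZZ j {0}"
  by (rule Fr_ZZ[OF is_ideal_zero, of "{0}"]) (use p2 in \<open>simp_all add: power_0_left\<close>)

section \<open>Finite length and powers of the maximal ideal\<close>

definition NIL :: "nat \<Rightarrow> (nat \<Rightarrow> nat set \<Rightarrow> 'a) set" where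
  "NIL j = {z \<in> ZZ j {0}. nil (\<lambda>_. 0) 0 j z}"

lemma nil_0: "nil x 0 j z \<longleftrightarrow> (\<exists>n. Fr (p ^ n) z \<in> BB j {0})" by (simp add: nil_def idl_0)

lemma subspace_NIL: "V.subspace (NIL j)"
proof (rule V.subspaceI)
  have ZZ: "V.subspace (ZZ j {0})" by (rule subspace_ZZ[OF is_ideal_zero])
  have BB: "V.subspace (BB j {0})" by (rule subspace_BB[OF is_ideal_zero])
  show "0 \<in> NIL j" unfolding NIL_def nil_0 using V.subspace_0[OF ZZ] V.subspace_0[OF BB] Fr_1[of 0] by (auto intro!: exI[of _ 0])
  fix y z assume yz: "y \<in> NIL j" "z \<in> NIL j"
  then obtain n k where n: "Fr (p ^ n) y \<in> BB j (idl (pw (\<lambda>_. 0) n) 0)" "Fr (p ^ k) z \<in> BB j (idl (pw (\<lambda>_. 0) k) 0)" by (auto simp: NIL_def nil_def)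
  have "Fr (p ^ max n k) (y + z) \<in> BB j {0}"
    using V.subspace_add[OF BB nil_later[OF n(1), of "max n k", unfolded idl_0] nil_later[OF n(2), of "max n k", unfolded idl_0]] by (simp add: Fr_add)
  then show "y + z \<in> NIL j" using yz V.subspace_add[OF ZZ] unfolding NIL_def nil_0 by blast
next
  fix r z assume z: "z \<in> NIL j"
  then obtain n where n: "Fr (p ^ n) z \<in> BB j {0}" unfolding NIL_def nil_0 by blast
  have "Fr (p ^ n) (vs r z) \<in> BB j {0}" unfolding Fr_vs by (rule V.subspace_scale[OF subspace_BB[OF is_ideal_zero] n])
  then show "vs r z \<in> NIL j" using z V.subspace_scale[OF subspace_ZZ[OF is_ideal_zero]] unfolding NIL_def nil_0 by blast
qed

lemma BB_NIL: "BB j {0} \<subseteq> NIL j" 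
proof
  fix z assume z: "z \<in> BB j {0}"
  then have "Fr (p ^ 0) z \<in> BB j {0}" by (simp only: Fr_1)
  then show "z \<in> NIL j" unfolding NIL_def nil_0 using z BB_ZZ by blast
qed

lemma frob_nil_NIL: assumes "frob_nil gs p j c" shows "lc c \<in> NIL j"
proof -
  have c: "lc c \<in> ZZ j {0}" using assms by (simp add: frob_nil_def cocycle_iff)
  obtain n where n: "coboundary gs j (cfrob p n c)" using assms by (auto simp: frob_nil_def)
  note F = Fr_ZZ0[OF c, of n]
  have "lc (cfrob p n c) \<in> BB j {0}" using n coboundary_iff[OF eveq_ZZ[OF lc_cfrob F]] by simp
  then have "Fr (p ^ n) (lc c) \<in> BB j {0}"
    using eveq_mem[OF subspace_BB[OF is_ideal_zero] subset_refl eveq_sym[OF lc_cfrob] eveq_ZZ[OF lc_cfrob F]] by blast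
  then show ?thesis using c unfolding NIL_def nil_0 by blast
qed

text \<open>Carries submodules of Koszul representatives over to the sets of Cech cocycles in which
  the finite length hypothesis is phrased.\<close>

lemma quot_submod_lc:
  assumes X: "V.subspace X" "NIL j \<subseteq> X" "X \<subseteq> ZZ j {0}" shows "quot_submod gs p j {c. lc c \<in> X}"
  unfolding quot_submod_def
proof (intro conjI ballI allI impI subsetI)
  have BX: "BB j {0} \<subseteq> X" using BB_NIL X(2) by blast
  show "c \<in> {z. cocycle gs j z}" if "c \<in> {c. lc c \<in> X}" for c using that X(3) by (auto simp: cocycle_iff)
  show "c \<in> {c. lc c \<in> X}" if "c \<in> {z. frob_nil gs p j z}" for c using that frob_nil_NIL X(2) by blast
  show "cadd gs c c' \<in> {c. lc c \<in> X}" if c: "c \<in> {c. lc c \<in> X}" "c' \<in> {c. lc c \<in> X}" for c c'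
  proof -
    have "lc c + lc c' \<in> X" using V.subspace_add[OF X(1)] c by blast
    then show ?thesis using eveq_mem[OF X(1) BX lc_cadd] X(3) by blast
  qed
  show "csmul r c \<in> {c. lc c \<in> X}" if "c \<in> {c. lc c \<in> X}" for r c using that V.subspace_scale[OF X(1)] by (simp add: lc_csmul)
  show "c' \<in> {c. lc c \<in> X}" if c: "c \<in> {c. lc c \<in> X}" and c': "cocycle gs j c' \<and> ccohom_eq gs j c c'" for c c'
  proof -
    have Z: "lc c \<in> ZZ j {0}" "lc c' \<in> ZZ j {0}" using c c' X(3) by (auto simp: cocycle_iff)
    define b where "b = cadd gs c (csmul (-1) c')"
    have "vs (-1) (lc c') = - lc c'" by (simp add: vs_def fun_eq_iff)
    then have e: "eveq j (lc c - lc c') (lc b)" using lc_cadd[of j c "csmul (-1) c'"] by (simp add: lc_csmul b_def)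
    have d: "lc c - lc c' \<in> ZZ j {0}" by (rule V.subspace_diff[OF subspace_ZZ[OF is_ideal_zero] Z])
    have "lc b \<in> BB j {0}" using c' coboundary_iff[OF eveq_ZZ[OF e d]] by (simp add: ccohom_eq_def b_def)
    then have "lc c - lc c' \<in> BB j {0}" using eveq_mem[OF subspace_BB[OF is_ideal_zero] subset_refl eveq_sym[OF e] eveq_ZZ[OF e d]] by blast
    then have "lc c - (lc c - lc c') \<in> X" using V.subspace_diff[OF X(1)] c BX by blast
    then show ?thesis by simp
  qed
qed

text \<open>\<open>X i\<close> consists of the classes made nilpotent by the i-th power of m. The
  \<open>X i\<close> increase and exhaust the module, every class being m-torsion. If none of them
  were everything, a strictly increasing infinite subsequence would exceed the length bound.\<close>

lemma finite_length_killed: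
  assumes fl: "cech_frob_quot_finite_length gs p j"
  shows "\<exists>k. \<forall>a\<in>idpow m k. \<forall>z\<in>ZZ j {0}. \<exists>n. Fr (p ^ n) (vs a z) \<in> BB j {0}"
proof (rule ccontr)
  define X where "X i = {z \<in> ZZ j {0}. \<forall>a\<in>idpow m i. vs a z \<in> NIL j}" for i
  assume not: "\<not> ?thesis"
  have ZZ: "V.subspace (ZZ j {0})" by (rule subspace_ZZ[OF is_ideal_zero])
  have ne: "X k \<noteq> ZZ j {0}" for k using not unfolding X_def NIL_def nil_0 by blast
  have X: "V.subspace (X i)" for i
  proof (rule V.subspaceI)
    show "0 \<in> X i" using V.subspace_0[OF ZZ] V.subspace_0[OF subspace_NIL] by (simp add: X_def)
    show "y + z \<in> X i" if "y \<in> X i" "z \<in> X i" for y z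
      using that V.subspace_add[OF ZZ] V.subspace_add[OF subspace_NIL] by (simp add: X_def V.scale_right_distrib)
    show "vs r z \<in> X i" if "z \<in> X i" for r z
      using that V.subspace_scale[OF ZZ] V.subspace_scale[OF subspace_NIL] V.scale_left_commute[of _ r] by (simp add: X_def del: V.scale_scale)
  qed
  have NX: "NIL j \<subseteq> X i" for i using V.subspace_scale[OF subspace_NIL] by (auto simp: X_def) (simp add: NIL_def)
  have XZ: "X i \<subseteq> ZZ j {0}" for i by (auto simp: X_def)
  have mono: "i \<le> i' \<Longrightarrow> X i \<subseteq> X i'" for i i' using idpow_anti[of i i' m] by (auto simp: X_def)
  have step: "\<exists>i'>i. X i \<subset> X i'" for i
  proof -
    obtain z where z: "z \<in> ZZ j {0}" "z \<notin> X i" using ne[of i] XZ[of i] by blast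
    obtain N where "\<forall>a\<in>idpow m N. vs a z \<in> BB j {0}" using torsion[OF is_ideal_zero z(1)] by blast
    then have "z \<in> X (max (Suc i) N)" using z(1) BB_NIL idpow_anti[of N "max (Suc i) N" m] by (auto simp: X_def)
    then show ?thesis using z(2) mono[of i "max (Suc i) N"] by (intro exI[of _ "max (Suc i) N"] conjI psubsetI) auto
  qed
  obtain f where "\<forall>n. True \<and> X (f n) \<subset> X (f (Suc n))"
    using dependent_nat_choice[of "\<lambda>_ _. True" "\<lambda>_ i i'. X i \<subset> X i'"] step by blast
  then have f: "\<And>n. X (f n) \<subset> X (f (Suc n))" by blast
  define U where "U n = {c. lc c \<in> X (f n)}" for n
  have "quot_submod gs p j (U n)" for n unfolding U_def by (rule quot_submod_lc[OF X NX XZ])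
  moreover have "U n \<subset> U (Suc n)" for n
  proof -
    \<comment> \<open>Strictness survives the passage to Cech cochains because every Koszul class is
      represented by one.\<close>
    obtain z where z: "z \<in> X (f (Suc n))" "z \<notin> X (f n)" using f[of n] by blast
    have zZ: "z \<in> ZZ j {0}" using z(1) XZ by blast
    obtain c where c: "eveq j z (lc c)" using ZZ_lc[OF zZ] by blast
    have BX: "BB j {0} \<subseteq> X i" for i using BB_NIL NX by blast
    have "lc c \<in> X (f (Suc n))" by (rule eveq_mem[OF X BX c zZ z(1)])
    moreover have "lc c \<notin> X (f n)" using eveq_mem[OF X BX eveq_sym[OF c] eveq_ZZ[OF c zZ]] z(2) by blast
    ultimately show ?thesis using f[of n] unfolding U_def by blast
  qed
  moreover obtain L where "\<And>n U. (\<forall>i\<le>n. quot_submod gs p j (U i)) \<and> (\<forall>i<n. U i \<subset> U (Suc i)) \<Longrightarrow> n \<le> L"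
    using fl unfolding cech_frob_quot_finite_length_def by blast
  ultimately have "Suc L \<le> L" by blast
  then show False by simp
qed

section \<open>The bound on Frobenius test exponents\<close>

lemma frob_power_idl: "frob_power p e (idl x t) = idl (pw x e) t"
proof
  show "frob_power p e (idl x t) \<subseteq> idl (pw x e) t" unfolding frob_power_def by (rule gen_least[OF is_ideal_idl]) (use idl_pw in auto)
  show "idl (pw x e) t \<subseteq> frob_power p e (idl x t)" unfolding frob_power_def idl_def[of "pw x e"]
    by (rule gen_mono) (auto simp: idl_in)
qed

text \<open>The bound N + f + E has three sources: f Frobenius steps bring the Frobenius closure
  into the saturation, N steps bring the sequence deep enough into m for \<open>nil_bounded\<close>,
  and E steps kill the nilpotent class in degree 0. As \<open>fte\<close> is a least exponent,
  equality of the two Frobenius powers at N + f + E is enough.\<close>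

theorem fte_bounded:
  assumes dim: "krull_dim TYPE('a) d" and t: "t \<le> d" and fl: "\<And>j. j < t \<Longrightarrow> cech_frob_quot_finite_length gs p j"
  shows "\<exists>C::nat. \<forall>x. filter_regular m t x \<longrightarrow> fte p (gen_ideal (x ` {..<t})) \<le> C"
proof -
  have killed: "\<exists>k. \<forall>x. FR x t \<longrightarrow> (\<forall>a\<in>idpow m k. \<forall>z\<in>ZZ j (idl x l). nil x l j (vs a z))" if "l + j < t" for l j
    by (rule nil_killed[OF finite_length_killed[OF fl] that])
  \<comment> \<open>Only finitely many pairs (l, j) occur, and a larger exponent only shrinks the
    power of m, so one N serves all of them.\<close>
  have "\<exists>N. \<forall>(l, j)\<in>{(l, j). l + j < t}. \<forall>x. FR x t \<longrightarrow> (\<forall>a\<in>idpow m N. \<forall>z\<in>ZZ j (idl x l). nil x l j (vs a z))"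
  proof (rule fin_bound)
    show "finite {(l, j). l + j < t}" by (rule finite_subset[of _ "{..<t} \<times> {..<t}"]) auto
    show "\<exists>N. case q of (l, j) \<Rightarrow> \<forall>x. FR x t \<longrightarrow> (\<forall>a\<in>idpow m N. \<forall>z\<in>ZZ j (idl x l). nil x l j (vs a z))"
      if "q \<in> {(l, j). l + j < t}" for q using that killed by (cases q) simp
    show "case q of (l, j) \<Rightarrow> \<forall>x. FR x t \<longrightarrow> (\<forall>a\<in>idpow m N'. \<forall>z\<in>ZZ j (idl x l). nil x l j (vs a z))"
      if "case q of (l, j) \<Rightarrow> \<forall>x. FR x t \<longrightarrow> (\<forall>a\<in>idpow m N. \<forall>z\<in>ZZ j (idl x l). nil x l j (vs a z))" "N \<le> N'" for q N N'
      using that(1) idpow_anti[OF that(2), of m] by (cases q) (simp, blast)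
  qed
  then obtain N where N: "\<And>l j x a z. l + j < t \<Longrightarrow> FR x t \<Longrightarrow> a \<in> idpow m N \<Longrightarrow> z \<in> ZZ j (idl x l) \<Longrightarrow> nil x l j (vs a z)" by blast
  obtain E where E: "\<And>x z. FR x t \<Longrightarrow> (\<forall>i<t. x i \<in> idpow m N) \<Longrightarrow> z \<in> ZZ 0 (idl x t) \<Longrightarrow> nil x t 0 z \<Longrightarrow> Fr (p ^ E) z \<in> BB 0 (idl (pw x E) t)"
  proof -
    have "\<exists>e. \<forall>x. FR x t \<longrightarrow> (\<forall>i<t. x i \<in> idpow m N) \<longrightarrow> (\<forall>z\<in>ZZ 0 (idl x t). nil x t 0 z \<longrightarrow> Fr (p ^ e) z \<in> BB 0 (idl (pw x e) t))"
    proof (rule nil_bounded[OF HSLb_all])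
      show "nil x l j (vs a z)" if "l + j < t" "FR x t" "a \<in> idpow m N" "z \<in> ZZ j (idl x l)" for l j x a z by (rule N[OF that])
    qed simp
    then show thesis using that by (elim exE) blast
  qed
  have chains: "n \<le> d" if "prime_chain n P" for n and P :: "nat \<Rightarrow> 'a set" using dim that by (auto simp: krull_dim_def)
  obtain f where f: "\<And>x y. FR x t \<Longrightarrow> (\<exists>n. y ^ (p ^ n) \<in> idl (pw x n) t) \<Longrightarrow> y ^ (p ^ f) \<in> sat m (idl (pw x f) t)"
  proof -
    have "\<exists>e. \<forall>x y. FR x t \<longrightarrow> (\<exists>n. y ^ (p ^ n) \<in> idl (pw x n) t) \<longrightarrow> y ^ (p ^ e) \<in> sat m (idl (pw x e) t)"
    proof (rule frob_sat_bounded[OF HSLb_all _ t])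
      show "sat m (idl x d) = UNIV" if "FR x d" for x using chains that by (rule FR_dim)
    qed
    then show thesis using that by (elim exE) blast
  qed
  show ?thesis
  proof (intro exI[of _ "N + f + E"] allI impI)
    fix x assume fr: "filter_regular m t x"
    then have x: "FR x t" by (rule filter_regular_FR)
    define x' where "x' = pw x (N + f)"
    have x': "FR x' t" unfolding x'_def by (rule FR_pw[OF x])
    have deep: "\<forall>i<t. x' i \<in> idpow m N"
    proof (intro allI impI)
      fix i assume "i < t"
      then have "x i \<in> m" using x by (auto simp: FR_def)
      then have "x' i \<in> idpow m (p ^ (N + f))" unfolding x'_def by (rule idpow_pow)
      moreover have "N \<le> p ^ (N + f)" using power_gt_expt[of p "N + f"] p2 by simp
      ultimately show "x' i \<in> idpow m N" using idpow_anti by blast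
    qed
    have main: "y ^ (p ^ (N + f + E)) \<in> idl (pw x (N + f + E)) t" if y: "y \<in> frob_closure p (idl x t)" for y
    proof -
      obtain n where n: "y ^ (p ^ n) \<in> idl (pw x n) t" using y by (auto simp: frob_closure_def frob_power_idl)
      have up: "(y ^ (p ^ k)) ^ (p ^ n) \<in> idl (pw (pw x k) n) t" for k
        using idl_pw[OF n, of k] by (simp add: pw_pw add.commute mult.commute flip: power_mult)
      define y' where "y' = y ^ (p ^ (N + f))"
      \<comment> \<open>The N steps are taken first: \<open>y ^ (p ^ N)\<close> is in the Frobenius
        closure for the sequence \<open>pw x N\<close>, to which f applies because it is uniform in
        the sequence.\<close>
      have y'_eq: "y' = (y ^ (p ^ N)) ^ (p ^ f)" by (simp add: y'_def power_add power_mult)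
      have "y' \<in> sat m (idl x' t)" unfolding y'_eq x'_def pw_pw[symmetric] by (rule f[OF FR_pw[OF x]]) (use up in blast)
      then have z: "cst y' \<in> ZZ 0 (idl x' t)" by (rule cst_ZZ[OF is_ideal_idl])
      have "Fr (p ^ n) (cst y') \<in> BB 0 (idl (pw x' n) t)"
      proof (rule BB_ideal[where ?e0.0 = 0])
        show "Fr (p ^ n) (cst y') \<in> ZZ 0 (idl (pw x' n) t)" by (rule Fr_ZZ[OF is_ideal_idl idl_pw z])
        show "Fr (p ^ n) (cst y') e S \<in> idl (pw x' n) t" if "S \<in> csubs gs 0" for e S
          using that up[of "N + f"] by (simp add: csubs_0 Fr_cst y'_def x'_def)
      qed
      then have "nil x' t 0 (cst y')" unfolding nil_def by blast
      then have "Fr (p ^ E) (cst y') \<in> BB 0 (idl (pw x' E) t)" by (rule E[OF x' deep z])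
      then obtain e where "Fr (p ^ E) (cst y') e {} \<in> idl (pw x' E) t" by (rule BB_0_get) blast
      then have "y' ^ (p ^ E) \<in> idl (pw x' E) t" by (simp only: Fr_cst)
      moreover have "y' ^ (p ^ E) = y ^ (p ^ (N + f + E))" by (simp add: y'_def power_add power_mult)
      ultimately show ?thesis unfolding x'_def pw_pw by simp
    qed
    have "frob_power p (N + f + E) (frob_closure p (idl x t)) = frob_power p (N + f + E) (idl x t)"
    proof
      show "frob_power p (N + f + E) (frob_closure p (idl x t)) \<subseteq> frob_power p (N + f + E) (idl x t)"
        unfolding frob_power_idl unfolding frob_power_def by (rule gen_least[OF is_ideal_idl]) (use main in auto)
      have "idl x t \<subseteq> frob_closure p (idl x t)" unfolding frob_closure_def frob_power_idl by (auto intro: exI[of _ 0])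
      then show "frob_power p (N + f + E) (idl x t) \<subseteq> frob_power p (N + f + E) (frob_closure p (idl x t))"
        unfolding frob_power_def by (intro gen_mono image_mono)
    qed
    then show "fte p (gen_ideal (x ` {..<t})) \<le> N + f + E" unfolding fte_def idl_def by (rule Least_le)
  qed
qed

end

theorem theorem1p2:
  fixes m :: "'a::comm_ring_1 set" and p d t :: nat
  assumes "noetherian_cring TYPE('a)"
    and "local_ring_max m"
    and "krull_dim TYPE('a) d"
    and "prime p" and "CHAR('a) = p"
    and "0 < t" and "t \<le> d"
    and "\<forall>j<t. lc_frob_quot_finite_length p m j"
  shows "\<exists>C::nat. 0 < C \<and>
           (\<forall>x :: nat \<Rightarrow> 'a. filter_regular m t x \<longrightarrow> fte p (gen_ideal (x ` {..<t})) \<le> C)"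
proof -
  have "is_ideal m" using assms(2) by (simp add: local_ring_max_def maximal_ideal_def)
  then obtain S where "finite S" "m = gen_ideal S" using assms(1) unfolding noetherian_cring_def by blast
  then have "\<exists>gs. gen_ideal (set gs) = m" using finite_list by metis
  then have "gen_ideal (set (max_gens m)) = m" unfolding max_gens_def by (rule someI_ex)
  then interpret frob m "max_gens m" p using assms by unfold_locales
  obtain C where "\<forall>x. filter_regular m t x \<longrightarrow> fte p (gen_ideal (x ` {..<t})) \<le> C"
    using fte_bounded[OF assms(3,7)] assms(8) unfolding lc_frob_quot_finite_length_def by blast
  then show ?thesis by (intro exI[of _ "Suc C"]) (auto intro: le_SucI)
qed

end
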